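(* Let $E$ be a symmetric quasi-Banach function space on the positive half-line $\mathbf{R}^+=[0,\infty)$, and let $\mathcal{M}$ be a semi-finite von Neumann algebra on a Hilbert space $H$ with a faithful, normal, semi-finite trace $\tau$. Suppose that $E$ is $\alpha$-convex with $\alpha$-convexity constant $M^{(\alpha)}(E)=1$ for some $0<\alpha\le 1$, and that $E$ satisfies a lower $q$-estimate with constant $1$ for some finite $q\ge\alpha$. Then $(E(\mathcal{M}),\|\cdot\|_{E(\mathcal{M})})$ has the uniform Kadec-Klee-Huff property with respect to local convergence in measure.
   Context: Measurable operators. $\widetilde{\mathcal{M}}$ denotes the $*$-algebra of $\tau$-measurable operators: closed densely defined linear operators $x$ affiliated with $\mathcal{M}$ such that $\tau(\chi_{(s,\infty)}(|x|))<\infty$ for some $s\ge 0$; sums and products are closures of the algebraic ones. For $x\in\widetilde{\mathcal{M}}$ the generalized singular value function (decreasing rearrangement) is $\mu_t(x)=\inf\{s\ge 0:\tau(\chi_{(s,\infty)}(|x|))\le t\}$, $t\ge 0$. For $\mathcal{M}=L^\infty(\mathbf{R}^+)$ with Lebesgue integration as trace, $\mu(f)$ is the usual right-continuous decreasing rearrangement of $|f|$. Symmetric spaces. A symmetric quasi-Banach function space on $\mathbf{R}^+$ is a quasi-Banach lattice $E$ of (complex) Lebesgue measurable functions on $\mathbf{R}^+$ such that (i) $E$ is an order ideal in the space $L^0(\mathbf{R}^+)$ of all finite a.e. measurable functions; (ii) if $x\in E$ and $y$ is measurable with $\mu(y)=\mu(x)$, then $y\in E$ and $\|y\|_E=\|x\|_E$;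 (iii) $E$ contains all finitely supported simple functions (those with support of finite measure). $E(\mathcal{M})=\{x\in\widetilde{\mathcal{M}}:\mu(x)\in E\}$ with $\|x\|_{E(\mathcal{M})}=\|\mu(x)\|_E$. Convexity and estimates. For $0<p<\infty$, $E$ is $p$-convex if there is $C>0$ such that $\|(\sum|x_n|^p)^{1/p}\|_E\le C(\sum\|x_n\|_E^p)^{1/p}$ for all finite sequences $(x_n)$ in $E$; the least such $C$ is the $p$-convexity constant $M^{(p)}(E)$. $E$ satisfies a lower $q$-estimate with constant $C$ if $(\sum\|x_n\|_E^q)^{1/q}\le C\|\sum x_n\|_E$ for all finite sequences $(x_n)$ of mutually disjoint elements of $E$. Local convergence in measure. This is the Hausdorff linear topology on $\widetilde{\mathcal{M}}$ (restricted to $E(\mathcal{M})$) with neighbourhood base at $0$ given by the sets $\{x\in\widetilde{\mathcal{M}}:\mu_\delta(exe)<\epsilon\}$, where $\epsilon,\delta>0$ and $e\in\mathcal{M}$ is a projection with $\tau(e)<\infty$. UKKH property. Let $(X,\|\cdot\|_X)$ be an $\alpha$-normed quasi-Banach space, $0<\alpha\le 1$ (i.e. $\|x+y\|_X^\alpha\le\|x\|_X^\alpha+\|y\|_X^\alpha$), with unit ball $\mathbf{B}_X$, and let $\mathcal{T}$ be a vector space topology on $X$ weaker than the quasi-norm topology. $X$ has the uniform Kadec-Klee-Huff property with respect to $\mathcal{T}$ if for every $\epsilon>0$ there exists $\delta\in(0,1)$ such that whenever $(x_n)$ is a sequence in $\mathbf{B}_X$ with $x_n\to x\in X$ with respect to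 $\mathcal{T}$ and $\|x\|_X>1-\delta$, there is a positive integer $N$ with $\sup_{n,m\ge N}\|x_n-x_m\|_X\le\epsilon$. *)

theory Defs
  imports "HOL-Analysis.Analysis"
begin

section \<open>Complex Hilbert spaces and bounded operators\<close>

text \<open>The real inner product space structure of the library is kept, so that norm and
  topology are the library's; it is tied to the complex structure by the last axiom.
  The complex inner product is linear in its first argument.\<close>

class complex_hilbert = real_inner + complete_space +
  fixes scaleC :: "complex \<Rightarrow> 'a \<Rightarrow> 'a"  (infixr "*\<^sub>C" 75)
    and cinner :: "'a \<Rightarrow> 'a \<Rightarrow> complex"
  assumes scaleC_add_right: "c *\<^sub>C (x + y) = c *\<^sub>C x + c *\<^sub>C y"
    and scaleC_add_left: "(c + d) *\<^sub>C x = c *\<^sub>C x + d *\<^sub>C x"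
    and scaleC_scaleC: "c *\<^sub>C (d *\<^sub>C x) = (c * d) *\<^sub>C x"
    and scaleC_complex_of_real: "complex_of_real r *\<^sub>C x = r *\<^sub>R x"
    and cinner_commute: "cinner x y = cnj (cinner y x)"
    and cinner_add_left: "cinner (x + y) z = cinner x z + cinner y z"
    and cinner_scaleC_left: "cinner (c *\<^sub>C x) y = c * cinner x y"
    and inner_eq_Re_cinner: "inner x y = Re (cinner x y)"

instantiation complex :: complex_hilbert
begin

definition scaleC_complex :: "complex \<Rightarrow> complex \<Rightarrow> complex"
  where "scaleC_complex c x = c * x"

definition cinner_complex :: "complex \<Rightarrow> complex \<Rightarrow> complex"
  where "cinner_complex x y = x * cnj y"

instance
  by standard
    (auto simp: scaleC_complex_def cinner_complex_def algebra_simps scaleR_conv_of_real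
      inner_complex_def)

end

definition bounded_clinear :: "('h::complex_hilbert \<Rightarrow> 'h) \<Rightarrow> bool"
  where "bounded_clinear T \<longleftrightarrow> bounded_linear T \<and> (\<forall>c x. T (c *\<^sub>C x) = c *\<^sub>C T x)"

definition adjoint_pair :: "('h::complex_hilbert \<Rightarrow> 'h) \<Rightarrow> ('h \<Rightarrow> 'h) \<Rightarrow> bool"
  where "adjoint_pair T S \<longleftrightarrow> (\<forall>x y. cinner (T x) y = cinner x (S y))"

definition positive_op :: "('h::complex_hilbert \<Rightarrow> 'h) \<Rightarrow> bool"
  where "positive_op T \<longleftrightarrow> bounded_clinear T \<and> (\<forall>x. cinner (T x) x \<in> \<real>\<^sub>\<ge>\<^sub>0)"

definition op_le :: "('h::complex_hilbert \<Rightarrow> 'h) \<Rightarrow> ('h \<Rightarrow> 'h) \<Rightarrow> bool"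
  where "op_le S T \<longleftrightarrow> positive_op (\<lambda>x. T x - S x)"

definition projection_op :: "('h::complex_hilbert \<Rightarrow> 'h) \<Rightarrow> bool"
  where "projection_op p \<longleftrightarrow> bounded_clinear p \<and> p \<circ> p = p \<and> adjoint_pair p p"

definition unitary_op :: "('h::complex_hilbert \<Rightarrow> 'h) \<Rightarrow> bool"
  where "unitary_op u \<longleftrightarrow>
    bounded_clinear u \<and> surj u \<and> (\<forall>x y. cinner (u x) (u y) = cinner x y)"


section \<open>Von Neumann algebras and traces\<close>

definition commutant :: "('h::complex_hilbert \<Rightarrow> 'h) set \<Rightarrow> ('h \<Rightarrow> 'h) set"
  where "commutant M = {T. bounded_clinear T \<and> (\<forall>S\<in>M. T \<circ> S = S \<circ> T)}"

definition von_neumann_algebra :: "('h::complex_hilbert \<Rightarrow> 'h) set \<Rightarrow> bool"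
  where "von_neumann_algebra M \<longleftrightarrow>
    (\<forall>T\<in>M. \<exists>S\<in>M. adjoint_pair T S) \<and> commutant (commutant M) = M"

text \<open>A faithful, normal, semi-finite trace. Only the values of \<open>\<tau>\<close> on the positive
  cone of \<open>M\<close> matter.\<close>

locale fns_trace =
  fixes M :: "('h::complex_hilbert \<Rightarrow> 'h) set" and \<tau> :: "('h \<Rightarrow> 'h) \<Rightarrow> ennreal"
  assumes add: "\<lbrakk>S \<in> M; positive_op S; T \<in> M; positive_op T\<rbrakk> \<Longrightarrow> \<tau> (\<lambda>x. S x + T x) = \<tau> S + \<tau> T"
    and scale: "\<lbrakk>S \<in> M; positive_op S; 0 \<le> c\<rbrakk> \<Longrightarrow> \<tau> (\<lambda>x. c *\<^sub>R S x) = ennreal c * \<tau> S"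
    and tracial: "\<lbrakk>T \<in> M; S \<in> M; adjoint_pair T S\<rbrakk> \<Longrightarrow> \<tau> (S \<circ> T) = \<tau> (T \<circ> S)"
    and faithful: "\<lbrakk>S \<in> M; positive_op S; \<tau> S = 0\<rbrakk> \<Longrightarrow> S = (\<lambda>x. 0)"
    and normal: "\<lbrakk>D \<subseteq> {S \<in> M. positive_op S}; D \<noteq> {};
        \<And>S T. S \<in> D \<Longrightarrow> T \<in> D \<Longrightarrow> \<exists>R\<in>D. op_le S R \<and> op_le T R;
        A \<in> M; positive_op A; \<And>S. S \<in> D \<Longrightarrow> op_le S A;
        \<And>B. B \<in> M \<Longrightarrow> positive_op B \<Longrightarrow> (\<And>S. S \<in> D \<Longrightarrow> op_le S B) \<Longrightarrow> op_le A B\<rbrakk>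
      \<Longrightarrow> \<tau> A = (SUP S\<in>D. \<tau> S)"
    and semifinite: "\<lbrakk>S \<in> M; positive_op S; S \<noteq> (\<lambda>x. 0)\<rbrakk>
      \<Longrightarrow> \<exists>T\<in>M. positive_op T \<and> op_le T S \<and> T \<noteq> (\<lambda>x. 0) \<and> \<tau> T < \<infinity>"


section \<open>Unbounded operators\<close>

text \<open>An unbounded operator is represented by its graph. Relational composition \<open>x O y\<close>
  is the algebraic product in which \<open>x\<close> acts first.\<close>

type_synonym 'h unbdd_op = "('h \<times> 'h) set"

definition graph_of :: "('h \<Rightarrow> 'h) \<Rightarrow> 'h unbdd_op"
  where "graph_of T = {(\<xi>, T \<xi>) | \<xi>. True}"

definition linear_op :: "'h::complex_hilbert unbdd_op \<Rightarrow> bool"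
  where "linear_op x \<longleftrightarrow> single_valued x \<and> (0, 0) \<in> x \<and>
    (\<forall>(\<xi>, \<eta>)\<in>x. \<forall>(\<xi>', \<eta>')\<in>x. (\<xi> + \<xi>', \<eta> + \<eta>') \<in> x) \<and>
    (\<forall>c. \<forall>(\<xi>, \<eta>)\<in>x. (c *\<^sub>C \<xi>, c *\<^sub>C \<eta>) \<in> x)"

definition closed_dense_op :: "'h::complex_hilbert unbdd_op \<Rightarrow> bool"
  where "closed_dense_op x \<longleftrightarrow> linear_op x \<and> closed x \<and> closure (Domain x) = UNIV"

definition op_adj :: "'h::complex_hilbert unbdd_op \<Rightarrow> 'h unbdd_op"
  where "op_adj x = {(\<eta>, \<zeta>). \<forall>(\<xi>, \<xi>')\<in>x. cinner \<xi>' \<eta> = cinner \<xi> \<zeta>}"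

definition positive_selfadjoint :: "'h::complex_hilbert unbdd_op \<Rightarrow> bool"
  where "positive_selfadjoint a \<longleftrightarrow> closed_dense_op a \<and> op_adj a = a \<and>
    (\<forall>(\<xi>, \<eta>)\<in>a. cinner \<eta> \<xi> \<in> \<real>\<^sub>\<ge>\<^sub>0)"

text \<open>The modulus is the positive self-adjoint square root of \<open>x\<^sup>* x\<close>.\<close>

definition op_abs :: "'h::complex_hilbert unbdd_op \<Rightarrow> 'h unbdd_op"
  where "op_abs x = (THE a. positive_selfadjoint a \<and> a O a = x O op_adj x)"

definition spectral_measure :: "(real set \<Rightarrow> 'h::complex_hilbert \<Rightarrow> 'h) \<Rightarrow> bool"
  where "spectral_measure P \<longleftrightarrow>
    (\<forall>B\<in>sets borel. projection_op (P B)) \<and> P UNIV = id \<and>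
    (\<forall>B\<in>sets borel. \<forall>C\<in>sets borel. P (B \<inter> C) = P B \<circ> P C) \<and>
    (\<forall>B \<xi>. range B \<subseteq> sets borel \<longrightarrow> disjoint_family B \<longrightarrow>
      (\<lambda>n. P (B n) \<xi>) sums P (\<Union>n::nat. B n) \<xi>)"

definition scalar_measure :: "(real set \<Rightarrow> 'h::complex_hilbert \<Rightarrow> 'h) \<Rightarrow> 'h \<Rightarrow> real measure"
  where "scalar_measure P \<xi> =
    measure_of UNIV (sets borel) (\<lambda>B. ennreal (Re (cinner (P B \<xi>) \<xi>)))"

text \<open>\<open>a = \<integral> t dP(t)\<close>. By polarization a linear operator is determined by its domain and the
  diagonal values \<open>\<langle>a \<xi>, \<xi>\<rangle>\<close>, so no complex measures \<open>\<langle>P(\<cdot>) \<xi>, \<eta>\<rangle>\<close> are needed.\<close>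

definition is_spectral_measure_of :: "(real set \<Rightarrow> 'h::complex_hilbert \<Rightarrow> 'h) \<Rightarrow> 'h unbdd_op \<Rightarrow> bool"
  where "is_spectral_measure_of P a \<longleftrightarrow> spectral_measure P \<and>
    Domain a = {\<xi>. (\<integral>\<^sup>+ t. ennreal (t\<^sup>2) \<partial>scalar_measure P \<xi>) < \<infinity>} \<and>
    (\<forall>(\<xi>, \<eta>)\<in>a. cinner \<eta> \<xi> = complex_of_real (\<integral> t. t \<partial>scalar_measure P \<xi>))"

text \<open>The spectral projection \<open>\<chi>\<^sub>B(a)\<close> of a self-adjoint \<open>a\<close>, for a Borel set \<open>B\<close>. The
  description refers to the value at \<open>B\<close> since \<open>P\<close> is unconstrained off the Borel sets.\<close>

definition spectral_proj :: "'h::complex_hilbert unbdd_op \<Rightarrow> real set \<Rightarrow> 'h \<Rightarrow> 'h"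
  where "spectral_proj a B = (THE p. \<exists>P. is_spectral_measure_of P a \<and> p = P B)"


section \<open>Measurable operators\<close>

definition affiliated :: "('h::complex_hilbert \<Rightarrow> 'h) set \<Rightarrow> 'h unbdd_op \<Rightarrow> bool"
  where "affiliated M x \<longleftrightarrow>
    (\<forall>u\<in>commutant M. unitary_op u \<longrightarrow> (\<lambda>(\<xi>, \<eta>). (u \<xi>, u \<eta>)) ` x = x)"

definition measurable_ops ::
    "('h::complex_hilbert \<Rightarrow> 'h) set \<Rightarrow> (('h \<Rightarrow> 'h) \<Rightarrow> ennreal) \<Rightarrow> 'h unbdd_op set"
  where "measurable_ops M \<tau> = {x. closed_dense_op x \<and> affiliated M x \<and>
    (\<exists>s\<ge>0. \<tau> (spectral_proj (op_abs x) {s<..}) < \<infinity>)}"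

definition strong_diff :: "'h::complex_hilbert unbdd_op \<Rightarrow> 'h unbdd_op \<Rightarrow> 'h unbdd_op"
  where "strong_diff x y = closure {(\<xi>, \<eta> - \<eta>') | \<xi> \<eta> \<eta>'. (\<xi>, \<eta>) \<in> x \<and> (\<xi>, \<eta>') \<in> y}"

text \<open>The product \<open>x y\<close>, in which \<open>y\<close> acts first.\<close>

definition strong_prod :: "'h::complex_hilbert unbdd_op \<Rightarrow> 'h unbdd_op \<Rightarrow> 'h unbdd_op"
  where "strong_prod x y = closure (y O x)"

text \<open>Values are in \<open>[0,\<infinity>]\<close> because \<open>\<mu>\<^sub>0(x) = \<infinity>\<close> for unbounded \<open>x\<close>.\<close>

definition sing_val :: "(('h::complex_hilbert \<Rightarrow> 'h) \<Rightarrow> ennreal) \<Rightarrow> 'h unbdd_op \<Rightarrow> real \<Rightarrow> ennreal"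
  where "sing_val \<tau> x t =
    Inf {ennreal s | s. 0 \<le> s \<and> \<tau> (spectral_proj (op_abs x) {s<..}) \<le> ennreal t}"

definition local_basic_nbhd ::
    "('h::complex_hilbert \<Rightarrow> 'h) set \<Rightarrow> (('h \<Rightarrow> 'h) \<Rightarrow> ennreal) \<Rightarrow>
      ('h \<Rightarrow> 'h) \<Rightarrow> real \<Rightarrow> real \<Rightarrow> 'h unbdd_op set"
  where "local_basic_nbhd M \<tau> e \<epsilon> \<delta> = {x \<in> measurable_ops M \<tau>.
    sing_val \<tau> (strong_prod (strong_prod (graph_of e) x) (graph_of e)) \<delta> < ennreal \<epsilon>}"

definition local_basis0 ::
    "('h::complex_hilbert \<Rightarrow> 'h) set \<Rightarrow> (('h \<Rightarrow> 'h) \<Rightarrow> ennreal) \<Rightarrow> 'h unbdd_op set set"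
  where "local_basis0 M \<tau> = {local_basic_nbhd M \<tau> e \<epsilon> \<delta> | e \<epsilon> \<delta>.
    e \<in> M \<and> projection_op e \<and> \<tau> e < \<infinity> \<and> \<epsilon> > 0 \<and> \<delta> > 0}"

text \<open>The translation invariant topology with neighbourhood base \<open>local_basis0\<close> at \<open>0\<close>. The base
  is directed downwards, so admitting finite intersections of its members does not change the
  topology; it makes it evident that this is one.\<close>

definition local_measure_open ::
    "('h::complex_hilbert \<Rightarrow> 'h) set \<Rightarrow> (('h \<Rightarrow> 'h) \<Rightarrow> ennreal) \<Rightarrow> 'h unbdd_op set \<Rightarrow> bool"
  where "local_measure_open M \<tau> U \<longleftrightarrow> U \<subseteq> measurable_ops M \<tau> \<and>
    (\<forall>x\<in>U. \<exists>\<F>. finite \<F> \<and> \<F> \<subseteq> local_basis0 M \<tau> \<and>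
      {y \<in> measurable_ops M \<tau>. strong_diff y x \<in> \<Inter>\<F>} \<subseteq> U)"

definition local_measure_topology ::
    "('h::complex_hilbert \<Rightarrow> 'h) set \<Rightarrow> (('h \<Rightarrow> 'h) \<Rightarrow> ennreal) \<Rightarrow> 'h unbdd_op topology"
  where "local_measure_topology M \<tau> = topology (local_measure_open M \<tau>)"

lemma istopology_local_measure_open: "istopology (local_measure_open M \<tau>)"
proof -
  let ?V = "\<lambda>x \<F>. {y \<in> measurable_ops M \<tau>. strong_diff y x \<in> \<Inter>\<F>}"
  have sub: "U \<subseteq> measurable_ops M \<tau>" if "local_measure_open M \<tau> U" for U
    using that unfolding local_measure_open_def by (rule conjunct1)
  have ex: "\<exists>\<F>. finite \<F> \<and> \<F> \<subseteq> local_basis0 M \<tau> \<and> ?V x \<F> \<subseteq> U"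
    if "local_measure_open M \<tau> U" "x \<in> U" for U x
    using that unfolding local_measure_open_def by (elim conjE) (erule (1) bspec)
  have "local_measure_open M \<tau> (S \<inter> T)"
    if S: "local_measure_open M \<tau> S" and T: "local_measure_open M \<tau> T" for S T
    unfolding local_measure_open_def
  proof (intro conjI ballI)
    show "S \<inter> T \<subseteq> measurable_ops M \<tau>" using sub[OF S] by (rule le_infI1)
    fix x assume x: "x \<in> S \<inter> T"
    obtain F where F: "finite F" "F \<subseteq> local_basis0 M \<tau>" "?V x F \<subseteq> S"
      using ex[OF S IntD1[OF x]] by (elim exE conjE)
    obtain G where G: "finite G" "G \<subseteq> local_basis0 M \<tau>" "?V x G \<subseteq> T"
      using ex[OF T IntD2[OF x]] by (elim exE conjE)
    have "?V x (F \<union> G) \<subseteq> ?V x F \<inter> ?V x G" by auto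
    also have "\<dots> \<subseteq> S \<inter> T" by (rule Int_mono[OF F(3) G(3)])
    finally show "\<exists>\<F>. finite \<F> \<and> \<F> \<subseteq> local_basis0 M \<tau> \<and> ?V x \<F> \<subseteq> S \<inter> T"
      using finite_UnI[OF F(1) G(1)] Un_least[OF F(2) G(2)] by (intro exI conjI)
  qed
  moreover have "local_measure_open M \<tau> (\<Union>K)"
    if K: "\<forall>S\<in>K. local_measure_open M \<tau> S" for K
    unfolding local_measure_open_def
  proof (intro conjI ballI)
    show "\<Union>K \<subseteq> measurable_ops M \<tau>" by (rule Union_least) (rule sub[OF bspec[OF K]])
    fix x assume "x \<in> \<Union>K"
    then obtain S where S: "S \<in> K" "x \<in> S" by (rule UnionE)
    obtain F where F: "finite F" "F \<subseteq> local_basis0 M \<tau>" "?V x F \<subseteq> S"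
      using ex[OF bspec[OF K S(1)] S(2)] by (elim exE conjE)
    show "\<exists>\<F>. finite \<F> \<and> \<F> \<subseteq> local_basis0 M \<tau> \<and> ?V x \<F> \<subseteq> \<Union>K"
      using F(1,2) order_trans[OF F(3) Union_upper[OF S(1)]] by (intro exI conjI)
  qed
  ultimately show ?thesis unfolding istopology_def by simp
qed

lemma openin_local_measure_topology:
  "openin (local_measure_topology M \<tau>) = local_measure_open M \<tau>"
  by (simp add: local_measure_topology_def istopology_local_measure_open)

lemma topspace_local_measure_topology:
  "topspace (local_measure_topology M \<tau>) = measurable_ops M \<tau>"
proof (rule antisym)
  have "local_measure_open M \<tau> (measurable_ops M \<tau>)"
    unfolding local_measure_open_def by (intro conjI ballI exI[of _ "{}"]) simp_all
  then show "measurable_ops M \<tau> \<subseteq> topspace (local_measure_topology M \<tau>)"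
    by (intro openin_subset) (simp add: openin_local_measure_topology)
  have "openin (local_measure_topology M \<tau>) (topspace (local_measure_topology M \<tau>))"
    by (rule openin_topspace)
  then show "topspace (local_measure_topology M \<tau>) \<subseteq> measurable_ops M \<tau>"
    unfolding openin_local_measure_topology local_measure_open_def by (rule conjunct1)
qed


section \<open>Symmetric quasi-Banach function spaces\<close>

text \<open>Elements are represented by functions \<open>real \<Rightarrow> complex\<close>; the ideal property below makes
  membership and quasi-norm depend only on the class modulo equality a.e. on \<open>[0,\<infinity>)\<close>.\<close>

abbreviation lebesgue_pos :: "real measure"
  where "lebesgue_pos \<equiv> lebesgue_on {0..}"

definition rearrangement :: "(real \<Rightarrow> complex) \<Rightarrow> real \<Rightarrow> ennreal"
  where "rearrangement f t =
    Inf {ennreal s | s. 0 \<le> s \<and> emeasure lebesgue_pos {r \<in> {0..}. s < cmod (f r)} \<le> ennreal t}"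

locale symmetric_quasi_banach_space =
  fixes E :: "(real \<Rightarrow> complex) set" and N :: "(real \<Rightarrow> complex) \<Rightarrow> real"
  assumes measurable: "f \<in> E \<Longrightarrow> f \<in> borel_measurable lebesgue_pos"
    and add_mem: "\<lbrakk>f \<in> E; g \<in> E\<rbrakk> \<Longrightarrow> (\<lambda>t. f t + g t) \<in> E"
    and scale_mem: "f \<in> E \<Longrightarrow> (\<lambda>t. c * f t) \<in> E"
    and nonneg: "f \<in> E \<Longrightarrow> 0 \<le> N f"
    and eq_0_iff: "f \<in> E \<Longrightarrow> N f = 0 \<longleftrightarrow> (AE t in lebesgue_pos. f t = 0)"
    and homogeneous: "f \<in> E \<Longrightarrow> N (\<lambda>t. c * f t) = cmod c * N f"
    and quasi_triangle: "\<exists>K. \<forall>f\<in>E. \<forall>g\<in>E. N (\<lambda>t. f t + g t) \<le> K * (N f + N g)"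
    and complete: "\<lbrakk>\<And>n. X n \<in> E;
        \<And>\<epsilon>. \<epsilon> > 0 \<Longrightarrow> \<exists>k::nat. \<forall>m\<ge>k. \<forall>n\<ge>k. N (\<lambda>t. X m t - X n t) < \<epsilon>\<rbrakk>
      \<Longrightarrow> \<exists>f\<in>E. (\<lambda>n. N (\<lambda>t. X n t - f t)) \<longlonglongrightarrow> 0"
    and ideal: "\<lbrakk>g \<in> E; f \<in> borel_measurable lebesgue_pos;
        AE t in lebesgue_pos. cmod (f t) \<le> cmod (g t)\<rbrakk> \<Longrightarrow> f \<in> E \<and> N f \<le> N g"
    and symmetric: "\<lbrakk>f \<in> E; g \<in> borel_measurable lebesgue_pos;
        \<And>t. 0 \<le> t \<Longrightarrow> rearrangement g t = rearrangement f t\<rbrakk> \<Longrightarrow> g \<in> E \<and> N g = N f"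
    and simple: "\<lbrakk>simple_function lebesgue_pos f;
        emeasure lebesgue_pos {t \<in> {0..}. f t \<noteq> 0} < \<infinity>\<rbrakk> \<Longrightarrow> f \<in> E"

definition convexity_bound ::
    "real \<Rightarrow> (real \<Rightarrow> complex) set \<Rightarrow> ((real \<Rightarrow> complex) \<Rightarrow> real) \<Rightarrow> real \<Rightarrow> bool"
  where "convexity_bound p E N C \<longleftrightarrow> C > 0 \<and>
    (\<forall>(n::nat) x. (\<forall>i<n. x i \<in> E) \<longrightarrow>
      N (\<lambda>t. complex_of_real ((\<Sum>i<n. cmod (x i t) powr p) powr (1 / p)))
        \<le> C * (\<Sum>i<n. N (x i) powr p) powr (1 / p))"

definition p_convex :: "real \<Rightarrow> (real \<Rightarrow> complex) set \<Rightarrow> ((real \<Rightarrow> complex) \<Rightarrow> real) \<Rightarrow> bool"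
  where "p_convex p E N \<longleftrightarrow> (\<exists>C. convexity_bound p E N C)"

definition convexity_const :: "real \<Rightarrow> (real \<Rightarrow> complex) set \<Rightarrow> ((real \<Rightarrow> complex) \<Rightarrow> real) \<Rightarrow> real"
  where "convexity_const p E N = Inf {C. convexity_bound p E N C}"

definition lower_estimate ::
    "real \<Rightarrow> (real \<Rightarrow> complex) set \<Rightarrow> ((real \<Rightarrow> complex) \<Rightarrow> real) \<Rightarrow> real \<Rightarrow> bool"
  where "lower_estimate q E N C \<longleftrightarrow>
    (\<forall>(n::nat) x. (\<forall>i<n. x i \<in> E) \<longrightarrow>
      (\<forall>i<n. \<forall>j<n. i \<noteq> j \<longrightarrow> (AE t in lebesgue_pos. x i t = 0 \<or> x j t = 0)) \<longrightarrow>
      (\<Sum>i<n. N (x i) powr q) powr (1 / q) \<le> C * N (\<lambda>t. \<Sum>i<n. x i t))"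


section \<open>The operator space and the uniform Kadec-Klee-Huff property\<close>

text \<open>For a measurable operator only the null set \<open>{0}\<close> is affected by \<open>enn2real\<close>.\<close>

definition sing_fun :: "(('h::complex_hilbert \<Rightarrow> 'h) \<Rightarrow> ennreal) \<Rightarrow> 'h unbdd_op \<Rightarrow> real \<Rightarrow> complex"
  where "sing_fun \<tau> x = (\<lambda>t. complex_of_real (enn2real (sing_val \<tau> x t)))"

definition op_space ::
    "(real \<Rightarrow> complex) set \<Rightarrow> ('h::complex_hilbert \<Rightarrow> 'h) set \<Rightarrow> (('h \<Rightarrow> 'h) \<Rightarrow> ennreal) \<Rightarrow>
      'h unbdd_op set"
  where "op_space E M \<tau> = {x \<in> measurable_ops M \<tau>. sing_fun \<tau> x \<in> E}"

definition op_space_norm ::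
    "((real \<Rightarrow> complex) \<Rightarrow> real) \<Rightarrow> (('h::complex_hilbert \<Rightarrow> 'h) \<Rightarrow> ennreal) \<Rightarrow> 'h unbdd_op \<Rightarrow> real"
  where "op_space_norm N \<tau> x = N (sing_fun \<tau> x)"

text \<open>Stated for a space with carrier \<open>X\<close>, subtraction \<open>diff\<close> and quasi-norm \<open>nrm\<close>, and a
  topology \<open>T\<close> on \<open>X\<close>.\<close>

definition UKKH :: "'x set \<Rightarrow> ('x \<Rightarrow> 'x \<Rightarrow> 'x) \<Rightarrow> ('x \<Rightarrow> real) \<Rightarrow> 'x topology \<Rightarrow> bool"
  where "UKKH X diff nrm T \<longleftrightarrow>
    (\<forall>\<epsilon>>0. \<exists>\<delta>. 0 < \<delta> \<and> \<delta> < 1 \<and>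
      (\<forall>(xs::nat \<Rightarrow> 'x) x. (\<forall>n. xs n \<in> X \<and> nrm (xs n) \<le> 1) \<longrightarrow> x \<in> X \<longrightarrow>
        limitin T xs x sequentially \<longrightarrow> nrm x > 1 - \<delta> \<longrightarrow>
        (\<exists>k>0. \<forall>n\<ge>k. \<forall>m\<ge>k. nrm (diff (xs n) (xs m)) \<le> \<epsilon>)))"

end

theory Submission
  imports Defs "HOL-Analysis.Analysis"
begin

text \<open>Let a sequence in the unit ball converge locally in measure to an operator of norm close to 1.
  Cutting by a spectral projection of finite trace reduces the limit to an operator that is bounded
  with finite support, and on large corners the sequence is uniformly close to it; so
  multiplying the sequence on either side by a suitable projection almost preserves the norm.
  Everything then rests on one claim: if right multiplication of y by a projection g almost
  preserves the norm, then y (1 - g) is small in norm.  With A = y g y* and B = y y* one has A \<le> B, hence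
  the same for the iterated square roots a, b of A, B.  A trace inequality bounds r times the trace
  of the spectral projection of b - a above 2 r by the integral of the difference of the
  positive parts of \<mu>(b) - r and \<mu>(a) - r.  The right-hand side is controlled in E because
  \<alpha>-convexity with constant 1 makes averages norm-decreasing and the lower q-estimate
  with constant 1 makes the norm uniformly monotone.\<close>

section \<open>Hilbert space preliminaries\<close>

text \<open>The norm of E compares functions only, so the closeness of y g to y has to be extracted
  from singular value functions. Roots serve to sum a series: the gap between \<mu>(b) and \<mu>(a)
  is cut into dyadic layers, the layers are dilated by powers of 4, and \<alpha>-convexity bounds
  the cost; with the exponent \<open>ka\<close> = 2 / 2^k and 3 \<open>ka\<close> \<le> \<alpha> the
  costs decay geometrically. The way back is the identity b^2 - a^2 = b (b - a) + (b - a) a, used k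
  times at the price of a factor 2^k and a dilation by 4^k. The lower estimate has two further uses:
  with completeness it gives order continuity, hence dominated convergence, and it makes Y(L t)
  small for large L. The modulus and the spectral projections of the statement are definite
  descriptions; their existence and uniqueness are derived from the bounded resolvent (1 + x* x)^-1,
  read off from the projection onto the graph. Singular values enter through \<open>dle\<close>,
  which is meaningful for graphs before closure, so that triangle inequalities need no closed
  sums.\<close>

lemma scaleC_one [simp]: "1 *\<^sub>C (x::'h::complex_hilbert) = x"
 using scaleC_complex_of_real[of 1 x] by simp

lemma scaleC_zero_left [simp]: "0 *\<^sub>C (x::'h::complex_hilbert) = 0"
 using scaleC_complex_of_real[of 0 x] by simp

lemma scaleC_zero_right [simp]: "c *\<^sub>C (0::'h::complex_hilbert) = 0"
 using scaleC_add_right[of c "0::'h" 0] by simp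

lemma scaleC_minus_left: "(- c) *\<^sub>C (x::'h::complex_hilbert) = - (c *\<^sub>C x)"
 using scaleC_add_left[of c "-c" x] by (simp add: eq_neg_iff_add_eq_0 add.commute)

lemma scaleC_minus_right: "c *\<^sub>C (- x::'h::complex_hilbert) = - (c *\<^sub>C x)"
 using scaleC_add_right[of c x "-x"] by (simp add: eq_neg_iff_add_eq_0 add.commute)

lemma scaleC_diff_right: "c *\<^sub>C (x-y::'h::complex_hilbert) = c *\<^sub>C x-c *\<^sub>C y"
 using scaleC_add_right[of c x "-y"] by (simp add: scaleC_minus_right)

lemma scaleC_scaleR: "c *\<^sub>C (r *\<^sub>R x::'h::complex_hilbert) = r *\<^sub>R (c *\<^sub>C x)"
 by (simp add: scaleC_complex_of_real[symmetric] scaleC_scaleC mult.commute)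

lemma ci_add_right: "cinner x (y+z) = cinner x y+cinner x (z::'h::complex_hilbert)"
 by (metis cinner_add_left cinner_commute complex_cnj_add)

lemma ci_scaleC_right: "cinner x (c *\<^sub>C y) = cnj c*cinner x (y::'h::complex_hilbert)"
 by (metis cinner_commute cinner_scaleC_left complex_cnj_mult)

lemma ci_zero_left [simp]: "cinner 0 (x::'h::complex_hilbert) = 0"
 using cinner_scaleC_left[of 0 x x] by simp

lemma ci_zero_right [simp]: "cinner (x::'h::complex_hilbert) 0 = 0"
 using ci_scaleC_right[of x 0 x] by simp

lemma ci_minus_left [simp]: "cinner (- x) (y::'h::complex_hilbert) = - cinner x y"
 using cinner_add_left[of x "-x" y] by (simp add: eq_neg_iff_add_eq_0 add.commute)

lemma ci_minus_right [simp]: "cinner x (- y::'h::complex_hilbert) = - cinner x y"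
 using ci_add_right[of x y "-y"] by (simp add: eq_neg_iff_add_eq_0 add.commute)

lemma ci_diff_left: "cinner (x-y) (z::'h::complex_hilbert) = cinner x z-cinner y z"
 using cinner_add_left[of x "-y" z] by simp

lemma ci_diff_right: "cinner z (x-y::'h::complex_hilbert) = cinner z x-cinner z y"
 using ci_add_right[of z x "-y"] by simp

lemma ci_scaleR_left: "cinner (r *\<^sub>R x) (y::'h::complex_hilbert) = of_real r*cinner x y"
 by (simp add: scaleC_complex_of_real[symmetric] cinner_scaleC_left)

lemma ci_scaleR_right: "cinner x (r *\<^sub>R y::'h::complex_hilbert) = of_real r*cinner x y"
 by (simp add: scaleC_complex_of_real[symmetric] ci_scaleC_right)

lemmas ci_algebra = cinner_add_left ci_add_right ci_diff_left ci_diff_right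
 cinner_scaleC_left ci_scaleC_right ci_scaleR_left ci_scaleR_right

lemma ci_self: "cinner x x = complex_of_real ((norm (x::'h::complex_hilbert))^2)"
proof -
 have "Im (cinner x x) = 0" using arg_cong[OF cinner_commute[of x x], of Im] by simp
 moreover have "Re (cinner x x) = (norm x)^2"
  by (simp add: inner_eq_Re_cinner[symmetric] power2_norm_eq_inner)
 ultimately show ?thesis by (simp add: complex_eq_iff)
qed

lemma ci_self_eq_0 [simp]: "cinner x x = 0 \<longleftrightarrow> (x::'h::complex_hilbert) = 0"
 by (simp add: ci_self)

lemma norm_scaleC [simp]: "norm (c *\<^sub>C (x::'h::complex_hilbert)) = cmod c*norm x"
proof -
 have "complex_of_real ((norm (c *\<^sub>C x))^2) = complex_of_real ((cmod c*norm x)^2)"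
 proof -
  have "cinner (c *\<^sub>C x) (c *\<^sub>C x) = (c*cnj c)*cinner x x" by (simp add: ci_algebra)
  thus ?thesis
   unfolding ci_self complex_norm_square[symmetric] of_real_mult[symmetric] power_mult_distrib .
 qed
 hence "(norm (c *\<^sub>C x))^2 = (cmod c*norm x)^2" by (simp only: of_real_eq_iff)
 thus ?thesis by (simp add: power2_eq_iff_nonneg)
qed

text \<open>The real inequality applies once a unimodular factor \<open>c\<close> has turned the
  inner product into its modulus.\<close>

lemma ci_bound: "cmod (cinner x y) <= norm x*norm (y::'h::complex_hilbert)"
proof (cases "cinner x y = 0")
 case False
 define c where "c = cnj (cinner x y)/cmod (cinner x y)"
 have c: "cmod c = 1" using False by (simp add: c_def norm_divide)
 have "cinner (c *\<^sub>C x) y = complex_of_real (cmod (cinner x y))"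
  using False by (simp add: ci_algebra c_def complex_norm_square[symmetric] power2_eq_square
    mult.commute[of "cnj _"])
 hence "cmod (cinner x y) = inner (c *\<^sub>C x) y" by (simp add: inner_eq_Re_cinner)
 also have "... <= norm (c *\<^sub>C x)*norm y" by (rule norm_cauchy_schwarz)
 finally show ?thesis using c by simp
qed simp

lemma bdd_bilinear_cinner: "bounded_bilinear (cinner :: 'h::complex_hilbert => _)"
 by (standard) (auto simp: ci_algebra scaleR_conv_of_real intro!: exI[of _ 1] ci_bound)

lemmas tendsto_cinner [tendsto_intros] = bounded_bilinear.tendsto[OF bdd_bilinear_cinner]
lemmas cont_on_cinner [continuous_intros] =
 bounded_bilinear.continuous_on[OF bdd_bilinear_cinner]

lemma bdd_linear_scaleC: "bounded_linear (%x::'h::complex_hilbert. c *\<^sub>C x)"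
 by (rule bounded_linear_intro[of _ "cmod c"]) (simp_all add: scaleC_add_right scaleC_scaleR mult.commute)

lemmas tendsto_scaleC [tendsto_intros] = bounded_linear.tendsto[OF bdd_linear_scaleC]
lemmas cont_on_scaleC [continuous_intros] = bounded_linear.continuous_on[OF bdd_linear_scaleC]

lemma ci_eqI: "(!!z. cinner x z = cinner y z) ==> x = (y::'h::complex_hilbert)"
proof -
 assume "!!z. cinner x z = cinner y z"
 hence "cinner (x-y) (x-y) = 0" by (simp add: ci_diff_left)
 thus ?thesis by simp
qed

lemma ci_eqI2: "(!!z. cinner z x = cinner z y) ==> x = (y::'h::complex_hilbert)"
 by (rule ci_eqI) (metis cinner_commute)

lemma pythagoras: "cinner x y = 0 ==> (norm (x+y))^2 = (norm x)^2+(norm (y::'h::complex_hilbert))^2"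
 by (simp add: norm_add_Pythagorean orthogonal_def inner_eq_Re_cinner)

lemma bcl_add_simp: "bounded_clinear T ==> T (x+y) = T x+T y"
 by (simp add: bounded_clinear_def linear_add bounded_linear.linear)
lemma bcl_diff_simp: "bounded_clinear T ==> T (x-y) = T x-T y"
 by (simp add: bounded_clinear_def linear_diff bounded_linear.linear)
lemma bcl_minus_simp: "bounded_clinear T ==> T (- x) = - T x"
 by (simp add: bounded_clinear_def linear_neg bounded_linear.linear)
lemma bcl_zero_simp: "bounded_clinear T ==> T 0 = 0"
 by (simp add: bounded_clinear_def linear_0 bounded_linear.linear)
lemma bcl_scaleC_simp: "bounded_clinear T ==> T (c *\<^sub>C x) = c *\<^sub>C T x"
 by (simp add: bounded_clinear_def)
lemma bcl_scaleR_simp: "bounded_clinear T ==> T (r *\<^sub>R x) = r *\<^sub>R T x"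
 by (simp add: bounded_clinear_def linear_scale bounded_linear.linear)
lemmas bcl_simps = bcl_add_simp bcl_diff_simp bcl_minus_simp
 bcl_zero_simp bcl_scaleC_simp bcl_scaleR_simp

lemma bdd_clinearI:
 assumes "!!x y. T (x+y) = T x+T y" "!!c x. T (c *\<^sub>C x) = c *\<^sub>C T x" "!!x. norm (T x) <= K*norm x"
 shows "bounded_clinear T"
 unfolding bounded_clinear_def
 using assms by (auto intro!: bounded_linear_intro[of _ K] simp: scaleC_complex_of_real[symmetric] mult.commute)

lemma bcl_bdd:
 assumes "bounded_clinear T"
 shows "\<exists>K>0. \<forall>x. norm (T x) <= K*norm x"
 using assms bounded_linear.pos_bounded[of T] unfolding bounded_clinear_def by (metis mult.commute)

lemma bcl_id: "bounded_clinear id"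
 by (rule bdd_clinearI[of _ 1]) auto
lemma bcl_ident: "bounded_clinear (%x. x)"
 by (rule bdd_clinearI[of _ 1]) auto
lemma bcl_zero: "bounded_clinear (%x. 0)"
 by (rule bdd_clinearI[of _ 1]) auto
lemma bcl_compose: "bounded_clinear S ==> bounded_clinear T ==> bounded_clinear (%x. S (T x))"
 by (auto simp: bounded_clinear_def intro: bounded_linear_compose)
lemma bcl_add: "bounded_clinear S ==> bounded_clinear T ==> bounded_clinear (%x. S x+T x)"
 by (auto simp: bounded_clinear_def scaleC_add_right intro: bounded_linear_add)
lemma bcl_diff: "bounded_clinear S ==> bounded_clinear T ==> bounded_clinear (%x. S x-T x)"
 by (auto simp: bounded_clinear_def scaleC_diff_right intro: bounded_linear_sub)
lemma bcl_scaleC: "bounded_clinear T ==> bounded_clinear (%x. c *\<^sub>C T x)"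
 by (auto simp: bounded_clinear_def scaleC_scaleC mult.commute
   intro: bounded_linear_compose[OF bdd_linear_scaleC])
lemma bcl_scaleR: "bounded_clinear T ==> bounded_clinear (%x. r *\<^sub>R T x)"
 using bcl_scaleC[of T "of_real r"] by (simp add: scaleC_complex_of_real)
lemma bcl_minus: "bounded_clinear T ==> bounded_clinear (%x. - T x)"
 using bcl_scaleC[of T "-1"] by (simp add: scaleC_minus_left)
lemmas bcl_intros = bcl_id bcl_ident bcl_zero
 bcl_add bcl_diff bcl_scaleC bcl_scaleR
 bcl_minus bcl_compose

lemma bcl_tendsto:
 "bounded_clinear T ==> (f \<longlongrightarrow> l) F ==> ((%x. T (f x)) \<longlongrightarrow> T l) F"
 by (simp add: bounded_clinear_def bounded_linear.tendsto)

lemma bcl_cont: "bounded_clinear T ==> continuous_on A T"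
 by (simp add: bounded_clinear_def linear_continuous_on)


subsection \<open>Closed subspaces and projections\<close>

definition csub :: "'h::complex_hilbert set => bool"
 where "csub K \<longleftrightarrow> 0 : K & (\<forall>x\<in>K. \<forall>y\<in>K. x+y : K) & (\<forall>c. \<forall>x\<in>K. c *\<^sub>C x : K)"

lemma csub_0: "csub K ==> 0 : K"
 and csub_add: "csub K ==> x : K ==> y : K ==> x+y : K"
 and csub_scaleC: "csub K ==> x : K ==> c *\<^sub>C x : K"
 by (auto simp: csub_def)
lemma csub_minus: "csub K ==> x : K ==>-x : K"
 using csub_scaleC[of K x "-1"] by (simp add: scaleC_minus_left)
lemma csub_diff: "csub K ==> x : K ==> y : K ==> x-y : K"
 using csub_add[of K x "-y"] csub_minus[of K y] by simp
lemma csub_scaleR: "csub K ==> x : K ==> r *\<^sub>R x : K"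
 using csub_scaleC[of K x "of_real r"] by (simp add: scaleC_complex_of_real)

lemma csub_closure: assumes "csub K" shows "csub (closure K)"
proof -
 have "x+y : closure K" if xy: "x : closure K" "y : closure K" for x y
 proof -
  obtain f g where "!!n. f n : K" "f \<longlonglongrightarrow> x" "!!n. g n : K" "g \<longlonglongrightarrow> y"
   using xy by (auto simp: closure_sequential)
  thus ?thesis unfolding closure_sequential
   using csub_add[OF assms] by (intro exI[of _ "%n. f n+g n"]) (auto intro!: tendsto_intros)
 qed
 moreover have "c *\<^sub>C x : closure K" if x: "x : closure K" for x c
 proof -
  obtain f where "!!n. f n : K" "f \<longlonglongrightarrow> x"
   using x by (auto simp: closure_sequential)
  thus ?thesis unfolding closure_sequential
   using csub_scaleC[OF assms] by (intro exI[of _ "%n. c *\<^sub>C f n"]) (auto intro!: tendsto_intros)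
 qed
 moreover have "0 : closure K" using csub_0[OF assms] closure_subset by blast
 ultimately show ?thesis by (auto simp: csub_def)
qed

lemma csub_range: "bounded_clinear T ==> csub (range T)"
 unfolding csub_def
 by (auto simp: image_iff) (metis bcl_zero_simp, metis bcl_add_simp, metis bcl_scaleC_simp)

lemma csub_kernel: "bounded_clinear T ==> csub {x. T x = 0}"
 by (simp add: csub_def bcl_zero_simp bcl_add_simp bcl_scaleC_simp)

lemma closed_kernel: "bounded_clinear T ==> closed {x. T x = 0}"
 by (intro closed_Collect_eq bcl_cont continuous_intros)

definition ortho :: "'h::complex_hilbert set => 'h set"
 where "ortho S = {x. \<forall>y\<in>S. cinner x y = 0}"

lemma csub_ortho: "csub (ortho S)"
 by (auto simp: csub_def ortho_def ci_algebra)

lemma closed_ortho: "closed (ortho S)"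
proof -
 have "ortho S = (\<Inter>y\<in>S. {x. cinner x y = 0})" by (auto simp: ortho_def)
 thus ?thesis by (auto intro!: closed_INT closed_Collect_eq continuous_intros)
qed

text \<open>A minimizing sequence is Cauchy by the parallelogram law (\<open>par\<close>), because
  midpoints stay in \<open>K\<close>. Varying the limit gives orthogonality for the real inner
  product; testing with \<open>\<i> *\<^sub>C y\<close> as well gives the complex one.\<close>

lemma proj_exists:
 assumes K: "csub K" "closed K"
 shows "\<exists>k\<in>K. \<forall>y\<in>K. cinner (x-k) y = 0"
proof -
 define d where "d = Inf ((%k. (norm (x-k))^2) ` K)"
 have bdd: "bdd_below ((%k. (norm (x-k))^2) ` K)" by (rule bdd_belowI[of _ 0]) auto
 have ne: "(%k. (norm (x-k))^2) ` K ~= {}" using csub_0[OF K(1)] by auto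
 have dle: "d <= (norm (x-k))^2" if "k : K" for k
  unfolding d_def using bdd that by (auto intro: cInf_lower)
 have "\<exists>k\<in>K. (norm (x-k))^2 < d+e" if "e > 0" for e
  using cInf_lessD[OF ne, of "d+e"] that unfolding d_def by auto
 hence "\<exists>k\<in>K. (norm (x-k))^2 < d+inverse (Suc n)" for n by simp
 then obtain k where k: "!!n. k n : K" "!!n. (norm (x-k n))^2 < d+inverse (Suc n)"
  by metis
 have par: "(norm (k m-k n))^2 <= 2*(inverse (Suc m)+inverse (Suc n))" for m n
 proof -
  define u v where "u = x-k m" and "v = x-k n"
  have "(norm (u+v))^2+(norm (u-v))^2 = 2*(norm u)^2+2*(norm v)^2"
   by (simp add: power2_norm_eq_inner inner_add inner_diff inner_commute algebra_simps)
  moreover have "(norm (u+v))^2 = 4*(norm (x-(1/2) *\<^sub>R (k m+k n)))^2"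
  proof -
   have "u+v = 2 *\<^sub>R (x-(1/2) *\<^sub>R (k m+k n))" by (simp add: u_def v_def algebra_simps scaleR_2)
   thus ?thesis by simp
  qed
  moreover have "d <= (norm (x-(1/2) *\<^sub>R (k m+k n)))^2"
   by (intro dle csub_scaleR csub_add K k)
  moreover have "u-v = k n-k m" by (simp add: u_def v_def)
  ultimately show ?thesis using k(2)[of m] k(2)[of n] by (simp add: u_def v_def norm_minus_commute)
 qed
 have "Cauchy k"
 proof (rule metric_CauchyI)
  fix e :: real assume e: "e > 0"
  obtain N where N: "inverse (real (Suc N)) < e^2/4"
   using reals_Archimedean[of "e^2/4"] e by auto
  have "dist (k m) (k n) < e" if "m >= N" "n >= N" for m n
  proof -
   have "inverse (real (Suc m)) <= inverse (real (Suc N))" "inverse (real (Suc n)) <= inverse (real (Suc N))"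
    using that by (auto intro!: le_imp_inverse_le)
   hence "2*(inverse (real (Suc m))+inverse (real (Suc n)))
     <= 2*(inverse (real (Suc N))+inverse (real (Suc N)))" by (intro mult_left_mono add_mono) auto
   with par[of m n] have "(norm (k m-k n))^2 <= 2*(inverse (real (Suc N))+inverse (real (Suc N)))"
    by (rule order_trans)
   also have "... < e^2" using N by simp
   finally show ?thesis using e by (simp add: dist_norm power_less_imp_less_base)
  qed
  thus "\<exists>M. \<forall>m\<ge>M. \<forall>n\<ge>M. dist (k m) (k n) < e" by blast
 qed
 then obtain l where l: "k \<longlonglongrightarrow> l" by (auto simp: Cauchy_convergent_iff convergent_def)
 have lK: "l : K" using closed_sequentially[OF K(2)] k(1) l by blast
 have "(%n. (norm (x-k n))^2) \<longlonglongrightarrow> (norm (x-l))^2" using l by (intro tendsto_intros)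
 moreover have "(%n. d+inverse (real (Suc n))) \<longlonglongrightarrow> d+0"
  by (intro tendsto_intros LIMSEQ_inverse_real_of_nat)
 ultimately have "(norm (x-l))^2 <= d+0"
  by (rule LIMSEQ_le) (blast intro: less_imp_le k(2))
 hence ld: "(norm (x-l))^2 <= d" by simp
 have re: "inner (x-l) y = 0" if y: "y : K" for y
 proof (rule ccontr)
  assume ne: "inner (x-l) y ~= 0"
  hence y0: "inner y y > 0" by auto
  \<comment> \<open>The minimizer of the quadratic polynomial |x - l - t y|^2 in t.\<close>
  define t where "t = inner (x-l) y/inner y y"
  have "d <= (norm (x-(l+t *\<^sub>R y)))^2" by (intro dle csub_add csub_scaleR K lK y)
  also have "... = (norm (x-l))^2-(inner (x-l) y)^2/inner y y"
   using y0 unfolding t_def power2_norm_eq_inner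
   by (simp add: inner_add inner_diff inner_commute algebra_simps power2_eq_square)
    (simp add: field_simps)
  also have "... < (norm (x-l))^2" using ne y0 by simp
  finally show False using ld by simp
 qed
 have "cinner (x-l) y = 0" if y: "y : K" for y
 proof -
  have "Re (cinner (x-l) y) = 0" using re[OF y] by (simp add: inner_eq_Re_cinner)
  moreover have "Re (cinner (x-l) (\<i> *\<^sub>C y)) = 0"
   using re[OF csub_scaleC[OF K(1) y]] by (simp add: inner_eq_Re_cinner)
  ultimately show ?thesis by (simp add: ci_scaleC_right complex_eq_iff)
 qed
 thus ?thesis using lK by blast
qed

definition proj :: "'h::complex_hilbert set => 'h => 'h"
 where "proj K x = (SOME k. k : K & (\<forall>y\<in>K. cinner (x-k) y = 0))"

lemma proj_in: "csub K ==> closed K ==> proj K x : K"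
 and proj_ortho: "csub K ==> closed K ==> y : K ==> cinner (x-proj K x) y = 0"
 using someI_ex[OF proj_exists[of K x, unfolded Bex_def]] unfolding proj_def by blast+

lemma proj_ortho': "csub K ==> closed K ==> y : K ==> cinner y (x-proj K x) = 0"
 by (metis cinner_commute complex_cnj_zero proj_ortho)

lemma proj_unique:
 assumes K: "csub K" "closed K" and k: "k : K" "!!y. y : K ==> cinner (x-k) y = 0"
 shows "proj K x = k"
proof -
 have "cinner (proj K x-k) y = 0" if "y : K" for y
  using k(2)[OF that] proj_ortho[OF K that, of x] by (simp add: ci_diff_left)
 hence "cinner (proj K x-k) (proj K x-k) = 0"
  using csub_diff[OF K(1) proj_in[OF K] k(1)] by blast
 thus ?thesis by simp
qed

lemma proj_id: "csub K ==> closed K ==> x : K ==> proj K x = x"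
 by (rule proj_unique) auto

lemma pr_proj:
 assumes K: "csub K" "closed K" shows "projection_op (proj K)"
proof -
 have add: "proj K (x+y) = proj K x+proj K y" for x y
  using K proj_ortho[OF K, of _ x] proj_ortho[OF K, of _ y] proj_in[OF K, of x] proj_in[OF K, of y]
  by (intro proj_unique) (auto simp: csub_add ci_algebra)
 have sc: "proj K (c *\<^sub>C x) = c *\<^sub>C proj K x" for c x
  using K proj_ortho[OF K, of _ x] proj_in[OF K, of x]
  by (intro proj_unique) (auto simp: csub_scaleC ci_diff_left scaleC_diff_right[symmetric] cinner_scaleC_left)
 have nm: "norm (proj K x) <= 1*norm x" for x
 proof -
  have "(norm (proj K x+(x-proj K x)))^2 = (norm (proj K x))^2+(norm (x-proj K x))^2"
   by (intro pythagoras proj_ortho' K proj_in)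
  hence "(norm (proj K x))^2 <= (norm x)^2" by simp
  thus ?thesis by (simp add: power2_le_iff_abs_le)
 qed
 have "cinner (proj K x) y = cinner x (proj K y)" for x y
  using proj_ortho[OF K proj_in[OF K, of y], of x] proj_ortho'[OF K proj_in[OF K, of x], of y]
  by (simp add: ci_algebra)
 thus ?thesis unfolding projection_op_def adjoint_pair_def
  using bdd_clinearI[OF add sc nm] proj_id[OF K proj_in[OF K]] by auto
qed

lemma range_proj: "csub K ==> closed K ==> range (proj K) = K"
proof -
 assume K: "csub K" "closed K"
 show "range (proj K) = K"
 proof
  show "range (proj K) \<subseteq> K" using proj_in[OF K] by blast
  show "K \<subseteq> range (proj K)" using proj_id[OF K] by (metis rangeI subsetI)
 qed
qed

lemma projection_opD:
 assumes "projection_op p"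
 shows pr_bcl: "bounded_clinear p" and pr_idem: "p (p x) = p x"
  and pr_cinner: "cinner (p x) y = cinner x (p y)"
 using assms by (auto simp: projection_op_def adjoint_pair_def fun_eq_iff)

lemma pr_ci_self:
 assumes "projection_op p" shows "cinner (p x) x = complex_of_real ((norm (p x))^2)"
 using pr_cinner[OF assms, of x "p x"] pr_idem[OF assms]
 by (metis ci_self pr_cinner[OF assms])

lemma pr_ortho: "projection_op p ==> cinner (p x) (y-p y) = 0"
 by (simp add: ci_diff_right pr_cinner pr_idem)

lemma pr_split:
 assumes "projection_op p" shows "(norm x)^2 = (norm (p x))^2+(norm (x-p x))^2"
 using pythagoras[OF pr_ortho[OF assms, of x x]] by simp

lemma pr_nle: assumes "projection_op p" shows "norm (p x) <= norm x"
proof -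
 have "(norm (p x))^2 <= (norm x)^2" using pr_split[OF assms, of x] by simp
 thus ?thesis by (simp add: power2_le_iff_abs_le)
qed


lemma pr_range: "projection_op p ==> x : range p \<longleftrightarrow> p x = x"
proof -
 assume p: "projection_op p"
 have "p x = x ==> x : range p" using rangeI[of p x] by simp
 moreover have "x : range p ==> p x = x" using pr_idem[OF p] by auto
 ultimately show ?thesis by blast
qed

lemma pr_csub: "projection_op p ==> csub (range p)"
 by (simp add: csub_range pr_bcl)

lemma pr_closed: assumes "projection_op p" shows "closed (range p)"
proof -
 have "range p = {x. p x = x}" using pr_range[OF assms] by blast
 thus ?thesis
  using bcl_cont[OF pr_bcl[OF assms]]
  by (auto intro!: closed_Collect_eq continuous_intros)
qed

lemma pr_compl:
 assumes p: "projection_op p" shows "projection_op (%x. x-p x)"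
 unfolding projection_op_def adjoint_pair_def
 by (auto simp: fun_eq_iff bcl_simps[OF pr_bcl[OF p]] ci_algebra pr_idem[OF p]
   pr_cinner[OF p] intro!: bcl_diff bcl_ident pr_bcl[OF p])

lemma pr_ident: "projection_op (%x. x)"
 by (auto simp: projection_op_def adjoint_pair_def fun_eq_iff intro: bcl_intros)
lemma pr_zero: "projection_op (%x. 0)"
 by (auto simp: projection_op_def adjoint_pair_def fun_eq_iff intro: bcl_intros)


text \<open>The component of \<open>x\<close> orthogonal to the closure annihilates
  \<open>D\<close>, hence \<open>x\<close>, hence itself. Density of ranges, domains and cores is
  proved in this form below.\<close>

lemma in_closure_if_ortho:
 assumes D: "csub D" and x: "!!y. (!!z. z : D ==> cinner y z = 0) ==> cinner y x = 0"
 shows "x : closure D"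
proof -
 note c = csub_closure[OF D] closed_closure
 define y where "y = x-proj (closure D) x"
 have "cinner y z = 0" if "z : closure D" for z unfolding y_def by (rule proj_ortho[OF c that])
 hence "cinner y x = 0" "cinner y (proj (closure D) x) = 0"
  using x closure_subset proj_in[OF c] by blast+
 hence "cinner y y = 0" by (simp add: y_def ci_diff_right)
 hence "x = proj (closure D) x" by (simp add: y_def)
 thus ?thesis using proj_in[OF c] by metis
qed

lemma dense_if_ortho:
 assumes D: "csub D" and x: "!!y. (!!z. z : D ==> cinner y z = 0) ==> y = 0"
 shows "closure D = UNIV"
 using in_closure_if_ortho[OF D] x by (metis UNIV_eq_I ci_zero_left)

lemma ortho_of_closure:
 assumes "x : closure D" "!!z. z : D ==> cinner y z = 0"
 shows "cinner y x = 0"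
proof -
 obtain f where "!!n. f n : D" "f \<longlonglongrightarrow> x" using assms(1) by (auto simp: closure_sequential)
 moreover from this have "(%n. cinner y (f n)) \<longlonglongrightarrow> cinner y x" by (intro tendsto_intros)
 ultimately have "(%n::nat. 0) \<longlonglongrightarrow> cinner y x" using assms(2) by simp
 from LIMSEQ_unique[OF this tendsto_const] show ?thesis by simp
qed


subsection \<open>Adjoints\<close>

text \<open>The kernel of a nonzero \<open>f\<close> has a one-dimensional orthogonal complement,
  spanned by the component \<open>z\<close> of any vector outside the kernel.\<close>

lemma riesz_representation:
 fixes f :: "'h::complex_hilbert => complex"
 assumes bl: "bounded_linear f" and sc: "!!c x. f (c *\<^sub>C x) = c*f x"
 shows "\<exists>y. \<forall>x. f x = cinner x y"
proof (cases "\<forall>x. f x = 0")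
 case True thus ?thesis by (intro exI[of _ 0]) simp
next
 case False
 then obtain x0 where x0: "f x0 ~= 0" by blast
 note lin = linear_add[OF bounded_linear.linear[OF bl]] linear_diff[OF bounded_linear.linear[OF bl]]
 have K: "csub {x. f x = 0}" "closed {x. f x = 0}"
  using lin sc linear_0[OF bounded_linear.linear[OF bl]]
  by (auto simp: csub_def intro!: closed_Collect_eq linear_continuous_on bl continuous_intros)
 define z where "z = x0-proj {x. f x = 0} x0"
 have fz: "f z = f x0" using proj_in[OF K, of x0] by (simp add: z_def lin)
 have zo: "cinner y z = 0" if "f y = 0" for y
  unfolding z_def using proj_ortho'[OF K, of y] that by simp
 have z0: "z ~= 0" using fz x0 linear_0[OF bounded_linear.linear[OF bl]] by metis
 have "f x = cinner x (cnj (f z/cinner z z) *\<^sub>C z)" for x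
 proof -
  have "f (x-(f x/f z) *\<^sub>C z) = 0" using fz x0 by (simp add: lin sc)
  hence "cinner x z = (f x/f z)*cinner z z" by (drule_tac zo) (simp add: ci_algebra)
  thus ?thesis using fz x0 z0 by (simp add: ci_scaleC_right)
 qed
 thus ?thesis by blast
qed

lemma adjoint_exists:
 assumes T: "bounded_clinear T"
 shows "\<exists>S. bounded_clinear S & adjoint_pair T S"
proof -
 obtain K where K: "K > 0" "!!x. norm (T x) <= K*norm x" using bcl_bdd[OF T] by blast
 have "\<exists>z. \<forall>x. cinner (T x) y = cinner x z" for y
 proof (rule riesz_representation)
  show "bounded_linear (%x. cinner (T x) y)"
   using bounded_bilinear.bounded_linear_left[OF bdd_bilinear_cinner, of y] T
   by (auto simp: bounded_clinear_def intro: bounded_linear_compose)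
 qed (simp add: bcl_simps[OF T] cinner_scaleC_left)
 then obtain S where S: "!!x y. cinner (T x) y = cinner x (S y)" by metis
 have "norm (S y) <= K*norm y" for y
 proof -
  have "(norm (S y))^2 = cmod (cinner (T (S y)) y)" by (simp add: S ci_self norm_power)
  also have "... <= norm (T (S y))*norm y" by (rule ci_bound)
  also have "... <= (K*norm (S y))*norm y" by (intro mult_right_mono K) simp
  finally have "norm (S y)*norm (S y) <= norm (S y)*(K*norm y)" by (simp add: power2_eq_square mult_ac)
  thus ?thesis
   by (cases "norm (S y) = 0") (use K(1) in \<open>auto simp: mult_le_cancel_left\<close>)
 qed
 moreover have "S (x+y) = S x+S y" "S (c *\<^sub>C x) = c *\<^sub>C S x" for x y c
  by (rule ci_eqI2, simp add: S[symmetric] ci_algebra)+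
 ultimately have "bounded_clinear S" by (intro bdd_clinearI)
 with S show ?thesis by (auto simp: adjoint_pair_def)
qed

definition adj :: "('h::complex_hilbert => 'h) => 'h => 'h"
 where "adj T = (SOME S. bounded_clinear S & adjoint_pair T S)"

lemma adj_bcl: "bounded_clinear T ==> bounded_clinear (adj T)"
 and adj_pair: "bounded_clinear T ==> adjoint_pair T (adj T)"
 using someI_ex[OF adjoint_exists] unfolding adj_def by blast+

lemma adj_cinner: "bounded_clinear T ==> cinner (T x) y = cinner x (adj T y)"
 using adj_pair[of T] by (simp add: adjoint_pair_def)

lemma adj_cinner': "bounded_clinear T ==> cinner (adj T x) y = cinner x (T y)"
 by (metis adj_cinner cinner_commute)

lemma adjoint_pair_unique: "adjoint_pair T S ==> adjoint_pair T S' ==> S = S'"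
 by (rule ext, rule ci_eqI2) (metis adjoint_pair_def)

lemma adjoint_pair_eq_adj: "bounded_clinear T ==> adjoint_pair T S ==> adj T = S"
 using adj_pair adjoint_pair_unique by blast

lemma adjoint_pair_sym: "adjoint_pair T S ==> adjoint_pair S T"
 unfolding adjoint_pair_def by (metis cinner_commute)

lemma adj_adj: "bounded_clinear T ==> adj (adj T) = T"
 by (intro adjoint_pair_eq_adj adj_bcl adjoint_pair_sym[OF adj_pair])

lemma adj_nle:
 assumes T: "bounded_clinear T" and K: "!!x. norm (T x) <= K*norm x"
 shows "norm (adj T y) <= K*norm y"
proof (cases "adj T y = 0")
 case True
 have "0 <= K*norm y" by (rule order_trans[OF norm_ge_zero K])
 thus ?thesis using True by simp
next
 case False
 have "(norm (adj T y))^2 = cmod (cinner (T (adj T y)) y)" by (simp add: adj_cinner[OF T] ci_self norm_power)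
 also have "... <= norm (T (adj T y))*norm y" by (rule ci_bound)
 also have "... <= (K*norm (adj T y))*norm y" by (intro mult_right_mono K) simp
 finally have "norm (adj T y)*norm (adj T y) <= norm (adj T y)*(K*norm y)"
  by (simp add: power2_eq_square mult_ac)
 thus ?thesis using False by (simp add: mult_le_cancel_left)
qed

section \<open>Self-adjoint and positive operators\<close>

definition selfadj :: "('h::complex_hilbert => 'h) => bool"
 where "selfadj T \<longleftrightarrow> bounded_clinear T & adjoint_pair T T"

lemma sa_bcl: "selfadj T ==> bounded_clinear T"
 and sa_cinner: "selfadj T ==> cinner (T x) y = cinner x (T y)"
 and sa_in: "selfadj T ==> inner (T x) y = inner x (T y)"
 by (auto simp: selfadj_def adjoint_pair_def inner_eq_Re_cinner)

lemma sa_ci_self: assumes "selfadj T" shows "cinner (T x) x = complex_of_real (inner (T x) x)"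
proof -
 have "cinner (T x) x = cnj (cinner (T x) x)"
  using sa_cinner[OF assms, of x x] cinner_commute by metis
 thus ?thesis by (simp add: inner_eq_Re_cinner complex_eq_iff)
qed

text \<open>Polarization at x + y and x + i y, for which complex scalars are essential. It lets
  bounded operators be compared by their diagonal values alone.\<close>

lemma quadratic_form_zero:
 assumes S: "bounded_clinear S" and z: "!!x. cinner (S x) x = 0"
 shows "S x = 0"
proof (rule ci_eqI)
 fix y
 have "cinner (S x) y+cinner (S y) x = 0"
  using z[of "x+y"] z[of x] z[of y] by (simp add: bcl_simps[OF S] ci_algebra add.commute)
 moreover have "cinner (S x) y-cinner (S y) x = 0"
  using z[of "x+\<i> *\<^sub>C y"] z[of x] z[of y] by (simp add: bcl_simps[OF S] ci_algebra algebra_simps)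
 ultimately show "cinner (S x) y = cinner 0 y" by simp
qed

lemma quadratic_form_eqI:
 assumes S: "bounded_clinear S" and T: "bounded_clinear T" and z: "!!x. cinner (S x) x = cinner (T x) x"
 shows "S = T"
 using quadratic_form_zero[OF bcl_diff[OF S T]] z by (auto simp: ci_diff_left)

lemma pr_sa: "projection_op p ==> selfadj p"
 by (simp add: projection_op_def selfadj_def)

lemma pr_eqI_norm:
 assumes p: "projection_op p" and q: "projection_op q" and "!!x. norm (p x) = norm (q x)"
 shows "p = q"
 by (rule quadratic_form_eqI)
  (simp_all add: p q pr_bcl pr_ci_self assms(3))

lemma pos_sa: assumes T: "positive_op T" shows "selfadj T"
proof -
 have b: "bounded_clinear T" using T by (simp add: positive_op_def)
 have "cinner (T x) x = cinner (adj T x) x" for x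
 proof -
  have "cinner (T x) x : \<real>" using T by (auto simp: positive_op_def complex_nonneg_Reals_iff complex_is_Real_iff)
  hence "cinner (T x) x = cnj (cinner (T x) x)" by (simp add: Reals_cnj_iff)
  thus ?thesis by (metis adj_cinner[OF b] cinner_commute)
 qed
 hence "T = adj T" by (rule quadratic_form_eqI[OF b adj_bcl[OF b]])
 thus ?thesis using adj_pair[OF b] b by (simp add: selfadj_def)
qed

lemma pos_iff: "positive_op T \<longleftrightarrow> selfadj T & (\<forall>x. 0 <= inner (T x) x)"
proof
 assume T: "positive_op T"
 thus "selfadj T & (\<forall>x. 0 <= inner (T x) x)"
  using pos_sa[OF T] by (auto simp: positive_op_def complex_nonneg_Reals_iff inner_eq_Re_cinner)
next
 assume "selfadj T & (\<forall>x. 0 <= inner (T x) x)"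
 thus "positive_op T"
  by (auto simp: positive_op_def sa_ci_self sa_bcl nonneg_Reals_of_real_iff)
qed

lemma pos_bcl: "positive_op T ==> bounded_clinear T"
 by (simp add: positive_op_def)
lemma pos_in: "positive_op T ==> 0 <= inner (T x) x"
 by (simp add: pos_iff)

lemma sa_diff: "selfadj S ==> selfadj T ==> selfadj (%x. S x-T x)"
 and sa_add: "selfadj S ==> selfadj T ==> selfadj (%x. S x+T x)"
 and sa_scaleR: "selfadj S ==> selfadj (%x. r *\<^sub>R S x)"
 and sa_minus: "selfadj S ==> selfadj (%x. - S x)"
 and sa_ident: "selfadj (%x. x)"
 and sa_zero: "selfadj (%x. 0)"
 by (auto simp: selfadj_def adjoint_pair_def ci_algebra intro: bcl_intros)

lemma sa_smult_ident: "selfadj (%x. r *\<^sub>R x)"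
 by (rule sa_scaleR[OF sa_ident])

lemma op_le_iff: "op_le S T \<longleftrightarrow> selfadj (%x. T x-S x) & (\<forall>x. inner (S x) x <= inner (T x) x)"
 by (simp add: op_le_def pos_iff inner_diff_left)

lemma pos_cauchy_schwarz:
 assumes T: "selfadj T" and p: "!!x. 0 <= inner (T x) x"
 shows "(inner (T x) y)^2 <= inner (T x) x*inner (T y) y"
proof -
 define a b c where "a = inner (T x) x" and "b = inner (T x) y" and "c = inner (T y) y"
 have q: "0 <= a+2*t*b+t^2*c" for t
 proof -
  have "0 <= inner (T (x+t *\<^sub>R y)) (x+t *\<^sub>R y)" by (rule p)
  also have "... = a+2*t*b+t^2*c"
   using sa_in[OF T, of y x]
   by (simp add: a_def b_def c_def bcl_simps[OF sa_bcl[OF T]] inner_add inner_commute power2_eq_square algebra_simps)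
  finally show ?thesis .
 qed
 have a0: "0 <= a" "0 <= c" using p by (simp_all add: a_def c_def)
 have "b^2 <= a*c"
 proof (cases "c = 0")
  case True
  have "b = 0"
  proof (rule ccontr)
   assume "b ~= 0"
   thus False using q[of "- (a+1)/(2*b)"] True by (simp add: field_simps)
  qed
  thus ?thesis using True by simp
 next
  case False
  hence "0 <= a+2*(- b/c)*b+(- b/c)^2*c" by (intro q)
  also have "... = a-b^2/c" using False by (simp add: power2_eq_square field_simps)
  finally show ?thesis using False a0 by (simp add: field_simps)
 qed
 thus ?thesis by (simp add: a_def b_def c_def)
qed

text \<open>Cauchy-Schwarz for the form of \<open>T\<close> with second vector \<open>T x\<close>.
  This upgrades a bound on the quadratic form to a bound on the operator.\<close>

lemma pos_norm_bound:
 assumes T: "selfadj T" and p: "!!x. 0 <= inner (T x) x" and K: "!!x. inner (T x) x <= K*(norm x)^2"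
 shows "(norm (T x))^2 <= K*inner (T x) x" and "norm (T x) <= K*norm x"
proof -
 have *: "(norm (T x))^2*(norm (T x))^2 <= (K*inner (T x) x)*(norm (T x))^2"
 proof -
  have "(norm (T x))^2*(norm (T x))^2 = (inner (T x) (T x))^2"
   by (simp only: power2_norm_eq_inner) (simp only: power2_eq_square)
  also have "... <= inner (T x) x*inner (T (T x)) (T x)" by (rule pos_cauchy_schwarz[OF T p])
  also have "... <= inner (T x) x*(K*(norm (T x))^2)" by (intro mult_left_mono K p)
  finally show ?thesis by (simp add: mult_ac)
 qed
 have K0: "0 <= K*(norm x)^2" by (rule order_trans[OF p K])
 show 1: "(norm (T x))^2 <= K*inner (T x) x"
 proof (cases "T x = 0")
  case False
  hence "0 < (norm (T x))^2" by simp
  with * show ?thesis by (rule mult_right_le_imp_le)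
 qed simp
 show "norm (T x) <= K*norm x"
 proof (cases "x = 0")
  case False
  hence K': "0 <= K" using K0 by (simp add: zero_le_mult_iff)
  have "(norm (T x))^2 <= K*(K*(norm x)^2)"
   by (rule order_trans[OF 1]) (intro mult_left_mono K K')
  hence "(norm (T x))^2 <= (K*norm x)^2" by (simp add: power2_eq_square mult_ac)
  thus ?thesis using K' by (simp add: power2_le_iff_abs_le)
 qed (simp add: bcl_simps[OF sa_bcl[OF T]])
qed

lemma pos_in_eq_0:
 assumes T: "positive_op T" and "inner (T x) x = 0" shows "T x = 0"
proof -
 have "(inner (T x) (T x))^2 <= inner (T x) x*inner (T (T x)) (T x)"
  using T by (intro pos_cauchy_schwarz) (auto simp: pos_iff)
 thus ?thesis using assms by simp
qed

lemma bdd_form: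
 assumes "bounded_clinear T" obtains K where "K > 0" "!!x. \<bar>inner (T x) x\<bar> <= K*(norm x)^2"
proof -
 obtain K where K: "K > 0" "!!x. norm (T x) <= K*norm x" using bcl_bdd[OF assms] by blast
 have "\<bar>inner (T x) x\<bar> <= K*(norm x)^2" for x
 proof -
  have "\<bar>inner (T x) x\<bar> <= norm (T x)*norm x" by (rule Cauchy_Schwarz_ineq2)
  also have "... <= (K*norm x)*norm x" by (intro mult_right_mono K) simp
  finally show ?thesis by (simp add: power2_eq_square mult.assoc)
 qed
 thus ?thesis using K that by blast
qed


subsection \<open>Square roots\<close>

text \<open>For X = 1 - A a fixed point Y satisfies 2 Y = X + Y^2, that is (1 - Y)^2 = A; the square
  root is obtained as 1 - Y.\<close>

primrec sqrt_iter :: "('h::complex_hilbert => 'h) => nat => 'h => 'h" where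
 "sqrt_iter X 0 = (%x. 0)"
| "sqrt_iter X (Suc n) = (%x. (1/2) *\<^sub>R (X x+sqrt_iter X n (sqrt_iter X n x)))"

text \<open>The same iteration for the number X = 1. It majorizes the norms and the increments of
  the operator iterates, so convergence of a bounded increasing real sequence suffices.\<close>

primrec sqrt_bound :: "nat => real" where
 "sqrt_bound 0 = 0"
| "sqrt_bound (Suc n) = (1+(sqrt_bound n)^2)/2"

lemma sqrt_bound_range: "0 <= sqrt_bound n & sqrt_bound n <= 1"
 by (induction n) (auto simp: power_le_one)

lemma sqrt_bound_mono: "sqrt_bound n <= sqrt_bound (Suc n)"
proof (induction n)
 case (Suc n)
 have "(sqrt_bound n)^2 <= (sqrt_bound (Suc n))^2" using Suc sqrt_bound_range by (intro power_mono) auto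
 thus ?case by (simp only: sqrt_bound.simps(2)) simp
qed simp

lemma sqrt_iter_sa: assumes X: "selfadj X" shows "selfadj (sqrt_iter X n)"
proof (induction n)
 case (Suc n)
 note S = Suc
 have "selfadj (%x. sqrt_iter X n (sqrt_iter X n x))"
  using S by (auto simp: selfadj_def adjoint_pair_def intro: bcl_compose)
 thus ?case by (simp add: sa_scaleR sa_add X)
qed (simp add: sa_zero)

lemma sqrt_iter_com:
 assumes X: "selfadj X" and C: "bounded_clinear C" and CX: "!!x. C (X x) = X (C x)"
 shows "C (sqrt_iter X n x) = sqrt_iter X n (C x)"
proof (induction n arbitrary: x)
 case 0 show ?case by (simp add: bcl_simps[OF C])
next
 case (Suc n) thus ?case by (simp add: bcl_simps[OF C] CX)
qed

lemma sqrt_iter_com2: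
 assumes X: "selfadj X"
 shows "sqrt_iter X m (sqrt_iter X n x) = sqrt_iter X n (sqrt_iter X m x)"
proof (rule sqrt_iter_com[OF X sa_bcl[OF sqrt_iter_sa[OF X]]])
 show "sqrt_iter X m (X x) = X (sqrt_iter X m x)" for x
  by (rule sqrt_iter_com[OF X sa_bcl[OF X], symmetric]) simp
qed

text \<open>The iterates are polynomials in \<open>X\<close> and commute, so consecutive squares
  differ by (Y' + Y)(Y' - Y); the scalar iterates factor in the same way.\<close>

lemma sqrt_iter_bounds:
 assumes X: "selfadj X" and n1: "!!x. norm (X x) <= norm x"
 shows "norm (sqrt_iter X n x) <= sqrt_bound n*norm x"
  and "norm (sqrt_iter X (Suc n) x-sqrt_iter X n x) <= (sqrt_bound (Suc n)-sqrt_bound n)*norm x"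
proof -
 show bd: "norm (sqrt_iter X n x) <= sqrt_bound n*norm x" for n x
 proof (induction n arbitrary: x)
  case (Suc n)
  have "norm (sqrt_iter X n (sqrt_iter X n x)) <= sqrt_bound n*(sqrt_bound n*norm x)"
   by (rule order_trans[OF Suc]) (intro mult_left_mono Suc, simp add: sqrt_bound_range)
  hence "norm (X x+sqrt_iter X n (sqrt_iter X n x)) <= norm x+(sqrt_bound n)^2*norm x"
   using n1[of x] by (intro norm_triangle_le) (simp add: power2_eq_square mult.assoc)
  thus ?case unfolding sqrt_iter.simps norm_scaleR by (simp add: algebra_simps add_divide_distrib)
 qed simp
 show "norm (sqrt_iter X (Suc n) x-sqrt_iter X n x) <= (sqrt_bound (Suc n)-sqrt_bound n)*norm x"
 proof (induction n arbitrary: x)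
  case 0
  thus ?case using n1[of x] by simp
 next
  case (Suc n)
  let ?Y = "sqrt_iter X" and ?s = "sqrt_bound"
  note bY = sa_bcl[OF sqrt_iter_sa[OF X]]
  define z where "z = ?Y (Suc n) x-?Y n x"
  have z: "norm z <= (?s (Suc n)-?s n)*norm x" unfolding z_def by (rule Suc)
  have "?Y (Suc n) (?Y (Suc n) x)-?Y n (?Y n x) = ?Y (Suc n) z+?Y n z"
   unfolding z_def bcl_simps[OF bY] sqrt_iter_com2[OF X, of n "Suc n"] by simp
  moreover have "norm (?Y (Suc n) z+?Y n z) <= (?s (Suc n)+?s n)*((?s (Suc n)-?s n)*norm x)"
  proof -
   have "norm (?Y (Suc n) z+?Y n z) <= ?s (Suc n)*norm z+?s n*norm z"
    by (intro norm_triangle_le add_mono bd)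
   also have "... = (?s (Suc n)+?s n)*norm z" by (simp add: algebra_simps)
   also have "... <= (?s (Suc n)+?s n)*((?s (Suc n)-?s n)*norm x)"
    using sqrt_bound_range by (intro mult_left_mono z) (simp add: add_nonneg_nonneg del: sqrt_bound.simps)
   finally show ?thesis .
  qed
  moreover have "?Y (Suc (Suc n)) x-?Y (Suc n) x = (1/2) *\<^sub>R (?Y (Suc n) (?Y (Suc n) x)-?Y n (?Y n x))"
  proof -
   have "?Y (Suc (Suc n)) x-?Y (Suc n) x =
     (1/2) *\<^sub>R (X x+?Y (Suc n) (?Y (Suc n) x))-(1/2) *\<^sub>R (X x+?Y n (?Y n x))"
    by (simp only: sqrt_iter.simps(2))
   thus ?thesis by (simp only: scaleR_diff_right[symmetric] add_diff_cancel_left)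
  qed
  ultimately have "norm (?Y (Suc (Suc n)) x-?Y (Suc n) x) <= (1/2)*((?s (Suc n)+?s n)*((?s (Suc n)-?s n)*norm x))"
   by simp
  also have "... = (?s (Suc (Suc n))-?s (Suc n))*norm x"
  proof -
   have "?s (Suc (Suc n))-?s (Suc n) = ((?s (Suc n))^2-(?s n)^2)/2"
    by (simp add: field_simps power2_eq_square)
   also have "... = (1/2)*((?s (Suc n)+?s n)*(?s (Suc n)-?s n))"
    by (simp add: power2_eq_square square_diff_square_factored del: sqrt_bound.simps)
   finally show ?thesis by (simp only: mult.assoc)
  qed
  finally show ?case .
 qed
qed

text \<open>The commutation clause is inherited from the polynomials whose strong limit is taken.
  Uniqueness of the root and its membership in a von Neumann algebra both rest on it.\<close>

lemma sqrt_contraction_exists: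
 assumes A: "positive_op A" and A1: "!!x. inner (A x) x <= (norm x)^2"
 shows "\<exists>S. positive_op S & (\<forall>x. S (S x) = A x) \<and>
  (\<forall>C. bounded_clinear C --> (\<forall>x. C (A x) = A (C x)) --> (\<forall>x. C (S x) = S (C x)))"
proof -
 define X where "X = (%x. x-A x)"
 have X: "selfadj X" unfolding X_def by (intro sa_diff sa_ident pos_sa A)
 have Xn: "norm (X x) <= norm x" for x
  using pos_norm_bound(2)[OF X, of 1] A1 pos_in[OF A]
  by (simp add: X_def inner_diff_left power2_norm_eq_inner)
 let ?Y = "sqrt_iter X" and ?s = "sqrt_bound"
 note Ysa = sqrt_iter_sa[OF X] and bY = sa_bcl[OF sqrt_iter_sa[OF X]]
 have s: "incseq ?s" by (intro incseq_SucI sqrt_bound_mono)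
 have "Cauchy ?s"
  using s sqrt_bound_range
  by (intro convergent_Cauchy Bseq_mono_convergent BseqI'[of _ 1]) (auto simp: incseq_def)
 have diff: "norm (?Y m x-?Y n x) <= (?s m-?s n)*norm x" if "n <= m" for m n x
  using that
 proof (induction m rule: dec_induct)
  case (step m)
  have "norm (?Y (Suc m) x-?Y n x) <= norm (?Y (Suc m) x-?Y m x)+norm (?Y m x-?Y n x)"
   using norm_triangle_ineq[of "?Y (Suc m) x-?Y m x" "?Y m x-?Y n x"] by simp
  also have "... <= (?s (Suc m)-?s m)*norm x+(?s m-?s n)*norm x"
   by (intro add_mono step sqrt_iter_bounds(2)[OF X Xn])
  finally show ?case by (simp add: algebra_simps)
 qed simp
 have "Cauchy (%n. ?Y n x)" for x
 proof (rule metric_CauchyI)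
  fix e :: real assume e: "0 < e"
  obtain M where M: "!!m n. m >= M ==> n >= M ==> dist (?s m) (?s n) < e/(norm x+1)"
   using metric_CauchyD[OF \<open>Cauchy ?s\<close>, of "e/(norm x+1)"] e by (auto simp: add_nonneg_pos)
  have *: "dist (?Y m x) (?Y n x) < e" if "m >= M" "n >= M" "n <= m" for m n
  proof -
   have "dist (?Y m x) (?Y n x) <= dist (?s m) (?s n)*norm x"
    using diff[OF that(3), of x] by (simp add: dist_norm) (smt (verit) mult_right_mono norm_ge_zero)
   also have "... <= e/(norm x+1)*norm x"
    using M[OF that(1,2)] by (intro mult_right_mono) auto
   also have "... < e/(norm x+1)*(norm x+1)"
    using e by (intro mult_strict_left_mono) (auto simp: add_nonneg_pos)
   also have "... = e"
   proof -
    have "norm x+1 ~= 0" using norm_ge_zero[of x] by linarith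
    thus ?thesis by simp
   qed
   finally show ?thesis .
  qed
  hence "\<forall>m\<ge>M. \<forall>n\<ge>M. dist (?Y m x) (?Y n x) < e" by (metis dist_commute nle_le)
  thus "\<exists>M. \<forall>m\<ge>M. \<forall>n\<ge>M. dist (?Y m x) (?Y n x) < e" by blast
 qed
 hence "\<exists>l. (%n. ?Y n x) \<longlonglongrightarrow> l" for x by (simp add: Cauchy_convergent_iff convergent_def)
 then obtain Y where Y: "!!x. (%n. ?Y n x) \<longlonglongrightarrow> Y x" by metis
 have Y1: "norm (?Y n x) <= 1*norm x" for n x
  using sqrt_bound_range by (intro order_trans[OF sqrt_iter_bounds(1)[OF X Xn]] mult_right_mono) auto
 have Yb: "norm (Y x) <= 1*norm x" for x
  by (rule LIMSEQ_le_const2[OF tendsto_norm[OF Y]]) (use Y1 in blast)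
 have bY': "bounded_clinear Y"
 proof (rule bdd_clinearI[OF _ _ Yb])
  show "Y (x+y) = Y x+Y y" for x y
   by (rule LIMSEQ_unique[OF Y]) (simp add: bcl_simps[OF bY] tendsto_add Y)
  show "Y (c *\<^sub>C x) = c *\<^sub>C Y x" for c x
   by (rule LIMSEQ_unique[OF Y]) (simp add: bcl_simps[OF bY] tendsto_scaleC Y)
 qed
 have YY: "(%n. ?Y n (?Y n x)) \<longlonglongrightarrow> Y (Y x)" for x
 proof -
  have "(%n. ?Y n (?Y n x-Y x)) \<longlonglongrightarrow> 0"
  proof (rule tendsto_norm_zero_cancel, rule Lim_null_comparison)
   show "\<forall>\<^sub>F n in sequentially. norm (norm (?Y n (?Y n x-Y x))) <= norm (?Y n x-Y x)"
    using Y1[of _ "?Y _ x-Y x"] by simp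
   show "(%n. norm (?Y n x-Y x)) \<longlonglongrightarrow> 0"
    using tendsto_norm_zero[OF LIM_zero[OF Y]] .
  qed
  from tendsto_add[OF this Y[of "Y x"]] show ?thesis by (simp add: bcl_simps[OF bY])
 qed
 have eq: "Y x = (1/2) *\<^sub>R (X x+Y (Y x))" for x
 proof (rule LIMSEQ_unique)
  show "(%n. ?Y (Suc n) x) \<longlonglongrightarrow> Y x" using Y by (rule LIMSEQ_Suc)
  show "(%n. ?Y (Suc n) x) \<longlonglongrightarrow> (1/2) *\<^sub>R (X x+Y (Y x))" by (simp, intro tendsto_intros YY)
 qed
 define S where "S = (%x. x-Y x)"
 have Ysym: "cinner (Y x) y = cinner x (Y y)" for x y
  by (rule LIMSEQ_unique[OF tendsto_cinner[OF Y tendsto_const]])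
   (simp add: sa_cinner[OF Ysa] tendsto_cinner Y)
 have "selfadj Y" using bY' Ysym by (simp add: selfadj_def adjoint_pair_def)
 hence S: "selfadj S" unfolding S_def by (intro sa_diff sa_ident)
 have "0 <= inner (S x) x" for x
 proof -
  have "inner (Y x) x <= norm (Y x)*norm x" by (rule norm_cauchy_schwarz)
  also have "... <= norm x*norm x" using Yb by (intro mult_right_mono) auto
  finally show ?thesis by (simp add: S_def inner_diff_left power2_norm_eq_inner[symmetric] power2_eq_square)
 qed
 with S have "positive_op S" by (simp add: pos_iff)
 moreover have "S (S x) = A x" for x
 proof -
  have "2 *\<^sub>R Y x = X x+Y (Y x)" by (subst eq) simp
  hence "Y (Y x) = Y x+Y x-X x" by (simp add: scaleR_2)
  thus ?thesis by (simp add: S_def bcl_simps[OF bY'] X_def)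
 qed
 moreover have "C (S x) = S (C x)" if C: "bounded_clinear C" "\<forall>x. C (A x) = A (C x)" for C x
 proof -
  have "C (Y x) = Y (C x)"
  proof (rule LIMSEQ_unique)
   show "(%n. C (?Y n x)) \<longlonglongrightarrow> C (Y x)" by (rule bcl_tendsto[OF C(1) Y])
   have "C (?Y n x) = ?Y n (C x)" for n
    by (rule sqrt_iter_com[OF X C(1)]) (simp add: X_def bcl_simps[OF C(1)] C(2))
   thus "(%n. C (?Y n x)) \<longlonglongrightarrow> Y (C x)" using Y by simp
  qed
  thus ?thesis by (simp add: S_def bcl_simps[OF C(1)])
 qed
 ultimately show ?thesis by blast
qed

lemma sqrt_exists:
 assumes A: "positive_op A"
 shows "\<exists>S. positive_op S & (\<forall>x. S (S x) = A x) \<and>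
  (\<forall>C. bounded_clinear C --> (\<forall>x. C (A x) = A (C x)) --> (\<forall>x. C (S x) = S (C x)))"
proof -
 obtain K where K: "K > 0" "!!x. \<bar>inner (A x) x\<bar> <= K*(norm x)^2"
  using bdd_form[OF pos_bcl[OF A]] by blast
 define A' where "A' = (%x. (1/K) *\<^sub>R A x)"
 have "positive_op A'" using A K unfolding A'_def pos_iff by (auto intro: sa_scaleR)
 moreover have "inner (A' x) x <= (norm x)^2" for x
  using K(1) K(2)[of x] by (simp add: A'_def field_simps)
 ultimately obtain S where S: "positive_op S" "!!x. S (S x) = A' x"
   "!!C x. bounded_clinear C ==> (\<forall>x. C (A' x) = A' (C x)) ==> C (S x) = S (C x)"
  using sqrt_contraction_exists[of A'] by blast
 define R where "R = (%x. sqrt K *\<^sub>R S x)"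
 note bS = pos_bcl[OF S(1)]
 have "positive_op R" using S(1) K(1) unfolding R_def pos_iff by (auto intro: sa_scaleR)
 moreover have "R (R x) = A x" for x
  using K(1) by (simp add: R_def bcl_simps[OF bS] S(2) A'_def)
 moreover have "C (R x) = R (C x)" if "bounded_clinear C" "\<forall>x. C (A x) = A (C x)" for C x
  using S(3)[OF that(1)] that by (simp add: R_def A'_def bcl_simps[OF that(1)])
 ultimately show ?thesis by blast
qed

definition sqop :: "('h::complex_hilbert => 'h) => 'h => 'h"
 where "sqop A = (SOME S. positive_op S & (\<forall>x. S (S x) = A x) \<and>
  (\<forall>C. bounded_clinear C --> (\<forall>x. C (A x) = A (C x)) --> (\<forall>x. C (S x) = S (C x))))"

lemma sqop_pos: "positive_op A ==> positive_op (sqop A)"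
 and sqop_sq: "positive_op A ==> sqop A (sqop A x) = A x"
 and sqop_com: "positive_op A ==> bounded_clinear C ==> (!!x. C (A x) = A (C x)) ==> C (sqop A x) = sqop A (C x)"
 using someI_ex[OF sqrt_exists] unfolding sqop_def by blast+

text \<open>A competing root S commutes with its square A, hence with T = \<open>sqop A\<close>, so
  (T + S)(T - S) = 0. By positivity the forms of T and S both vanish at y = (T - S) x, so T y = S y
  = 0 and y is orthogonal to itself.\<close>

lemma sqop_unique:
 assumes A: "positive_op A" and S: "positive_op S" and SS: "!!x. S (S x) = A x"
 shows "sqop A = S"
proof
 fix x
 let ?T = "sqop A"
 note T = sqop_pos[OF A]
 note bS = pos_bcl[OF S] and bT = pos_bcl[OF T]
 have comm: "S (?T y) = ?T (S y)" for y
  by (rule sqop_com[OF A bS]) (simp add: SS[symmetric])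
 define y where "y = ?T x-S x"
 have "?T y+S y = 0" by (simp add: y_def bcl_simps[OF bS] bcl_simps[OF bT] comm SS sqop_sq[OF A])
 hence "inner (?T y) y+inner (S y) y = 0" by (simp add: inner_add_left[symmetric])
 hence "inner (?T y) y = 0" "inner (S y) y = 0"
  using pos_in[OF S, of y] pos_in[OF T, of y] by linarith+
 hence "?T y = 0" "S y = 0" using S T pos_in_eq_0 by blast+
 moreover have "inner y y = inner (?T x) y-inner (S x) y" by (subst (1) y_def) (rule inner_diff_left)
 ultimately have "inner y y = 0"
  using sa_in[OF pos_sa[OF S]] sa_in[OF pos_sa[OF T]] by simp
 thus "?T x = S x" by (simp add: y_def)
qed

text \<open>At an approximate eigenvector of \<open>b - a\<close> for a negative lower bound of its numerical range,
 \<open>a\<^sup>2 \<le> b\<^sup>2\<close> fails.\<close>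

lemma sqrt_monotone:
 assumes a: "positive_op a" and b: "positive_op b"
  and le: "!!x. (norm (a x))^2 <= (norm (b x))^2"
 shows "inner (a x) x <= inner (b x) x"
proof (rule ccontr)
 assume x: "\<not> inner (a x) x <= inner (b x) x"
 define T where "T = (%x. b x-a x)"
 have T: "selfadj T" unfolding T_def by (intro sa_diff pos_sa a b)
 note bT = sa_bcl[OF T]
 obtain K where K: "K > 0" "!!x. \<bar>inner (T x) x\<bar> <= K*(norm x)^2" using bdd_form[OF bT] by blast
 define V where "V = (%x. inner (T x) x) ` {x. norm x = 1}"
 define m where "m = - Inf V"
 have "- K <= inner (T y) y" if "norm y = 1" for y using K(2)[of y] that by simp
 hence bdd: "bdd_below V" by (auto simp: V_def bdd_below_def intro!: exI[of _ "-K"])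
 have x0: "x ~= 0" using x by auto
 have xV: "inner (T ((1/norm x) *\<^sub>R x)) ((1/norm x) *\<^sub>R x) : V" unfolding V_def by (rule imageI) (use x0 in simp)
 have "inner (T ((1/norm x) *\<^sub>R x)) ((1/norm x) *\<^sub>R x) < 0"
  using x x0 by (simp add: bcl_simps[OF bT]) (simp add: T_def inner_diff_left divide_neg_pos)
 hence m: "m > 0" using cInf_lower[OF xV bdd] by (simp add: m_def)
 have Tm: "0 <= inner (T y+m *\<^sub>R y) y" for y
 proof (cases "y = 0")
  case False
  hence "inner (T ((1/norm y) *\<^sub>R y)) ((1/norm y) *\<^sub>R y) : V" unfolding V_def by (intro imageI) simp
  from cInf_lower[OF this bdd] have "- m <= inner (T y) y/(norm y)^2"
   by (simp add: m_def bcl_simps[OF bT] power2_eq_square)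
  thus ?thesis using False by (simp add: inner_add_left power2_norm_eq_inner field_simps)
 qed simp
 define U where "U = (%y. T y+m *\<^sub>R y)"
 have U: "selfadj U" unfolding U_def by (intro sa_add T sa_smult_ident)
 have Ub: "(norm (U y))^2 <= (K+m)*inner (U y) y" for y
 proof (rule pos_norm_bound(1)[OF U])
  show "0 <= inner (U y) y" for y using Tm by (simp add: U_def)
  show "inner (U y) y <= (K+m)*(norm y)^2" for y
   using K(2)[of y] by (simp add: U_def inner_add_left power2_norm_eq_inner algebra_simps)
 qed
 obtain L where L: "L > 0" "!!x. norm (b x) <= L*norm x"
  using bcl_bdd[OF pos_bcl[OF b]] by blast
 \<comment> \<open>Chosen so that the cross term 2 (L + m) r = m^2 / 2 stays below the surplus m^2
   of \<open>w1\<close>.\<close>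
 define r where "r = m^2/4/(L+m)"
 have r: "r > 0" using m L by (simp add: r_def)
 have "Inf V < - m+r^2/(K+m)" using r m K by (simp add: m_def)
 then obtain y where y: "norm y = 1" "inner (T y) y < - m+r^2/(K+m)"
  using cInf_lessD[of V "- m+r^2/(K+m)"] xV by (auto simp: V_def)
 have "(norm (U y))^2 < r^2"
 proof -
  have "inner (U y) y < r^2/(K+m)" using y by (simp add: U_def inner_add_left power2_norm_eq_inner[symmetric])
  hence "(K+m)*inner (U y) y < r^2" using K m by (simp add: field_simps)
  thus ?thesis using Ub[of y] by linarith
 qed
 hence Ur: "norm (U y) < r" using r by (simp add: power_less_imp_less_base)
 have ay: "a y = (b y+m *\<^sub>R y)-U y" by (simp add: U_def T_def)
 define w where "w = b y+m *\<^sub>R y"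
 have w1: "(norm w)^2 >= (norm (b y))^2+m^2"
 proof -
  have "(norm w)^2 = (norm (b y))^2+2*m*inner (b y) y+m^2*(norm y)^2"
   unfolding w_def power2_norm_eq_inner
   by (simp add: inner_add inner_commute algebra_simps power2_eq_square)
  thus ?thesis using pos_in[OF b, of y] m y(1) by simp
 qed
 have w2: "norm w <= L+m"
  unfolding w_def using L(2)[of y] y(1) m by (intro norm_triangle_le) simp
 have "(norm (a y))^2 = (norm w)^2-2*inner w (U y)+(norm (U y))^2"
  unfolding ay w_def[symmetric] by (simp add: power2_norm_eq_inner inner_diff inner_commute)
 moreover have "inner w (U y) <= (L+m)*r"
  by (rule order_trans[OF norm_cauchy_schwarz]) (use w2 Ur L m r in \<open>intro mult_mono, auto\<close>)
 moreover have "2*((L+m)*r) < m^2"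
 proof -
  have "L+m ~= 0" using m L by linarith
  moreover have "z*(c/z) = c" if "z ~= 0" for z c :: real using that by simp
  ultimately have "(L+m)*r = m^2/4" unfolding r_def by blast
  moreover have "0 < m^2" using m by simp
  ultimately show ?thesis by linarith
 qed
 moreover have "(norm (U y))^2 >= 0" by simp
 ultimately have "(norm (a y))^2 > (norm (b y))^2" using w1 by linarith
 thus False using le[of y] by simp
qed


subsection \<open>Spectral cuts\<close>

lemma commute_proj:
 assumes K: "csub K" "closed K" and C: "bounded_clinear C"
  and inv: "!!x. x : K ==> C x : K" "!!x. x : K ==> adj C x : K"
 shows "C (proj K x) = proj K (C x)"
proof (rule proj_unique[OF K, symmetric])
 show "C (proj K x) : K" by (intro inv proj_in K)
 fix y assume y: "y : K"
 have "cinner (C x-C (proj K x)) y = cinner (x-proj K x) (adj C y)"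
  by (simp add: bcl_diff_simp[OF C, symmetric] adj_cinner[OF C])
 also have "... = 0" by (intro proj_ortho K inv y)
 finally show "cinner (C x-C (proj K x)) y = 0" .
qed

definition absop :: "('h::complex_hilbert => 'h) => 'h => 'h"
 where "absop T = sqop (%x. T (T x))"

text \<open>The spectral projection of a self-adjoint operator for the half-line \<open>(0, \<infinity>)\<close>.\<close>

definition cut :: "('h::complex_hilbert => 'h) => 'h => 'h"
 where "cut T = (%x. x-proj {y. absop T y+T y = 0} x)"

context
 fixes T :: "'h::complex_hilbert => 'h"
 assumes T: "selfadj T"
begin

lemma pos_square: "positive_op (%x. T (T x))"
proof -
 have "inner (T (T x)) x = inner (T x) (T x)" for x by (rule sa_in[OF T])
 thus ?thesis
  using T by (auto simp: pos_iff selfadj_def adjoint_pair_def intro: bcl_compose)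
qed

lemma absop_pos: "positive_op (absop T)"
 and absop_sq: "absop T (absop T x) = T (T x)"
 and absop_com: "bounded_clinear C ==> (!!x. C (T x) = T (C x)) ==> C (absop T x) = absop T (C x)"
 unfolding absop_def using pos_square by (auto intro: sqop_pos sqop_sq sqop_com)

lemma absop_com_self: "T (absop T x) = absop T (T x)"
 by (rule absop_com) (simp_all add: sa_bcl T)

lemma cut_kernel_sub: "csub {y. absop T y+T y = 0}" "closed {y. absop T y+T y = 0}"
 using csub_kernel[of "%y. absop T y+T y"] closed_kernel[of "%y. absop T y+T y"]
  bcl_add[OF pos_bcl[OF absop_pos] sa_bcl[OF T]] by auto

lemma pr_cut: "projection_op (cut T)"
 unfolding cut_def by (intro pr_compl pr_proj cut_kernel_sub)

lemma cut_com:
 assumes C: "bounded_clinear C" and CT: "!!x. C (T x) = T (C x)"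
 shows "C (cut T x) = cut T (C x)"
proof -
 have CT': "adj C (T x) = T (adj C x)" for x
 proof (rule ci_eqI2)
  fix z show "cinner z (adj C (T x)) = cinner z (T (adj C x))"
   using sa_cinner[OF T] by (simp add: adj_cinner[OF C, symmetric]) (metis CT adj_cinner[OF C])
 qed
 have *: "D (absop T y)+T (D y) = 0"
  if D: "bounded_clinear D" and DT: "!!x. D (T x) = T (D x)" and y: "absop T y+T y = 0" for D y
  using arg_cong[OF y, of D] by (simp add: bcl_simps[OF D] DT)
 have "C (proj {y. absop T y+T y = 0} x) = proj {y. absop T y+T y = 0} (C x)"
  using *[OF C CT] *[OF adj_bcl[OF C] CT'] absop_com[OF C CT] absop_com[OF adj_bcl[OF C] CT']
  by (intro commute_proj cut_kernel_sub C) auto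
 thus ?thesis by (simp add: cut_def bcl_simps[OF C])
qed

text \<open>A vector killed by the cut lies in the kernel of |T| + T, where T = -|T|.\<close>

lemma cut_neg: assumes "cut T x = 0" shows "inner (T x) x <= 0"
proof -
 have "x = proj {y. absop T y+T y = 0} x" using assms by (simp add: cut_def)
 hence "x : {y. absop T y+T y = 0}" using proj_in[OF cut_kernel_sub] by metis
 hence "T x = - absop T x" by (simp add: eq_neg_iff_add_eq_0 add.commute)
 thus ?thesis using pos_in[OF absop_pos, of x] by simp
qed

text \<open>Since |T|^2 = T^2, the values of |T| - T lie in the kernel of |T| + T. A vector
  orthogonal to that kernel therefore satisfies |T| x = T x.\<close>

lemma cut_pos: assumes e: "cut T x = x" and x: "x ~= 0" shows "inner (T x) x > 0"
proof -
 note bA = pos_bcl[OF absop_pos] and bT = sa_bcl[OF T]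
 have p0: "proj {y. absop T y+T y = 0} x = 0" using e by (simp add: cut_def)
 have orth: "cinner x y = 0" if "absop T y+T y = 0" for y
  using proj_ortho[OF cut_kernel_sub, of y x] that by (simp add: p0)
 have "absop T x = T x"
 proof (rule ci_eqI)
  fix y
  have "absop T (absop T y-T y)+T (absop T y-T y) = 0"
   by (simp add: bcl_simps[OF bA] bcl_simps[OF bT] absop_sq absop_com_self)
  hence "cinner x (absop T y-T y) = 0" by (rule orth)
  thus "cinner (absop T x) y = cinner (T x) y"
   by (simp add: ci_diff_right sa_cinner[OF T] sa_cinner[OF pos_sa[OF absop_pos]])
 qed
 hence "0 <= inner (T x) x" using pos_in[OF absop_pos, of x] by simp
 moreover have "inner (T x) x ~= 0"
 proof
  assume "inner (T x) x = 0"
  hence "absop T x = 0" using pos_in_eq_0[OF absop_pos, of x] \<open>absop T x = T x\<close> by metis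
  hence "cinner x x = 0" using orth[of x] \<open>absop T x = T x\<close> by simp
  thus False using x by simp
 qed
 ultimately show ?thesis by linarith
qed

end

section \<open>The modulus of a closed operator\<close>

instantiation prod :: (complex_hilbert, complex_hilbert) complex_hilbert
begin

definition scaleC_prod :: "complex => 'a \<times> 'b => 'a \<times> 'b"
 where "scaleC_prod c x = (c *\<^sub>C fst x, c *\<^sub>C snd x)"

definition cinner_prod :: "'a \<times> 'b => 'a \<times> 'b => complex"
 where "cinner_prod x y = cinner (fst x) (fst y)+cinner (snd x) (snd y)"

instance
proof
 fix x y :: "'a \<times> 'b"
 show "cinner x y = cnj (cinner y x)"
  unfolding cinner_prod_def by (subst (1 2) cinner_commute) simp
qed (auto simp: scaleC_prod_def cinner_prod_def scaleC_add_right scaleC_add_left scaleC_scaleC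
  scaleC_complex_of_real ci_algebra algebra_simps inner_prod_def inner_eq_Re_cinner prod_eq_iff)

end

lemma scaleC_Pair [simp]: "c *\<^sub>C (a, b) = (c *\<^sub>C a, c *\<^sub>C b)"
 by (simp add: scaleC_prod_def)
lemma ci_Pair [simp]: "cinner (a, b) (c, d) = cinner a c+cinner b d"
 by (simp add: cinner_prod_def)

text \<open>With Q the root of \<open>A\<close>, which commutes with \<open>B\<close>, the number is
  the form of \<open>B\<close> at Q x.\<close>

lemma pos_com_product:
 assumes A: "positive_op A" and B: "positive_op B" and c: "!!x. A (B x) = B (A x)"
 shows "0 <= inner (A x) (B x)"
proof -
 let ?Q = "sqop A"
 have Q: "selfadj ?Q" using sqop_pos[OF A] by (rule pos_sa)
 have QB: "B (?Q y) = ?Q (B y)" for y by (rule sqop_com[OF A pos_bcl[OF B]]) (simp add: c)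
 have "inner (A x) (B x) = inner (?Q (?Q x)) (B x)" by (simp add: sqop_sq[OF A])
 also have "... = inner (?Q x) (B (?Q x))" by (simp add: sa_in[OF Q] QB)
 also have "... >= 0" using pos_in[OF B] by (simp add: inner_commute)
 finally show ?thesis .
qed

text \<open>The projection of \<open>H \<times> H\<close> onto the graph of \<open>x\<close> maps \<open>(\<zeta>, 0)\<close> to \<open>(R \<zeta>, x R \<zeta>)\<close>
 with \<open>R = (1 + x\<^sup>* x)\<^sup>-\<^sup>1\<close>.\<close>

definition resolv :: "'h::complex_hilbert unbdd_op => 'h => 'h"
 where "resolv x u = fst (proj x (u, 0))"

definition rsv_op :: "'h::complex_hilbert unbdd_op => 'h => 'h"
 where "rsv_op x u = snd (proj x (u, 0))"

lemma lin_csub: "linear_op x ==> csub x"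
 by (auto simp: linear_op_def csub_def zero_prod_def split: prod.splits)

lemma norm_fst_snd_le: "norm (fst z) <= norm z" "norm (snd z) <= norm z"
 by (cases z; simp add: norm_fst_le norm_snd_le)+

lemma lin_uniq: "linear_op x ==> (a, b) : x ==> (a, c) : x ==> b = c"
 by (auto simp: linear_op_def single_valued_def)

lemma lin_add: "linear_op x ==> (a, b) : x ==> (c, d) : x ==> (a+c, b+d) : x"
 using csub_add[OF lin_csub, of x "(a, b)" "(c, d)"] by simp
lemma lin_diff: "linear_op x ==> (a, b) : x ==> (c, d) : x ==> (a-c, b-d) : x"
 using csub_diff[OF lin_csub, of x "(a, b)" "(c, d)"] by simp
lemma lin_scaleC: "linear_op x ==> (a, b) : x ==> (c *\<^sub>C a, c *\<^sub>C b) : x"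
 using csub_scaleC[OF lin_csub, of x "(a, b)"] by simp
lemma lin_zero: "linear_op x ==> (0, 0) : x"
 by (simp add: linear_op_def)

lemma csub_Dom: "linear_op x ==> csub (Domain x)"
 unfolding csub_def Domain_iff
 using lin_add lin_scaleC lin_zero by blast

context
 fixes x :: "'h::complex_hilbert unbdd_op"
 assumes x: "closed_dense_op x"
begin

lemma cdo_linear: "linear_op x" and cdo_closed: "closed x"
 and cdo_dense: "closure (Domain x) = UNIV"
 using x by (simp_all add: closed_dense_op_def)

lemma cdo_csub: "csub x"
 using cdo_linear by (rule lin_csub)

lemma dense_domain_zero: "(!!v w. (v, w) : x ==> cinner u v = 0) ==> u = 0"
 using ortho_of_closure[of u "Domain x" u] cdo_dense by (auto simp: Domain_iff)

lemma rsv_graph: "(resolv x u, rsv_op x u) : x"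
 using proj_in[OF cdo_csub cdo_closed] by (simp add: resolv_def rsv_op_def)

text \<open>Orthogonality of \<open>(u, 0)\<close> minus its projection to the graph. This is the
  weak form of (1 + x* x) R u = u, and by \<open>rsv_unique\<close> it determines both
  components.\<close>

lemma rsv_cinner: "(v, w) : x ==> cinner u v = cinner (resolv x u) v + cinner (rsv_op x u) w"
 using proj_ortho[OF cdo_csub cdo_closed, of "(v, w)" "(u, 0)"]
 by (simp add: resolv_def rsv_op_def cinner_prod_def ci_diff_left algebra_simps)

lemma rsv_unique:
 assumes m: "(v, w) : x"
  and c: "!!v' w'. (v', w') : x ==> cinner u v' = cinner v v'+cinner w w'"
 shows "resolv x u = v" "rsv_op x u = w"
proof -
 have "proj x (u, 0) = (v, w)"
  by (rule proj_unique[OF cdo_csub cdo_closed m])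
   (auto simp: cinner_prod_def ci_diff_left c)
 thus "resolv x u = v" "rsv_op x u = w" by (simp_all add: resolv_def rsv_op_def)
qed

lemma rsv_bcl: "bounded_clinear (resolv x)" and rsv_op_bcl: "bounded_clinear (rsv_op x)"
proof -
 note p = pr_proj[OF cdo_csub cdo_closed]
 note b = bcl_simps[OF pr_bcl[OF p]]
 have add: "proj x (u+u', 0) = proj x (u, 0)+proj x (u', 0)" for u u'
  using b(1)[of "(u, 0)" "(u', 0)"] by simp
 have sc: "proj x (c *\<^sub>C u, 0) = c *\<^sub>C proj x (u, 0)" for u c
  using b(5)[of c "(u, 0)"] by simp
 have n: "norm (proj x (u, 0)) <= 1*norm u" for u
  using pr_nle[OF p, of "(u, 0)"] by (simp add: norm_Pair)
 show "bounded_clinear (resolv x)"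
  by (rule bdd_clinearI[of _ 1])
   (auto simp: resolv_def add sc scaleC_prod_def intro: order_trans[OF norm_fst_snd_le(1) n[simplified]])
 show "bounded_clinear (rsv_op x)"
  by (rule bdd_clinearI[of _ 1])
   (auto simp: rsv_op_def add sc scaleC_prod_def intro: order_trans[OF norm_fst_snd_le(2) n[simplified]])
qed

lemma rsv_sa: "selfadj (resolv x)"
proof -
 have "cinner (resolv x u) u' = cinner u (resolv x u')" for u u'
  using rsv_cinner[OF rsv_graph[of u'], of u] rsv_cinner[OF rsv_graph[of u], of u']
  by (metis cinner_commute complex_cnj_add)
 thus ?thesis by (simp add: selfadj_def adjoint_pair_def rsv_bcl)
qed

lemma rsv_in: "inner (resolv x u) u = (norm (resolv x u))^2+(norm (rsv_op x u))^2"
 using rsv_cinner[OF rsv_graph[of u], of u]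
 by (subst inner_commute) (simp add: inner_eq_Re_cinner ci_self)

lemma rsv_pos: "positive_op (resolv x)"
 by (simp add: pos_iff rsv_sa rsv_in)

lemma rsv_le_1: "inner (resolv x u) u <= (norm u)^2"
proof -
 have "norm (resolv x u) <= norm u"
  using pr_nle[OF pr_proj[OF cdo_csub cdo_closed], of "(u, 0)"]
   norm_fst_snd_le(1)[of "proj x (u, 0)"] by (simp add: norm_Pair resolv_def)
 hence "norm (resolv x u)*norm u <= norm u*norm u" by (intro mult_right_mono) auto
 thus ?thesis using norm_cauchy_schwarz[of "resolv x u" u] by (simp add: power2_eq_square)
qed

text \<open>By \<open>rsv_in\<close> the second component vanishes too, and then the weak equation
  makes \<open>u\<close> orthogonal to the dense domain.\<close>

lemma rsv_inject: assumes "resolv x u = 0" shows "u = 0"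
proof -
 have "rsv_op x u = 0" using rsv_in[of u] assms by simp
 thus ?thesis using rsv_cinner[of _ _ u] assms by (intro dense_domain_zero) simp
qed

lemma rsv_op_adj: "(rsv_op x u, u-resolv x u) : op_adj x"
proof -
 have "cinner w (rsv_op x u) = cinner v (u-resolv x u)" if "(v, w) : x" for v w
  using arg_cong[OF rsv_cinner[OF that, of u], of cnj]
  by (simp add: ci_diff_right cinner_commute[symmetric])
 thus ?thesis by (auto simp: op_adj_def)
qed

text \<open>This is x* x = R^-1 - 1 without an inverse: the parameter is u = (1 + x* x) v. In
  particular x* x determines the resolvent (\<open>rsv_eqI\<close>).\<close>

lemma x_adj_x: "x O op_adj x = range (%u. (resolv x u, u-resolv x u))"
proof (intro equalityI subrelI)
 fix v ta assume "(v, ta) : x O op_adj x"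
 then obtain w where e: "(v, w) : x" "(w, ta) : op_adj x" by blast
 have "resolv x (v + ta) = v"
 proof (rule rsv_unique(1)[OF e(1)])
  fix v' w' assume "(v', w') : x"
  hence "cinner w' w = cinner v' ta" using e(2) by (auto simp: op_adj_def)
  hence "cinner w w' = cinner ta v'" by (metis cinner_commute)
  thus "cinner (v + ta) v' = cinner v v'+cinner w w'" by (simp add: cinner_add_left)
 qed
 thus "(v, ta) : range (%u. (resolv x u, u-resolv x u))"
  by (intro image_eqI[of _ _ "v + ta"]) auto
next
 fix v ta assume "(v, ta) : range (%u. (resolv x u, u-resolv x u))"
 thus "(v, ta) : x O op_adj x" using rsv_graph rsv_op_adj by blast
qed

text \<open>The domain of x* x is a core: if the graph vector (v, u) is orthogonal to all these
  pairs, the weak equation gives <h, v> = 0 for every h.\<close>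

lemma rsv_core: "x = closure (range (%h. (resolv x h, rsv_op x h)))"
proof
 let ?D = "range (%h. (resolv x h, rsv_op x h))"
 show "closure ?D \<subseteq> x" using rsv_graph cdo_closed by (intro closure_minimal) auto
 have D: "csub ?D"
  unfolding csub_def
  by (auto simp: image_iff zero_prod_def)
   (metis bcl_zero_simp[OF rsv_bcl] bcl_zero_simp[OF rsv_op_bcl],
    metis bcl_add_simp[OF rsv_bcl] bcl_add_simp[OF rsv_op_bcl],
    metis bcl_scaleC_simp[OF rsv_bcl] bcl_scaleC_simp[OF rsv_op_bcl])
 note K = cdo_csub cdo_closed
 show "x \<subseteq> closure ?D"
 proof
  fix z assume z: "z : x"
  show "z : closure ?D"
  proof (rule in_closure_if_ortho[OF D])
   fix y assume y: "!!w. w : ?D ==> cinner y w = 0"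
   obtain v u where p: "proj x y = (v, u)" by fastforce
   have px: "(v, u) : x" using proj_in[OF K, of y] by (simp add: p)
   have "cinner v h = 0" for h
   proof -
    have "cinner (y-proj x y) (resolv x h, rsv_op x h) = 0" by (rule proj_ortho[OF K rsv_graph])
    hence "cinner (v, u) (resolv x h, rsv_op x h) = 0"
     using y[of "(resolv x h, rsv_op x h)"] by (simp add: ci_diff_left p del: ci_Pair)
    hence "cinner (resolv x h) v + cinner (rsv_op x h) u = 0"
     by simp (metis cinner_commute complex_cnj_add complex_cnj_zero)
    hence "cinner h v = 0" using rsv_cinner[OF px, of h] by simp
    thus ?thesis by (metis cinner_commute complex_cnj_zero)
   qed
   hence "v = 0" by (metis ci_self_eq_0)
   hence "u = 0" using lin_uniq[OF cdo_linear px] lin_zero[OF cdo_linear] by simp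
   hence "proj x y = 0" using \<open>v = 0\<close> p by (simp add: zero_prod_def)
   thus "cinner y z = 0" using proj_ortho[OF K z, of y] by simp
  qed
 qed
qed

lemma one_minus_rsv_pos: "positive_op (%u. u-resolv x u)"
 using rsv_le_1 sa_diff[OF sa_ident rsv_sa]
 by (auto simp: pos_iff inner_diff_left power2_norm_eq_inner)

text \<open>This is (1 - R)^(1/2) R^(-1/2), the modulus of \<open>x\<close>, parametrized by
  \<open>ta\<close> so that no unbounded inverse occurs.\<close>

definition absg :: "'h unbdd_op"
 where "absg = range (%ta. (sqop (resolv x) ta, sqop (%u. u-resolv x u) ta))"

abbreviation "Ra \<equiv> sqop (resolv x)"
abbreviation "Sa \<equiv> sqop (%u. u-resolv x u)"

lemmas Ra_pos = sqop_pos[OF rsv_pos] and Sa_pos = sqop_pos[OF one_minus_rsv_pos]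
lemmas Ra_bcl = pos_bcl[OF Ra_pos] and Sa_bcl = pos_bcl[OF Sa_pos]

lemma Ra_Sa_com: "Ra (Sa y) = Sa (Ra y)"
proof (rule sqop_com[OF one_minus_rsv_pos Ra_bcl])
 show "Ra (y-resolv x y) = Ra y-resolv x (Ra y)" for y
  by (simp add: bcl_simps[OF Ra_bcl] sqop_sq[OF rsv_pos, symmetric])
qed

lemma Ra_sq: "Ra (Ra y) = resolv x y" and Sa_sq: "Sa (Sa y) = y-resolv x y"
 by (simp_all add: sqop_sq rsv_pos one_minus_rsv_pos)

lemma absg_iff: "(v, w) : absg \<longleftrightarrow> Ra (Ra v + Sa w) = v & Sa (Ra v + Sa w) = w"
proof
 assume "(v, w) : absg"
 then obtain ta where t: "v = Ra ta" "w = Sa ta" by (auto simp: absg_def)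
 have "Ra v + Sa w = ta" by (simp add: t Ra_sq Sa_sq)
 thus "Ra (Ra v + Sa w) = v & Sa (Ra v + Sa w) = w" by (simp add: t)
next
 assume "Ra (Ra v + Sa w) = v & Sa (Ra v + Sa w) = w"
 thus "(v, w) : absg" unfolding absg_def by (intro image_eqI[of _ _ "Ra v + Sa w"]) auto
qed

text \<open>Because Ra^2 + Sa^2 = 1, the parameter can be eliminated in favour of a linear equation
  between bounded operators. Closedness and self-adjointness become algebra.\<close>

lemma absg_iff': "(v, w) : absg \<longleftrightarrow> Sa v = Ra w"
proof
 assume "(v, w) : absg"
 thus "Sa v = Ra w" by (auto simp: absg_def Ra_Sa_com)
next
 assume s: "Sa v = Ra w"
 have "Ra (Ra v + Sa w) = v"
  by (simp add: bcl_simps[OF Ra_bcl] Ra_Sa_com Ra_sq s[symmetric] Sa_sq)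
 moreover have "Sa (Ra v + Sa w) = w"
  by (simp add: bcl_simps[OF Sa_bcl] Ra_Sa_com[symmetric] Ra_sq s Sa_sq)
 ultimately show "(v, w) : absg" by (simp add: absg_iff)
qed

lemma absg_closed_dense: "closed_dense_op absg"
 unfolding closed_dense_op_def
proof (intro conjI)
 note b = bcl_simps[OF Ra_bcl] bcl_simps[OF Sa_bcl]
 have "single_valued absg"
 proof (rule single_valuedI)
  fix a b c assume "(a, b) : absg" "(a, c) : absg"
  hence "Ra (b-c) = 0" by (simp add: absg_iff' b)
  hence "resolv x (b-c) = 0" by (simp add: Ra_sq[symmetric] b)
  thus "b = c" using rsv_inject by fastforce
 qed
 thus "linear_op absg"
  unfolding linear_op_def by (auto simp: absg_iff' b)
 have "closed {z. Sa (fst z) = Ra (snd z)}"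
  by (intro closed_Collect_eq continuous_on_compose2[OF bcl_cont[OF Sa_bcl, of UNIV]]
    continuous_on_compose2[OF bcl_cont[OF Ra_bcl, of UNIV]] continuous_intros) auto
 moreover have "absg = {z. Sa (fst z) = Ra (snd z)}" using absg_iff' by auto
 ultimately show "closed absg" by simp
 have "closure (range (resolv x)) = UNIV"
 proof (rule dense_if_ortho[OF csub_range[OF rsv_bcl]])
  fix y assume y: "!!z. z : range (resolv x) ==> cinner y z = 0"
  have "cinner (resolv x y) (resolv x y) = 0"
   using y by (simp add: sa_cinner[OF rsv_sa])
  thus "y = 0" by (rule rsv_inject[OF iffD1[OF ci_self_eq_0]])
 qed
 moreover have "range (resolv x) \<subseteq> Domain absg" by (auto simp: absg_def Ra_sq[symmetric])
 ultimately show "closure (Domain absg) = UNIV" using closure_mono by blast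
qed

lemma absg_pos: "positive_selfadjoint absg"
 unfolding positive_selfadjoint_def
proof (intro conjI absg_closed_dense)
 note b = bcl_simps[OF Ra_bcl] bcl_simps[OF Sa_bcl]
 note sa = sa_cinner[OF pos_sa[OF Ra_pos]] sa_cinner[OF pos_sa[OF Sa_pos]]
 have "(w, u) : op_adj absg \<longleftrightarrow> Sa w = Ra u" for w u
 proof -
  have "(w, u) : op_adj absg \<longleftrightarrow> (\<forall>ta. cinner (Sa ta) w = cinner (Ra ta) u)"
   by (auto simp: op_adj_def absg_def)
  also have "... \<longleftrightarrow> (\<forall>ta. cinner ta (Sa w) = cinner ta (Ra u))" by (simp add: sa)
  also have "... \<longleftrightarrow> Sa w = Ra u" by (rule iffI, rule ci_eqI2) simp_all
  finally show ?thesis .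
 qed
 thus "op_adj absg = absg" using absg_iff' by auto
 show "\<forall>(v, w)\<in>absg. cinner w v : \<real>\<^sub>\<ge>\<^sub>0"
 proof (clarsimp simp: absg_def)
  fix ta
  have "cinner (Sa ta) (Ra ta) = cinner (Ra (Sa ta)) ta" by (simp add: sa)
  moreover have "selfadj (%ta. Ra (Sa ta))"
   unfolding selfadj_def adjoint_pair_def
   using bcl_compose[OF Ra_bcl Sa_bcl] by (simp add: sa Ra_Sa_com)
  ultimately have "cinner (Sa ta) (Ra ta) = complex_of_real (inner (Sa ta) (Ra ta))"
   using sa_ci_self[of "%ta. Ra (Sa ta)" ta] sa_in[OF pos_sa[OF Ra_pos]] by simp
  thus "cinner (Sa ta) (Ra ta) : \<real>\<^sub>\<ge>\<^sub>0"
   using pos_com_product[OF Sa_pos Ra_pos, of ta] Ra_Sa_com by (simp add: nonneg_Reals_of_real_iff)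
 qed
qed

lemma absg_sq: "absg O absg = x O op_adj x"
proof -
 note b = bcl_simps[OF Ra_bcl] bcl_simps[OF Sa_bcl]
 have "(v, u) : absg O absg \<longleftrightarrow> (\<exists>ta. v = resolv x ta & u = ta-resolv x ta)" for v u
 proof
  assume "(v, u) : absg O absg"
  then obtain ta where t: "v = Ra ta" "(Sa ta, u) : absg" by (auto simp: absg_def)
  hence e: "Ra u = ta-resolv x ta" by (simp add: absg_iff' Sa_sq)
  have "resolv x (v + u) = v" by (simp add: t(1) Ra_sq[symmetric] b e)
  thus "\<exists>ta. v = resolv x ta & u = ta-resolv x ta" by (intro exI[of _ "v + u"]) simp
 next
  assume "\<exists>ta. v = resolv x ta & u = ta-resolv x ta"
  then obtain ta where t: "v = resolv x ta" "u = ta-resolv x ta" by blast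
  have "(v, Sa (Ra ta)) : absg" "(Sa (Ra ta), u) : absg"
   by (simp_all add: absg_iff' t Ra_sq[of ta, symmetric] Ra_sq[of "Ra ta", symmetric] Sa_sq Ra_Sa_com b)
  thus "(v, u) : absg O absg" by blast
 qed
 hence "(v, u) : absg O absg \<longleftrightarrow>
   (v, u) : range (%u. (resolv x u, u-resolv x u))" for v u
  by (simp only: image_iff prod.inject bex_UNIV)
 thus ?thesis unfolding x_adj_x by (intro equalityI subrelI) (simp_all only:)
qed

end

lemma rsv_eqI:
 assumes x: "closed_dense_op x" and y: "closed_dense_op y" and e: "x O op_adj x = y O op_adj y"
 shows "resolv x = resolv y"
proof
 fix u
 have "(resolv x u, u-resolv x u) : y O op_adj y" unfolding e[symmetric] x_adj_x[OF x] by blast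
 then obtain u' where "resolv x u = resolv y u'" "u-resolv x u = u'-resolv y u'"
  unfolding x_adj_x[OF y] by auto
 thus "resolv x u = resolv y u" by simp
qed

text \<open>For self-adjoint \<open>a\<close> the operator Z = a R commutes with R and has square R
  - R^2; it is positive, so uniqueness of positive roots identifies it. Together with
  \<open>rsv_core\<close> this recovers \<open>a\<close> from its resolvent.\<close>

lemma rsv_op_psa:
 assumes a: "positive_selfadjoint a"
 shows "rsv_op a = sqop (%u. resolv a u-resolv a (resolv a u))"
proof -
 let ?R = "resolv a" and ?Z = "rsv_op a"
 have c: "closed_dense_op a" and sa: "op_adj a = a"
  and pos: "!!v w. (v, w) : a ==> cinner w v : \<real>\<^sub>\<ge>\<^sub>0"
  using a by (auto simp: positive_selfadjoint_def)
 note lin = cdo_linear[OF c]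
 have g1: "(?R u, ?Z u) : a" for u by (rule rsv_graph[OF c])
 have g2: "(?Z u, u-?R u) : a" for u using rsv_op_adj[OF c] sa by simp
 have comm: "?R (?Z u) = ?Z (?R u)" for u
 proof -
  have "(?R u-?R (?R u), ?Z u-?Z (?R u)) : a" by (intro lin_diff lin g1)
  hence "(?Z (?R u), ?Z u-?Z (?R u)) : a O op_adj a" using g2[of "?R u"] sa by auto
  then obtain u' where "?Z (?R u) = ?R u'" "?Z u-?Z (?R u) = u'-?R u'" unfolding x_adj_x[OF c] by auto
  thus ?thesis by simp
 qed
 have Zpos: "cinner (?Z u) u : \<real>\<^sub>\<ge>\<^sub>0" for u
 proof -
  have "cinner (?Z u) u = cinner (?Z u) (?R u)+cnj (cinner (u-?R u) (?Z u))"
   by (simp add: cinner_commute[symmetric] ci_diff_right)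
  thus ?thesis using pos[OF g1[of u]] pos[OF g2[of u]] by (auto simp: complex_nonneg_Reals_iff)
 qed
 have "positive_op ?Z" using Zpos rsv_op_bcl[OF c] by (simp add: positive_op_def)
 moreover have ZZ: "?Z (?Z u) = ?R u-?R (?R u)" for u
  using g1[of "?Z u"] g2[of "?R u"] by (simp add: comm lin_uniq[OF lin])
 moreover have "positive_op (%u. ?R u-?R (?R u))"
  unfolding ZZ[symmetric] by (rule pos_square[OF pos_sa[OF \<open>positive_op ?Z\<close>]])
 ultimately show ?thesis by (intro sqop_unique[symmetric]) auto
qed

text \<open>Every candidate has the resolvent of \<open>x\<close>, and its graph is the closure of
  pairs computed from that resolvent alone. Hence the definite description denotes.\<close>

lemma op_abs_eq:
 assumes x: "closed_dense_op x"
 shows "op_abs x = absg x"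
 unfolding op_abs_def
proof (rule the_equality)
 show "positive_selfadjoint (absg x) & absg x O absg x = x O op_adj x"
  using absg_pos[OF x] absg_sq[OF x] by blast
 have *: "a = closure (range (%u. (resolv x u, sqop (%u. resolv x u-resolv x (resolv x u)) u)))"
  if a: "positive_selfadjoint a & a O a = x O op_adj x" for a
 proof -
  have c: "closed_dense_op a" "op_adj a = a" using a by (auto simp: positive_selfadjoint_def)
  hence "resolv a = resolv x" using a x by (intro rsv_eqI) auto
  thus ?thesis using rsv_core[OF c(1)] rsv_op_psa a by metis
 qed
 fix a assume a: "positive_selfadjoint a & a O a = x O op_adj x"
 have "positive_selfadjoint (absg x) & absg x O absg x = x O op_adj x"
  using absg_pos[OF x] absg_sq[OF x] by blast
 from *[OF a] *[OF this] show "a = absg x" by simp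
qed

lemma op_abs_psa: "closed_dense_op x ==> positive_selfadjoint (op_abs x)"
 by (simp add: op_abs_eq absg_pos)

lemma rsv_op_abs:
 assumes x: "closed_dense_op x" shows "resolv (op_abs x) = resolv x"
 using x absg_pos[OF x] absg_sq[OF x] unfolding op_abs_eq[OF x]
 by (intro rsv_eqI) (auto simp: positive_selfadjoint_def)

text \<open>For \<open>s \<ge> 0\<close> the spectral projection of \<open>|x|\<close> for \<open>(s, \<infinity>)\<close>, since \<open>|x| > s\<close> iff
 \<open>R < 1 / (1 + s\<^sup>2)\<close>.\<close>

definition spa :: "'h::complex_hilbert unbdd_op => real => 'h => 'h"
 where "spa x s = cut (%u. (1/(1+s^2)) *\<^sub>R u-resolv x u)"

context
 fixes x :: "'h::complex_hilbert unbdd_op"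
 assumes x: "closed_dense_op x"
begin

lemma cut_arg_sa: "selfadj (%u. r *\<^sub>R u-resolv x u)"
 by (intro sa_diff sa_smult_ident rsv_sa x)

lemma pr_spa: "projection_op (spa x s)"
 unfolding spa_def by (rule pr_cut[OF cut_arg_sa])

lemma spa_com:
 assumes "bounded_clinear C" "!!u. C (resolv x u) = resolv x (C u)"
 shows "C (spa x s u) = spa x s (C u)"
 unfolding spa_def using assms by (intro cut_com[OF cut_arg_sa]) (simp_all add: bcl_simps[OF assms(1)])

lemma spa_rsv: "resolv x (spa x s u) = spa x s (resolv x u)"
 by (rule spa_com) (simp_all add: rsv_bcl[OF x])

lemma spa_0: assumes "spa x s v = 0" shows "(norm v)^2 <= (1+s^2)*inner (resolv x v) v"
proof -
 have c: "0 < 1+s^2" by (simp add: add_pos_nonneg)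
 have "inner ((1/(1+s^2)) *\<^sub>R v - resolv x v) v <= 0"
  using cut_neg[OF cut_arg_sa] assms unfolding spa_def by blast
 hence "(norm v)^2/(1+s^2) <= inner (resolv x v) v"
  by (simp add: inner_diff_left power2_norm_eq_inner)
 thus ?thesis unfolding pos_divide_le_eq[OF c] by (simp only: mult.commute)
qed

lemma spa_1:
 assumes "spa x s v = v" "v ~= 0" shows "(1+s^2)*inner (resolv x v) v < (norm v)^2"
proof -
 have c: "0 < 1+s^2" by (simp add: add_pos_nonneg)
 have "0 < inner ((1/(1+s^2)) *\<^sub>R v - resolv x v) v"
  using cut_pos[OF cut_arg_sa] assms unfolding spa_def by blast
 hence "inner (resolv x v) v < (norm v)^2/(1+s^2)"
  by (simp add: inner_diff_left power2_norm_eq_inner)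
 thus ?thesis unfolding pos_less_divide_eq[OF c] by (simp only: mult.commute)
qed

text \<open>On the kernel of the projection the form bound for R gives |Z h| \<le> s |R h|. The
  vectors R h with h in the kernel are dense in it, and closedness of \<open>x\<close> carries the
  bound, and membership in the domain, to all of it.\<close>

lemma spa_below:
 assumes s: "s >= 0" and e: "spa x s u = 0"
 shows "\<exists>\<eta>. (u, \<eta>) : x & norm \<eta> <= s*norm u"
proof -
 let ?R = "resolv x" and ?Z = "rsv_op x" and ?e = "spa x s"
 note bR = rsv_bcl[OF x] and bZ = rsv_op_bcl[OF x] and pe = pr_spa[of s]
 note be = pr_bcl[OF pe]
 define K where "K = {u. ?e u = 0}"
 have Z: "norm (?Z \<zeta>) <= s*norm (?R \<zeta>)" if "\<zeta> : K" for \<zeta>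
 proof -
  define i n r where "i = inner (?R \<zeta>) \<zeta>" and "n = norm \<zeta>" and "r = norm (?R \<zeta>)"
  \<comment> \<open>The chain is <R h, h>^2 \<le> |R h|^2 |h|^2 \<le> |R h|^2 (1 + s^2) <R h, h>;
    one factor cancels.\<close>
  have "i <= r*n" unfolding i_def r_def n_def by (rule norm_cauchy_schwarz)
  moreover have i0: "0 <= i" unfolding i_def by (rule pos_in[OF rsv_pos[OF x]])
  ultimately have "i^2 <= (r*n)^2" by (intro power_mono)
  also have "... <= r^2*((1+s^2)*i)"
   using spa_0[of s \<zeta>] that unfolding power_mult_distrib n_def i_def K_def by (intro mult_left_mono) auto
  finally have "i*i <= (r^2*(1+s^2))*i" by (simp add: power2_eq_square mult_ac)
  hence "i <= r^2*(1+s^2)" using i0 by (cases "i = 0") (auto simp: mult_le_cancel_right)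
  hence "(norm (?Z \<zeta>))^2 <= (s*r)^2"
   using rsv_in[OF x, of \<zeta>] by (simp add: i_def r_def power_mult_distrib algebra_simps)
  thus ?thesis using s by (simp add: r_def power2_le_iff_abs_le)
 qed
 have K: "csub K" unfolding K_def by (rule csub_kernel[OF be])
 have D: "csub (?R ` K)"
  using K unfolding csub_def
  by (auto simp: image_iff)
   (metis bcl_zero_simp[OF bR], metis bcl_add_simp[OF bR], metis bcl_scaleC_simp[OF bR])
 have "u : closure (?R ` K)"
 proof (rule in_closure_if_ortho[OF D])
  fix y assume y: "!!z. z : ?R ` K ==> cinner y z = 0"
  define w where "w = y-?e y"
  have wK: "w : K" by (simp add: K_def w_def bcl_simps[OF be] pr_idem[OF pe])
  have RwK: "?R w : K" using wK by (simp add: K_def spa_rsv[symmetric] bcl_simps[OF bR])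
  have perp: "cinner (?e v) z = 0" if "z : K" for v z
   using that by (simp add: K_def pr_cinner[OF pe])
  have "cinner (?R w) (?R w) = cinner w (?R (?R w))" by (rule sa_cinner[OF rsv_sa[OF x]])
  also have "... = cinner y (?R (?R w))-cinner (?e y) (?R (?R w))" by (simp add: w_def ci_diff_left)
  also have "cinner y (?R (?R w)) = 0" using y RwK by blast
  also have "cinner (?e y) (?R (?R w)) = 0"
   using RwK by (intro perp) (simp add: K_def spa_rsv[symmetric] bcl_simps[OF bR])
  finally have "resolv x w = 0" by simp
  hence "w = 0" by (rule rsv_inject[OF x])
  hence "y = ?e y" by (simp add: w_def)
  thus "cinner y u = 0" using perp[of u y] e by (simp add: K_def)
 qed
 then obtain f where f: "!!n. f n : ?R ` K" "f \<longlonglongrightarrow> u" by (auto simp: closure_sequential)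
 hence "\<forall>n. \<exists>z. z : K & f n = ?R z" by blast
 then obtain g where "\<forall>n. g n : K & f n = ?R (g n)" by (rule choice[THEN exE])
 hence g: "!!n. g n : K" "!!n. f n = ?R (g n)" by blast+
 have "Cauchy (%n. ?Z (g n))"
 proof (rule metric_CauchyI)
  fix d :: real assume d: "d > 0"
  obtain M where M: "!!m n. m >= M ==> n >= M ==> dist (f m) (f n) < d/(s+1)"
   using metric_CauchyD[OF LIMSEQ_imp_Cauchy[OF f(2)], of "d/(s+1)"] d s by auto
  have "dist (?Z (g m)) (?Z (g n)) < d" if "m >= M" "n >= M" for m n
  proof -
   have "dist (?Z (g m)) (?Z (g n)) <= s*dist (f m) (f n)"
    using Z[OF csub_diff[OF K g(1)[of m] g(1)[of n]]]
    by (simp add: dist_norm g(2) bcl_simps[OF bR] bcl_simps[OF bZ])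
   also have "... <= s*(d/(s+1))" using M[OF that] s by (intro mult_left_mono) auto
   also have "... < d" using d s by (simp add: field_simps)
   finally show ?thesis .
  qed
  thus "\<exists>M. \<forall>m\<ge>M. \<forall>n\<ge>M. dist (?Z (g m)) (?Z (g n)) < d" by blast
 qed
 then obtain \<eta> where h: "(%n. ?Z (g n)) \<longlonglongrightarrow> \<eta>" by (auto simp: Cauchy_convergent_iff convergent_def)
 have l: "(%n. (f n, ?Z (g n))) \<longlonglongrightarrow> (u, \<eta>)" by (intro tendsto_Pair f h)
 have m: "(f n, ?Z (g n)) : x" for n unfolding g(2) by (rule rsv_graph[OF x])
 have "(u, \<eta>) : x" by (rule closed_sequentially[OF cdo_closed[OF x] m l])
 moreover have "norm \<eta> <= s*norm u"
  by (rule LIMSEQ_le[OF tendsto_norm[OF h] tendsto_mult[OF tendsto_const tendsto_norm[OF f(2)]]])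
   (use Z g in auto)
 ultimately show ?thesis by blast
qed

text \<open>Cauchy-Schwarz in the graph inner product for the weak resolvent equation at
  \<open>v\<close>, combined with the strict form bound \<open>spa_1\<close>.\<close>

lemma spa_above:
 assumes s: "s >= 0" and e: "spa x s v = v" and x0: "v ~= 0" and g: "(v, w) : x"
 shows "s*norm v < norm w"
proof -
 let ?R = "resolv x" and ?Z = "rsv_op x"
 have "(norm v)^2 = inner (?R v, ?Z v) (v, w)"
  using arg_cong[OF rsv_cinner[OF x g, of v], of Re]
  by (simp add: inner_eq_Re_cinner[symmetric] power2_norm_eq_inner inner_prod_def)
 also have "... <= norm (?R v, ?Z v)*norm (v, w)" by (rule norm_cauchy_schwarz)
 finally have "((norm v)^2)^2 <= (norm (?R v, ?Z v)*norm (v, w))^2" by (intro power_mono) auto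
 also have "... = inner (?R v) v * ((norm v)^2+(norm w)^2)"
  by (simp add: power_mult_distrib norm_Pair rsv_in[OF x])
 finally have "(1+s^2)*((norm v)^2)^2 <= (1+s^2)*(inner (?R v) v * ((norm v)^2+(norm w)^2))"
  by (intro mult_left_mono) (auto simp: add_nonneg_nonneg)
 also have "... = ((1+s^2)*inner (?R v) v)*((norm v)^2+(norm w)^2)" by (rule mult.assoc[symmetric])
 also have "... < (norm v)^2*((norm v)^2+(norm w)^2)"
  using x0 by (intro mult_strict_right_mono spa_1 e) (auto simp: add_pos_nonneg)
 finally have "(1+s^2)*((norm v)^2)^2 < (norm v)^2*((norm v)^2+(norm w)^2)" .
 hence "(norm v)^2*((1+s^2)*(norm v)^2) < (norm v)^2*((norm v)^2+(norm w)^2)"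
  by (simp add: power2_eq_square mult_ac)
 hence "(1+s^2)*(norm v)^2 < (norm v)^2+(norm w)^2" by (simp add: mult_less_cancel_left)
 hence "(s*norm v)^2 < (norm w)^2" by (simp add: power_mult_distrib algebra_simps)
 thus ?thesis by (rule power_less_imp_less_base) simp
qed

text \<open>The two projections commute, and a nonzero vector w in the range of the one for t that
  is killed by the one for s would satisfy t |w| < |x w| \<le> s |w|.\<close>

lemma spa_mono:
 assumes st: "0 <= s" "s <= t" shows "spa x s (spa x t v) = spa x t v"
proof -
 let ?e = "spa x s" and ?f = "spa x t"
 note pe = pr_spa[of s] and pf = pr_spa[of t]
 have c: "?f (?e y) = ?e (?f y)" for y
  by (rule spa_com[OF pr_bcl[OF pf]]) (simp add: spa_rsv)
 define w where "w = ?f v - ?e (?f v)"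
 have fw: "?f w = w" by (simp add: w_def bcl_simps[OF pr_bcl[OF pf]] pr_idem[OF pf] c)
 have ew: "?e w = 0" by (simp add: w_def bcl_simps[OF pr_bcl[OF pe]] pr_idem[OF pe])
 have "w = 0"
 proof (rule ccontr)
  assume w: "w ~= 0"
  obtain u where h: "(w, u) : x" "norm u <= s*norm w" using spa_below[OF st(1) ew] by blast
  have "t*norm w < norm u" using spa_above[OF _ fw w h(1)] st by simp
  moreover have "s*norm w <= t*norm w" using st by (intro mult_right_mono) auto
  ultimately show False using h(2) by linarith
 qed
 thus ?thesis by (simp add: w_def)
qed

end

section \<open>Spectral measures\<close>

context
 fixes P :: "real set => 'h::complex_hilbert => 'h"
 assumes P: "spectral_measure P"
begin

lemma sm_proj: "B : sets borel ==> projection_op (P B)"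
 and sm_UNIV: "P UNIV = id"
 and sm_Int: "B : sets borel ==> C : sets borel ==> P B (P C v) = P (B \<inter> C) v"
 and sm_sums: "range A \<subseteq> sets borel ==> disjoint_family A ==> (%n. P (A n) v) sums P (\<Union>n::nat. A n) v"
 using P by (simp_all add: spectral_measure_def)

lemma sm_bcl: "B : sets borel ==> bounded_clinear (P B)"
 by (rule pr_bcl[OF sm_proj])

lemma sm_empty: "P {} v = 0"
proof -
 have "(%n::nat. P {} v) sums P {} v" using sm_sums[of "%n. {}" v] by (simp add: disjoint_family_on_def)
 hence "(%n::nat. P {} v) \<longlonglongrightarrow> 0" by (intro summable_LIMSEQ_zero sums_summable)
 thus ?thesis by (simp add: LIMSEQ_const_iff)
qed

lemma sm_Un:
 assumes "B : sets borel" "C : sets borel" "B \<inter> C = {}"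
 shows "P (B \<union> C) v = P B v + P C v"
proof -
 have "(%n. P (binaryset B C n) v) sums P (\<Union>n. binaryset B C n) v"
  using assms by (intro sm_sums) (auto simp: disjoint_family_on_def binaryset_def)
 moreover have "(%n. P (binaryset B C n) v) sums (P B v + P C v)"
  by (rule binaryset_sums[of "%A. P A v"]) (rule sm_empty)
 ultimately show ?thesis using sums_unique2 by (fastforce simp: UN_binaryset_eq)
qed

lemma sm_compl: assumes B: "B : sets borel" shows "P (- B) v = v - P B v"
proof -
 have "P (B \<union>-B) v = P B v + P (- B) v" using B by (intro sm_Un) auto
 thus ?thesis by (simp add: sm_UNIV eq_diff_eq add.commute)
qed

lemma sm_cinner: "B : sets borel ==> Re (cinner (P B v) v) = (norm (P B v))^2"
 by (simp add: pr_ci_self[OF sm_proj])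

lemma space_smeas [simp]: "space (scalar_measure P v) = UNIV"
 by (simp add: scalar_measure_def)
lemma sets_smeas [simp, measurable_cong]: "sets (scalar_measure P v) = sets borel"
 using sets.sigma_sets_eq[of borel] by (simp add: scalar_measure_def sets_measure_of_conv)

lemma emeasure_smeas:
 assumes B: "B : sets borel"
 shows "emeasure (scalar_measure P v) B = ennreal ((norm (P B v))^2)"
proof -
 let ?m = "%B. ennreal (Re (cinner (P B v) v))"
 have "emeasure (scalar_measure P v) B = ?m B"
  unfolding scalar_measure_def
 proof (rule emeasure_measure_of_sigma[OF _ _ _ B])
  show "sigma_algebra UNIV (sets (borel::real measure))" using sets.sigma_algebra_axioms[of "borel::real measure"] by simp
  show "positive (sets borel) ?m" by (simp add: positive_def sm_empty)
  show "countably_additive (sets borel) ?m"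
  proof (rule countably_additiveI)
   fix A :: "nat => real set" assume A: "range A \<subseteq> sets borel" "disjoint_family A" "\<Union> (range A) : sets borel"
   have A': "A i : sets borel" for i using A(1) by blast
   have "bounded_linear (%y. Re (cinner y v))"
    using bounded_linear_compose[OF bounded_linear_Re bounded_bilinear.bounded_linear_left[OF bdd_bilinear_cinner, of v]] .
   from bounded_linear.sums[OF this sm_sums[OF A(1,2)]]
   have "(%i. Re (cinner (P (A i) v) v)) sums Re (cinner (P (\<Union> (range A)) v) v)" .
   hence "(%i. ?m (A i)) sums ?m (\<Union> (range A))"
    using A A' by (subst sums_ennreal) (simp_all add: sm_cinner)
   thus "(\<Sum>i. ?m (A i)) = ?m (\<Union> (range A))" by (rule sums_unique[symmetric])
  qed
 qed
 thus ?thesis by (simp add: sm_cinner B)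
qed

lemma finite_measure_scalar: "finite_measure (scalar_measure P v)"
 by (rule finite_measureI) (simp add: emeasure_smeas)

lemma smeas_proj:
 assumes B: "B : sets borel"
 shows "scalar_measure P (P B v) = density (scalar_measure P v) (%t. ennreal (indicator B t))"
proof (rule measure_eqI)
 fix A assume "A : sets (scalar_measure P (P B v))"
 hence A: "A : sets borel" by simp
 have "emeasure (density (scalar_measure P v) (%t. ennreal (indicator B t))) A
   = (\<integral>\<^sup>+ t. ennreal (indicator B t)*indicator A t \<partial>scalar_measure P v)"
  using A B by (intro emeasure_density) auto
 also have "... = (\<integral>\<^sup>+ t. indicator (A \<inter> B) t \<partial>scalar_measure P v)"
  by (intro nn_integral_cong) (simp split: split_indicator)
 also have "... = emeasure (scalar_measure P v) (A \<inter> B)" using A B by (intro nn_integral_indicator) simp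
 finally show "emeasure (scalar_measure P (P B v)) A = emeasure (density (scalar_measure P v) (%t. ennreal (indicator B t))) A"
  using A B by (simp add: emeasure_smeas sm_Int)
qed simp

end

context
 fixes P :: "real set => 'h::complex_hilbert => 'h" and a :: "'h unbdd_op"
 assumes Pa: "is_spectral_measure_of P a" and a: "positive_selfadjoint a"
begin

lemma smo: "spectral_measure P"
 and smo_Dom: "v : Domain a \<longleftrightarrow> (\<integral>\<^sup>+ t. ennreal (t^2) \<partial>scalar_measure P v) < \<infinity>"
 and smo_cinner: "(v, w) : a ==> cinner w v = complex_of_real (\<integral> t. t \<partial>scalar_measure P v)"
 using Pa by (auto simp: is_spectral_measure_of_def)

lemma smo_closed_dense: "closed_dense_op a" and smo_adj: "op_adj a = a"
 using a by (simp_all add: positive_selfadjoint_def)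

lemmas smo_linear = cdo_linear[OF smo_closed_dense]

lemma smo_integrable:
 assumes "v : Domain a" shows "integrable (scalar_measure P v) (%t. t)"
proof -
 interpret finite_measure "scalar_measure P v" by (rule finite_measure_scalar[OF smo])
 have m: "borel_measurable (scalar_measure P v) = borel_measurable borel"
  by (rule measurable_cong_sets) (simp_all add: smo)
 have "integrable (scalar_measure P v) (%t. t^2)"
  using assms by (intro integrableI_nonneg) (auto simp: smo_Dom m)
 thus ?thesis
  by (rule square_integrable_imp_integrable[rotated]) (simp add: m)
qed

lemma smo_proj_Dom:
 assumes B: "B : sets borel" and x: "v : Domain a" shows "P B v : Domain a"
proof -
 have m: "borel_measurable (scalar_measure P v) = borel_measurable borel"
  by (rule measurable_cong_sets) (simp_all add: smo)
 have "(\<integral>\<^sup>+ t. ennreal (t^2) \<partial>scalar_measure P (P B v)) =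
   (\<integral>\<^sup>+ t. ennreal (indicator B t)*ennreal (t^2) \<partial>scalar_measure P v)"
  unfolding smeas_proj[OF smo B] using B by (intro nn_integral_density) (auto simp: m)
 also have "... <= (\<integral>\<^sup>+ t. ennreal (t^2) \<partial>scalar_measure P v)"
  by (intro nn_integral_mono) (auto simp: indicator_def)
 also have "... < \<infinity>" using x smo_Dom by simp
 finally show ?thesis using smo_Dom by simp
qed

lemma smo_int_proj:
 assumes B: "B : sets borel"
 shows "(\<integral> t. t \<partial>scalar_measure P (P B v)) = (\<integral> t. indicator B t*t \<partial>scalar_measure P v)"
proof -
 have m: "borel_measurable (scalar_measure P v) = borel_measurable borel"
  by (rule measurable_cong_sets) (simp_all add: smo)
 show ?thesis unfolding smeas_proj[OF smo B]
  using B by (subst integral_density) (auto simp: m)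
qed

lemma smo_split:
 assumes B: "B : sets borel" and x: "v : Domain a"
 shows "(\<integral> t. t \<partial>scalar_measure P v) =
  (\<integral> t. t \<partial>scalar_measure P (P B v))+(\<integral> t. t \<partial>scalar_measure P (P (- B) v))"
proof -
 have B': "- B : sets borel" using B by simp
 have i: "integrable (scalar_measure P v) (%t. indicator C t*t)" if "C : sets borel" for C
  using integrable_mult_indicator[of C _ "%t. t"] smo_integrable[OF x] that by (simp add: smo)
 have "(\<integral> t. t \<partial>scalar_measure P v) =
   (\<integral> t. indicator B t*t+indicator (- B) t*t \<partial>scalar_measure P v)"
  by (intro Bochner_Integration.integral_cong) (auto simp: indicator_def)
 also have "... = (\<integral> t. indicator B t*t \<partial>scalar_measure P v)+(\<integral> t. indicator (- B) t*t \<partial>scalar_measure P v)"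
  by (intro Bochner_Integration.integral_add i B B')
 finally show ?thesis unfolding smo_int_proj[OF B] smo_int_proj[OF B'] .
qed

text \<open>Only diagonal values of \<open>a\<close> are prescribed by the definition. The mixed
  terms are extracted by expanding the form at w1 + w2 and w1 + i w2, where the integral splits over
  \<open>B\<close> and its complement.\<close>

lemma smo_orthogonal:
 assumes B: "B : sets borel" and u: "(P B v, ta) : a" and x: "v : Domain a"
  and y: "h : Domain a"
 shows "cinner ta (P (- B) h) = 0"
proof -
 have B': "- B : sets borel" using B by simp
 define w1 where "w1 = P B v"
 have cross: "cinner ta w2+cinner ta' w1 = 0"
  if w2: "P (- B) w2 = w2" "(w2, ta') : a" for w2 ta'
 proof -
  have a1: "(w1, ta) : a" using u by (simp add: w1_def)
  have s: "(w1+w2, ta+ta') : a" by (rule lin_add[OF smo_linear a1 w2(2)])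
  have p1: "P B w1 = w1" by (simp add: w1_def sm_Int[OF smo] B)
  have p2: "P (- B) w1 = 0" by (simp add: sm_compl[OF smo B] p1)
  have p3: "P B w2 = 0" using w2(1) by (simp add: sm_compl[OF smo B])
  have q1: "P B (w1+w2) = w1" by (simp add: bcl_simps[OF sm_bcl[OF smo B]] p1 p3)
  have q2: "P (- B) (w1+w2) = w2" by (simp add: bcl_simps[OF sm_bcl[OF smo B']] p2 w2(1))
  have "cinner (ta+ta') (w1+w2) = complex_of_real (\<integral> t. t \<partial>scalar_measure P (w1+w2))"
   by (rule smo_cinner[OF s])
  also have "... = complex_of_real (\<integral> t. t \<partial>scalar_measure P w1)+complex_of_real (\<integral> t. t \<partial>scalar_measure P w2)"
   using smo_split[OF B DomainI[OF s]] by (simp add: q1 q2)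
  also have "... = cinner ta w1+cinner ta' w2" using smo_cinner[OF a1] smo_cinner[OF w2(2)] by simp
  finally show ?thesis by (simp add: ci_algebra add.commute)
 qed
 define w2 where "w2 = P (- B) h"
 have w2p: "P (- B) w2 = w2" by (simp add: w2_def sm_Int[OF smo] B')
 have "w2 : Domain a" unfolding w2_def by (rule smo_proj_Dom[OF B' y])
 then obtain ta' where t: "(w2, ta') : a" by blast
 have "cinner ta w2+cinner ta' w1 = 0" by (rule cross[OF w2p t])
 moreover have "cinner ta (\<i> *\<^sub>C w2)+cinner (\<i> *\<^sub>C ta') w1 = 0"
  by (rule cross) (simp_all add: bcl_simps[OF sm_bcl[OF smo B']] w2p lin_scaleC[OF smo_linear t])
 hence "- cinner ta w2+cinner ta' w1 = 0" by (simp add: ci_algebra)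
 ultimately have "cinner ta w2 = 0" by (simp add: add_eq_0_iff)
 thus ?thesis by (simp add: w2_def)
qed

lemma smo_reduce_aux:
 assumes B: "B : sets borel" and x: "v : Domain a"
 shows "\<exists>ta. (P B v, ta) : a & P B ta = ta"
proof -
 obtain ta where t: "(P B v, ta) : a" using smo_proj_Dom[OF B x] by blast
 have B': "- B : sets borel" using B by simp
 have "P (- B) ta = 0"
 proof (rule dense_domain_zero[OF smo_closed_dense])
  fix u w assume z: "(u, w) : a"
  have "cinner (P (- B) ta) u = cinner ta (P (- B) u)" by (rule pr_cinner[OF sm_proj[OF smo B']])
  also have "... = 0" by (rule smo_orthogonal[OF B t x DomainI[OF z]])
  finally show "cinner (P (- B) ta) u = 0" .
 qed
 hence "P B ta = ta" by (simp add: sm_compl[OF smo B])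
 thus ?thesis using t by blast
qed

lemma smo_reduce:
 assumes B: "B : sets borel" and x: "(v, w) : a"
 shows "(P B v, P B w) : a"
proof -
 have B': "- B : sets borel" using B by simp
 obtain ta where t: "(P B v, ta) : a" "P B ta = ta" using smo_reduce_aux[OF B DomainI[OF x]] by blast
 obtain ta' where t': "(P (- B) v, ta') : a" "P (- B) ta' = ta'" using smo_reduce_aux[OF B' DomainI[OF x]] by blast
 have "P B v + P (- B) v = v" by (simp add: sm_compl[OF smo B])
 hence "(v, ta+ta') : a" using lin_add[OF smo_linear t(1) t'(1)] by simp
 hence e: "w = ta+ta'" using lin_uniq[OF smo_linear x] by simp
 have "P B ta' = 0" using t'(2) by (simp add: sm_compl[OF smo B])
 hence "P B w = ta" by (simp add: e bcl_simps[OF sm_bcl[OF smo B]] t(2))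
 thus ?thesis using t by simp
qed

text \<open>The projections reduce \<open>a\<close>, hence also a^2, and \<open>x_adj_x\<close>
  translates this to the resolvent. Commutation with a common bounded operator is what makes two
  spectral measures comparable.\<close>

lemma smo_com_rsv:
 assumes B: "B : sets borel"
 shows "P B (resolv a u) = resolv a (P B u)"
proof -
 let ?e = "P B"
 note b = bcl_simps[OF sm_bcl[OF smo B]]
 have "(?e (resolv a u), ?e (rsv_op a u)) : a" by (rule smo_reduce[OF B rsv_graph[OF smo_closed_dense]])
 moreover have "(rsv_op a u, u-resolv a u) : a" using rsv_op_adj[OF smo_closed_dense, of u] smo_adj by simp
 hence "(?e (rsv_op a u), ?e u-?e (resolv a u)) : a" using smo_reduce[OF B] by (fastforce simp: b)
 ultimately have "(?e (resolv a u), ?e u-?e (resolv a u)) : a O op_adj a" using smo_adj by auto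
 then obtain w where w: "?e (resolv a u) = resolv a w" "?e u-?e (resolv a u) = w-resolv a w"
  unfolding x_adj_x[OF smo_closed_dense] by auto
 hence "w = ?e u" by simp
 thus ?thesis using w by simp
qed

lemma smo_upper:
 assumes s: "P {..s} v = v" and x: "(v, w) : a"
 shows "inner w v <= s*(norm v)^2"
proof -
 interpret finite_measure "scalar_measure P v" by (rule finite_measure_scalar[OF smo])
 have sp: "measure (scalar_measure P v) (space (scalar_measure P v)) = (norm v)^2"
  by (simp add: measure_def emeasure_smeas[OF smo] sm_UNIV[OF smo] space_smeas[OF smo])
 have "emeasure (scalar_measure P v) {s<..} = 0"
  using sm_compl[OF smo, of "{..s}" v] s
  by (simp add: emeasure_smeas[OF smo] not_le[symmetric] Compl_atMost)
 hence "{s<..} : null_sets (scalar_measure P v)" by (intro null_setsI) (simp_all add: smo)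
 hence ae: "AE t in scalar_measure P v. t <= s" by (rule AE_I') auto
 have "(\<integral> t. t \<partial>scalar_measure P v) <= (\<integral> t. s \<partial>scalar_measure P v)"
  using ae by (intro integral_mono_AE smo_integrable[OF DomainI[OF x]]) auto
 also have "... = s*(norm v)^2" by (simp only: lebesgue_integral_const sp) simp
 finally show ?thesis using arg_cong[OF smo_cinner[OF x], of Re] by (simp add: inner_eq_Re_cinner)
qed

lemma smo_lower:
 assumes s: "P {s<..} v = v" and x: "(v, w) : a" and x0: "v ~= 0"
 shows "inner w v > s*(norm v)^2"
proof -
 let ?m = "scalar_measure P v"
 interpret finite_measure ?m by (rule finite_measure_scalar[OF smo])
 have sp: "measure ?m (space ?m) = (norm v)^2"
  by (simp add: measure_def emeasure_smeas[OF smo] sm_UNIV[OF smo] space_smeas[OF smo])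
 have "P {..s} v = 0" using sm_compl[OF smo, of "{s<..}" v] s by (simp add: Compl_greaterThan)
 hence "emeasure ?m {..s} = 0" by (simp add: emeasure_smeas[OF smo])
 hence "{..s} : null_sets ?m" by (intro null_setsI) (simp_all add: smo)
 hence ae: "AE t in ?m. s < t" by (rule AE_I') auto
 note i = smo_integrable[OF DomainI[OF x]]
 have "(\<integral> t. t-s \<partial>?m) ~= 0"
 proof
  assume "(\<integral> t. t-s \<partial>?m) = 0"
  hence "AE t in ?m. t-s = 0"
   using ae i by (subst (asm) integral_nonneg_eq_0_iff_AE) auto
  hence "AE t in ?m. False" using ae by eventually_elim simp
  hence "emeasure ?m UNIV = 0"
   by (subst (asm) AE_iff_measurable[of UNIV]) (simp_all add: smo)
  thus False using x0 by (simp add: emeasure_smeas[OF smo] sm_UNIV[OF smo])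
 qed
 moreover have "(\<integral> t. t-s \<partial>?m) >= 0" using ae by (intro integral_nonneg_AE) auto
 ultimately have "0 < (\<integral> t. t-s \<partial>?m)" by simp
 also have "... = (\<integral> t. t \<partial>?m)-s*(norm v)^2"
  using i by (subst Bochner_Integration.integral_diff) (simp_all only: lebesgue_integral_const sp integrable_const, simp)
 finally show ?thesis using arg_cong[OF smo_cinner[OF x], of Re] by (simp add: inner_eq_Re_cinner)
qed

end

text \<open>A vector w in both ranges has form at most s |w|^2 and, unless it is zero, above s
  |w|^2.\<close>

lemma smo_unique_aux:
 assumes P: "is_spectral_measure_of P a" and Q: "is_spectral_measure_of Q a" and a: "positive_selfadjoint a"
  and comm: "!!v. P {..s} (Q {s<..} v) = Q {s<..} (P {..s} v)"
 shows "P {..s} (Q {s<..} v) = 0"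
proof (rule dense_domain_zero[OF smo_closed_dense[OF P a]])
 note sP = smo[OF P a] and sQ = smo[OF Q a]
 fix y u assume z: "(y, u) : a"
 define w where "w = P {..s} (Q {s<..} y)"
 have g: "(w, P {..s} (Q {s<..} u)) : a" unfolding w_def
  by (intro smo_reduce[OF P a] smo_reduce[OF Q a] z) simp_all
 have w: "P {..s} w = w" "Q {s<..} w = w"
  by (simp_all add: w_def comm[symmetric] sm_Int[OF sP] sm_Int[OF sQ])
   (simp add: comm sm_Int[OF sQ])?
 have "w = 0"
  using smo_upper[OF P a w(1) g] smo_lower[OF Q a w(2) g] by fastforce
 have "cinner (P {..s} (Q {s<..} v)) y = cinner v (Q {s<..} (P {..s} y))"
  by (simp add: pr_cinner[OF sm_proj[OF sP]] pr_cinner[OF sm_proj[OF sQ]])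
 also have "... = 0" using \<open>w = 0\<close> by (simp add: w_def comm[symmetric])
 finally show "cinner (P {..s} (Q {s<..} v)) y = 0" .
qed

text \<open>Hypothesis \<open>PR\<close> places the projections of \<open>P\<close> in the
  bicommutant of the resolvent. Those of \<open>Q\<close> commute with the resolvent, hence with
  those of \<open>P\<close>, as \<open>smo_unique_aux\<close> requires.\<close>

lemma smo_unique:
 assumes P: "is_spectral_measure_of P a" and Q: "is_spectral_measure_of Q a" and a: "positive_selfadjoint a"
  and PR: "!!C v. bounded_clinear C ==> (!!u. C (resolv a u) = resolv a (C u)) ==> C (P {s<..} v) = P {s<..} (C v)"
 shows "Q {s<..} = P {s<..}"
proof
 note sP = smo[OF P a] and sQ = smo[OF Q a]
 fix v
 have cPQ: "Q B (P {s<..} u) = P {s<..} (Q B u)" if "B : sets borel" for B u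
  using that by (intro PR sm_bcl[OF sQ] smo_com_rsv[OF Q a])
 have compl: "P {..s} u = u-P {s<..} u" "Q {..s} u = u-Q {s<..} u" for u
  using sm_compl[OF sP, of "{s<..}" u] sm_compl[OF sQ, of "{s<..}" u] by (simp_all add: Compl_greaterThan)
 have bQ: "bounded_clinear (Q {s<..})" "bounded_clinear (P {s<..})" by (simp_all add: sm_bcl[OF sQ] sm_bcl[OF sP])
 have "P {..s} (Q {s<..} v) = 0"
  by (rule smo_unique_aux[OF P Q a]) (simp add: compl bcl_simps[OF bQ(1)] cPQ)
 moreover have "Q {..s} (P {s<..} v) = 0"
  by (rule smo_unique_aux[OF Q P a]) (simp add: compl bcl_simps[OF bQ(2)] cPQ)
 ultimately show "Q {s<..} v = P {s<..} v" by (simp add: compl cPQ)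
qed

section \<open>Construction of a spectral measure from a resolution of the identity\<close>

lemma pr_sub_adj:
 assumes p: "projection_op p" and q: "projection_op q" and s: "!!x. q (p x) = p x"
 shows "p (q x) = p x"
 by (rule ci_eqI) (metis s pr_cinner[OF p] pr_cinner[OF q])

lemma pr_ortho_adj:
 assumes p: "projection_op p" and q: "projection_op q" and s: "!!x. q (p x) = 0"
 shows "p (q x) = 0"
 by (rule ci_eqI) (metis s pr_cinner[OF p] pr_cinner[OF q] ci_zero_left ci_zero_right)

lemma csub_INT: "(!!n. csub (K n)) ==> csub (\<Inter>n. K n)"
 by (auto simp: csub_def)

text \<open>|p m x - p n x|^2 is a difference of two terms of the decreasing sequence |p n x|^2, so
  the strong limit exists; it satisfies the defining property of the projection onto the
  intersection.\<close>

lemma decseq_projs: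
 assumes p: "!!n::nat. projection_op (p n)" and dec: "!!m n x. m <= n ==> p m (p n x) = p n x"
 shows "csub (\<Inter>n. range (p n))" "closed (\<Inter>n. range (p n))"
  "(%n. p n x) \<longlonglongrightarrow> proj (\<Inter>n. range (p n)) x"
proof -
 let ?K = "\<Inter>n. range (p n)"
 show K: "csub ?K" "closed ?K"
  using pr_closed[OF p] by (auto intro!: closed_INT csub_INT pr_csub[OF p])
 note b = bcl_simps[OF pr_bcl[OF p]]
 have dec': "p n (p m x) = p n x" if "m <= n" for m n x
  by (rule pr_sub_adj[OF p p dec[OF that]])
 have diff: "(norm (p m x-p n x))^2 = (norm (p m x))^2-(norm (p n x))^2" if "m <= n" for m n
  using pr_split[OF p[of n], of "p m x"] by (simp add: dec'[OF that])
 have "(norm (p (Suc n) x))^2 <= (norm (p n x))^2" for n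
  using diff[of n "Suc n"] zero_le_power2[of "norm (p n x-p (Suc n) x)"] by linarith
 hence decn: "decseq (%n. (norm (p n x))^2)" by (rule decseq_SucI)
 hence "convergent (%n. (norm (p n x))^2)"
  using decseq_convergent[OF decn, of 0] by (auto simp: convergent_def)
 hence C: "Cauchy (%n. (norm (p n x))^2)" by (rule convergent_Cauchy)
 have "Cauchy (%n. p n x)"
 proof (rule metric_CauchyI)
  fix e :: real assume e: "e > 0"
  obtain M where M: "!!m n. m >= M ==> n >= M ==> dist ((norm (p m x))^2) ((norm (p n x))^2) < e^2"
   using metric_CauchyD[OF C, of "e^2"] e by auto
  have *: "dist (p m x) (p n x) < e" if "m >= M" "n >= M" "m <= n" for m n
  proof -
   have "(norm (p m x-p n x))^2 < e^2" using M[OF that(1,2)] diff[OF that(3)] by (simp add: dist_real_def)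
   thus ?thesis using e by (simp add: dist_norm power_less_imp_less_base)
  qed
  hence "dist (p m x) (p n x) < e" if "m >= M" "n >= M" for m n
   using that *[of m n] *[of n m] by (cases "m <= n") (auto simp: dist_commute)
  thus "\<exists>M. \<forall>m\<ge>M. \<forall>n\<ge>M. dist (p m x) (p n x) < e" by blast
 qed
 then obtain l where l: "(%n. p n x) \<longlonglongrightarrow> l" by (auto simp: Cauchy_convergent_iff convergent_def)
 have "proj ?K x = l"
 proof (rule proj_unique[OF K])
  have "p m l = l" for m
  proof (rule LIMSEQ_unique[OF _ l])
   have "(%n. p m (p n x)) \<longlonglongrightarrow> p m l" by (rule bcl_tendsto[OF pr_bcl[OF p] l])
   thus "(%n. p n x) \<longlonglongrightarrow> p m l"
    by (rule Lim_transform_eventually) (auto simp: eventually_sequentially dec intro!: exI[of _ m])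
  qed
  thus "l : ?K" by (auto simp: pr_range[OF p])
  fix y assume "y : ?K"
  hence y: "p n y = y" for n by (auto simp: pr_range[OF p])
  have "cinner (x-p n x) y = 0" for n
   using pr_cinner[OF p[of n], of x y] by (simp add: ci_diff_left y)
  moreover have "(%n. cinner (x-p n x) y) \<longlonglongrightarrow> cinner (x-l) y" by (intro tendsto_intros l)
  ultimately have "(%n::nat. 0) \<longlonglongrightarrow> cinner (x-l) y" by simp
  from LIMSEQ_unique[OF this tendsto_const] show "cinner (x-l) y = 0" by simp
 qed
 thus "(%n. p n x) \<longlonglongrightarrow> proj ?K x" using l by simp
qed

lemma le_if_le_add_mult:
 fixes x y c :: real
 assumes le: "!!d. 0 < d ==> x <= y+d*c" shows "x <= y"
proof (rule field_le_epsilon)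
 fix e :: real assume e: "0 < e"
 define d where "d = e/(\<bar>c\<bar>+1)"
 have d: "0 < d" "d*(\<bar>c\<bar>+1) = e" using e by (auto simp: d_def intro!: divide_pos_pos add_nonneg_pos)
 have "d*c <= d*(\<bar>c\<bar>+1)" using d(1) by (intro mult_left_mono) auto
 thus "x <= y+e" using le[OF d(1)] d(2) by linarith
qed

lemma cont_at_right_mono:
 fixes F :: "real => real"
 assumes mono: "!!x y. x <= y ==> F x <= F y" and l: "(%n. F (s+1/real (Suc n))) \<longlonglongrightarrow> F s"
 shows "continuous (at_right s) F"
 unfolding continuous_within
proof (rule order_tendstoI)
 fix c assume c: "c < F s"
 show "\<forall>\<^sub>F x in at_right s. c < F x"
  unfolding eventually_at_right_field
  using mono[of s] c by (intro exI[of _ "s+1"]) (auto intro: less_le_trans)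
next
 fix c assume c: "F s < c"
 then obtain n where n: "F (s+1/real (Suc n)) < c"
  using order_tendstoD(2)[OF l c] by (auto simp: eventually_sequentially)
 show "\<forall>\<^sub>F x in at_right s. F x < c"
  unfolding eventually_at_right_field
 proof (intro exI[of _ "s+1/real (Suc n)"] conjI allI impI)
  show "s < s+1/real (Suc n)" by simp
  fix y assume "s < y" "y < s+1/real (Suc n)"
  thus "F y < c" using mono[of y "s+1/real (Suc n)"] n by linarith
 qed
qed

text \<open>The sets \<open>B\<close> for which \<open>\<xi> \<mapsto> \<mu>\<^sub>\<xi>(B)\<close> is the quadratic form of a projection form a Dynkin system.\<close>

lemma rsl_spec_measure:
 fixes E :: "real => 'h::complex_hilbert => 'h"
 assumes E: "!!s. projection_op (E s)" and mono: "!!s t v. s <= t ==> E t (E s v) = E s v"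
  and right: "!!s v. (%n. E (s+1/real (Suc n)) v) \<longlonglongrightarrow> E s v"
  and neg: "!!s v. s < 0 ==> E s v = 0" and top: "!!v. (%n. E (real n) v) \<longlonglongrightarrow> v"
 shows "\<exists>P. spectral_measure P & (\<forall>s. P {..s} = E s)"
proof -
 \<comment> \<open>The scalar measure of \<open>v\<close> is to be the Stieltjes measure of this
   distribution function.\<close>
 define F where "F v s = (norm (E s v))^2" for v s
 define \<mu> where "\<mu> v = interval_measure (F v)" for v
 have mono': "E s (E t v) = E s v" if "s <= t" for s t v
  by (rule pr_sub_adj[OF E E mono[OF that]])
 have Fmono: "F v s <= F v t" if "s <= t" for v s t
  unfolding F_def using pr_nle[OF E, of s "E t v"] by (intro power_mono) (auto simp: mono' that)
 have Fr: "continuous (at_right s) (F v)" for v s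
  by (rule cont_at_right_mono[OF Fmono]) (simp_all only: F_def tendsto_power tendsto_norm right)
 have Ioc: "emeasure (\<mu> v) {s<..t} = ennreal (F v t-F v s)" if "s <= t" for v s t
  unfolding \<mu>_def by (rule emeasure_interval_measure_Ioc[OF that Fmono Fr])
 have sets: "sets (\<mu> v) = sets borel" and space: "space (\<mu> v) = UNIV" for v by (simp_all add: \<mu>_def)
 have Iic: "emeasure (\<mu> v) {..t} = ennreal (F v t)" for v t
 proof -
  have l1: "(%n. emeasure (\<mu> v) {t-1-real n <.. t}) \<longlonglongrightarrow> emeasure (\<mu> v) (\<Union>n. {t-1-real n <.. t})"
   by (rule Lim_emeasure_incseq) (auto simp: sets incseq_def)
  moreover have "(\<Union>n. {t-1-real n <.. t}) = {..t}"
  proof (intro equalityI subsetI)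
   fix x assume "x : {..t}"
   moreover obtain n where "t-x < real n" using reals_Archimedean2 by blast
   ultimately show "x : (\<Union>n. {t-1-real n <.. t})" by (auto intro!: exI[of _ n])
  qed auto
  moreover have "\<forall>\<^sub>F n in sequentially. emeasure (\<mu> v) {t-1-real n <.. t} = ennreal (F v t)"
  proof -
   obtain N where N: "t < real N" using reals_Archimedean2 by blast
   have "emeasure (\<mu> v) {t-1-real n <.. t} = ennreal (F v t)" if "n >= N" for n
   proof -
    have "t < real n" using N that by (meson less_le_trans of_nat_mono)
    hence "F v (t-1-real n) = 0" by (simp add: F_def neg)
    thus ?thesis by (subst Ioc) auto
   qed
   thus ?thesis by (auto simp: eventually_sequentially)
  qed
  hence "(%n. emeasure (\<mu> v) {t-1-real n <.. t}) \<longlonglongrightarrow> ennreal (F v t)" by (rule tendsto_eventually)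
  ultimately show ?thesis using LIMSEQ_unique[OF l1] by simp
 qed
 have top': "emeasure (\<mu> v) UNIV = ennreal ((norm v)^2)" for v
 proof -
  have l1: "(%n. emeasure (\<mu> v) {..real n}) \<longlonglongrightarrow> emeasure (\<mu> v) (\<Union>n. {..real n})"
   by (rule Lim_emeasure_incseq) (auto simp: sets incseq_def)
  moreover have "(\<Union>n. {..real n}) = UNIV" using real_arch_simple by auto
  moreover have "(%n. emeasure (\<mu> v) {..real n}) \<longlonglongrightarrow> ennreal ((norm v)^2)"
   unfolding Iic F_def by (intro tendsto_ennrealI tendsto_intros top)
  ultimately show ?thesis using LIMSEQ_unique[OF l1] by simp
 qed
 define Q where "Q B p \<longleftrightarrow> projection_op p & (\<forall>v. emeasure (\<mu> v) B = ennreal ((norm (p v))^2))" for B p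
 \<comment> \<open>For the vector \<open>q v\<close> the set C already carries the total mass |q
   v|^2, so nothing is left for the disjoint set B.\<close>
 have Qorth: "p (q v) = 0"
  if "Q B p" "Q C q" "B \<inter> C = {}" "B : sets borel" "C : sets borel" for B C p q v
 proof -
  have q: "projection_op q" using that by (simp add: Q_def)
  have "ennreal ((norm (p (q v)))^2)+ennreal ((norm (q (q v)))^2) = emeasure (\<mu> (q v)) (B \<union> C)"
   using that by (subst plus_emeasure[symmetric]) (auto simp: Q_def sets)
  also have "... <= emeasure (\<mu> (q v)) UNIV" by (intro emeasure_mono) (auto simp: sets)
  finally have "ennreal ((norm (p (q v)))^2+(norm (q v))^2) <= ennreal ((norm (q v))^2)"
   by (simp add: top' pr_idem[OF q])
  hence "(norm (p (q v)))^2 <= 0" by (simp add: ennreal_le_iff)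
  thus ?thesis by simp
 qed
 \<comment> \<open>Partial sums of the orthogonal projections increase, so their complements
   decrease and \<open>decseq_projs\<close> supplies the limit.\<close>
 have lim: "\<exists>r. Q (\<Union>i. A i) r & (\<forall>v. (%i. p i v) sums r v)"
  if A: "!!i::nat. A i : sets borel" and dA: "disjoint_family A" and p: "!!i. Q (A i) (p i)" for A p
 proof -
  have dj: "A i \<inter> A j = {}" if "i ~= j" for i j using dA that by (auto simp: disjoint_family_on_def)
  have pp: "projection_op (p i)" for i using p by (simp add: Q_def)
  define S where "S n v = (\<Sum>i<n. p i v)" for n v
  have Sp: "projection_op (S n) & (\<forall>j\<ge>n. \<forall>v. p j (S n v) = 0) & (\<forall>v. (norm (S n v))^2 = (\<Sum>i<n. (norm (p i v))^2))" for n
  proof (induction n)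
   case 0 show ?case by (simp add: S_def[abs_def] pr_zero bcl_simps[OF pr_bcl[OF pp]])
  next
   case (Suc n)
   hence S: "projection_op (S n)" and o: "!!j v. j >= n ==> p j (S n v) = 0"
    and nn: "!!v. (norm (S n v))^2 = (\<Sum>i<n. (norm (p i v))^2)" by blast+
   have eq: "S (Suc n) = (%v. S n v + p n v)" by (simp add: S_def[abs_def])
   note b1 = bcl_simps[OF pr_bcl[OF S]] and b2 = bcl_simps[OF pr_bcl[OF pp]]
   have o': "S n (p n v) = 0" for v by (rule pr_ortho_adj[OF S pp o]) simp
   have "bounded_clinear (%v. S n v + p n v)" by (intro bcl_add pr_bcl S pp)
   hence "projection_op (S (Suc n))" unfolding eq projection_op_def[of "%v. S n v + p n v"] adjoint_pair_def
    by (simp add: fun_eq_iff b1 b2 o o' pr_idem[OF S] pr_idem[OF pp] ci_algebra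
      pr_cinner[OF S] pr_cinner[OF pp])
   moreover have "p j (S (Suc n) v) = 0" if "j >= Suc n" for j v
    using that Qorth[OF p p dj A A, of j n] by (simp add: eq b2 o)
   moreover have "(norm (S (Suc n) v))^2 = (\<Sum>i<Suc n. (norm (p i v))^2)" for v
   proof -
    have "cinner (S n v) (p n v) = cinner (p n (S n v)) v" by (simp add: pr_cinner[OF pp])
    hence "cinner (S n v) (p n v) = 0" by (simp add: o)
    thus ?thesis by (simp add: eq pythagoras nn)
   qed
   ultimately show ?case by blast
  qed
  define q where "q n v = v - S n v" for n v
  have Spp: "projection_op (S n)" for n using Sp by blast
  have qp: "projection_op (q n)" for n unfolding q_def[abs_def] by (rule pr_compl[OF Spp])
  have SS: "S n (S m v) = S m v" if "m <= n" for m n v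
  proof -
   have "S n (S m v) = (\<Sum>i<n. p i (S m v))" by (rule S_def)
   also have "... = (\<Sum>i<m. p i (S m v))+(\<Sum>i=m..<n. p i (S m v))"
    using sum.atLeastLessThan_concat[of 0 m n "%i. p i (S m v)"] that by (simp only: lessThan_atLeast0)
   also have "(\<Sum>i<m. p i (S m v)) = S m (S m v)" by (rule S_def[symmetric])
   also have "... = S m v" by (rule pr_idem[OF Spp])
   also have "(\<Sum>i=m..<n. p i (S m v)) = 0" using Sp[of m] by (intro sum.neutral) auto
   finally show ?thesis by simp
  qed
  have SS': "S m (S n v) = S m v" if "m <= n" for m n v
   by (rule pr_sub_adj[OF Spp Spp SS[OF that]])
  have qdec: "q m (q n v) = q n v" if "m <= n" for m n v
   by (simp add: q_def bcl_simps[OF pr_bcl[OF Spp]] SS'[OF that])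
  note lim = decseq_projs[OF qp qdec]
  define r where "r v = v - proj (\<Inter>n. range (q n)) v" for v
  have rp: "projection_op r" unfolding r_def[abs_def] by (intro pr_compl pr_proj lim(1,2))
  have Sr: "(%n. S n v) \<longlonglongrightarrow> r v" for v
   using tendsto_diff[OF tendsto_const[of v] lim(3)[where x=v]] by (simp add: q_def r_def)
  have "emeasure (\<mu> v) (\<Union>i. A i) = ennreal ((norm (r v))^2)" for v
  proof -
   have "(%n. ennreal ((norm (S n v))^2)) \<longlonglongrightarrow> ennreal ((norm (r v))^2)"
    by (intro tendsto_ennrealI tendsto_intros Sr)
   moreover have "ennreal ((norm (S n v))^2) = (\<Sum>i<n. emeasure (\<mu> v) (A i))" for n
    using Sp[of n] p by (simp add: Q_def sum_ennreal)
   ultimately have "(%i. emeasure (\<mu> v) (A i)) sums ennreal ((norm (r v))^2)" by (simp add: sums_def)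
   moreover have "(%i. emeasure (\<mu> v) (A i)) sums emeasure (\<mu> v) (\<Union>i. A i)"
    using A dA by (intro sums_emeasure) (auto simp: disjoint_family_on_def sets)
   ultimately show ?thesis using sums_unique2 by blast
  qed
  hence "Q (\<Union>i. A i) r" using rp by (simp add: Q_def)
  moreover have "(%i. p i v) sums r v" for v using Sr[of v] by (simp add: sums_def S_def)
  ultimately show ?thesis by blast
 qed
 have ex: "\<exists>p. Q B p" if B: "B : sets borel" for B
 proof -
  have mem: "B : sigma_sets UNIV (range (%a::real. {..a}))"
   using B unfolding borel_eq_atMost by (simp add: sets_measure_of)
  have stable: "Int_stable (range (%a::real. {..a}))" by (auto simp: Int_stable_def intro!: image_eqI[of _ _ "min _ _"])
  have sub: "range (%a::real. {..a}) \<subseteq> Pow UNIV" by simp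
  from mem show ?thesis
  proof (induction rule: sigma_sets_induct_disjoint[OF stable sub, consumes 1, case_names basic empty compl union])
   case (basic A)
   then obtain t where "A = {..t}" by blast
   hence "Q A (E t)" by (simp add: Q_def E Iic F_def)
   thus ?case by blast
  next
   case empty
   have "Q {} (%x. 0)" by (simp add: Q_def pr_zero)
   thus ?case by blast
  next
   case (compl A)
   then obtain p where p: "Q A p" by blast
   have A: "A : sets borel" using compl unfolding borel_eq_atMost by (simp add: sets_measure_of)
   have "emeasure (\<mu> v) (UNIV-A) = ennreal ((norm (v - p v))^2)" for v
   proof -
    have "emeasure (\<mu> v) (UNIV-A) = emeasure (\<mu> v) UNIV-emeasure (\<mu> v) A"
     using p A by (intro emeasure_Diff) (auto simp: Q_def sets)
    also have "... = ennreal ((norm v)^2-(norm (p v))^2)" using p by (simp add: Q_def top' ennreal_minus)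
    also have "(norm v)^2-(norm (p v))^2 = (norm (v - p v))^2"
     using pr_split[of p v] p by (simp add: Q_def)
    finally show ?thesis .
   qed
   hence "Q (UNIV-A) (%x. x-p x)" using p by (simp add: Q_def pr_compl)
   thus ?case by blast
  next
   case (union A)
   hence "A i : sets borel" for i unfolding borel_eq_atMost by (auto simp: sets_measure_of)
   moreover obtain p where "!!i. Q (A i) (p i)" using union(3) by metis
   ultimately show ?case using lim union(1) by blast
  qed
 qed
 \<comment> \<open>The choice is harmless: a projection is determined by the norms of its values
   (\<open>pr_eqI_norm\<close>).\<close>
 define P where "P B = (SOME p. Q B p)" for B
 have QP: "Q B (P B)" if "B : sets borel" for B unfolding P_def using someI_ex[OF ex[OF that]] .
 have PP: "projection_op (P B)" if "B : sets borel" for B using QP[OF that] by (simp add: Q_def)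
 have Pem: "emeasure (\<mu> v) B = ennreal ((norm (P B v))^2)" if "B : sets borel" for B v
  using QP[OF that] by (simp add: Q_def)
 have Pn: "(norm (P B v))^2 = measure (\<mu> v) B" if "B : sets borel" for B v
  using Pem[OF that] by (simp add: measure_def)
 interpret fm: finite_measure "\<mu> v" for v by (rule finite_measureI) (simp add: space top')
 have Porth: "P B (P C v) = 0" if "B : sets borel" "C : sets borel" "B \<inter> C = {}" for B C v
  using Qorth[OF QP QP] that by blast
 have Padd: "P (B \<union> C) v = P B v + P C v" if BC: "B : sets borel" "C : sets borel" "B \<inter> C = {}" for B C v
 proof -
  have "P (B \<union> C) = (%v. P B v + P C v)"
  proof (rule quadratic_form_eqI)
   fix v
   show "cinner (P (B \<union> C) v) v = cinner (P B v + P C v) v"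
    using BC by (simp add: cinner_add_left pr_ci_self PP Pn fm.finite_measure_Union sets)
  qed (use BC in \<open>auto intro!: bcl_add pr_bcl[OF PP]\<close>)
  thus ?thesis by simp
 qed
 have PInt: "P (B \<inter> C) = P B \<circ> P C" if BC: "B : sets borel" "C : sets borel" for B C
 proof
  fix v
  let ?D = "B \<inter> C"
  have D: "?D : sets borel" "B-C : sets borel" "C-B : sets borel" using BC by auto
  have PB: "P B u = P ?D u+P (B-C) u" for u
   using Padd[OF D(1,2), of u] by (simp add: Int_Diff_Un Int_Diff_disjoint)
  have PC: "P C u = P ?D u+P (C-B) u" for u
  proof -
   have "?D \<union> (C-B) = C" "?D \<inter> (C-B) = {}" by auto
   thus ?thesis using Padd[OF D(1,3), of u] by simp
  qed
  have dj: "?D \<inter> (C-B) = {}" "(B-C) \<inter> ?D = {}" "(B-C) \<inter> (C-B) = {}" by auto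
  show "P ?D v = (P B \<circ> P C) v"
   using Porth[OF D(1,3) dj(1)] Porth[OF D(2,1) dj(2)] Porth[OF D(2,3) dj(3)] pr_idem[OF PP[OF D(1)]]
   by (subst o_apply, subst PC, subst PB) (simp add: bcl_simps[OF pr_bcl[OF PP[OF D(1)]]] bcl_simps[OF pr_bcl[OF PP[OF D(2)]]])
 qed
 have Psums: "(%n. P (A n) v) sums P (\<Union>n. A n) v"
  if A: "range A \<subseteq> sets borel" "disjoint_family A" for A :: "nat => real set" and v
 proof -
  have Ai: "A i : sets borel" for i using A(1) by blast
  obtain r where r: "Q (\<Union>i. A i) r" "!!v. (%i. P (A i) v) sums r v" using lim[OF Ai A(2) QP[OF Ai]] by blast
  have U: "Q (\<Union>i. A i) (P (\<Union>i. A i))" using Ai by (intro QP) auto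
  have "P (\<Union>i. A i) = r"
  proof (rule pr_eqI_norm)
   fix v
   have "ennreal ((norm (P (\<Union>i. A i) v))^2) = ennreal ((norm (r v))^2)" using U r(1) by (simp add: Q_def)
   thus "norm (P (\<Union>i. A i) v) = norm (r v)" by (simp add: power2_eq_iff_nonneg)
  qed (use U r(1) in \<open>simp_all add: Q_def\<close>)
  thus ?thesis using r(2) by simp
 qed
 have "P UNIV = id"
 proof
  fix v
  have "(norm (P UNIV v))^2 = (norm v)^2" using Pem[of UNIV v] by (simp add: top')
  thus "P UNIV v = id v" using pr_split[OF PP[of UNIV], of v] by simp
 qed
 hence "spectral_measure P" using PP PInt Psums by (simp add: spectral_measure_def)
 moreover have "P {..s} = E s" for s
 proof (rule pr_eqI_norm[OF PP E])
  fix v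
  have "(norm (P {..s} v))^2 = (norm (E s v))^2" using Pem[of "{..s}" v] by (simp add: Iic F_def)
  thus "norm (P {..s} v) = norm (E s v)" by (simp add: power2_eq_iff_nonneg)
 qed simp
 ultimately show ?thesis by blast
qed

text \<open>\<open>C\<close> also commutes with \<open>rsv_op a\<close>, a square root of a
  polynomial in the resolvent. It therefore preserves the core of \<open>rsv_core\<close>, and by
  continuity the graph.\<close>

lemma graph_com_rsv:
 assumes a: "positive_selfadjoint a" and C: "bounded_clinear C"
  and CR: "!!u. C (resolv a u) = resolv a (C u)" and x: "(v, w) : a"
 shows "(C v, C w) : a"
proof -
 have c: "closed_dense_op a" using a by (simp add: positive_selfadjoint_def)
 let ?A = "%u. resolv a u-resolv a (resolv a u)"
 have Apos: "positive_op ?A"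
 proof -
  have "0 <= inner (resolv a u) (u-resolv a u)" for u
   by (rule pos_com_product[OF rsv_pos[OF c] one_minus_rsv_pos[OF c]])
    (simp add: bcl_simps[OF rsv_bcl[OF c]])
  moreover have "inner (?A u) u = inner (resolv a u) (u-resolv a u)" for u
   using sa_in[OF rsv_sa[OF c], of "resolv a u" u] by (simp add: inner_diff inner_commute)
  moreover have "selfadj ?A"
   using pos_square[OF rsv_sa[OF c]]
   by (intro sa_diff rsv_sa[OF c] pos_sa)
  ultimately show ?thesis by (simp add: pos_iff)
 qed
 have CZ: "C (rsv_op a u) = rsv_op a (C u)" for u
  unfolding rsv_op_psa[OF a]
  by (rule sqop_com[OF Apos C]) (simp add: bcl_simps[OF C] CR)
 let ?V = "(%z. (C (fst z), C (snd z))) -` a"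
 have cont: "continuous_on UNIV (%z. (C (fst z), C (snd z)))"
  by (intro continuous_on_Pair continuous_on_compose2[OF bcl_cont[OF C, of UNIV]] continuous_intros) auto
 have "closed ?V" using continuous_closed_vimage[OF cdo_closed[OF c]] cont
  by (metis continuous_on_eq_continuous_at open_UNIV UNIV_I)
 moreover have "range (%u. (resolv a u, rsv_op a u)) \<subseteq> ?V"
  using rsv_graph[OF c] by (auto simp: CR CZ)
 ultimately have "closure (range (%u. (resolv a u, rsv_op a u))) \<subseteq> ?V" by (intro closure_minimal)
 thus ?thesis using x rsv_core[OF c] by auto
qed

section \<open>The spectral resolution of a positive self-adjoint operator\<close>

context
 fixes a :: "'h::complex_hilbert unbdd_op"
 assumes a: "positive_selfadjoint a"
begin

lemma psa_closed_dense: "closed_dense_op a"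
 using a by (simp add: positive_selfadjoint_def)

text \<open>\<open>spa a s\<close> sees s only through s^2, so for negative s the value 0 is set by
  hand, as the positivity of \<open>a\<close> demands.\<close>

definition resolution :: "real => 'h => 'h"
 where "resolution s v = (if s < 0 then 0 else v - spa a s v)"

abbreviation "ea \<equiv> spa a"

lemmas ea_proj = pr_spa[OF psa_closed_dense]
lemmas ea_simps = bcl_simps[OF pr_bcl[OF ea_proj]]

lemma ea_mono: "0 <= s ==> s <= t ==> ea s (ea t v) = ea t v"
 by (rule spa_mono[OF psa_closed_dense])

lemma ea_mono': "0 <= s ==> s <= t ==> ea t (ea s v) = ea t v"
 by (rule pr_sub_adj[OF ea_proj ea_proj ea_mono])

text \<open>The asymmetry of the two form bounds is decisive: the non-strict bound at s + 1/(n+1)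
  survives the limit and contradicts the strict one at s.\<close>

lemma ea_right: assumes s: "0 <= s" and z: "!!n. ea (s+1/real (Suc n)) v = 0" shows "ea s v = 0"
proof (rule ccontr)
 let ?w = "ea s v" and ?t = "%n. s+1/real (Suc n)"
 assume w: "?w ~= 0"
 have "(norm ?w)^2 <= (1+(?t n)^2)*inner (resolv a ?w) ?w" for n
  using s z[of n] by (intro spa_0[OF psa_closed_dense]) (simp add: ea_mono')
 moreover have "(%n. (1+(?t n)^2)*inner (resolv a ?w) ?w) \<longlonglongrightarrow> (1+(s+0)^2)*inner (resolv a ?w) ?w"
  by (intro tendsto_intros LIMSEQ_inverse_real_of_nat[unfolded inverse_eq_divide])
 ultimately have "(norm ?w)^2 <= (1+s^2)*inner (resolv a ?w) ?w"
  by (intro LIMSEQ_le_const[of _ _ "(norm ?w)^2"]) auto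
 moreover have "(1+s^2)*inner (resolv a ?w) ?w < (norm ?w)^2"
  by (rule spa_1[OF psa_closed_dense pr_idem[OF ea_proj] w])
 ultimately show False by linarith
qed

text \<open>A nonzero vector l in all ranges would satisfy (1 + n^2) <R l, l> < |l|^2 for every n,
  although <R l, l> > 0 by injectivity of the positive operator R.\<close>

lemma ea_top: "(%n. ea (real n) v) \<longlonglongrightarrow> 0"
proof -
 have lim: "(%n. ea (real n) v) \<longlonglongrightarrow> proj (\<Inter>n. range (ea (real n))) v"
  and K: "csub (\<Inter>n::nat. range (ea (real n)))" "closed (\<Inter>n::nat. range (ea (real n)))"
  using decseq_projs[of "%n. ea (real n)", OF ea_proj ea_mono] by auto
 define l where "l = proj (\<Inter>n. range (ea (real n))) v"
 have "l : (\<Inter>n. range (ea (real n)))" unfolding l_def by (rule proj_in[OF K])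
 hence l: "ea (real n) l = l" for n using pr_range[OF ea_proj] by blast
 have "l = 0"
 proof (rule ccontr)
  assume l0: "l ~= 0"
  have i: "inner (resolv a l) l > 0"
   using pos_in[OF rsv_pos[OF psa_closed_dense], of l] l0
    pos_in_eq_0[OF rsv_pos[OF psa_closed_dense], of l] rsv_inject[OF psa_closed_dense, of l]
   by fastforce
  obtain n where n: "(norm l)^2/inner (resolv a l) l < real n" using reals_Archimedean2 by blast
  have "(norm l)^2 < real n*inner (resolv a l) l" using n i by (simp add: field_simps)
  also have "... <= (1+(real n)^2)*inner (resolv a l) l"
  proof (intro mult_right_mono)
   have "real n <= real n*real n" by (cases n) (auto simp: algebra_simps)
   thus "real n <= 1+(real n)^2" by (simp add: power2_eq_square)
  qed (use i in simp)
  also have "... < (norm l)^2" by (rule spa_1[OF psa_closed_dense l l0])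
  finally show False .
 qed
 thus ?thesis using lim by (simp add: l_def)
qed

lemma rsl_mono: assumes "s <= t" shows "resolution t (resolution s v) = resolution s v"
 using assms by (auto simp: resolution_def ea_simps ea_mono')

lemma rsl_proj: "projection_op (resolution s)"
 unfolding resolution_def[abs_def]
 by (cases "s < 0") (simp_all add: pr_zero pr_compl ea_proj)

lemma rsl_right: "(%n. resolution (s+1/real (Suc n)) v) \<longlonglongrightarrow> resolution s v"
proof (cases "s < 0")
 case True
 have "(%n. s+1/real (Suc n)) \<longlonglongrightarrow> s+0"
  by (intro tendsto_intros LIMSEQ_inverse_real_of_nat[unfolded inverse_eq_divide])
 hence "\<forall>\<^sub>F n in sequentially. s+1/real (Suc n) < 0" using True by (intro order_tendstoD) auto
 hence "\<forall>\<^sub>F n in sequentially. resolution (s+1/real (Suc n)) v = resolution s v"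
  by eventually_elim (use True in \<open>simp add: resolution_def\<close>)
 thus ?thesis by (rule tendsto_eventually)
next
 case False
 let ?p = "%n. resolution (s+1/real (Suc n))"
 have dec: "?p m (?p n x) = ?p n x" if "m <= n" for m n x
  using that by (intro rsl_mono) (auto simp: frac_le)
 note lim = decseq_projs[of ?p, OF rsl_proj dec]
 define l where "l = proj (\<Inter>n. range (?p n)) v"
 have "l : (\<Inter>n. range (?p n))" unfolding l_def by (rule proj_in[OF lim(1,2)])
 hence l: "?p n l = l" for n using pr_range[OF rsl_proj] by blast
 have z: "ea (s+1/real (Suc n)) l = 0" for n
 proof -
  have "\<not> s+1/real (Suc n) < 0" using False by (smt (verit) divide_nonneg_nonneg of_nat_0_le_iff)
  thus ?thesis using l[of n] by (simp add: resolution_def)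
 qed
 have "ea s l = 0" by (rule ea_right[OF _ z]) (use False in linarith)
 hence sl: "resolution s l = l" using False by (simp add: resolution_def)
 have "(%n. resolution s (?p n v)) \<longlonglongrightarrow> resolution s l"
  unfolding l_def by (rule bcl_tendsto[OF pr_bcl[OF rsl_proj] lim(3)])
 moreover have "resolution s (?p n v) = resolution s v" for n
  by (rule pr_sub_adj[OF rsl_proj rsl_proj rsl_mono]) simp
 ultimately have "(%n::nat. resolution s v) \<longlonglongrightarrow> l" by (simp add: sl)
 from LIMSEQ_unique[OF this tendsto_const] have "l = resolution s v" .
 thus ?thesis using lim(3)[where x=v] by (simp add: l_def)
qed

lemma rsl_top: "(%n. resolution (real n) v) \<longlonglongrightarrow> v"
 using tendsto_diff[OF tendsto_const[of v] ea_top[of v]] by (simp add: resolution_def)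


lemma rsl_measure: obtains P where "spectral_measure P" "!!s. P {..s} = resolution s"
 using rsl_spec_measure[of resolution, OF rsl_proj rsl_mono rsl_right _ rsl_top]
 by (auto simp: resolution_def)

context
 fixes P :: "real set => 'h => 'h" and d :: real
 assumes P: "spectral_measure P" and PE: "!!s. P {..s} = resolution s" and d: "d > 0"
begin

text \<open>Upper end points are included, so the slice with index 0 is (-d, 0] and carries a
  possible atom at 0.\<close>

definition slice :: "nat => real set"
 where "slice k = {(real k-1)*d <.. real k*d}"

abbreviation "pk k \<equiv> P (slice k)"

lemma slice_borel [measurable, simp]: "slice k : sets borel"
 by (simp add: slice_def)

lemma slice_eq: "pk k v = resolution (real k*d) v - resolution ((real k-1)*d) v"
proof -
 have "(real k-1)*d <= real k*d" using d by (intro mult_right_mono) auto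
 hence "{..real k*d} = {..(real k-1)*d} \<union> slice k" by (auto simp: slice_def)
 hence "P {..real k*d} v = P {..(real k-1)*d} v + pk k v"
  by (simp only:) (intro sm_Un[OF P], auto simp: slice_def)
 thus ?thesis by (simp add: PE)
qed

lemma slice_proj: "projection_op (pk k)"
 by (rule sm_proj[OF P]) simp

lemmas slice_bcl = pr_bcl[OF slice_proj]

lemma slice_disjoint: "disjoint_family slice"
proof -
 have "slice i \<inter> slice j = {}" if "i < j" for i j
 proof -
  have "real i*d <= (real j-1)*d" using that d by (intro mult_right_mono) auto
  thus ?thesis by (auto simp: slice_def)
 qed
 thus ?thesis unfolding disjoint_family_on_def by (metis Int_commute linorder_neqE_nat)
qed

lemma slice_orth: "i ~= j ==> pk i (pk j v) = 0"
 using slice_disjoint by (simp add: sm_Int[OF P] disjoint_family_on_def sm_empty[OF P])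


lemma UN_slice: "(\<Union>k. slice k) = {- d <..}"
proof (intro equalityI subsetI)
 fix t assume "t : {- d<..}"
 hence t: "- 1 < t/d" using d by (simp add: field_simps)
 define k where "k = nat \<lceil>t/d\<rceil>"
 have "\<lceil>t/d\<rceil> >= 0" using t by linarith
 hence "real k = of_int \<lceil>t/d\<rceil>" by (simp add: k_def)
 hence "real k-1 < t/d" "t/d <= real k" by linarith+
 thus "t : (\<Union>k. slice k)" using d by (auto simp: slice_def field_simps intro!: exI[of _ k])
next
 fix t assume "t : (\<Union>k. slice k)"
 then obtain k where "(real k-1)*d < t" by (auto simp: slice_def)
 moreover have "- d <= (real k-1)*d" using d mult_right_mono[of "-1" "real k-1" d] by simp
 ultimately show "t : {- d<..}" by simp
qed

lemma slice_sums: "(%k. pk k v) sums v"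
proof -
 have "P {.. - d} v = 0" using d by (simp add: PE resolution_def)
 hence "P {- d <..} v = v" using sm_compl[OF P, of "{.. - d}" v] by (simp add: Compl_atMost)
 moreover have "(%k. pk k v) sums P (\<Union>k. slice k) v"
  by (rule sm_sums[OF P _ slice_disjoint]) auto
 ultimately show ?thesis by (simp add: UN_slice)
qed

lemma slice_norm_sums: "(%k. (norm (pk k v))^2) sums (norm v)^2"
proof -
 have "bounded_linear (%y. Re (cinner y v))"
  using bounded_linear_compose[OF bounded_linear_Re bounded_bilinear.bounded_linear_left[OF bdd_bilinear_cinner, of v]] .
 from bounded_linear.sums[OF this slice_sums[of v]] show ?thesis
  by (simp add: sm_cinner[OF P] ci_self)
qed

lemma slice_com: "(v, w) : a ==> (pk k v, pk k w) : a"
proof -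
 have "resolution s (resolv a u) = resolv a (resolution s u)" for s u
  by (simp add: resolution_def bcl_simps[OF rsv_bcl[OF psa_closed_dense]] spa_rsv[OF psa_closed_dense])
 hence "pk k (resolv a u) = resolv a (pk k u)" for u
  by (simp add: slice_eq bcl_simps[OF rsv_bcl[OF psa_closed_dense]])
 thus "(v, w) : a ==> (pk k v, pk k w) : a"
  by (intro graph_com_rsv[OF a slice_bcl])
qed

lemma slice_ea: assumes "pk k v = v" shows "ea (real k*d) v = 0" and "k >= 1 ==> ea ((real k-1)*d) v = v"
proof -
 have m: "(real k-1)*d <= real k*d" using d by (intro mult_right_mono) auto
 have "resolution (real k*d) v = P {..real k*d} (pk k v)" by (simp only: assms PE)
 also have "... = pk k v" by (subst sm_Int[OF P]) (auto simp: slice_def intro!: arg_cong2[where f=P])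
 finally have "resolution (real k*d) v = v" using assms by simp
 moreover have "\<not> real k*d < 0" using d by (simp add: not_less)
 ultimately show "ea (real k*d) v = 0" by (simp add: resolution_def)
 have "resolution ((real k-1)*d) v = P {..(real k-1)*d} (pk k v)" by (simp only: assms PE)
 also have "... = P {} v" by (subst sm_Int[OF P]) (auto simp: slice_def intro!: arg_cong2[where f=P])
 finally have 0: "resolution ((real k-1)*d) v = 0" by (simp add: sm_empty[OF P])
 assume "k >= 1"
 hence "\<not> (real k-1)*d < 0" using d by (simp add: not_less)
 thus "ea ((real k-1)*d) v = v" using 0 by (simp add: resolution_def)
qed

lemma slice_dom: "\<exists>w. (pk k v, w) : a & pk k w = w & norm w <= (real k*d)*norm (pk k v)"
proof -
 have 1: "pk k (pk k v) = pk k v" by (rule pr_idem[OF slice_proj])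
 obtain w where e: "(pk k v, w) : a" "norm w <= (real k*d)*norm (pk k v)"
  using spa_below[OF psa_closed_dense _ slice_ea(1)[OF 1]] d by auto
 have "(pk k (pk k v), pk k w) : a" by (rule slice_com[OF e(1)])
 hence "pk k w = w" using lin_uniq[OF cdo_linear[OF psa_closed_dense] e(1)] 1 by metis
 thus ?thesis using e by blast
qed

lemma slice_lower:
 assumes "(pk k v, w) : a" "k >= 1" shows "((real k-1)*d)*norm (pk k v) <= norm w"
proof (cases "pk k v = 0")
 case False
 have 1: "pk k (pk k v) = pk k v" by (rule pr_idem[OF slice_proj])
 have "((real k-1)*d)*norm (pk k v) < norm w"
  by (rule spa_above[OF psa_closed_dense _ slice_ea(2)[OF 1 assms(2)] False assms(1)]) (use assms d in auto)
 thus ?thesis by simp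
qed simp

text \<open>Positivity of \<open>a\<close> at \<open>\<xi> - \<eta> / t\<close> with \<open>\<eta> = a \<xi>\<close> turns \<open>\<parallel>a \<eta>\<parallel> \<le> t \<parallel>\<eta>\<parallel>\<close> into \<open>\<parallel>\<eta>\<parallel>\<^sup>2 \<le> t \<langle>\<eta>, \<xi>\<rangle>\<close>.\<close>

lemma slice_form_lower:
 assumes e: "(pk k w, y) : a" shows "(real k-2)*d*(norm (pk k w))^2 <= inner y (pk k w)"
  and "inner y (pk k w) <= real k*d*(norm (pk k w))^2" and "0 <= inner y (pk k w)"
  and "cinner y (pk k w) = complex_of_real (inner y (pk k w))"
proof -
 note lin = cdo_linear[OF psa_closed_dense]
 let ?x = "pk k w" and ?t = "real k*d" and ?s = "(real k-1)*d"
 have c: "(u, v) : a ==> cinner v u : \<real>\<^sub>\<ge>\<^sub>0" for u v using a by (auto simp: positive_selfadjoint_def)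
 hence pos: "(u, v) : a ==> 0 <= inner v u" for u v
  by (fastforce simp: complex_nonneg_Reals_iff inner_eq_Re_cinner)
 show "0 <= inner y ?x" by (rule pos[OF e])
 show "cinner y ?x = complex_of_real (inner y ?x)"
  using c[OF e] by (simp add: complex_nonneg_Reals_iff inner_eq_Re_cinner complex_eq_iff)
 obtain y' where h: "(?x, y') : a" "pk k y' = y'" "norm y' <= ?t*norm ?x" using slice_dom by blast
 have eq: "y' = y" by (rule lin_uniq[OF lin h(1) e])
 show "inner y ?x <= ?t*(norm ?x)^2"
 proof -
  have "inner y ?x <= norm y*norm ?x" by (rule norm_cauchy_schwarz)
  also have "... <= (?t*norm ?x)*norm ?x" using h eq by (intro mult_right_mono) auto
  finally show ?thesis by (simp add: power2_eq_square mult_ac)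
 qed
 show "(real k-2)*d*(norm ?x)^2 <= inner y ?x"
 proof (cases "k = 0")
  case True
  have "(real k-2)*d*(norm ?x)^2 <= 0" using True d by (simp add: mult_nonneg_nonneg)
  thus ?thesis using pos[OF e] by linarith
 next
  case False
  hence k: "k >= 1" by simp
  have t: "?t > 0" using k d by simp
  obtain ta where th: "(y, ta) : a" "norm ta <= ?t*norm y" using slice_dom[of k y] h eq by metis
  have adj: "op_adj a = a" using a by (simp add: positive_selfadjoint_def)
  have "cinner ta ?x = cinner y y"
  proof -
   have "(?x, y) : op_adj a" using e adj by simp
   thus ?thesis using th(1) by (auto simp: op_adj_def)
  qed
  hence thx: "inner ta ?x = (norm y)^2" by (simp add: inner_eq_Re_cinner ci_self)
  define N where "N = (norm y)^2"
  define r where "r = 1/?t"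
  have "(?x-complex_of_real r *\<^sub>C y, y-complex_of_real r *\<^sub>C ta) : a"
   by (intro lin_diff[OF lin e] lin_scaleC[OF lin th(1)])
  from pos[OF this] have "0 <= inner y ?x-2*(r*N)+r^2*inner ta y"
   unfolding scaleC_complex_of_real
   by (simp add: inner_diff thx N_def power2_norm_eq_inner[symmetric] power2_eq_square[of r] algebra_simps)
  hence "0 <= inner y ?x-2*N/?t+inner ta y/?t^2" by (simp add: r_def power_divide)
  moreover have "inner ta y/?t^2 <= N/?t"
  proof -
   have "inner ta y <= norm ta*norm y" by (rule norm_cauchy_schwarz)
   also have "... <= (?t*norm y)*norm y" by (intro mult_right_mono th) simp
   finally have "inner ta y <= ?t*N" by (simp add: N_def power2_eq_square mult_ac)
   hence "inner ta y/?t^2 <= ?t*N/?t^2" by (rule divide_right_mono) simp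
   moreover have "z*N/z^2 = N/z" for z :: real by (simp add: power2_eq_square)
   ultimately show ?thesis by metis
  qed
  ultimately have 1: "N/?t <= inner y ?x" by simp
  have "(?s*norm ?x)^2 <= N" unfolding N_def using slice_lower[OF e k] d k by (intro power_mono) auto
  hence 2: "?s^2*(norm ?x)^2/?t <= N/?t" using t by (intro divide_right_mono) (auto simp: power_mult_distrib)
  \<comment> \<open>From (k - 1)^2 \<ge> k (k - 2). The loss of 2 d against the upper end point is
    the source of the error 2 d |v|^2 in \<open>rsl_measure_cinner\<close>.\<close>
  have "(real k-2)*d*?t <= ?s^2"
  proof -
   have "(real k-2)*real k <= (real k-1)^2" by (simp add: power2_eq_square algebra_simps)
   hence "((real k-2)*real k)*d^2 <= (real k-1)^2*d^2" by (rule mult_right_mono) simp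
   thus ?thesis by (simp add: power_mult_distrib power2_eq_square mult_ac)
  qed
  hence "(real k-2)*d <= ?s^2/?t" using t by (simp add: pos_le_divide_eq)
  hence "(real k-2)*d*(norm ?x)^2 <= ?s^2/?t*(norm ?x)^2" by (rule mult_right_mono) simp
  thus ?thesis using 1 2 by simp
 qed
qed

lemma emeasure_slice: "emeasure (scalar_measure P v) (slice k) = ennreal ((norm (pk k v))^2)"
 by (rule emeasure_smeas[OF P]) simp

lemma scalar_AE: "AE t in scalar_measure P v. t >= 0"
proof -
 have "(\<Union>n. {.. - 1/real (Suc n)}) = {..<0::real}"
 proof (intro equalityI subsetI)
  fix x :: real assume "x : {..<0}"
  then obtain n where "inverse (real (Suc n)) < - x" using reals_Archimedean[of "-x"] by auto
  thus "x : (\<Union>n. {.. - 1/real (Suc n)})" by (auto simp: inverse_eq_divide intro!: exI[of _ n])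
 next
  fix x :: real assume "x : (\<Union>n. {.. - 1/real (Suc n)})"
  then obtain n where "x <= - 1/real (Suc n)" by auto
  moreover have "- 1/real (Suc n) < 0" by simp
  ultimately show "x : {..<0}" by (simp only: lessThan_iff)
 qed
 moreover have "emeasure (scalar_measure P v) (\<Union>n. {.. - 1/real (Suc n)}) = 0"
  by (rule emeasure_UN_eq_0) (auto simp: emeasure_smeas[OF P] PE resolution_def P)
 ultimately have "{..<0} : null_sets (scalar_measure P v)" by (intro null_setsI) (simp_all add: P)
 thus ?thesis by (rule AE_I') auto
qed

lemma scalar_AE_slice: "AE t in scalar_measure P v. t : (\<Union>k. slice k)"
 using scalar_AE by eventually_elim (use d in \<open>simp add: UN_slice\<close>)

lemma meas_scalar: "borel_measurable (scalar_measure P v) = borel_measurable borel"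
 by (rule measurable_cong_sets) (simp_all add: P)

lemma slice_step_int:
 "(\<integral>\<^sup>+ t. (\<Sum>k. ennreal (u k)*indicator (slice k) t) \<partial>scalar_measure P v) =
  (\<Sum>k. ennreal (u k)*ennreal ((norm (pk k v))^2))"
 by (subst nn_integral_suminf)
  (auto simp: meas_scalar nn_integral_cmult_indicator P emeasure_slice)

lemma slice_step_value: "t : slice k ==> (\<Sum>k. ennreal (u k)*indicator (slice k) t) = ennreal (u k)"
proof -
 assume t: "t : slice k"
 have "(\<Sum>k. ennreal (u k)*indicator (slice k) t) = (\<Sum>i\<in>{k}. ennreal (u i)*indicator (slice i) t)"
  using slice_disjoint t by (intro suminf_finite) (auto simp: disjoint_family_on_def indicator_def)
 thus ?thesis using t by simp
qed

lemma slice_upper_int: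
 assumes "!!k t. t : slice k ==> 0 <= t ==> f t <= ennreal (u k)"
 shows "(\<integral>\<^sup>+ t. f t \<partial>scalar_measure P v) <= (\<Sum>k. ennreal (u k)*ennreal ((norm (pk k v))^2))"
 unfolding slice_step_int[symmetric]
proof (rule nn_integral_mono_AE)
 show "AE t in scalar_measure P v. f t <= (\<Sum>k. ennreal (u k)*indicator (slice k) t)"
  using scalar_AE_slice scalar_AE
 proof eventually_elim
  case (elim t)
  then obtain k where "t : slice k" by blast
  thus ?case using assms elim by (simp add: slice_step_value)
 qed
qed

lemma slice_lower_int:
 assumes "!!k t. t : slice k ==> 0 <= t ==> ennreal (u k) <= f t"
 shows "(\<Sum>k. ennreal (u k)*ennreal ((norm (pk k v))^2)) <= (\<integral>\<^sup>+ t. f t \<partial>scalar_measure P v)"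
 unfolding slice_step_int[symmetric]
proof (rule nn_integral_mono_AE)
 show "AE t in scalar_measure P v. (\<Sum>k. ennreal (u k)*indicator (slice k) t) <= f t"
  using scalar_AE_slice scalar_AE
 proof eventually_elim
  case (elim t)
  then obtain k where "t : slice k" by blast
  thus ?case using assms elim by (simp add: slice_step_value)
 qed
qed

end

end

instance complex_hilbert \<subseteq> banach ..

section \<open>The constructed measure is the spectral measure of the operator\<close>

context
 fixes a :: "'h::complex_hilbert unbdd_op" and P :: "real set => 'h => 'h"
 assumes a: "positive_selfadjoint a" and P: "spectral_measure P" and PE: "!!s. P {..s} = resolution a s"
begin

text \<open>Exchanges the upper end point of a unit slice for the lower one, at the price of a
  summable extra term.\<close>

lemma slice_square: "(real k)^2*n <= 2*((max 0 (real k-1))^2*n)+2*n" if "n >= 0" for n :: real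
proof -
 have "(real k)^2 <= 2*(max 0 (real k-1))^2+2"
 proof (cases "k = 0")
  case False
  have "0 <= (real k-2)^2" by simp
  thus ?thesis using False by (simp add: max_def power2_eq_square algebra_simps)
 qed simp
 hence "(real k)^2*n <= (2*(max 0 (real k-1))^2+2)*n" using that by (rule mult_right_mono)
 thus ?thesis by (simp add: algebra_simps)
qed

text \<open>Unit mesh suffices: both conditions amount to summability of k^2 |p_k v|^2. Conversely
  the images of the slices of \<open>v\<close> are pairwise orthogonal, so square summability makes
  their series converge in norm, and closedness of \<open>a\<close> puts \<open>v\<close> into the
  domain.\<close>

lemma rsl_measure_Dom: "v : Domain a \<longleftrightarrow> (\<integral>\<^sup>+ t. ennreal (t^2) \<partial>scalar_measure P v) < \<infinity>"
proof
 note S = a P PE zero_less_one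
 let ?p = "%k. P (slice 1 k)"
 assume "v : Domain a"
 then obtain w where e: "(v, w) : a" by blast
 have "(\<integral>\<^sup>+ t. ennreal (t^2) \<partial>scalar_measure P v) \<le>
   (\<Sum>k. ennreal ((real k)^2)*ennreal ((norm (?p k v))^2))"
  by (rule slice_upper_int[OF S]) (auto simp: slice_def[OF S] intro!: power_mono)
 also have "... <= (\<Sum>k. ennreal (2*(norm (?p k w))^2+2*(norm (?p k v))^2))"
 proof (intro suminf_le)
  fix k
  have "(max 0 (real k-1))^2*(norm (?p k v))^2 <= (norm (?p k w))^2"
  proof (cases "k = 0")
   case False
   have "((real k-1)*1)*norm (?p k v) <= norm (?p k w)"
    by (rule slice_lower[OF S slice_com[OF S e]]) (use False in simp)
   hence "((real k-1)*norm (?p k v))^2 <= (norm (?p k w))^2"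
    using False by (intro power_mono) auto
   thus ?thesis using False by (simp add: power_mult_distrib max_def)
  qed simp
  hence "(real k)^2*(norm (?p k v))^2 <= 2*(norm (?p k w))^2+2*(norm (?p k v))^2"
   using slice_square[of "(norm (?p k v))^2" k] by simp
  thus "ennreal ((real k)^2)*ennreal ((norm (?p k v))^2)
    <= ennreal (2*(norm (?p k w))^2+2*(norm (?p k v))^2)"
   by (simp add: ennreal_mult[symmetric] ennreal_leI del: ennreal_plus)
 qed simp_all
 also have "... = ennreal (2*(norm w)^2+2*(norm v)^2)"
  by (intro suminf_ennreal_eq sums_add sums_mult slice_norm_sums[OF S]) simp
 also have "... < \<infinity>" by simp
 finally show "(\<integral>\<^sup>+ t. ennreal (t^2) \<partial>scalar_measure P v) < \<infinity>" .
next
 note S = a P PE zero_less_one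
 let ?p = "%k. P (slice 1 k)"
 assume fin: "(\<integral>\<^sup>+ t. ennreal (t^2) \<partial>scalar_measure P v) < \<infinity>"
 let ?u = "%k. (max 0 (real k-1))^2"
 have "(\<Sum>k. ennreal (?u k)*ennreal ((norm (?p k v))^2)) <= (\<integral>\<^sup>+ t. ennreal (t^2) \<partial>scalar_measure P v)"
  by (rule slice_lower_int[OF S]) (auto simp: slice_def[OF S] intro!: power_mono ennreal_leI)
 hence fin': "(\<Sum>k. ennreal (?u k)*ennreal ((norm (?p k v))^2)) < \<infinity>" using fin by (rule le_less_trans)
 have su: "summable (%k. ?u k*(norm (?p k v))^2)"
  using fin' by (intro summable_suminf_not_top) (auto simp: ennreal_mult top_unique less_top)
 have sn: "summable (%k. (norm (?p k v))^2)" by (rule sums_summable[OF slice_norm_sums[OF S]])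
 obtain h where h: "!!k. (?p k v, h k) : a" "!!k. ?p k (h k) = h k" "!!k. norm (h k) <= (real k*1)*norm (?p k v)"
 proof -
  have "\<forall>k. \<exists>w. (?p k v, w) : a & ?p k w = w & norm w <= (real k*1)*norm (?p k v)"
   using slice_dom[OF S] by blast
  from choice[OF this] that show ?thesis by blast
 qed
 have sh: "summable (%k. (norm (h k))^2)"
 proof (rule summable_comparison_test'[of _ 0])
  show "summable (%k. 2*(?u k*(norm (?p k v))^2)+2*(norm (?p k v))^2)"
   by (intro summable_add summable_mult su sn)
  fix k :: nat
  have "(norm (h k))^2 <= (real k*norm (?p k v))^2" using h(3)[of k] by (intro power_mono) auto
  also have "... = (real k)^2*(norm (?p k v))^2" by (simp add: power_mult_distrib)
  also have "... <= 2*(?u k*(norm (?p k v))^2)+2*(norm (?p k v))^2" by (rule slice_square) simp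
  finally show "norm ((norm (h k))^2) <= 2*(?u k*(norm (?p k v))^2)+2*(norm (?p k v))^2" by simp
 qed
 have orth: "inner (h i) (h j) = 0" if "i ~= j" for i j
 proof -
  have "cinner (h i) (h j) = cinner (?p i (h i)) (?p j (h j))" by (simp add: h(2))
  also have "... = cinner (h i) (?p i (?p j (h j)))" by (rule pr_cinner[OF slice_proj[OF S]])
  also have "... = 0" using slice_orth[OF S that] by simp
  finally show ?thesis by (simp add: inner_eq_Re_cinner)
 qed
 have "summable h"
 proof (unfold summable_Cauchy, intro allI impI)
  fix e :: real assume e: "e > 0"
  hence "e^2 > 0" by simp
  then obtain N where N: "!!m n. m >= N ==> norm (\<Sum>k=m..<n. (norm (h k))^2) < e^2"
   using sh unfolding summable_Cauchy by metis
  have "norm (\<Sum>k=m..<n. h k) < e" if "m >= N" for m n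
  proof -
   have "(norm (\<Sum>k=m..<n. h k))^2 = (\<Sum>k=m..<n. (norm (h k))^2)"
    by (rule norm_sum_Pythagorean) (auto simp: pairwise_def orthogonal_def orth)
   hence "(norm (\<Sum>k=m..<n. h k))^2 < e^2" using N[OF that, of n] by simp
   thus ?thesis using e by (simp add: power_less_imp_less_base)
  qed
  thus "\<exists>N. \<forall>m\<ge>N. \<forall>n. norm (\<Sum>k=m..<n. h k) < e" by blast
 qed
 hence l1: "(%n. \<Sum>k<n. h k) \<longlonglongrightarrow> suminf h" by (rule summable_LIMSEQ)
 have l2: "(%n. \<Sum>k<n. ?p k v) \<longlonglongrightarrow> v" using slice_sums[OF S] by (simp add: sums_def)
 have "((\<Sum>k<n. ?p k v), (\<Sum>k<n. h k)) : a" for n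
  by (induction n) (simp_all add: lin_zero lin_add h(1) cdo_linear psa_closed_dense[OF a])
 from closed_sequentially[OF cdo_closed[OF psa_closed_dense[OF a]] this tendsto_Pair[OF l2 l1]]
 show "v : Domain a" by blast
qed

text \<open>Form and integral are compared slice by slice with errors d |v|^2 and 2 d |v|^2; then d
  tends to 0.\<close>

lemma rsl_measure_cinner:
 assumes e: "(v, w) : a"
 shows "cinner w v = complex_of_real (\<integral> t. t \<partial>scalar_measure P v)"
proof -
 define i where "i = inner w v"
 define nn where "nn = (norm v)^2"
 let ?I = "\<integral>\<^sup>+ t. ennreal t \<partial>scalar_measure P v"
 have *: "cinner w v = complex_of_real i & ?I <= ennreal (i+2*(d*nn)) & ennreal i <= ?I+ennreal (d*nn) & 0 <= i"
  if d: "d > 0" for d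
 proof -
  note S = a P PE d
  let ?p = "%k. P (slice d k)"
  define c where "c k = inner (?p k w) (?p k v)" for k
  define n where "n k = (norm (?p k v))^2" for k
  have n0: "0 <= n k" for k by (simp add: n_def)
  note g = slice_com[OF S e]
  have ck: "cinner w (?p k v) = complex_of_real (c k)" for k
  proof -
   have "cinner w (?p k v) = cinner (?p k w) (?p k v)"
    by (simp add: pr_cinner[OF slice_proj[OF S]] pr_idem[OF slice_proj[OF S]])
   thus ?thesis using slice_form_lower(4)[OF S g] by (simp add: c_def)
  qed
  have bl: "bounded_linear (%y. cinner w y)" by (rule bounded_bilinear.bounded_linear_right[OF bdd_bilinear_cinner])
  have sc: "(%k. complex_of_real (c k)) sums cinner w v"
   using bounded_linear.sums[OF bl slice_sums[OF S, of v]] by (simp add: ck)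
  have "(%k. Im (complex_of_real (c k))) sums Im (cinner w v)" by (rule sums_Im[OF sc])
  hence im: "Im (cinner w v) = 0" using sums_unique2[OF _ sums_zero] by simp
  hence ci: "cinner w v = complex_of_real i" by (simp add: i_def inner_eq_Re_cinner complex_eq_iff)
  have sc': "c sums i" using sums_Re[OF sc] by (simp add: ci)
  have c0: "0 <= c k" for k unfolding c_def by (rule slice_form_lower(3)[OF S g])
  have cu: "c k <= real k*d*n k" for k unfolding c_def n_def by (rule slice_form_lower(2)[OF S g])
  have cl: "(real k-2)*d*n k <= c k" for k unfolding c_def n_def by (rule slice_form_lower(1)[OF S g])
  have ns: "n sums nn" unfolding n_def nn_def by (rule slice_norm_sums[OF S])
  have "?I <= (\<Sum>k. ennreal (real k*d)*ennreal (n k))"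
   unfolding n_def by (rule slice_upper_int[OF S]) (auto simp: slice_def[OF S] intro!: ennreal_leI)
  also have "... <= (\<Sum>k. ennreal (c k+2*(d*n k)))"
  proof (intro suminf_le)
   fix k
   have "(real k*d)*n k <= c k+2*(d*n k)" using cl[of k] by (simp add: algebra_simps)
   thus "ennreal (real k*d)*ennreal (n k) <= ennreal (c k+2*(d*n k))"
    using d n0 by (simp add: ennreal_mult[symmetric] ennreal_leI)
  qed simp_all
  also have "... = ennreal (i+2*(d*nn))"
   using c0 n0 d by (intro suminf_ennreal_eq sums_add sums_mult sc' ns) simp
  finally have up: "?I <= ennreal (i+2*(d*nn))" .
  have "ennreal i = (\<Sum>k. ennreal (c k))" by (rule suminf_ennreal_eq[OF c0 sc', symmetric])
  also have "... <= (\<Sum>k. ennreal (max 0 (real k-1)*d)*ennreal (n k)+ennreal (d*n k))"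
  proof (intro suminf_le)
   fix k
   have "real k*d*n k <= (max 0 (real k-1)+1)*d*n k"
    using d n0 by (intro mult_right_mono) auto
   hence "c k <= (max 0 (real k-1)*d)*n k+d*n k" using cu[of k] by (simp add: algebra_simps)
   thus "ennreal (c k) <= ennreal (max 0 (real k-1)*d)*ennreal (n k)+ennreal (d*n k)"
    using d n0 by (simp add: ennreal_mult[symmetric] ennreal_plus[symmetric] ennreal_leI del: ennreal_plus)
  qed simp_all
  also have "... = (\<Sum>k. ennreal (max 0 (real k-1)*d)*ennreal (n k))+(\<Sum>k. ennreal (d*n k))"
   by (rule suminf_add[symmetric]) simp_all
  also have "(\<Sum>k. ennreal (d*n k)) = ennreal (d*nn)"
   using d n0 by (intro suminf_ennreal_eq sums_mult ns) simp
  also have "(\<Sum>k. ennreal (max 0 (real k-1)*d)*ennreal (n k)) <= ?I"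
   unfolding n_def
  proof (rule slice_lower_int[OF S])
   fix k t assume "t : slice d k" "0 <= t"
   thus "ennreal (max 0 (real k-1)*d) <= ennreal t"
    by (intro ennreal_leI) (auto simp: slice_def[OF S] max_def)
  qed
  finally have lo: "ennreal i <= ?I+ennreal (d*nn)" by (simp add: add_right_mono)
  have "0 <= i" by (rule sums_le[OF c0 sums_zero sc'])
  thus ?thesis using ci up lo by blast
 qed
 have ci: "cinner w v = complex_of_real i" and i0: "0 <= i" using *[of 1] by auto
 have nn0: "0 <= nn" by (simp add: nn_def)
 have "?I < \<infinity>" using *[of 1] by (auto intro: le_less_trans simp: ennreal_less_top)
 then obtain r where r: "?I = ennreal r" "0 <= r" by (cases ?I) auto
 have up: "r <= i+d*(2*nn)" and lo: "i <= r+d*nn" if d: "d > 0" for d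
 proof -
  have "0 <= d*nn" using d nn0 by simp
  moreover have "ennreal r <= ennreal (i+2*(d*nn))" "ennreal i <= ennreal r+ennreal (d*nn)"
   using *[OF d] r by auto
  ultimately show "r <= i+d*(2*nn)" "i <= r+d*nn"
   using i0 r by (simp_all add: ennreal_plus[symmetric] mult_ac del: ennreal_plus)
 qed
 have "r = i" using le_if_le_add_mult[OF up] le_if_le_add_mult[OF lo] by simp
 have "(\<integral> t. t \<partial>scalar_measure P v) = enn2real ?I"
  using scalar_AE[OF a P PE zero_less_one] by (intro integral_eq_nn_integral) (auto simp: meas_scalar[OF a P PE zero_less_one])
 thus ?thesis using ci r \<open>r = i\<close> by simp
qed

lemma rsl_measure_of: "is_spectral_measure_of P a"
 unfolding is_spectral_measure_of_def
 using P rsl_measure_Dom rsl_measure_cinner by auto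

end

text \<open>Existence comes from the resolution, uniqueness on half-lines from
  \<open>smo_unique\<close>, whose bicommutant hypothesis is \<open>spa_com\<close>.\<close>

lemma spec_proj_psa:
 assumes a: "positive_selfadjoint a" and s: "s >= 0"
 shows "spectral_proj a {s<..} = spa a s"
proof -
 obtain P where P: "spectral_measure P" "!!s. P {..s} = resolution a s" using rsl_measure[OF a] by blast
 have Pa: "is_spectral_measure_of P a" by (rule rsl_measure_of[OF a P])
 have Ps: "P {s<..} = spa a s"
 proof
  fix v show "P {s<..} v = spa a s v"
   using sm_compl[OF P(1), of "{..s}" v] s by (simp add: Compl_atMost P(2) resolution_def[OF a])
 qed
 show ?thesis unfolding spectral_proj_def
 proof (rule the_equality)
  show "\<exists>P. is_spectral_measure_of P a & spa a s = P {s<..}" using Pa Ps by auto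
  fix p assume "\<exists>Q. is_spectral_measure_of Q a & p = Q {s<..}"
  then obtain Q where Q: "is_spectral_measure_of Q a" "p = Q {s<..}" by blast
  have "Q {s<..} = P {s<..}"
   by (rule smo_unique[OF Pa Q(1) a]) (simp add: Ps spa_com[OF psa_closed_dense[OF a]])
  thus "p = spa a s" using Q Ps by simp
 qed
qed

lemma spec_proj_op_abs:
 assumes x: "closed_dense_op x" and s: "s >= 0"
 shows "spectral_proj (op_abs x) {s<..} = spa x s"
 using spec_proj_psa[OF op_abs_psa[OF x] s]
 by (simp add: spa_def rsv_op_abs[OF x])

section \<open>Von Neumann algebras with a trace\<close>

lemma commutantD:
 assumes "T : commutant A"
 shows comm_bcl: "bounded_clinear T" and comm_com: "S : A ==> T (S v) = S (T v)"
 using assms by (auto simp: commutant_def fun_eq_iff)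

lemma commutantI: "bounded_clinear T ==> (!!S v. S : A ==> T (S v) = S (T v)) ==> T : commutant A"
 by (auto simp: commutant_def fun_eq_iff)

lemma comm_add: "S : commutant A ==> T : commutant A ==> (!!R. R : A ==> bounded_clinear R) ==>
  (%x. S x+T x) : commutant A"
 by (auto intro!: commutantI bcl_add simp: comm_bcl comm_com bcl_add_simp)

lemma comm_scaleC: "S : commutant A ==> (!!R. R : A ==> bounded_clinear R) ==>
  (%x. c *\<^sub>C S x) : commutant A"
 by (auto intro!: commutantI bcl_scaleC simp: comm_bcl comm_com bcl_scaleC_simp)

lemma comm_ident: "(%x. x) : commutant A"
 by (auto intro!: commutantI bcl_ident)

lemma comm_compose: "S : commutant A ==> T : commutant A ==> (%x. S (T x)) : commutant A"
 by (rule commutantI) (simp_all add: bcl_compose comm_bcl comm_com[of S A] comm_com[of T A])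

lemma adj_com:
 assumes S: "bounded_clinear S" and T: "bounded_clinear T" and c: "!!v. T (adj S v) = adj S (T v)"
 shows "adj T (S v) = S (adj T v)"
 by (rule ci_eqI2) (metis adj_cinner[OF T] adj_cinner'[OF S] c)

lemma comm_sqop:
 assumes "A : commutant B" "positive_op A" "!!R. R : B ==> bounded_clinear R"
 shows "sqop A : commutant B"
proof (rule commutantI)
 show "bounded_clinear (sqop A)" by (rule pos_bcl[OF sqop_pos[OF assms(2)]])
 fix S v assume S: "S : B"
 show "sqop A (S v) = S (sqop A v)"
  by (rule sqop_com[OF assms(2) assms(3)[OF S], symmetric]) (rule comm_com[OF assms(1) S, symmetric])
qed

locale vn_trace = fns_trace M \<tau> for M :: "('h::complex_hilbert => 'h) set" and \<tau> +
 assumes vn: "von_neumann_algebra M"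
begin

abbreviation "M' \<equiv> commutant M"

lemma M_bicommutant: "M = commutant M'"
 using vn by (simp add: von_neumann_algebra_def)

lemma M_bcl: "T : M ==> bounded_clinear T"
 using M_bicommutant comm_bcl by blast

lemma M_com: "T : M ==> S : M' ==> S (T v) = T (S v)"
 by (rule comm_com)

lemma M_I: "bounded_clinear T ==> (!!S v. S : M' ==> T (S v) = S (T v)) ==> T : M"
 by (subst M_bicommutant) (rule commutantI)

lemma M_adj: assumes "T : M" shows "adj T : M"
proof -
 obtain S where "S : M" "adjoint_pair T S" using vn assms by (auto simp: von_neumann_algebra_def)
 thus ?thesis using adjoint_pair_eq_adj[OF M_bcl[OF assms]] by simp
qed

lemma M'_adj: assumes T: "T : M'" shows "adj T : M'"
proof (rule commutantI)
 show "bounded_clinear (adj T)" by (rule adj_bcl[OF comm_bcl[OF T]])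
 fix S v assume S: "S : M"
 show "adj T (S v) = S (adj T v)"
  by (rule adj_com[OF M_bcl[OF S] comm_bcl[OF T]]) (rule comm_com[OF T M_adj[OF S]])
qed

lemma M_add: "S : M ==> T : M ==> (%x. S x+T x) : M"
 by (metis M_bicommutant comm_add comm_bcl)
lemma M_scaleC: "S : M ==> (%x. c *\<^sub>C S x) : M"
 by (metis M_bicommutant comm_scaleC comm_bcl)
lemma M_ident: "(%x. x) : M"
 by (metis M_bicommutant comm_ident)
lemma M_compose: "S : M ==> T : M ==> (%x. S (T x)) : M"
 by (metis M_bicommutant comm_compose)
lemma M_scaleR: "S : M ==> (%x. r *\<^sub>R S x) : M"
 using M_scaleC[of S "of_real r"] by (simp add: scaleC_complex_of_real)
lemma M_zero: "(%x. 0) : M"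
 using M_scaleC[OF M_ident, of 0] by simp
lemma M_minus: "S : M ==> (%x. - S x) : M"
 using M_scaleC[of S "-1"] by (simp add: scaleC_minus_left)
lemma M_diff: "S : M ==> T : M ==> (%x. S x-T x) : M"
 using M_add[of S "%x. - T x"] M_minus[of T] by simp

lemma M_sqop: "A : M ==> positive_op A ==> sqop A : M"
 by (metis M_bicommutant comm_sqop comm_bcl)

lemma M_cut:
 assumes T: "T : M" "selfadj T" shows "cut T : M"
proof (rule M_I)
 show "bounded_clinear (cut T)" by (rule pr_bcl[OF pr_cut[OF T(2)]])
 fix S v assume S: "S : M'"
 show "cut T (S v) = S (cut T v)"
  by (rule cut_com[OF T(2) comm_bcl[OF S], symmetric]) (rule comm_com[OF S T(1)])
qed

lemma M_proj:
 assumes K: "csub K" "closed K" and inv: "!!S v. S : M' ==> v : K ==> S v : K"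
 shows "proj K : M"
proof (rule M_I)
 show "bounded_clinear (proj K)" by (rule pr_bcl[OF pr_proj[OF K]])
 fix S v assume S: "S : M'"
 show "proj K (S v) = S (proj K v)"
  by (rule commute_proj[OF K comm_bcl[OF S], symmetric]) (auto intro: inv S M'_adj)
qed

text \<open>A self-adjoint contraction \<open>T\<close> is the real part of the unitary \<open>T + i (1 - T\<^sup>2)\<^sup>1\<^sup>/\<^sup>2\<close>, so
 the unitaries span the commutant.\<close>

lemma unitary_of_contraction:
 assumes T: "T : M'" "selfadj T" and n: "!!v. norm (T v) <= norm v"
 obtains U V where "U : M'" "V : M'" "unitary_op U" "unitary_op V" "!!v. 2 *\<^sub>R T v = U v + V v"
proof -
 note bT = sa_bcl[OF T(2)]
 note Mb = M_bcl
 define A where "A = (%v. v - T (T v))"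
 have "inner (T (T v)) v <= inner v v" for v
  using sa_in[OF T(2), of "T v" v] n[of v] power_mono[OF n[of v], of 2]
  by (simp add: power2_norm_eq_inner)
 moreover have "selfadj A" unfolding A_def
  by (intro sa_diff sa_ident pos_sa[OF pos_square[OF T(2)]])
 ultimately have Ap: "positive_op A" by (simp add: pos_iff A_def inner_diff_left)
 have AM: "A : M'"
  using comm_add[OF comm_ident comm_scaleC[OF comm_compose[OF T(1) T(1)] Mb, of "-1"] Mb]
  by (simp add: A_def scaleC_minus_left)
 define V where "V = sqop A"
 have VM: "V : M'" unfolding V_def by (rule comm_sqop[OF AM Ap Mb])
 have Vp: "positive_op V" unfolding V_def by (rule sqop_pos[OF Ap])
 note bV = pos_bcl[OF Vp]
 have VV: "V (V v) = v - T (T v)" for v unfolding V_def using sqop_sq[OF Ap] by (simp add: A_def)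
 have TV: "T (V v) = V (T v)" for v
  unfolding V_def by (rule sqop_com[OF Ap bT]) (simp add: A_def bcl_simps[OF bT])
 define W where "W c v = T v + c *\<^sub>C V v" for c v
 have WM: "W c : M'" for c
  unfolding W_def[abs_def] by (intro comm_add comm_scaleC T VM Mb)
 have WW: "W (cnj c) (W c v) = v" if "c*cnj c = 1" "c+cnj c = 0" for c v
 proof -
  have "W (cnj c) (W c v) = T (T v)+(c+cnj c) *\<^sub>C V (T v)+(c*cnj c) *\<^sub>C (v - T (T v))"
   by (simp add: W_def bcl_simps[OF bT] bcl_simps[OF bV] TV VV scaleC_add_left scaleC_add_right scaleC_scaleC mult.commute)
  thus ?thesis using that by simp
 qed
 have adj: "cinner (W c v) w = cinner v (W (cnj c) w)" for c v w
  by (simp add: W_def ci_algebra sa_cinner[OF T(2)] sa_cinner[OF pos_sa[OF Vp]])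
 have U: "unitary_op (W c)" if c: "c*cnj c = 1" "c+cnj c = 0" for c
  unfolding unitary_op_def
 proof (intro conjI allI)
  show "bounded_clinear (W c)" by (rule comm_bcl[OF WM])
  have "W c (W (cnj c) v) = v" for v using WW[of "cnj c" v] c by (simp add: mult.commute add.commute)
  thus "surj (W c)" by (metis surjI)
  show "cinner (W c x) (W c y) = cinner x y" for x y by (simp add: adj WW[OF c])
 qed
 show ?thesis
 proof (rule that[of "W \<i>" "W (- \<i>)"])
  show "2 *\<^sub>R T v = W \<i> v + W (- \<i>) v" for v by (simp add: W_def scaleC_minus_left scaleR_2)
 qed (auto intro: WM U)
qed

text \<open>Affiliation speaks of unitaries only. Self-adjoint contractions are averages of two of
  them; scaling and the splitting into real and imaginary parts reach the whole commutant.\<close>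

lemma aff_invariant:
 assumes x: "affiliated M x" and lin: "linear_op x" and S: "S : M'" and e: "(v, w) : x"
 shows "(S v, S w) : x"
proof -
 note Mb = M_bcl
 have unit: "(U v, U w) : x" if "U : M'" "unitary_op U" for U
  using x that e unfolding affiliated_def by (metis (no_types, lifting) case_prod_conv image_eqI)
 have contr: "(T v, T w) : x" if T: "T : M'" "selfadj T" and n: "!!v. norm (T v) <= norm v" for T
 proof -
  obtain U V where UV: "U : M'" "V : M'" "unitary_op U" "unitary_op V" "!!v. 2 *\<^sub>R T v = U v + V v"
   using unitary_of_contraction[OF T n] by blast
  have "(U v + V v, U w+V w) : x" by (intro lin_add lin unit UV)
  from lin_scaleC[OF lin this, of "of_real (1/2)"]
  show ?thesis unfolding UV(5)[symmetric] scaleC_complex_of_real by simp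
 qed
 have sa: "(T v, T w) : x" if T: "T : M'" "selfadj T" for T
 proof -
  obtain K where K: "K > 0" "!!v. norm (T v) <= K*norm v"
   using bcl_bdd[OF sa_bcl[OF T(2)]] by blast
  define T' where "T' = (%v. (1/K) *\<^sub>R T v)"
  have "T' : M'" using comm_scaleC[OF T(1) Mb, of "of_real (1/K)"] by (simp only: T'_def scaleC_complex_of_real)
  moreover have "selfadj T'" unfolding T'_def by (rule sa_scaleR[OF T(2)])
  moreover have "norm (T' v) <= norm v" for v using K by (simp add: T'_def field_simps)
  ultimately have "(T' v, T' w) : x" by (rule contr)
  from lin_scaleC[OF lin this, of "of_real K"]
  show ?thesis unfolding scaleC_complex_of_real using K by (simp add: T'_def)
 qed
 note bS = comm_bcl[OF S]
 define H1 where "H1 = (%v. S v + adj S v)"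
 define H2 where "H2 = (%v. \<i> *\<^sub>C S v + (- \<i>) *\<^sub>C adj S v)"
 have H1: "H1 : M'" unfolding H1_def by (intro comm_add S M'_adj Mb)
 have H2: "H2 : M'" unfolding H2_def by (intro comm_add comm_scaleC S M'_adj Mb)
 have "selfadj H1" "selfadj H2"
  using comm_bcl[OF H1] comm_bcl[OF H2]
  by (simp_all add: selfadj_def adjoint_pair_def H1_def H2_def ci_algebra adj_cinner[OF bS] adj_cinner'[OF bS])
 hence "(H1 v, H1 w) : x" "(H2 v, H2 w) : x" using sa H1 H2 by auto
 hence "(H1 v + (- \<i>) *\<^sub>C H2 v, H1 w+(- \<i>) *\<^sub>C H2 w) : x" by (intro lin_add lin_scaleC lin)
 moreover have "H1 z+(- \<i>) *\<^sub>C H2 z = 2 *\<^sub>R S z" for z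
  by (simp add: H1_def H2_def scaleC_add_right scaleC_diff_right scaleC_scaleC scaleC_minus_left scaleR_2)
 ultimately have "(2 *\<^sub>R S v, 2 *\<^sub>R S w) : x" by simp
 from lin_scaleC[OF lin this, of "of_real (1/2)"] show ?thesis unfolding scaleC_complex_of_real by simp
qed

lemma affiliatedI:
 assumes "!!S v w. S : M' ==> (v, w) : x ==> (S v, S w) : x"
 shows "affiliated M x"
 unfolding affiliated_def
proof (intro ballI impI equalityI subrelI)
 fix u v w assume u: "u : M'" "unitary_op u"
 show "(v, w) : x" if "(v, w) : (%(v, w). (u v, u w)) ` x"
  using that assms[OF u(1)] by auto
 note b = comm_bcl[OF u(1)]
 have "adj u (u y) = y" for y
  by (rule ci_eqI2) (use u(2) in \<open>simp add: adj_cinner[OF b, symmetric] unitary_op_def\<close>)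
 moreover obtain v' w' where "v = u v'" "w = u w'" using u(2) unfolding unitary_op_def by (metis surj_def)
 ultimately have e: "u (adj u v) = v" "u (adj u w) = w" by simp_all
 assume "(v, w) : x"
 hence "(adj u v, adj u w) : x" by (rule assms[OF M'_adj[OF u(1)]])
 thus "(v, w) : (%(v, w). (u v, u w)) ` x" using e by force
qed

text \<open>The graph is invariant under each \<open>S\<close> in the commutant and under its
  adjoint, so S R u solves the weak resolvent equation of S u, which has only one solution.\<close>

lemma M_rsv:
 assumes x: "closed_dense_op x" "affiliated M x" shows "resolv x : M"
proof (rule M_I)
 show "bounded_clinear (resolv x)" by (rule rsv_bcl[OF x(1)])
 fix S u assume S: "S : M'"
 note bS = comm_bcl[OF S] and lin = cdo_linear[OF x(1)]
 show "resolv x (S u) = S (resolv x u)"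
 proof (rule rsv_unique(1)[OF x(1)])
  show "(S (resolv x u), S (rsv_op x u)) : x"
   by (rule aff_invariant[OF x(2) lin S rsv_graph[OF x(1)]])
  fix v' w' assume "(v', w') : x"
  hence "(adj S v', adj S w') : x" by (rule aff_invariant[OF x(2) lin M'_adj[OF S]])
  from rsv_cinner[OF x(1) this, of u]
  show "cinner (S u) v' = cinner (S (resolv x u)) v'+cinner (S (rsv_op x u)) w'"
   by (simp add: adj_cinner[OF bS])
 qed
qed

lemma M_spa:
 assumes x: "closed_dense_op x" "affiliated M x" shows "spa x s : M"
 unfolding spa_def
 by (intro M_cut M_diff M_scaleR M_ident M_rsv x cut_arg_sa)


subsection \<open>Projections and the trace\<close>

definition Pr :: "('h => 'h) => bool"
 where "Pr p \<longleftrightarrow> p : M & projection_op p"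

lemma PrD: assumes "Pr p" shows Pr_M: "p : M" and Pr_proj: "projection_op p" and Pr_bcl: "bounded_clinear p"
  and Pr_idem: "p (p x) = p x" and Pr_ci: "cinner (p x) y = cinner x (p y)"
 using assms projection_opD[of p] by (auto simp: Pr_def)

lemma Pr_ident: "Pr (%x. x)" and Pr_zero: "Pr (%x. 0)"
 by (auto simp: Pr_def M_ident M_zero pr_ident pr_zero)

lemma Pr_compl: "Pr p ==> Pr (%x. x-p x)"
 by (simp add: Pr_def M_diff M_ident pr_compl)

lemma pos_proj: "projection_op p ==> positive_op p"
 by (auto simp: pos_iff pr_sa inner_eq_Re_cinner pr_ci_self)

lemma Pr_pos: "Pr p ==> positive_op p"
 by (rule pos_proj[OF Pr_proj])

lemma tr_mono:
 assumes S: "S : M" "positive_op S" and T: "T : M" "positive_op T" and le: "!!x. inner (S x) x <= inner (T x) x"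
 shows "\<tau> S <= \<tau> T"
proof -
 have d: "(%x. T x-S x) : M" by (rule M_diff[OF T(1) S(1)])
 have p: "positive_op (%x. T x-S x)"
  unfolding pos_iff
  using le sa_diff[OF pos_sa[OF T(2)] pos_sa[OF S(2)]] by (simp add: inner_diff_left)
 have "\<tau> (%x. S x+(T x-S x)) = \<tau> S+\<tau> (%x. T x-S x)" by (rule add[OF S d p])
 thus ?thesis by simp
qed

lemma tr_zero: "\<tau> (%x. 0) = 0"
 using scale[OF M_ident, of 0] pos_proj[OF pr_ident] by simp

lemma Pr_sub_diff:
 assumes p: "Pr p" and q: "Pr q" and s: "!!x. q (p x) = p x" shows "Pr (%x. q x-p x)"
proof -
 have s': "p (q x) = p x" for x by (rule pr_sub_adj[OF Pr_proj[OF p] Pr_proj[OF q] s])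
 have b: "bounded_clinear (%x. q x-p x)" by (intro bcl_diff Pr_bcl p q)
 have "projection_op (%x. q x-p x)"
  unfolding projection_op_def[of "%x. q x-p x"] adjoint_pair_def using b
  by (simp add: fun_eq_iff bcl_simps[OF Pr_bcl[OF p]] bcl_simps[OF Pr_bcl[OF q]] s s' Pr_idem[OF p] Pr_idem[OF q]
    ci_algebra Pr_ci[OF p] Pr_ci[OF q])
 thus ?thesis unfolding Pr_def by (intro conjI M_diff Pr_M p q)
qed

lemma tr_sub_diff:
 assumes p: "Pr p" and q: "Pr q" and s: "!!x. q (p x) = p x"
 shows "\<tau> q = \<tau> p+\<tau> (%x. q x-p x)"
proof -
 note d = Pr_sub_diff[OF p q s]
 have "\<tau> (%x. p x+(q x-p x)) = \<tau> p+\<tau> (%x. q x-p x)"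
  by (intro add Pr_M[OF p] Pr_pos[OF p] Pr_M[OF d] Pr_pos[OF d])
 thus ?thesis by simp
qed

lemma tr_Pr_mono: "Pr p ==> Pr q ==> (!!x. q (p x) = p x) ==> \<tau> p <= \<tau> q"
 using tr_sub_diff[of p q] by simp

lemma tr_compl_eq_0: "Pr p ==> \<tau> p = 0 ==> p x = 0"
 using faithful[of p] Pr_M Pr_pos by metis

lemma Pr_kernel: assumes T: "T : M" shows "Pr (proj {x. T x = 0})"
 unfolding Pr_def
proof
 note K = csub_kernel[OF M_bcl[OF T]] closed_kernel[OF M_bcl[OF T]]
 show "projection_op (proj {x. T x = 0})" by (rule pr_proj[OF K])
 show "proj {x. T x = 0} : M"
 proof (rule M_proj[OF K])
  fix S v assume "S : M'" "v : {x. T x = 0}"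
  thus "S v : {x. T x = 0}"
   using M_com[OF T, of S v] bcl_zero_simp[OF comm_bcl, of S] by auto
 qed
qed

text \<open>Polar decomposition: the closure of \<open>|T| \<xi> \<mapsto> T \<xi>\<close> is a partial isometry from the support
 of \<open>T\<close> to the closure of its range.\<close>

lemma polar_dec:
 assumes T: "T : M"
 obtains u where "u : M" "!!x. norm (u x) = norm (x-proj {x. T x = 0} x)" "!!x. u x : closure (range T)"
proof -
 note bT = M_bcl[OF T]
 define A where "A = (%x. adj T (T x))"
 have Ain: "inner (A x) y = inner (T x) (T y)" for x y
  by (simp add: A_def inner_eq_Re_cinner adj_cinner'[OF bT])
 have AM: "A : M" unfolding A_def by (rule M_compose[OF M_adj[OF T] T])
 have "cinner (A x) y = cinner x (A y)" for x y by (simp add: A_def adj_cinner'[OF bT] adj_cinner[OF bT])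
 hence Ap: "positive_op A" using M_bcl[OF AM] by (simp add: pos_iff selfadj_def adjoint_pair_def Ain)
 define B where "B = sqop A"
 have BM: "B : M" unfolding B_def by (rule M_sqop[OF AM Ap])
 have Bp: "positive_op B" unfolding B_def by (rule sqop_pos[OF Ap])
 note bB = pos_bcl[OF Bp]
 have nB: "norm (B x) = norm (T x)" for x
 proof -
  have "inner (B x) (B x) = inner (B (B x)) x" using sa_in[OF pos_sa[OF Bp]] by metis
  also have "... = inner (T x) (T x)" unfolding B_def by (simp add: sqop_sq[OF Ap] Ain)
  finally show ?thesis by (simp add: norm_eq_sqrt_inner)
 qed
 have kern: "B x = 0 \<longleftrightarrow> T x = 0" for x using nB[of x] by (metis norm_eq_zero)
 define G where "G = closure (range (%x. (B x, T x)))"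
 have Gc: "closed G" by (simp add: G_def)
 have Gin: "(B y, T y) : G" for y unfolding G_def by (rule subsetD[OF closure_subset]) auto
 have "csub (range (%x. (B x, T x)))"
  unfolding csub_def
  by (auto simp: image_iff zero_prod_def)
   (metis bcl_zero_simp[OF bB] bcl_zero_simp[OF bT],
    metis bcl_add_simp[OF bB] bcl_add_simp[OF bT],
    metis bcl_scaleC_simp[OF bB] bcl_scaleC_simp[OF bT])
 hence Gs: "csub G" unfolding G_def by (rule csub_closure)
 have "closed {z::'h \<times> 'h. norm (fst z) = norm (snd z)}"
  by (intro closed_Collect_eq continuous_intros)
 hence "G \<subseteq> {z. norm (fst z) = norm (snd z)}" unfolding G_def by (intro closure_minimal) (auto simp: nB)
 hence Gn: "(a, b) : G ==> norm a = norm b" for a b by auto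
 have Gu: "b = c" if "(a, b) : G" "(a, c) : G" for a b c
  using Gn[of 0 "b-c"] csub_diff[OF Gs that] by simp
 define K where "K = closure (range B)"
 have K: "csub K" "closed K" unfolding K_def using csub_closure[OF csub_range[OF bB]] by auto
 have "\<exists>b. (a, b) : G" if aK: "a : K" for a
 proof -
  obtain f where f: "!!n. f n : range B" "f \<longlonglongrightarrow> a" using aK by (auto simp: K_def closure_sequential)
  from f(1) have "\<forall>n. \<exists>z. f n = B z" by blast
  then obtain g where g: "!!n. f n = B (g n)" by metis
  have "Cauchy (%n. T (g n))"
  proof -
   have "dist (T (g m)) (T (g n)) = dist (f m) (f n)" for m n
    using nB[of "g m-g n"] by (simp add: dist_norm g bcl_simps[OF bB] bcl_simps[OF bT])
   thus ?thesis using LIMSEQ_imp_Cauchy[OF f(2)] by (simp add: Cauchy_def)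
  qed
  then obtain b where b: "(%n. T (g n)) \<longlonglongrightarrow> b" by (auto simp: Cauchy_convergent_iff convergent_def)
  have "(f n, T (g n)) : G" for n by (simp add: g Gin)
  from closed_sequentially[OF Gc this tendsto_Pair[OF f(2) b]] show ?thesis by blast
 qed
 then obtain v where v: "!!a. a : K ==> (a, v a) : G" by metis
 define u where "u x = v (proj K x)" for x
 have uG: "(proj K x, u x) : G" for x unfolding u_def by (rule v[OF proj_in[OF K]])
 have un: "norm (u x) = norm (proj K x)" for x using Gn[OF uG] by simp
 note bp = bcl_simps[OF pr_bcl[OF pr_proj[OF K]]]
 have bu: "bounded_clinear u"
 proof (rule bdd_clinearI[of _ 1])
  show "u (x+y) = u x+u y" for x y
   using csub_add[OF Gs uG[of x] uG[of y]] uG[of "x+y"] by (intro Gu) (auto simp: bp)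
  show "u (c *\<^sub>C x) = c *\<^sub>C u x" for c x
   using csub_scaleC[OF Gs uG[of x], of c] uG[of "c *\<^sub>C x"] by (intro Gu) (auto simp: bp)
  show "norm (u x) <= 1*norm x" for x
   using pr_nle[OF pr_proj[OF K]] by (simp add: un)
 qed
 have Ginv: "(S a, S b) : G" if S: "S : M'" and "(a, b) : G" for S a b
 proof -
  let ?V = "(%z. (S (fst z), S (snd z))) -` G"
  note bS = comm_bcl[OF S]
  have cont: "continuous_on UNIV (%z. (S (fst z), S (snd z)))"
   by (intro continuous_on_Pair continuous_on_compose2[OF bcl_cont[OF bS, of UNIV]] continuous_intros) auto
  have "closed ?V" using continuous_closed_vimage[OF Gc] cont
   by (metis continuous_on_eq_continuous_at open_UNIV UNIV_I)
  moreover have "range (%x. (B x, T x)) \<subseteq> ?V"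
   using Gin by (auto simp: M_com[OF BM S] M_com[OF T S])
  ultimately have "G \<subseteq> ?V" unfolding G_def by (intro closure_minimal) auto
  thus ?thesis using that by auto
 qed
 have projK: "proj K x = x-proj {x. T x = 0} x" for x
 proof (rule proj_unique[OF K])
  note N = csub_kernel[OF bT] closed_kernel[OF bT]
  have Bsa: "cinner (B x) y = cinner x (B y)" for x y by (rule sa_cinner[OF pos_sa[OF Bp]])
  show "x-proj {x. T x = 0} x : K"
   unfolding K_def
  proof (rule in_closure_if_ortho[OF csub_range[OF bB]])
   fix y assume "!!z. z : range B ==> cinner y z = 0"
   hence "cinner (B y) z = 0" for z by (simp add: Bsa)
   hence "B y = 0" using ci_self_eq_0 by blast
   thus "cinner y (x-proj {x. T x = 0} x) = 0" by (intro proj_ortho'[OF N]) (simp add: kern)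
  qed
  fix y assume y: "y : K"
  have "proj {x. T x = 0} x : {x. T x = 0}" by (rule proj_in[OF N])
  hence "B (proj {x. T x = 0} x) = 0" by (simp add: kern)
  hence "cinner (proj {x. T x = 0} x) (B z) = 0" for z by (simp add: Bsa[symmetric])
  thus "cinner (x-(x-proj {x. T x = 0} x)) y = 0"
   using y by (intro ortho_of_closure[of y "range B"]) (auto simp: K_def)
 qed
 have "u : M"
 proof (rule M_I[OF bu])
  fix S x assume S: "S : M'"
  have "S (proj K x) = proj K (S x)"
   using M_com[OF Pr_M[OF Pr_kernel[OF T]] S] by (simp add: projK bcl_simps[OF comm_bcl[OF S]])
  thus "u (S x) = S (u x)" using Ginv[OF S uG[of x]] uG[of "S x"] by (intro Gu[of "proj K (S x)"]) auto
 qed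
 moreover have "u x : closure (range T)" for x
 proof -
  have "closed (snd -` closure (range T) :: ('h \<times> 'h) set)"
   by (intro continuous_closed_vimage) (auto intro: continuous_intros)
  hence "G \<subseteq> snd -` closure (range T)" unfolding G_def using subsetD[OF closure_subset, of _ "range T"] by (intro closure_minimal) auto
  thus ?thesis using uG[of x] by auto
 qed
 ultimately show ?thesis using un projK that by metis
qed

text \<open>For the polar part u of \<open>T\<close>, u* u is the support of \<open>T\<close> and u
  u* lies below \<open>q\<close>; the trace property equates the traces of the two products.\<close>

lemma tr_support:
 assumes T: "T : M" and q: "Pr q" and qT: "!!x. q (T x) = T x"
 shows "\<tau> (%x. x-proj {x. T x = 0} x) <= \<tau> q"
proof -
 let ?r = "%x. x-proj {x. T x = 0} x"
 have r: "Pr ?r" by (rule Pr_compl[OF Pr_kernel[OF T]])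
 obtain u where u: "u : M" "!!x. norm (u x) = norm (?r x)" "!!x. u x : closure (range T)"
  using polar_dec[OF T] by blast
 note bu = M_bcl[OF u(1)]
 have qu: "q (u x) = u x" for x
 proof -
  have "closure (range T) \<subseteq> range q"
   using qT pr_range[OF Pr_proj[OF q]] by (intro closure_minimal pr_closed Pr_proj q) auto
  thus ?thesis using u(3)[of x] pr_range[OF Pr_proj[OF q]] by blast
 qed
 have "(%x. adj u (u x)) = ?r"
 proof (rule quadratic_form_eqI)
  show "bounded_clinear (%x. adj u (u x))" by (rule bcl_compose[OF adj_bcl[OF bu] bu])
  show "bounded_clinear ?r" by (rule Pr_bcl[OF r])
  show "cinner (adj u (u x)) x = cinner (?r x) x" for x
   using pr_ci_self[OF Pr_proj[OF r], of x] by (simp add: adj_cinner'[OF bu] ci_self u(2))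
 qed
 hence "\<tau> ?r = \<tau> (adj u \<circ> u)" by (simp add: o_def)
 also have "... = \<tau> (u \<circ> adj u)" by (rule tracial[OF u(1) M_adj[OF u(1)] adj_pair[OF bu]])
 also have "... <= \<tau> q"
 proof (rule tr_mono)
  show M: "u \<circ> adj u : M" using M_compose[OF u(1) M_adj[OF u(1)]] by (simp add: o_def)
  have f: "inner ((u \<circ> adj u) x) x = (norm (adj u x))^2" for x
   by (simp add: inner_eq_Re_cinner adj_cinner[OF bu] ci_self)
  have "cinner ((u \<circ> adj u) x) y = cinner x ((u \<circ> adj u) y)" for x y
   by (simp add: adj_cinner[OF bu] adj_cinner'[OF bu, symmetric])
  thus "positive_op (u \<circ> adj u)" using M_bcl[OF M] f by (simp add: pos_iff selfadj_def adjoint_pair_def)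
  show "q : M" "positive_op q" by (simp_all add: Pr_M Pr_pos q)
  fix x
  have "adj u x = adj u (q x)"
   by (rule ci_eqI2) (metis adj_cinner[OF bu] Pr_ci[OF q] qu)
  moreover have "norm (adj u (q x)) <= 1*norm (q x)"
  proof (rule adj_nle[OF bu])
   show "norm (u y) <= 1*norm y" for y using pr_nle[OF Pr_proj[OF r], of y] by (simp add: u(2))
  qed
  ultimately have "(norm (adj u x))^2 <= (norm (q x))^2" by (intro power_mono) simp_all
  thus "inner ((u \<circ> adj u) x) x <= inner (q x) x"
   using pr_ci_self[OF Pr_proj[OF q], of x] unfolding f by (simp add: inner_eq_Re_cinner)
 qed
 finally show ?thesis .
qed

text \<open>A projection in place of a preimage: what holds on the range of \<open>q\<close> holds
  after \<open>T\<close> on the range of the pullback, and the cotrace does not grow because (1 - q)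
  T has its range below 1 - q.\<close>

definition pullback :: "('h => 'h) => ('h => 'h) => 'h => 'h"
 where "pullback T q = proj {x. T x-q (T x) = 0}"

lemma pullback:
 assumes T: "T : M" and q: "Pr q"
 shows Pr_pullback: "Pr (pullback T q)" and pullback_range: "pullback T q x = x \<longleftrightarrow> q (T x) = T x"
  and pullback_trace: "\<tau> (%x. x-pullback T q x) <= \<tau> (%x. x-q x)"
proof -
 let ?S = "%x. T x-q (T x)"
 have S: "?S : M" by (rule M_diff[OF T M_compose[OF Pr_M[OF q] T]])
 show "Pr (pullback T q)" unfolding pullback_def by (rule Pr_kernel[OF S])
 note K = csub_kernel[OF M_bcl[OF S]] closed_kernel[OF M_bcl[OF S]]
 show "pullback T q x = x \<longleftrightarrow> q (T x) = T x"
  unfolding pullback_def using proj_in[OF K, of x] proj_id[OF K, of x] by auto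
 show "\<tau> (%x. x-pullback T q x) <= \<tau> (%x. x-q x)"
  unfolding pullback_def
  by (rule tr_support[OF S Pr_compl[OF q]]) (simp add: bcl_simps[OF Pr_bcl[OF q]] Pr_idem[OF q])
qed

lemma csub_Int: "csub K ==> csub L ==> csub (K \<inter> L)"
 by (auto simp: csub_def)

definition meet :: "('h => 'h) => ('h => 'h) => 'h => 'h"
 where "meet e f = proj (range e \<inter> range f)"

lemma meet_sub: assumes e: "Pr e" and f: "Pr f"
 shows "csub (range e \<inter> range f)" "closed (range e \<inter> range f)"
 by (intro csub_Int pr_csub pr_closed Pr_proj e f closed_Int)+

lemma Pr_com_range: "Pr e ==> S : M' ==> x : range e ==> S x : range e"
 using M_com[OF Pr_M, of e S] by (metis image_iff rangeI)

lemma Pr_meet: assumes e: "Pr e" and f: "Pr f" shows "Pr (meet e f)"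
 unfolding Pr_def meet_def
 using Pr_com_range[OF e] Pr_com_range[OF f]
 by (auto intro!: pr_proj meet_sub e f M_proj)

lemma meet_range: assumes e: "Pr e" and f: "Pr f"
 shows "meet e f x = x \<longleftrightarrow> e x = x & f x = x"
 unfolding meet_def pr_range[OF Pr_proj[OF e], symmetric] pr_range[OF Pr_proj[OF f], symmetric]
  Int_iff[symmetric]
 using proj_in[OF meet_sub[OF e f], of x] proj_id[OF meet_sub[OF e f], of x] by metis

text \<open>\<open>e\<close> maps the range of \<open>pullback e f\<close> into the common range of
  \<open>e\<close> and \<open>f\<close>, so the difference on the left is orthogonal to the pullback
  and lies below its complement. This inequality takes the place of the parallelogram law for
  projections.\<close>

lemma meet_tr_diff: assumes e: "Pr e" and f: "Pr f"
 shows "\<tau> (%x. e x-meet e f x) <= \<tau> (%x. x-f x)"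
proof -
 let ?d = "%x. e x-meet e f x" and ?r = "%x. x-pullback e f x"
 have me: "e (meet e f x) = meet e f x" for x
  using meet_range[OF e f, of "meet e f x"] Pr_idem[OF Pr_meet[OF e f]] by simp
 have d: "Pr ?d" by (rule Pr_sub_diff[OF Pr_meet[OF e f] e me])
 have r: "Pr ?r" by (rule Pr_compl[OF Pr_pullback[OF Pr_M[OF e] f]])
 have "?r (?d x) = ?d x" for x
 proof -
  have "pullback e f (?d x) = 0"
  proof (rule ci_eqI)
   fix y
   let ?z = "pullback e f y"
   have "f (e ?z) = e ?z" using pullback_range[OF Pr_M[OF e] f, of ?z] Pr_idem[OF Pr_pullback[OF Pr_M[OF e] f]] by simp
   hence z: "meet e f (e ?z) = e ?z" using meet_range[OF e f] Pr_idem[OF e] by simp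
   have "cinner (pullback e f (?d x)) y = cinner (e x-meet e f x) ?z"
    by (rule Pr_ci[OF Pr_pullback[OF Pr_M[OF e] f]])
   also have "... = cinner x (e ?z)-cinner (meet e f x) (e ?z)"
    by (simp add: ci_diff_left Pr_ci[OF e]) (metis me Pr_ci[OF e])
   also have "cinner (meet e f x) (e ?z) = cinner x (e ?z)" using z Pr_ci[OF Pr_meet[OF e f]] by simp
   finally show "cinner (pullback e f (?d x)) y = cinner 0 y" by simp
  qed
  thus ?thesis by simp
 qed
 hence "\<tau> ?d <= \<tau> ?r" by (rule tr_Pr_mono[OF d r])
 also have "... <= \<tau> (%x. x-f x)" by (rule pullback_trace[OF Pr_M[OF e] f])
 finally show ?thesis .
qed

lemma meet_trace: assumes e: "Pr e" and f: "Pr f"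
 shows "\<tau> (%x. x-meet e f x) <= \<tau> (%x. x-e x)+\<tau> (%x. x-f x)"
proof -
 have me: "e (meet e f x) = meet e f x" for x
  using meet_range[OF e f, of "meet e f x"] Pr_idem[OF Pr_meet[OF e f]] by simp
 note d = Pr_sub_diff[OF Pr_meet[OF e f] e me] and c = Pr_compl[OF e]
 have "\<tau> (%x. (x-e x)+(e x-meet e f x)) = \<tau> (%x. x-e x)+\<tau> (%x. e x-meet e f x)"
  by (intro add Pr_M[OF c] Pr_pos[OF c] Pr_M[OF d] Pr_pos[OF d])
 thus ?thesis using meet_tr_diff[OF e f] by (simp add: add_left_mono)
qed

text \<open>With meet 0, \<open>meet_tr_diff\<close> compares traces. The optimality of spectral
  projections among all competitors is always obtained in this way.\<close>

lemma tr_disjoint: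
 assumes e: "Pr e" and p: "Pr p" and z: "!!x. e x = x ==> p x = x ==> x = 0"
 shows "\<tau> e <= \<tau> (%x. x-p x)"
proof -
 have "meet e p x = 0" for x
  using z meet_range[OF e p, of "meet e p x"] Pr_idem[OF Pr_meet[OF e p]] by simp
 thus ?thesis using meet_tr_diff[OF e p] by simp
qed

text \<open>Normality applies to the differences p 0 - p n, which increase to p 0; finiteness of the
  trace of p 0 turns this into continuity from above.\<close>

lemma tr_decseq:
 assumes p: "!!n::nat. Pr (p n)" and dec: "!!m n x. m <= n ==> p m (p n x) = p n x"
  and z: "!!x. (%n. p n x) \<longlonglongrightarrow> 0" and fin: "\<tau> (p 0) < \<infinity>" and e: "eps > 0"
 shows "\<exists>n. \<tau> (p n) < eps"
proof -
 define D where "D = range (%n x. p 0 x-p n x)"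
 have P: "Pr (%x. p 0 x-p n x)" for n by (rule Pr_sub_diff[OF p p dec]) simp
 have dec': "p n (p m x) = p n x" if "m <= n" for m n x
  by (rule pr_sub_adj[OF Pr_proj[OF p] Pr_proj[OF p] dec[OF that]])
 have le: "inner (p n x) x <= inner (p m x) x" if "m <= n" for m n x
 proof -
  have "inner (p m x-p n x) x >= 0"
   by (rule pos_in[OF Pr_pos[OF Pr_sub_diff[OF p p dec[OF that]]]])
  thus ?thesis by (simp add: inner_diff_left)
 qed
 have sa: "selfadj (p n)" for n by (rule pos_sa[OF Pr_pos[OF p]])
 have "\<tau> (p 0) = (SUP S\<in>D. \<tau> S)"
 proof (rule normal)
  show "D \<subseteq> {S : M. positive_op S}" using P by (auto simp: D_def Pr_M Pr_pos)
  show "D ~= {}" by (simp add: D_def)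
  show "p 0 : M" "positive_op (p 0)" by (simp_all add: Pr_M Pr_pos p)
  show "op_le S (p 0)" if "S : D" for S
  proof -
   obtain n where n: "S = (%x. p 0 x-p n x)" using \<open>S : D\<close> by (auto simp: D_def)
   show ?thesis unfolding n op_le_iff
    using pos_in[OF Pr_pos[OF p[of n]]] sa[of n] by (simp add: inner_diff_left)
  qed
  show "\<exists>R\<in>D. op_le S R & op_le T R" if ST: "S : D" "T : D" for S T
  proof -
   obtain m n where mn: "S = (%x. p 0 x-p m x)" "T = (%x. p 0 x-p n x)" using ST by (auto simp: D_def)
   have "op_le (%x. p 0 x-p i x) (%x. p 0 x-p j x)" if "i <= j" for i j
    unfolding op_le_iff
    using sa_diff[OF sa_diff[OF sa[of 0] sa[of j]] sa_diff[OF sa[of 0] sa[of i]]] le[OF that]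
    by (simp add: inner_diff_left)
   from this[of m "max m n"] this[of n "max m n"] show ?thesis
    unfolding mn by (intro bexI[of _ "%x. p 0 x-p (max m n) x"]) (auto simp: D_def)
  qed
  fix B assume B: "B : M" "positive_op B" "!!S. S : D ==> op_le S B"
  have "inner (p 0 x) x <= inner (B x) x" for x
  proof (rule LIMSEQ_le_const2)
   have "(%n. inner (p 0 x-p n x) x) \<longlonglongrightarrow> inner (p 0 x-0) x" by (intro tendsto_intros z)
   thus "(%n. inner (p 0 x-p n x) x) \<longlonglongrightarrow> inner (p 0 x) x" by simp
   have "op_le (%x. p 0 x-p n x) B" for n by (rule B(3)) (simp add: D_def)
   hence "inner (p 0 x-p n x) x <= inner (B x) x" for n by (simp add: op_le_iff)
   thus "\<exists>N. \<forall>n\<ge>N. inner (p 0 x-p n x) x <= inner (B x) x" by blast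
  qed
  thus "op_le (p 0) B" by (simp add: op_le_iff sa_diff sa pos_sa B)
 qed
 hence sup: "\<tau> (p 0) = (SUP n. \<tau> (%x. p 0 x-p n x))" by (simp add: D_def image_image)
 have split: "\<tau> (p 0) = \<tau> (p n)+\<tau> (%x. p 0 x-p n x)" for n by (rule tr_sub_diff[OF p p dec]) simp
 show ?thesis
 proof (rule ccontr)
  assume "\<nexists>n. \<tau> (p n) < eps"
  hence ge: "eps <= \<tau> (p n)" for n by (simp add: not_less)
  have "\<tau> (%x. p 0 x-p n x)+eps <= \<tau> (p 0)" for n using split[of n] ge[of n] by (simp add: add.commute add_left_mono)
  hence "(SUP n. \<tau> (%x. p 0 x-p n x)+eps) <= \<tau> (p 0)" by (intro SUP_least)
  hence "\<tau> (p 0)+eps <= \<tau> (p 0)" by (subst (1) sup) (simp add: ennreal_SUP_add_left)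
  moreover have "\<tau> (p 0)+0 < \<tau> (p 0)+eps" using fin e by (subst ennreal_add_left_cancel_less) auto
  ultimately show False by simp
 qed
qed

end

section \<open>Singular values\<close>

context vn_trace
begin

text \<open>\<open>dle z t s\<close> means that \<open>\<mu>\<^sub>t(z) \<le> s\<close>: \<open>z\<close> is bounded by \<open>s\<close> on the range of a projection of
 cotrace at most \<open>t\<close>. It makes sense for operators which are not closed.\<close>

definition bd :: "'h unbdd_op => ('h => 'h) => real => bool"
 where "bd z p s \<longleftrightarrow> (\<forall>v. p v = v --> (\<exists>w. (v, w) : z & norm w <= s*norm v))"

definition dle :: "'h unbdd_op => real => real => bool"
 where "dle z t s \<longleftrightarrow> (\<exists>p. Pr p & \<tau> (%x. x-p x) <= ennreal t & bd z p s)"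

definition aff :: "'h unbdd_op => bool"
 where "aff x \<longleftrightarrow> closed_dense_op x & affiliated M x"

lemma affD: "aff x ==> closed_dense_op x" "aff x ==> affiliated M x"
 and aff_linear: "aff x ==> linear_op x"
 by (auto simp: aff_def cdo_linear)

lemma dle_mono: assumes "dle z t s" "t <= t'" "s <= s'" shows "dle z t' s'"
proof -
 obtain p where p: "Pr p" "\<tau> (%x. x-p x) <= ennreal t" "bd z p s" using assms by (auto simp: dle_def)
 have "\<tau> (%x. x-p x) <= ennreal t'" using p(2) ennreal_leI[OF assms(2)] by (rule order_trans)
 moreover have "bd z p s'"
  unfolding bd_def
 proof (intro allI impI)
  fix v assume "p v = v"
  then obtain w where "(v, w) : z" "norm w <= s*norm v" using p(3) by (auto simp: bd_def)
  moreover have "s*norm v <= s'*norm v" using assms(3) by (intro mult_right_mono) auto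
  ultimately show "\<exists>w. (v, w) : z & norm w <= s'*norm v" by (meson order_trans)
 qed
 ultimately show ?thesis using p(1) by (auto simp: dle_def)
qed

lemma dle_subset: "dle z t s ==> z \<subseteq> z' ==> dle z' t s"
 unfolding dle_def bd_def by (meson subsetD)

lemma Pr_spa: "aff x ==> Pr (spa x s)"
 by (simp add: Pr_def aff_def M_spa pr_spa)

lemma bd_spa: assumes x: "aff x" and s: "0 <= s" shows "bd x (%v. v - spa x s v) s"
 unfolding bd_def using spa_below[OF affD(1)[OF x] s] by simp


text \<open>By \<open>spa_above\<close> the range of \<open>spa x s\<close> meets the range of any
  projection that bounds \<open>x\<close> by s only in 0, so the spectral projection has the least
  trace.\<close>

lemma dle_iff:
 assumes x: "aff x" and s: "0 <= s"
 shows "dle x t s \<longleftrightarrow> \<tau> (spa x s) <= ennreal t"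
proof
 note e = Pr_spa[OF x, of s]
 assume "\<tau> (spa x s) <= ennreal t"
 thus "dle x t s" unfolding dle_def
  using bd_spa[OF x s] Pr_compl[OF e] by (intro exI[of _ "%v. v - spa x s v"]) simp
next
 note e = Pr_spa[OF x, of s]
 assume "dle x t s"
 then obtain p where p: "Pr p" "\<tau> (%x. x-p x) <= ennreal t" "bd x p s" by (auto simp: dle_def)
 have "\<tau> (spa x s) <= \<tau> (%x. x-p x)"
 proof (rule tr_disjoint[OF e p(1)])
  fix v assume z: "spa x s v = v" "p v = v"
  obtain w where h: "(v, w) : x" "norm w <= s*norm v" using p(3) z(2) by (auto simp: bd_def)
  thus "v = 0" using spa_above[OF affD(1)[OF x] s z(1) _ h(1)] by fastforce
 qed
 thus "\<tau> (spa x s) <= ennreal t" using p(2) by (rule order_trans)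
qed

definition mu :: "'h unbdd_op => real => ennreal"
 where "mu z t = Inf {ennreal s | s. 0 <= s & dle z t s}"

lemma sing_val_eq_mu: assumes x: "aff x" shows "sing_val \<tau> x t = mu x t"
 unfolding sing_val_def mu_def
 using spec_proj_op_abs[OF affD(1)[OF x]] dle_iff[OF x] by (intro arg_cong[where f=Inf]) auto

lemma mu_le: "0 <= s ==> dle z t s ==> mu z t <= ennreal s"
 unfolding mu_def by (intro Inf_lower) auto

lemma mu_less: assumes "mu z t < ennreal s" shows "\<exists>s'. 0 <= s' & s' < s & dle z t s'"
proof -
 obtain s' where "0 <= s'" "dle z t s'" "ennreal s' < ennreal s"
  using assms unfolding mu_def Inf_less_iff by auto
 moreover from this have "s' < s" by (simp add: ennreal_less_iff)
 ultimately show ?thesis by blast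
qed


text \<open>The last hypothesis asks only for values of \<open>z\<close> controlled in norm by those
  of \<open>x\<close> and \<open>y\<close>. Hence algebraic sums and differences, their closures and
  graphs of bounded operators are all covered.\<close>

lemma dle_add:
 assumes x: "dle x t s" and y: "dle y t' s'" and nn: "0 <= t" "0 <= t'"
  and z: "!!v w w'. (v, w) : x ==> (v, w') : y ==> \<exists>u. (v, u) : z & norm u <= norm w+norm w'"
 shows "dle z (t+t') (s+s')"
proof -
 obtain p where p: "Pr p" "\<tau> (%x. x-p x) <= ennreal t" "bd x p s" using x by (auto simp: dle_def)
 obtain q where q: "Pr q" "\<tau> (%x. x-q x) <= ennreal t'" "bd y q s'" using y by (auto simp: dle_def)
 have "\<tau> (%x. x-meet p q x) <= ennreal (t+t')"
  using meet_trace[OF p(1) q(1)] add_mono[OF p(2) q(2)] nn by (simp add: ennreal_plus[symmetric] del: ennreal_plus)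
 moreover have "bd z (meet p q) (s+s')"
  unfolding bd_def
 proof (intro allI impI)
  fix v assume "meet p q v = v"
  hence pq: "p v = v" "q v = v" using meet_range[OF p(1) q(1)] by auto
  obtain w where e: "(v, w) : x" "norm w <= s*norm v" using p(3) pq by (auto simp: bd_def)
  obtain w' where e': "(v, w') : y" "norm w' <= s'*norm v" using q(3) pq by (auto simp: bd_def)
  obtain u where "(v, u) : z" "norm u <= norm w+norm w'" using z[OF e(1) e'(1)] by blast
  thus "\<exists>u. (v, u) : z & norm u <= (s+s')*norm v"
   using e(2) e'(2) by (intro exI[of _ u]) (auto simp: algebra_simps)
 qed
 ultimately show ?thesis using Pr_meet[OF p(1) q(1)] by (auto simp: dle_def)
qed

lemma graph_of_iff [simp]: "(v, w) : graph_of T \<longleftrightarrow> w = T v"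
 by (auto simp: graph_of_def)

lemma bd_graph_of: "bd (graph_of T) p s \<longleftrightarrow> (\<forall>v. p v = v --> norm (T v) <= s*norm v)"
 by (auto simp: bd_def)

abbreviation dB :: "('h => 'h) => real => real => bool"
 where "dB T \<equiv> dle (graph_of T)"

lemma dB_add: "dB T t s ==> dB T' t' s' ==> 0 <= t ==> 0 <= t' ==> dB (%x. T x+T' x) (t+t') (s+s')"
 by (rule dle_add) (auto intro: norm_triangle_ineq)

lemma dB_diff: "dB T t s ==> dB T' t' s' ==> 0 <= t ==> 0 <= t' ==> dB (%x. T x-T' x) (t+t') (s+s')"
 by (rule dle_add) (auto intro: norm_triangle_ineq4)

text \<open>The bound for \<open>T'\<close> holds on the range of \<open>q\<close>, and
  \<open>T\<close> maps the range of the pullback there.\<close>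

lemma dB_mult:
 assumes x: "dB T t s" and y: "dB T' t' s'" and nn: "0 <= t" "0 <= t'" "0 <= s'" and T: "T : M"
 shows "dB (%x. T' (T x)) (t+t') (s' * s)"
proof -
 obtain p where p: "Pr p" "\<tau> (%x. x-p x) <= ennreal t" "!!v. p v = v ==> norm (T v) <= s*norm v"
  using x by (auto simp: dle_def bd_graph_of)
 obtain q where q: "Pr q" "\<tau> (%x. x-q x) <= ennreal t'" "!!v. q v = v ==> norm (T' v) <= s'*norm v"
  using y by (auto simp: dle_def bd_graph_of)
 let ?r = "meet p (pullback T q)"
 note P = Pr_pullback[OF T q(1)]
 have "\<tau> (%x. x-?r x) <= ennreal t+ennreal t'"
  by (rule order_trans[OF meet_trace[OF p(1) P]])
   (intro add_mono p(2) order_trans[OF pullback_trace[OF T q(1)] q(2)])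
 moreover have "norm (T' (T v)) <= (s' * s)*norm v" if "?r v = v" for v
 proof -
  have "p v = v" "q (T v) = T v" using that meet_range[OF p(1) P] pullback_range[OF T q(1)] by auto
  hence "norm (T' (T v)) <= s'*norm (T v)" "norm (T v) <= s*norm v" using p q by auto
  thus ?thesis using nn(3) mult_left_mono[of "norm (T v)" "s*norm v" s'] by (simp add: mult.assoc)
 qed
 ultimately show ?thesis using Pr_meet[OF p(1) P] nn unfolding dle_def bd_graph_of
  by (intro exI[of _ ?r]) (simp add: ennreal_plus)
qed

text \<open>If T* v lies in the range of \<open>p\<close>, then |T* v|^2 = <T T* v, v> \<le> s |T*
  v| |v|; such v form the range of a pullback.\<close>

lemma dB_adj:
 assumes T: "T : M" and d: "dB T t s" and s: "0 <= s"
 shows "dB (adj T) t s"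
proof -
 obtain p where p: "Pr p" "\<tau> (%x. x-p x) <= ennreal t" "!!v. p v = v ==> norm (T v) <= s*norm v"
  using d by (auto simp: dle_def bd_graph_of)
 note A = M_adj[OF T] and b = M_bcl[OF T]
 have "norm (adj T v) <= s*norm v" if "pullback (adj T) p v = v" for v
 proof (cases "adj T v = 0")
  case False
  have "p (adj T v) = adj T v" using that pullback_range[OF A p(1)] by simp
  hence n: "norm (T (adj T v)) <= s*norm (adj T v)" by (rule p(3))
  have "(norm (adj T v))^2 = cmod (cinner (T (adj T v)) v)" by (simp add: adj_cinner[OF b] ci_self norm_power)
  also have "... <= norm (T (adj T v))*norm v" by (rule ci_bound)
  also have "... <= (s*norm (adj T v))*norm v" by (intro mult_right_mono n) simp
  finally have "norm (adj T v)*norm (adj T v) <= norm (adj T v)*(s*norm v)" by (simp add: power2_eq_square mult_ac)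
  thus ?thesis using False by (simp add: mult_le_cancel_left)
 qed (use s in simp)
 thus ?thesis unfolding dle_def bd_graph_of
  using Pr_pullback[OF A p(1)] order_trans[OF pullback_trace[OF A p(1)] p(2)] by blast
qed

lemma dB_nle:
 assumes d: "dB T t s" and n: "!!x. norm (S x) <= norm (T x)" shows "dB S t s"
 using d n unfolding dle_def bd_graph_of by (meson order_trans)

lemma dB_bdd: "0 <= t ==> (!!x. norm (T x) <= K*norm x) ==> dB T t K"
 unfolding dle_def bd_graph_of using Pr_ident by (intro exI[of _ "%x. x"]) (simp add: tr_zero)

lemma dB_cutoff: assumes g: "Pr g" and t: "\<tau> g <= ennreal t" and T: "!!x. T (x-g x) = 0" shows "dB T t 0"
 unfolding dle_def bd_graph_of
proof (intro exI conjI)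
 show "Pr (%x. x-g x)" by (rule Pr_compl[OF g])
 show "\<tau> (%x. x-(x-g x)) <= ennreal t" using t by simp
 show "\<forall>v. v - g v = v --> norm (T v) <= 0*norm v" using T by (metis mult_zero_left norm_zero order_refl)
qed

definition cutp :: "('h => 'h) => real => 'h => 'h"
 where "cutp b ka = cut (%x. b x-ka *\<^sub>R x)"

context
 fixes b :: "'h => 'h"
 assumes bM: "b : M" and bp: "positive_op b"
begin

lemma cutp_arg: "selfadj (%x. b x-ka *\<^sub>R x)"
 by (rule sa_diff[OF pos_sa[OF bp] sa_smult_ident])

lemma Pr_cutp: "Pr (cutp b ka)"
 unfolding Pr_def cutp_def
 using M_cut[OF M_diff[OF bM M_scaleR[OF M_ident]] cutp_arg] pr_cut[OF cutp_arg] by blast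

lemma cutp_com: "b (cutp b ka x) = cutp b ka (b x)"
 unfolding cutp_def
 by (rule cut_com[OF cutp_arg M_bcl[OF bM]]) (simp add: bcl_simps[OF M_bcl[OF bM]])

lemma cutp_above: "cutp b ka x = x ==> x ~= 0 ==> ka*(norm x)^2 < inner (b x) x"
 using cut_pos[OF cutp_arg, of ka x] by (simp add: cutp_def inner_diff_left power2_norm_eq_inner)

lemma cutp_below: "cutp b ka x = 0 ==> inner (b x) x <= ka*(norm x)^2"
 using cut_neg[OF cutp_arg, of ka x] by (simp add: cutp_def inner_diff_left power2_norm_eq_inner)

text \<open>The cut yields a form bound only. Since it commutes with \<open>b\<close>, the
  compression \<open>T\<close> is self-adjoint and obeys the form bound on all vectors, and
  \<open>pos_norm_bound\<close> applies.\<close>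

lemma cutp_norm_below:
 assumes l: "0 <= ka" and x: "cutp b ka x = 0" shows "norm (b x) <= ka*norm x"
proof -
 let ?e = "cutp b ka"
 define T where "T = (%x. b (x-?e x))"
 note pf = Pr_proj[OF Pr_compl[OF Pr_cutp[of ka]]]
 note bb = bcl_simps[OF M_bcl[OF bM]] and be = bcl_simps[OF Pr_bcl[OF Pr_cutp[of ka]]]
 have ee: "?e (?e y) = ?e y" for y by (rule Pr_idem[OF Pr_cutp])
 have Tc: "T y = (b y)-?e (b y)" for y by (simp add: T_def bb cutp_com)
 have sb: "cinner (b y) z = cinner y (b z)" for y z by (rule sa_cinner[OF pos_sa[OF bp]])
 have TM: "T : M" unfolding T_def by (rule M_compose[OF bM Pr_M[OF Pr_compl[OF Pr_cutp]]])
 have "cinner (T y) z = cinner y (T z)" for y z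
 proof -
  have "cinner (T y) z = cinner (y-?e y) (b z)" by (simp add: T_def sb)
  also have "... = cinner y (b z-?e (b z))" by (simp add: ci_algebra Pr_ci[OF Pr_cutp])
  finally show ?thesis by (simp add: Tc)
 qed
 hence Tsa: "selfadj T" using M_bcl[OF TM] by (simp add: selfadj_def adjoint_pair_def)
 have form: "inner (T y) y = inner (b (y-?e y)) (y-?e y)" for y
 proof -
  have "?e (y-?e y) = 0" by (simp add: be ee)
  hence "inner (b (y-?e y)) (?e y) = 0"
   using cutp_com[of ka "y-?e y"] Pr_ci[OF Pr_cutp, of ka "b (y-?e y)" y]
   by (simp add: inner_eq_Re_cinner bb)
  thus ?thesis by (simp add: T_def inner_diff_right)
 qed
 have f0: "0 <= inner (T y) y" for y using pos_in[OF bp] by (simp add: form)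
 have f1: "inner (T y) y <= ka*(norm y)^2" for y
 proof -
  have "inner (T y) y <= ka*(norm (y-?e y))^2" unfolding form by (rule cutp_below) (simp add: be ee)
  also have "... <= ka*(norm y)^2" using pr_nle[OF pf, of y] l by (intro mult_left_mono power_mono) auto
  finally show ?thesis .
 qed
 show ?thesis using pos_norm_bound(2)[OF Tsa f0 f1, of x] x by (simp add: T_def)
qed

lemma dB_iff_cutp: assumes l: "0 <= ka" shows "dB b t ka \<longleftrightarrow> \<tau> (cutp b ka) <= ennreal t"
proof
 assume "\<tau> (cutp b ka) <= ennreal t"
 thus "dB b t ka" unfolding dle_def bd_graph_of
  using Pr_compl[OF Pr_cutp[of ka]] cutp_norm_below[OF l]
  by (intro exI[of _ "%x. x-cutp b ka x"]) auto
next
 assume "dB b t ka"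
 then obtain p where p: "Pr p" "\<tau> (%x. x-p x) <= ennreal t" "!!v. p v = v ==> norm (b v) <= ka*norm v"
  by (auto simp: dle_def bd_graph_of)
 have "\<tau> (cutp b ka) <= \<tau> (%x. x-p x)"
 proof (rule tr_disjoint[OF Pr_cutp p(1)])
  fix v assume z: "cutp b ka v = v" "p v = v"
  show "v = 0"
  proof (rule ccontr)
   assume "v ~= 0"
   hence "ka*(norm v)^2 < inner (b v) v" by (rule cutp_above[OF z(1)])
   also have "... <= norm (b v)*norm v" by (rule norm_cauchy_schwarz)
   also have "... <= (ka*norm v)*norm v" by (intro mult_right_mono p(3) z) simp
   finally show False by (simp add: power2_eq_square)
  qed
 qed
 thus "\<tau> (cutp b ka) <= ennreal t" using p(2) by (rule order_trans)
qed

end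

text \<open>A norm bound for \<open>T\<close> on the range of \<open>p\<close> bounds only the form
  of T* T there. The passage to norms goes through the spectral projection of T* T above s^2, whose
  range meets that of \<open>p\<close> in 0.\<close>

lemma dB_square:
 assumes T: "T : M" and s: "0 <= s"
 shows "dB (%x. adj T (T x)) t (s^2) \<longleftrightarrow> dB T t s"
proof
 note bT = M_bcl[OF T]
 let ?A = "%x. adj T (T x)"
 have in_A: "inner (?A x) y = inner (T x) (T y)" for x y
  by (simp add: inner_eq_Re_cinner adj_cinner'[OF bT])
 have AM: "?A : M" by (rule M_compose[OF M_adj[OF T] T])
 have "cinner (?A x) y = cinner x (?A y)" for x y by (simp add: adj_cinner'[OF bT] adj_cinner[OF bT])
 hence Ap: "positive_op ?A" using M_bcl[OF AM] in_A by (simp add: pos_iff selfadj_def adjoint_pair_def)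
 show "dB T t s" if "dB ?A t (s^2)"
 proof -
  have "norm (T v) <= s*norm v" if "norm (?A v) <= s^2*norm v" for v
  proof -
   have "(norm (T v))^2 = inner (?A v) v" by (simp add: in_A power2_norm_eq_inner)
   also have "... <= norm (?A v)*norm v" by (rule norm_cauchy_schwarz)
   also have "... <= (s^2*norm v)*norm v" using that by (intro mult_right_mono) auto
   finally have "(norm (T v))^2 <= (s*norm v)^2" by (simp add: power2_eq_square mult_ac)
   thus ?thesis using s by (simp add: power2_le_iff_abs_le)
  qed
  thus ?thesis using that unfolding dle_def bd_graph_of by meson
 qed
 assume "dB T t s"
 then obtain p where p: "Pr p" "\<tau> (%x. x-p x) <= ennreal t" "!!v. p v = v ==> norm (T v) <= s*norm v"
  by (auto simp: dle_def bd_graph_of)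
 have "\<tau> (cutp ?A (s^2)) <= \<tau> (%x. x-p x)"
 proof (rule tr_disjoint[OF Pr_cutp[OF AM Ap] p(1)])
  fix v assume z: "cutp ?A (s^2) v = v" "p v = v"
  show "v = 0"
  proof (rule ccontr)
   assume "v ~= 0"
   hence "s^2*(norm v)^2 < (norm (T v))^2"
    using cutp_above[OF AM Ap z(1)] by (simp add: in_A power2_norm_eq_inner)
   moreover have "(norm (T v))^2 <= (s*norm v)^2" by (intro power_mono p(3) z) simp
   ultimately show False by (simp add: power_mult_distrib)
  qed
 qed
 hence "\<tau> (cutp ?A (s^2)) <= ennreal t" using p(2) by (rule order_trans)
 thus "dB ?A t (s^2)" using dB_iff_cutp[OF AM Ap] by simp
qed


section \<open>Measurable operators\<close>

lemma mops_aff: "x : measurable_ops M \<tau> ==> aff x"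
 by (simp add: measurable_ops_def aff_def)

lemma spa_top: assumes x: "aff x" shows "(%n. spa x (real n) v) \<longlonglongrightarrow> 0"
 using ea_top[OF op_abs_psa[OF affD(1)[OF x]]]
 by (simp add: spa_def rsv_op_abs[OF affD(1)[OF x]])

lemma spa_tr_small:
 assumes x: "aff x" and s0: "0 <= s0" and fin: "\<tau> (spa x s0) < \<infinity>" and e: "0 < eps"
 shows "\<exists>s\<ge>s0. \<tau> (spa x s) < eps"
proof -
 obtain k where k: "s0 <= real k" using real_arch_simple by blast
 note mono = spa_mono[OF affD(1)[OF x]]
 let ?p = "%n. spa x (real (n+k))"
 have "\<exists>n. \<tau> (?p n) < eps"
 proof (rule tr_decseq[OF _ _ _ _ e])
  show "Pr (?p n)" for n by (rule Pr_spa[OF x])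
  show "?p m (?p n y) = ?p n y" if "m <= n" for m n y using that by (intro mono) auto
  show "(%n. ?p n y) \<longlonglongrightarrow> 0" for y using LIMSEQ_ignore_initial_segment[OF spa_top[OF x]] by simp
  have "\<tau> (?p 0) <= \<tau> (spa x s0)" using k s0 by (intro tr_Pr_mono Pr_spa x mono) auto
  thus "\<tau> (?p 0) < \<infinity>" using fin by (rule le_less_trans)
 qed
 then obtain n where "\<tau> (?p n) < eps" by blast
 thus ?thesis using k by (intro exI[of _ "real (n+k)"]) auto
qed

lemma mops_iff:
 "x : measurable_ops M \<tau> \<longleftrightarrow> aff x & (\<exists>s\<ge>0. \<tau> (spa x s) < \<infinity>)"
proof -
 have "(\<exists>s\<ge>0. \<tau> (spectral_proj (op_abs x) {s<..}) < \<infinity>) \<longleftrightarrow> (\<exists>s\<ge>0. \<tau> (spa x s) < \<infinity>)"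
  if "closed_dense_op x" using spec_proj_op_abs[OF that] by (simp cong: conj_cong)
 thus ?thesis unfolding measurable_ops_def aff_def by blast
qed

text \<open>Measurability for graphs that need not be closed. For measurable operators, finite trace
  of one spectral projection improves to arbitrarily small trace by normality
  (\<open>spa_tr_small\<close>).\<close>

definition tmeas :: "'h unbdd_op => bool"
 where "tmeas z \<longleftrightarrow> (\<forall>t>0. \<exists>s\<ge>0. dle z t s)"

lemma mops_tmeas: assumes x: "x : measurable_ops M \<tau>" shows "tmeas x"
 unfolding tmeas_def
proof (intro allI impI)
 fix t :: real assume t: "t > 0"
 have a: "aff x" by (rule mops_aff[OF x])
 obtain s0 where "0 <= s0" "\<tau> (spa x s0) < \<infinity>" using x mops_iff by blast
 then obtain s where "s >= s0" "\<tau> (spa x s) < ennreal t"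
  using spa_tr_small[OF a, of s0 "ennreal t"] t by auto
 thus "\<exists>s\<ge>0. dle x t s" using \<open>0 <= s0\<close> dle_iff[OF a] by (intro exI[of _ s]) auto
qed

text \<open>The usual notion of \<tau>-density. Unlike norm density it is stable under intersections
  and under preimages by elements of \<open>M\<close>.\<close>

definition tdense :: "'h set => bool"
 where "tdense D \<longleftrightarrow> (\<forall>t>0. \<exists>q. Pr q & \<tau> (%x. x-q x) <= ennreal t & range q \<subseteq> D)"

lemma tmeas_tdense: "tmeas z ==> tdense (Domain z)"
 unfolding tmeas_def tdense_def dle_def bd_def by (meson DomainI Pr_proj pr_range subsetI)

lemma tdense_Int: assumes "tdense D" "tdense D'" shows "tdense (D \<inter> D')"
 unfolding tdense_def
proof (intro allI impI)
 fix t :: real assume "t > 0"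
 hence t: "t/2 > 0" by simp
 obtain p where p: "Pr p" "\<tau> (%x. x-p x) <= ennreal (t/2)" "range p \<subseteq> D"
  using assms(1)[unfolded tdense_def, rule_format, OF t] by blast
 obtain q where q: "Pr q" "\<tau> (%x. x-q x) <= ennreal (t/2)" "range q \<subseteq> D'"
  using assms(2)[unfolded tdense_def, rule_format, OF t] by blast
 have "\<tau> (%x. x-meet p q x) <= ennreal (t/2)+ennreal (t/2)"
  by (rule order_trans[OF meet_trace[OF p(1) q(1)] add_mono[OF p(2) q(2)]])
 also have "... = ennreal t" using t by (subst ennreal_plus[symmetric]) auto
 finally have "\<tau> (%x. x-meet p q x) <= ennreal t" .
 moreover have "range (meet p q) \<subseteq> D \<inter> D'"
  unfolding meet_def using range_proj[OF meet_sub[OF p(1) q(1)]] p(3) q(3) by auto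
 ultimately show "\<exists>q. Pr q & \<tau> (%x. x-q x) <= ennreal t & range q \<subseteq> D \<inter> D'"
  using Pr_meet[OF p(1) q(1)] by blast
qed

lemma tdense_vimage: assumes T: "T : M" and D: "tdense D" shows "tdense (T -` D)"
 unfolding tdense_def
proof (intro allI impI)
 fix t :: real assume "t > 0"
 then obtain q where q: "Pr q" "\<tau> (%x. x-q x) <= ennreal t" "range q \<subseteq> D" using D by (auto simp: tdense_def)
 have "x : T -` D" if "x : range (pullback T q)" for x
 proof -
  have "q (T x) = T x"
   using that pr_range[OF Pr_proj[OF Pr_pullback[OF T q(1)]]] pullback_range[OF T q(1)] by blast
  thus ?thesis using q(3) by (metis rangeI subsetD vimageI)
 qed
 thus "\<exists>q. Pr q & \<tau> (%x. x-q x) <= ennreal t & range q \<subseteq> T -` D"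
  using Pr_pullback[OF T q(1)] order_trans[OF pullback_trace[OF T q(1)] q(2)] by blast
qed

text \<open>The projection onto \<open>K\<close> lies in \<open>M\<close> and is disjoint from
  projections of arbitrarily small cotrace, so its trace is 0 and faithfulness applies. Both
  closability and density of domains come from here.\<close>

lemma tdense_zero:
 assumes D: "tdense D" and K: "csub K" "closed K" and inv: "!!S v. S : M' ==> v : K ==> S v : K"
  and z: "!!v. v : K ==> v : D ==> v = 0"
 shows "K = {0}"
proof -
 have "proj K : M" by (rule M_proj[OF K]) (rule inv)
 hence p: "Pr (proj K)" using pr_proj[OF K] by (simp add: Pr_def)
 have le: "\<tau> (proj K) <= ennreal t" if t: "t > 0" for t
 proof -
  obtain q where q: "Pr q" "\<tau> (%x. x-q x) <= ennreal t" "range q \<subseteq> D" using D t by (auto simp: tdense_def)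
  have "\<tau> (proj K) <= \<tau> (%x. x-q x)"
  proof (rule tr_disjoint[OF p q(1)])
   fix v assume "proj K v = v" "q v = v"
   hence "v : K" "v : D" using proj_in[OF K, of v] q(3) by (auto, metis rangeI subsetD)
   thus "v = 0" by (rule z)
  qed
  thus ?thesis using q(2) by (rule order_trans)
 qed
 have "\<tau> (proj K) = 0"
 proof (rule ccontr)
  assume n: "\<tau> (proj K) ~= 0"
  obtain r where r: "\<tau> (proj K) = ennreal r" "0 <= r" using le[of 1] by (cases "\<tau> (proj K)") (auto simp: top_unique)
  hence "r > 0" using n by (cases "r = 0") auto
  hence "ennreal r <= ennreal (r/2)" using le[of "r/2"] r by simp
  thus False using \<open>r > 0\<close> by simp
 qed
 hence "proj K v = 0" for v by (rule tr_compl_eq_0[OF p])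
 thus ?thesis using proj_id[OF K] csub_0[OF K(1)] by auto
qed

lemma bdd_part:
 assumes x: "aff x" and p: "Pr p" and b: "bd x p s"
 obtains B where "B : M" "!!v. (p v, B v) : x" "!!v. norm (B v) <= s*norm (p v)"
proof -
 note lin = aff_linear[OF x]
 have "\<forall>v. \<exists>w. (p v, w) : x & norm w <= s*norm (p v)" using b Pr_idem[OF p] by (auto simp: bd_def)
 from choice[OF this] obtain B where B: "!!v. (p v, B v) : x" "!!v. norm (B v) <= s*norm (p v)" by blast
 note bp = bcl_simps[OF Pr_bcl[OF p]]
 have bB: "bounded_clinear B"
 proof (rule bdd_clinearI[of _ "\<bar>s\<bar>"])
  show "B (v + w) = B v + B w" for v w
   using lin_add[OF lin B(1)[of v] B(1)[of w]] B(1)[of "v + w"] by (intro lin_uniq[OF lin]) (auto simp: bp)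
  show "B (c *\<^sub>C v) = c *\<^sub>C B v" for v c
   using lin_scaleC[OF lin B(1)[of v], of c] B(1)[of "c *\<^sub>C v"] by (intro lin_uniq[OF lin]) (auto simp: bp)
  show "norm (B v) <= \<bar>s\<bar>*norm v" for v
   using B(2)[of v] pr_nle[OF Pr_proj[OF p], of v]
    mult_right_mono[OF abs_ge_self[of s] norm_ge_zero[of "p v"]] mult_left_mono[of "norm (p v)" "norm v" "\<bar>s\<bar>"]
   by linarith
 qed
 have "B : M"
 proof (rule M_I[OF bB])
  fix S v assume S: "S : M'"
  show "B (S v) = S (B v)"
   using aff_invariant[OF affD(2)[OF x] lin S B(1)[of v]] B(1)[of "S v"]
   by (intro lin_uniq[OF lin]) (auto simp: M_com[OF Pr_M[OF p] S])
 qed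
 thus ?thesis using B that by blast
qed

text \<open>Let e be the spectral projection above s; off e the operator is the bounded
  \<open>B\<close>. If Z* w is killed by e, then <Z u, w> = <B R u, w> on the core, so w is in the
  domain of the adjoint. These w are the range of a pullback of small cotrace.\<close>

lemma tdense_op_adj: assumes x: "x : measurable_ops M \<tau>" shows "tdense (Domain (op_adj x))"
 unfolding tdense_def
proof (intro allI impI)
 fix t :: real assume t: "t > 0"
 have a: "aff x" by (rule mops_aff[OF x])
 note c = affD(1)[OF a]
 obtain s where s: "0 <= s" "dle x t s" using mops_tmeas[OF x] t by (auto simp: tmeas_def)
 let ?e = "spa x s" and ?f = "%v. v - spa x s v" and ?R = "resolv x" and ?Z = "rsv_op x"
 note e = Pr_spa[OF a, of s]
 note f = Pr_compl[OF e]
 obtain B where B: "B : M" "!!v. (?f v, B v) : x" "!!v. norm (B v) <= s*norm (?f v)"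
  by (rule bdd_part[OF a f bd_spa[OF a s(1)]]) (rule that)
 note bZ = rsv_op_bcl[OF c] and bR = rsv_bcl[OF c]
 have ZM: "?Z : M"
 proof (rule M_I[OF bZ])
  fix S u assume S: "S : M'"
  have "(S (?R u), S (?Z u)) : x" by (rule aff_invariant[OF affD(2)[OF a] aff_linear[OF a] S rsv_graph[OF c]])
  thus "?Z (S u) = S (?Z u)"
   using rsv_graph[OF c, of "S u"] M_com[OF M_rsv[OF c affD(2)[OF a]] S, of u]
   by (intro lin_uniq[OF aff_linear[OF a]]) auto
 qed
 let ?q = "pullback (adj ?Z) ?f"
 note q = Pr_pullback[OF M_adj[OF ZM] f]
 have BR: "B (?R u) = ?Z (?f u)" for u
  using B(2)[of "?R u"] rsv_graph[OF c, of "?f u"]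
  by (intro lin_uniq[OF aff_linear[OF a]]) (auto simp: bcl_simps[OF bR] spa_rsv[OF c])
 have "range ?q \<subseteq> Domain (op_adj x)"
 proof
  fix w assume "w : range ?q"
  hence "?f (adj ?Z w) = adj ?Z w"
   using pr_range[OF Pr_proj[OF q]] pullback_range[OF M_adj[OF ZM] f] by blast
  hence z: "?e (adj ?Z w) = 0" by simp
  have core: "cinner (?Z u) w = cinner (?R u) (adj B w)" for u
  proof -
   have "cinner (?Z (?e u)) w = cinner u (?e (adj ?Z w))" by (simp add: adj_cinner[OF bZ] Pr_ci[OF e])
   hence "cinner (?Z u) w = cinner (?Z (?f u)) w" by (simp add: z bcl_simps[OF bZ] ci_diff_left)
   thus ?thesis by (simp add: BR[symmetric] adj_cinner[OF M_bcl[OF B(1)]])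
  qed
  have "closed {z. cinner (snd z) w = cinner (fst z) (adj B w)}" by (intro closed_Collect_eq continuous_intros)
  hence "closure (range (%u. (?R u, ?Z u))) \<subseteq> {z. cinner (snd z) w = cinner (fst z) (adj B w)}"
   by (intro closure_minimal) (auto simp: core)
  hence "x \<subseteq> {z. cinner (snd z) w = cinner (fst z) (adj B w)}" using rsv_core[OF c] by simp
  hence "(w, adj B w) : op_adj x" by (auto simp: op_adj_def)
  thus "w : Domain (op_adj x)" by blast
 qed
 moreover have "\<tau> (%x. x-?q x) <= ennreal t"
  using pullback_trace[OF M_adj[OF ZM] f] s(2) dle_iff[OF a s(1)] by (simp add: order_trans)
 ultimately show "\<exists>q. Pr q & \<tau> (%x. x-q x) <= ennreal t & range q \<subseteq> Domain (op_adj x)" using q by blast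
qed

lemma op_adj_cinner: "(w, u) : op_adj x ==> (v, v') : x ==> cinner v' w = cinner v u"
 by (auto simp: op_adj_def)

text \<open>The relation \<open>w\<close> is a formal adjoint of \<open>z\<close>; its \<tau>-dense
  domain prevents the closure from being multivalued. One statement serves differences and products
  from either side.\<close>

lemma closure_meas:
 assumes sub: "csub z" and inv: "!!S u h. S : M' ==> (u, h) : z ==> (S u, S h) : z"
  and tm: "tmeas z" and w: "tdense (Domain w)"
  and adj: "!!u h u' h'. (u, h) : z ==> (u', h') : w ==> cinner h u' = cinner u h'"
 shows "closure z : measurable_ops M \<tau>"
proof -
 have csub: "csub (closure z)" by (rule csub_closure[OF sub])
 have inv': "(S u, S h) : closure z" if S: "S : M'" and "(u, h) : closure z" for S u h
 proof -
  let ?V = "(%z. (S (fst z), S (snd z))) -` closure z"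
  note bS = comm_bcl[OF S]
  have cont: "continuous_on UNIV (%z. (S (fst z), S (snd z)))"
   by (intro continuous_on_Pair continuous_on_compose2[OF bcl_cont[OF bS, of UNIV]] continuous_intros) auto
  have "closed ?V" using continuous_closed_vimage[OF closed_closure] cont
   by (metis continuous_on_eq_continuous_at open_UNIV UNIV_I)
  moreover have "z \<subseteq> ?V" using inv[OF S] subsetD[OF closure_subset, of _ z] by auto
  ultimately have "closure z \<subseteq> ?V" by (intro closure_minimal)
  thus ?thesis using that by auto
 qed
 have adj': "cinner h u' = cinner u h'" if e: "(u, h) : closure z" and wm: "(u', h') : w" for u h u' h'
 proof -
  have "closed {z. cinner (snd z) u' = cinner (fst z) h'}" by (intro closed_Collect_eq continuous_intros)
  hence "closure z \<subseteq> {z. cinner (snd z) u' = cinner (fst z) h'}"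
   using adj[OF _ wm] by (intro closure_minimal) auto
  thus ?thesis using e by auto
 qed
 let ?K0 = "{h. (0, h) : closure z}"
 have K0: "csub ?K0" "closed ?K0"
 proof -
  show "csub ?K0" using csub_0[OF csub] csub_add[OF csub] csub_scaleC[OF csub]
   by (fastforce simp: csub_def zero_prod_def)
  have "?K0 = (%h. (0, h)) -` closure z" by auto
  thus "closed ?K0" by (auto intro!: continuous_closed_vimage continuous_intros)
 qed
 have "?K0 = {0}"
 proof (rule tdense_zero[OF w K0])
  show "S u : ?K0" if "S : M'" "u : ?K0" for S u
   using inv'[OF that(1), of 0 u] that bcl_zero_simp[OF comm_bcl[OF that(1)]] by simp
  fix u assume x: "u : ?K0" "u : Domain w"
  then obtain h' where "(u, h') : w" by blast
  hence "cinner u u = cinner 0 h'" using adj' x(1) by blast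
  thus "u = 0" by simp
 qed
 hence uniq0: "h = 0" if "(0, h) : closure z" for h using that by auto
 have "single_valued (closure z)"
 proof (rule single_valuedI)
  fix a b c assume "(a, b) : closure z" "(a, c) : closure z"
  hence "(a-a, b-c) : closure z" using csub_diff[OF csub, of "(a, b)" "(a, c)"] by simp
  thus "b = c" using uniq0[of "b-c"] by simp
 qed
 moreover have "(0, 0) : closure z" using csub_0[OF csub] by (simp add: zero_prod_def)
 moreover have "\<forall>(u, h)\<in>closure z. \<forall>(u', h')\<in>closure z. (u+u', h+h') : closure z"
  using csub_add[OF csub] by fastforce
 moreover have "\<forall>c. \<forall>(u, h)\<in>closure z. (c *\<^sub>C u, c *\<^sub>C h) : closure z"
  using csub_scaleC[OF csub] by fastforce
 ultimately have lin: "linear_op (closure z)" by (simp add: linear_op_def)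
 have D: "tdense (Domain (closure z))"
 proof -
  have "Domain z \<subseteq> Domain (closure z)" using closure_subset[of z] by blast
  thus ?thesis using tmeas_tdense[OF tm] unfolding tdense_def by (meson order_trans)
 qed
 have "ortho (Domain (closure z)) = {0}"
 proof (rule tdense_zero[OF D csub_ortho closed_ortho])
  show "S u : ortho (Domain (closure z))" if S: "S : M'" and o: "u : ortho (Domain (closure z))" for S u
  proof -
   have "cinner (S u) y = 0" if y: "y : Domain (closure z)" for y
   proof -
    obtain v where "(y, v) : closure z" using y by blast
    hence "(adj S y, adj S v) : closure z" by (rule inv'[OF M'_adj[OF S]])
    hence "cinner u (adj S y) = 0" using o by (auto simp: ortho_def)
    thus ?thesis by (simp add: adj_cinner[OF comm_bcl[OF S]])
   qed
   thus ?thesis by (simp add: ortho_def)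
  qed
  show "u = 0" if "u : ortho (Domain (closure z))" "u : Domain (closure z)" for u
   using that by (auto simp: ortho_def) (metis DomainI ci_self_eq_0)
 qed
 hence "closure (Domain (closure z)) = UNIV"
  by (intro dense_if_ortho csub_Dom lin) (auto simp: ortho_def)
 hence cd: "closed_dense_op (closure z)" using lin by (simp add: closed_dense_op_def)
 have a: "aff (closure z)" unfolding aff_def using cd affiliatedI[of "closure z"] inv' by blast
 obtain s where s: "0 <= s" "dle z 1 s"
  using tm[unfolded tmeas_def, rule_format, OF zero_less_one] by blast
 have "dle (closure z) 1 s" by (rule dle_subset[OF s(2) closure_subset])
 hence "\<tau> (spa (closure z) s) <= ennreal 1" using dle_iff[OF a s(1)] by simp
 also have "ennreal 1 < \<infinity>" by simp
 finally show ?thesis unfolding mops_iff using a s(1) by blast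
qed

end

section \<open>Differences, corners and local convergence in measure\<close>

context vn_trace
begin

definition algdiff :: "'h unbdd_op => 'h unbdd_op => 'h unbdd_op"
 where "algdiff x y = {(v, w-w') | v w w'. (v, w) : x & (v, w') : y}"

lemma str_diff_adiff: "strong_diff x y = closure (algdiff x y)"
 by (simp add: strong_diff_def algdiff_def)

lemma adiffI: "(v, w) : x ==> (v, w') : y ==> (v, w-w') : algdiff x y"
 by (auto simp: algdiff_def)

lemma adiffE:
 assumes "(v, u) : algdiff x y"
 obtains w w' where "(v, w) : x" "(v, w') : y" "u = w-w'"
 using assms by (auto simp: algdiff_def)

lemma csubI_pairs:
 assumes "(0, 0) : z" "!!a b c d. (a, b) : z ==> (c, d) : z ==> (a+c, b+d) : z"
  "!!k a b. (a, b) : z ==> (k *\<^sub>C a, k *\<^sub>C b) : z"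
 shows "csub (z :: 'h unbdd_op)"
 using assms by (auto simp: csub_def zero_prod_def)

lemma aff_invariant':
 "x : measurable_ops M \<tau> ==> S : M' ==> (v, w) : x ==> (S v, S w) : x"
 using aff_invariant[OF affD(2) aff_linear, OF mops_aff mops_aff] by blast

lemma tdense_mono: "tdense D ==> D \<subseteq> D' ==> tdense D'"
 unfolding tdense_def by (meson order_trans)

lemma tmeas_add:
 assumes x: "tmeas x" and y: "tmeas y"
  and z: "!!v w w'. (v, w) : x ==> (v, w') : y ==> \<exists>u. (v, u) : z & norm u <= norm w+norm w'"
 shows "tmeas z"
 unfolding tmeas_def
proof (intro allI impI)
 fix t :: real assume "t > 0"
 hence t: "t/2 > 0" by simp
 obtain s where s: "0 <= s" "dle x (t/2) s" using x[unfolded tmeas_def, rule_format, OF t] by blast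
 obtain s' where s': "0 <= s'" "dle y (t/2) s'" using y[unfolded tmeas_def, rule_format, OF t] by blast
 have "dle z (t/2+t/2) (s+s')" using t by (intro dle_add[OF s(2) s'(2)] z) auto
 thus "\<exists>s\<ge>0. dle z t s" using s s' by (intro exI[of _ "s+s'"]) auto
qed

lemma str_diff_meas:
 assumes x: "x : measurable_ops M \<tau>" and y: "y : measurable_ops M \<tau>"
 shows "strong_diff x y : measurable_ops M \<tau>"
 unfolding str_diff_adiff
proof (rule closure_meas)
 note lx = aff_linear[OF mops_aff[OF x]] and ly = aff_linear[OF mops_aff[OF y]]
 show "csub (algdiff x y)"
 proof (rule csubI_pairs)
  show "(0, 0) : algdiff x y" using adiffI[OF lin_zero[OF lx] lin_zero[OF ly]] by simp
  fix a b c d assume "(a, b) : algdiff x y" "(c, d) : algdiff x y"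
  thus "(a+c, b+d) : algdiff x y"
   by (elim adiffE) (use adiffI[OF lin_add[OF lx] lin_add[OF ly]] in \<open>fastforce simp: algebra_simps\<close>)
 next
  fix k a b assume "(a, b) : algdiff x y"
  thus "(k *\<^sub>C a, k *\<^sub>C b) : algdiff x y"
   by (elim adiffE) (use adiffI[OF lin_scaleC[OF lx] lin_scaleC[OF ly]] in \<open>auto simp: scaleC_diff_right\<close>)
 qed
 show "(S v, S w) : algdiff x y" if "S : M'" "(v, w) : algdiff x y" for S v w
  using that(2) adiffI[OF aff_invariant'[OF x that(1)] aff_invariant'[OF y that(1)]]
  by (elim adiffE) (simp add: bcl_simps[OF comm_bcl[OF that(1)]])
 show "tmeas (algdiff x y)"
  by (rule tmeas_add[OF mops_tmeas[OF x] mops_tmeas[OF y]])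
   (meson adiffI norm_triangle_ineq4)
 show "tdense (Domain (algdiff (op_adj x) (op_adj y)))"
  by (rule tdense_mono[OF tdense_Int[OF tdense_op_adj[OF x] tdense_op_adj[OF y]]]) (auto intro: adiffI)
 show "cinner w v' = cinner v w'" if "(v, w) : algdiff x y" "(v', w') : algdiff (op_adj x) (op_adj y)" for v w v' w'
  using that by (elim adiffE) (simp add: ci_algebra op_adj_cinner)
qed

context
 fixes e :: "'h => 'h"
 assumes e: "Pr e"
begin

lemma rg_iff: "(v, w) : x O graph_of e \<longleftrightarrow> (\<exists>u. (v, u) : x & w = e u)"
 "(v, w) : graph_of e O x \<longleftrightarrow> (e v, w) : x"
 by (auto simp: relcomp_unfold)

lemmas e_simps = bcl_simps[OF Pr_bcl[OF e]]

lemma e_commutant: "S : M' ==> S (e v) = e (S v)"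
 by (rule M_com[OF Pr_M[OF e]])

lemma tmeas_left: assumes "tmeas x" shows "tmeas (x O graph_of e)"
proof -
 have "bd (x O graph_of e) p s" if b: "bd x p s" for p s
  unfolding bd_def
 proof (intro allI impI)
  fix v assume "p v = v"
  then obtain w where "(v, w) : x" "norm w <= s*norm v" using b by (auto simp: bd_def)
  thus "\<exists>w. (v, w) : x O graph_of e & norm w <= s*norm v"
   using pr_nle[OF Pr_proj[OF e], of w]
   by (intro exI[of _ "e w"]) (auto simp: rg_iff(1))
 qed
 thus ?thesis using assms unfolding tmeas_def dle_def by blast
qed

lemma tmeas_right: assumes "tmeas x" shows "tmeas (graph_of e O x)"
proof -
 have "dle (graph_of e O x) t s" if d: "dle x t s" and s: "0 <= s" for t s
 proof -
  obtain q where q: "Pr q" "\<tau> (%x. x-q x) <= ennreal t" "bd x q s" using d by (auto simp: dle_def)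
  note P = pullback[OF Pr_M[OF e] q(1)]
  have "bd (graph_of e O x) (pullback e q) s"
   unfolding bd_def
  proof (intro allI impI)
   fix v assume "pullback e q v = v"
   hence "q (e v) = e v" using P(2) by simp
   then obtain w where h: "(e v, w) : x" "norm w <= s*norm (e v)" using q(3) by (auto simp: bd_def)
   moreover have "s*norm (e v) <= s*norm v"
    using pr_nle[OF Pr_proj[OF e], of v] s by (intro mult_left_mono)
   ultimately show "\<exists>w. (v, w) : graph_of e O x & norm w <= s*norm v"
    by (intro exI[of _ w]) (auto simp: rg_iff(2))
  qed
  thus ?thesis using P(1) order_trans[OF P(3) q(2)] by (auto simp: dle_def)
 qed
 thus ?thesis using assms unfolding tmeas_def by blast
qed

lemma str_prod_left_meas:
 assumes x: "x : measurable_ops M \<tau>" shows "strong_prod (graph_of e) x : measurable_ops M \<tau>"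
 unfolding strong_prod_def
proof (rule closure_meas)
 note lx = aff_linear[OF mops_aff[OF x]]
 show "csub (x O graph_of e)"
 proof (rule csubI_pairs)
  show "(0, 0) : x O graph_of e" using lin_zero[OF lx] by (auto simp: rg_iff(1) e_simps)
  show "(a+c, b+d) : x O graph_of e" if "(a, b) : x O graph_of e" "(c, d) : x O graph_of e" for a b c d
   using that lin_add[OF lx] unfolding rg_iff(1) by (metis e_simps(1))
  show "(k *\<^sub>C a, k *\<^sub>C b) : x O graph_of e" if "(a, b) : x O graph_of e" for k a b
   using that lin_scaleC[OF lx] unfolding rg_iff(1) by (metis e_simps(5))
 qed
 show "(S v, S w) : x O graph_of e" if "S : M'" "(v, w) : x O graph_of e" for S v w
  using that aff_invariant'[OF x that(1)] e_commutant[OF that(1)] unfolding rg_iff(1) by metis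
 show "tmeas (x O graph_of e)" by (rule tmeas_left[OF mops_tmeas[OF x]])
 show "tdense (Domain (graph_of e O op_adj x))"
  by (rule tdense_mono[OF tdense_vimage[OF Pr_M[OF e] tdense_op_adj[OF x]]]) (auto simp: rg_iff Domain_iff)
 show "cinner w v' = cinner v w'" if "(v, w) : x O graph_of e" "(v', w') : graph_of e O op_adj x" for v w v' w'
  using that op_adj_cinner Pr_ci[OF e] unfolding rg_iff by metis
qed

lemma str_prod_right_meas:
 assumes x: "x : measurable_ops M \<tau>" shows "strong_prod x (graph_of e) : measurable_ops M \<tau>"
 unfolding strong_prod_def
proof (rule closure_meas)
 note lx = aff_linear[OF mops_aff[OF x]]
 show "csub (graph_of e O x)"
 proof (rule csubI_pairs)
  show "(0, 0) : graph_of e O x" using lin_zero[OF lx] by (auto simp: rg_iff e_simps)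
  show "(a+c, b+d) : graph_of e O x" if "(a, b) : graph_of e O x" "(c, d) : graph_of e O x" for a b c d
   using that lin_add[OF lx] unfolding rg_iff by (metis e_simps(1))
  show "(k *\<^sub>C a, k *\<^sub>C b) : graph_of e O x" if "(a, b) : graph_of e O x" for k a b
   using that lin_scaleC[OF lx] unfolding rg_iff by (metis e_simps(5))
 qed
 show "(S v, S w) : graph_of e O x" if "S : M'" "(v, w) : graph_of e O x" for S v w
  using that aff_invariant'[OF x that(1)] e_commutant[OF that(1)] unfolding rg_iff by metis
 show "tmeas (graph_of e O x)" by (rule tmeas_right[OF mops_tmeas[OF x]])
 show "tdense (Domain (op_adj x O graph_of e))"
  by (rule tdense_mono[OF tdense_op_adj[OF x]]) (auto simp: rg_iff Domain_iff)
 show "cinner w v' = cinner v w'" if "(v, w) : graph_of e O x" "(v', w') : op_adj x O graph_of e" for v w v' w'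
  using that op_adj_cinner Pr_ci[OF e] unfolding rg_iff by metis
qed

definition corner :: "'h unbdd_op => 'h unbdd_op"
 where "corner x = strong_prod (strong_prod (graph_of e) x) (graph_of e)"

lemma corner_meas: "x : measurable_ops M \<tau> ==> corner x : measurable_ops M \<tau>"
 unfolding corner_def by (intro str_prod_right_meas str_prod_left_meas)

text \<open>The corner e (x - y) e before any closure. Composing such relations gives an exact
  triangle inequality, while \<open>cdiff_subset\<close> and \<open>dle_restrict\<close> connect it
  with the closed corner of the topology.\<close>

definition cdiff :: "'h unbdd_op => 'h unbdd_op => 'h unbdd_op"
 where "cdiff x y = {(v, e (w-w')) | v w w'. (e v, w) : x & (e v, w') : y}"

lemma cdiff_subset: "cdiff x y \<subseteq> corner (strong_diff x y)"
proof
 fix z assume "z : cdiff x y"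
 then obtain v w w' where z: "z = (v, e (w-w'))" "(e v, w) : x" "(e v, w') : y" by (auto simp: cdiff_def)
 have "(e v, w-w') : strong_diff x y"
  unfolding str_diff_adiff by (rule subsetD[OF closure_subset adiffI[OF z(2,3)]])
 hence "(e v, e (w-w')) : strong_diff x y O graph_of e" by (auto simp: rg_iff)
 hence "(e v, e (w-w')) : strong_prod (graph_of e) (strong_diff x y)"
  unfolding strong_prod_def by (rule subsetD[OF closure_subset])
 hence "(v, e (w-w')) : graph_of e O strong_prod (graph_of e) (strong_diff x y)" by (simp add: rg_iff)
 thus "z : corner (strong_diff x y)"
  unfolding corner_def z(1) strong_prod_def[of _ "graph_of e"] by (rule subsetD[OF closure_subset])
qed

lemma cdiff_tdense:
 assumes x: "x : measurable_ops M \<tau>" and y: "y : measurable_ops M \<tau>"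
 shows "tdense (Domain (cdiff x y))"
proof (rule tdense_mono)
 show "tdense (e -` (Domain x \<inter> Domain y))"
  by (intro tdense_vimage tdense_Int tmeas_tdense mops_tmeas x y Pr_M e)
 show "e -` (Domain x \<inter> Domain y) \<subseteq> Domain (cdiff x y)" by (auto simp: cdiff_def)
qed

text \<open>Single-valuedness of \<open>Z\<close> passes a bound down to a \<tau>-densely defined
  part, at the price of an arbitrarily small additional cotrace.\<close>

lemma dle_restrict:
 assumes Z: "single_valued Z" and z: "z \<subseteq> Z" and D: "tdense (Domain z)" and d: "dle Z t s" "0 <= t" "0 < de"
 shows "dle z (t+de) s"
proof -
 obtain p where p: "Pr p" "\<tau> (%x. x-p x) <= ennreal t" "bd Z p s" using d by (auto simp: dle_def)
 obtain q where q: "Pr q" "\<tau> (%x. x-q x) <= ennreal de" "range q \<subseteq> Domain z" using D d(3) by (auto simp: tdense_def)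
 have "\<tau> (%x. x-meet p q x) <= ennreal (t+de)"
  using meet_trace[OF p(1) q(1)] add_mono[OF p(2) q(2)] d by (simp add: ennreal_plus[symmetric] del: ennreal_plus)
 moreover have "bd z (meet p q) s"
  unfolding bd_def
 proof (intro allI impI)
  fix v assume "meet p q v = v"
  hence pq: "p v = v" "q v = v" using meet_range[OF p(1) q(1)] by auto
  obtain w where h: "(v, w) : Z" "norm w <= s*norm v" using p(3) pq by (auto simp: bd_def)
  have "v : Domain z" using q(3) pq(2) by (metis rangeI subsetD)
  then obtain w' where h': "(v, w') : z" by blast
  hence "w' = w" using Z h(1) z by (meson single_valuedD subsetD)
  thus "\<exists>w. (v, w) : z & norm w <= s*norm v" using h h' by auto
 qed
 ultimately show ?thesis using Pr_meet[OF p(1) q(1)] by (auto simp: dle_def)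
qed

lemma dle_cdiff:
 assumes x: "x : measurable_ops M \<tau>" and y: "y : measurable_ops M \<tau>"
  and d: "dle (corner (strong_diff x y)) t s" "0 <= t" "0 < de"
 shows "dle (cdiff x y) (t+de) s"
proof (rule dle_restrict[OF _ cdiff_subset cdiff_tdense[OF x y] d])
 show "single_valued (corner (strong_diff x y))"
  using aff_linear[OF mops_aff[OF corner_meas[OF str_diff_meas[OF x y]]]]
  by (simp add: linear_op_def)
qed

text \<open>The basic sets of the topology are not open by definition. A bound at strictly smaller t
  and s leaves room for the triangle inequality, so this variant can be shown to be open.\<close>

definition corner_nbhd :: "real => real => 'h unbdd_op => 'h unbdd_op set"
 where "corner_nbhd eps de x = {y : measurable_ops M \<tau>. \<exists>t s. 0 <= t & t < de & 0 <= s & s < eps \<and>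
  dle (corner (strong_diff y x)) t s}"

lemma corner_nbhd_open:
 assumes x: "x : measurable_ops M \<tau>" and fin: "\<tau> e < \<infinity>"
 shows "local_measure_open M \<tau> (corner_nbhd eps de x)"
 unfolding local_measure_open_def
proof (intro conjI ballI)
 show "corner_nbhd eps de x \<subseteq> measurable_ops M \<tau>" by (auto simp: corner_nbhd_def)
 fix y assume "y : corner_nbhd eps de x"
 then obtain t s where y: "y : measurable_ops M \<tau>" and ts: "0 <= t" "t < de" "0 <= s" "s < eps"
  and d: "dle (corner (strong_diff y x)) t s" by (auto simp: corner_nbhd_def)
 \<comment> \<open>Two restrictions to \<open>cdiff\<close> and one new bound each cost de', and t +
   3 de' < de.\<close>
 define de' where "de' = (de-t)/4"
 define eps' where "eps' = eps-s"
 have pos: "de' > 0" "eps' > 0" using ts by (simp_all add: de'_def eps'_def)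
 let ?F = "{local_basic_nbhd M \<tau> e eps' de'}"
 have "?F \<subseteq> local_basis0 M \<tau>" using e fin pos unfolding local_basis0_def Pr_def by blast
 moreover have "{y' : measurable_ops M \<tau>. strong_diff y' y : \<Inter>?F} \<subseteq> corner_nbhd eps de x"
 proof
  fix y' assume "y' : {y' : measurable_ops M \<tau>. strong_diff y' y : \<Inter>?F}"
  hence y': "y' : measurable_ops M \<tau>" and "sing_val \<tau> (corner (strong_diff y' y)) de' < ennreal eps'"
   by (auto simp: local_basic_nbhd_def corner_def)
  hence "mu (corner (strong_diff y' y)) de' < ennreal eps'"
   using sing_val_eq_mu[OF mops_aff[OF corner_meas[OF str_diff_meas[OF y' y]]]] by simp
  then obtain s' where s': "0 <= s'" "s' < eps'" "dle (corner (strong_diff y' y)) de' s'" using mu_less by blast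
  have "dle (cdiff y' y) (de'+de') s'" using pos by (intro dle_cdiff y' y s') auto
  moreover have "dle (cdiff y x) (t+de') s" using pos ts by (intro dle_cdiff y x d) auto
  ultimately have "dle (cdiff y' x) ((de'+de')+(t+de')) (s'+s)"
  proof (rule dle_add)
   fix v u u' assume "(v, u) : cdiff y' y" "(v, u') : cdiff y x"
   then obtain a b c d where h: "u = e (a-b)" "(e v, a) : y'" "(e v, b) : y" "u' = e (c-d)" "(e v, c) : y" "(e v, d) : x"
    by (auto simp: cdiff_def)
   have "b = c" using lin_uniq[OF aff_linear[OF mops_aff[OF y]] h(3,5)] .
   hence "e (a-d) = u+u'" using h by (simp add: e_simps)
   thus "\<exists>u''. (v, u'') : cdiff y' x & norm u'' <= norm u+norm u'"
   proof (intro exI conjI)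
    show "(v, e (a-d)) : cdiff y' x" using h unfolding cdiff_def by blast
    show "norm (e (a-d)) <= norm u+norm u'" unfolding \<open>e (a - d) = u + u'\<close> by (rule norm_triangle_ineq)
   qed
  qed (use pos ts in auto)
  hence "dle (corner (strong_diff y' x)) ((de'+de')+(t+de')) (s'+s)" by (rule dle_subset[OF _ cdiff_subset])
  moreover have "(de'+de')+(t+de') < de" "0 <= (de'+de')+(t+de')" "s'+s < eps" "0 <= s'+s"
   using ts s' pos by (auto simp: de'_def eps'_def field_simps)
  ultimately show "y' : corner_nbhd eps de x" using y' unfolding corner_nbhd_def by blast
 qed
 ultimately show "\<exists>\<F>. finite \<F> & \<F> \<subseteq> local_basis0 M \<tau> \<and>
   {y' : measurable_ops M \<tau>. strong_diff y' y : \<Inter>\<F>} \<subseteq> corner_nbhd eps de x"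
  by (intro exI[of _ ?F]) simp
qed

lemma corner_nbhd_self:
 assumes x: "x : measurable_ops M \<tau>" and "0 < eps" "0 < de" shows "x : corner_nbhd eps de x"
proof -
 have d2: "de/2 > 0" using assms by simp
 obtain q where q: "Pr q" "\<tau> (%x. x-q x) <= ennreal (de/2)" "range q \<subseteq> Domain (cdiff x x)"
  using cdiff_tdense[OF x x, unfolded tdense_def, rule_format, OF d2] by blast
 have "bd (cdiff x x) q 0"
  unfolding bd_def
 proof (intro allI impI)
  fix v assume "q v = v"
  hence "v : Domain (cdiff x x)" using q(3) by (metis rangeI subsetD)
  then obtain a b where h: "(e v, a) : x" "(e v, b) : x" by (auto simp: cdiff_def)
  hence "a = b" by (rule lin_uniq[OF aff_linear[OF mops_aff[OF x]]])
  thus "\<exists>w. (v, w) : cdiff x x & norm w <= 0*norm v"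
   using h by (intro exI[of _ 0]) (force simp: cdiff_def e_simps)
 qed
 hence "dle (cdiff x x) (de/2) 0" using q by (auto simp: dle_def)
 hence "dle (corner (strong_diff x x)) (de/2) 0" by (rule dle_subset[OF _ cdiff_subset])
 moreover have "0 <= de/2" "de/2 < de" using assms by auto
 ultimately show ?thesis using x assms(2) unfolding corner_nbhd_def by blast
qed

lemma local_conv_corner:
 assumes lim: "limitin (subtopology (local_measure_topology M \<tau>) X) xs x sequentially"
  and fin: "\<tau> e < \<infinity>" and pos: "0 < eps" "0 < de"
 shows "\<exists>N. \<forall>n\<ge>N. dle (cdiff (xs n) x) de eps"
proof -
 let ?T = "subtopology (local_measure_topology M \<tau>) X"
 have xt: "x : topspace ?T" using lim by (simp add: limitin_def)
 hence x: "x : measurable_ops M \<tau>" and xX: "x : X" by (auto simp: topspace_local_measure_topology)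
 let ?U = "corner_nbhd eps (de/2) x"
 have "openin ?T (?U \<inter> X)"
  unfolding openin_subtopology openin_local_measure_topology using corner_nbhd_open[OF x fin] by blast
 moreover have "x : ?U \<inter> X" using corner_nbhd_self[OF x pos(1), of "de/2"] pos xX by simp
 ultimately have "\<forall>\<^sub>F n in sequentially. xs n : ?U \<inter> X" using lim unfolding limitin_def by blast
 then obtain N where N: "!!n. n >= N ==> xs n : ?U" by (auto simp: eventually_sequentially)
 have "dle (cdiff (xs n) x) de eps" if "n >= N" for n
 proof -
  from N[OF that] obtain t s where xn: "xs n : measurable_ops M \<tau>" and ts: "0 <= t" "t < de/2" "0 <= s" "s < eps"
   and d: "dle (corner (strong_diff (xs n) x)) t s" by (auto simp: corner_nbhd_def)
  have "dle (cdiff (xs n) x) (t+de/2) s" using pos ts by (intro dle_cdiff xn x d) auto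
  thus ?thesis using ts by (elim dle_mono) auto
 qed
 thus ?thesis by blast
qed

end

end

section \<open>Symmetric function spaces with a lower estimate\<close>

text \<open>The infimum of the admissible constants is itself admissible, because each of the
  inequalities survives a limit in C.\<close>

lemma convexity_bound_1:
 assumes "p_convex p E N" "convexity_const p E N = 1" shows "convexity_bound p E N 1"
 unfolding convexity_bound_def
proof (intro conjI allI impI)
 fix n :: nat and x assume x: "\<forall>i<n. x i : E"
 let ?l = "N (%t. complex_of_real ((\<Sum>i<n. cmod (x i t) powr p) powr (1/p)))"
 let ?r = "(\<Sum>i<n. N (x i) powr p) powr (1/p)"
 have "{C. convexity_bound p E N C} ~= {}" using assms(1) by (auto simp: p_convex_def)
 hence ex: "\<exists>C. convexity_bound p E N C & C < 1+e" if "e > 0" for e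
  using cInf_lessD[of "{C. convexity_bound p E N C}" "1+e"] assms(2) that by (auto simp: convexity_const_def)
 have "?l <= (1+e)*?r" if e: "e > 0" for e
 proof -
  obtain C where C: "convexity_bound p E N C" "C < 1+e" using ex[OF e] by blast
  have "?l <= C*?r" using C(1) x by (simp add: convexity_bound_def)
  also have "... <= (1+e)*?r" using C(2) by (intro mult_right_mono) auto
  finally show ?thesis .
 qed
 hence "?l <= ?r+e*?r" if "e > 0" for e using that by (simp only: distrib_right mult_1)
 thus "?l <= 1*?r" unfolding mult_1 by (rule le_if_le_add_mult)
qed simp

locale E_space = symmetric_quasi_banach_space E N for E N +
 fixes \<alpha> q :: real
 assumes \<alpha>: "0 < \<alpha>" "\<alpha> <= 1" and conv: "convexity_bound \<alpha> E N 1" and \<alpha>q: "\<alpha> <= q" and low: "lower_estimate q E N 1"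
begin

lemma q_pos: "0 < q" using \<alpha> \<alpha>q by linarith

definition cf :: "(real => real) => real => complex" where "cf f = (%t. complex_of_real (f t))"
text \<open>Elements of E represented by real Borel functions on the whole line. Values at t \<le> 0
  do not matter, {0} being a null set, so pointwise hypotheses below are for t > 0.\<close>

definition Er :: "(real => real) set" where "Er = {f : borel_measurable borel. cf f : E}"
definition Nr :: "(real => real) => real" where "Nr f = N (cf f)"

lemma cf_meas: "f : borel_measurable borel ==> cf f : borel_measurable lebesgue_pos"
 unfolding cf_def
 by (intro measurable_restrict_space1 measurable_completion borel_measurable_of_real) simp

lemma AE_pos: assumes "!!t. 0 < t ==> P t" shows "AE t in lebesgue_pos. P t"
proof -
 have "AE t in lborel. t ~= (0::real)" by (rule AE_lborel_singleton)
 hence "AE t in lebesgue. t ~= (0::real)" by (rule AE_completion)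
 hence "AE t in lebesgue. t : {0..} --> P t" by eventually_elim (use assms in force)
 thus ?thesis by (subst AE_restrict_space_iff) auto
qed

lemma Er_borel: "f : Er ==> f : borel_measurable borel" by (simp add: Er_def)

lemma Er_ideal:
 assumes g: "g : Er" and f: "f : borel_measurable borel" and le: "!!t. 0 < t ==> \<bar>f t\<bar> <= \<bar>g t\<bar>"
 shows "f : Er" "Nr f <= Nr g"
 using ideal[of "cf g" "cf f"] g cf_meas[OF f] f AE_pos[of "%t. cmod (cf f t) <= cmod (cf g t)"] le
 by (auto simp: Er_def Nr_def cf_def)

lemma Nr_nonneg: "f : Er ==> 0 <= Nr f" using nonneg by (simp add: Er_def Nr_def)

lemma Er_scale: "f : Er ==> (%t. c*f t) : Er"
 and Nr_scale: "f : Er ==> Nr (%t. c*f t) = \<bar>c\<bar>*Nr f"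
 using scale_mem[of "cf f" "of_real c"] homogeneous[of "cf f" "of_real c"] by (auto simp: Er_def Nr_def cf_def)

lemma Nr_pointwise: "f : Er ==> g : borel_measurable borel ==> (!!t. 0 < t ==> \<bar>g t\<bar> = \<bar>f t\<bar>) ==> g : Er & Nr g = Nr f"
 using Er_ideal[of f g] Er_ideal[of g f] by (metis Er_borel order_antisym order_refl)

lemma Er_add: assumes "f : Er" "g : Er" shows "(%t. f t+g t) : Er"
 using add_mem[of "cf f" "cf g"] assms by (auto simp: Er_def cf_def)

lemma alpha_sum_Er:
 assumes f: "f : Er" and g: "g : Er"
 shows "(%t. (\<bar>f t\<bar> powr \<alpha>+\<bar>g t\<bar> powr \<alpha>) powr (1/\<alpha>)) : Er"
proof -
 let ?h = "%t. (\<bar>f t\<bar> powr \<alpha>+\<bar>g t\<bar> powr \<alpha>) powr (1/\<alpha>)"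
 note bf = Er_borel[OF f] Er_borel[OF g]
 have "(%t. \<bar>f t\<bar>) : Er" "(%t. \<bar>g t\<bar>) : Er"
  using Er_ideal(1)[OF f, of "%t. \<bar>f t\<bar>"] Er_ideal(1)[OF g, of "%t. \<bar>g t\<bar>"] bf by auto
 hence k: "(%t. 2 powr (1/\<alpha>)*(\<bar>f t\<bar>+\<bar>g t\<bar>)) : Er" by (intro Er_scale Er_add)
 have "\<bar>?h t\<bar> <= \<bar>2 powr (1/\<alpha>)*(\<bar>f t\<bar>+\<bar>g t\<bar>)\<bar>" for t
 proof -
  have "\<bar>f t\<bar> powr \<alpha>+\<bar>g t\<bar> powr \<alpha> <= 2*(\<bar>f t\<bar>+\<bar>g t\<bar>) powr \<alpha>"
   using powr_mono2[of \<alpha> "\<bar>f t\<bar>" "\<bar>f t\<bar>+\<bar>g t\<bar>"] powr_mono2[of \<alpha> "\<bar>g t\<bar>" "\<bar>f t\<bar>+\<bar>g t\<bar>"] \<alpha> by simp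
  hence "?h t <= (2*(\<bar>f t\<bar>+\<bar>g t\<bar>) powr \<alpha>) powr (1/\<alpha>)" using \<alpha> by (intro powr_mono2) auto
  thus ?thesis using \<alpha> by (simp add: powr_mult powr_powr)
 qed
 thus ?thesis using bf by (intro Er_ideal(1)[OF k]) auto
qed

text \<open>Here the constant 1 enters. Any loss in this inequality would defeat
  \<open>norm_gap\<close>, where the two sides differ by an arbitrarily small amount.\<close>

lemma Nr_alpha:
 assumes f: "f : Er" and g: "g : Er"
 shows "Nr (%t. (\<bar>f t\<bar> powr \<alpha>+\<bar>g t\<bar> powr \<alpha>) powr (1/\<alpha>)) powr \<alpha> <= Nr f powr \<alpha>+Nr g powr \<alpha>"
proof -
 let ?h = "%t. (\<bar>f t\<bar> powr \<alpha>+\<bar>g t\<bar> powr \<alpha>) powr (1/\<alpha>)"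
 have "Nr ?h <= (Nr f powr \<alpha>+Nr g powr \<alpha>) powr (1/\<alpha>)"
  using conv[unfolded convexity_bound_def, THEN conjunct2, rule_format, of 2 "%i. if i = 0 then cf f else cf g"] f g
  by (simp add: Nr_def Er_def cf_def numeral_2_eq_2)
 hence "Nr ?h powr \<alpha> <= ((Nr f powr \<alpha>+Nr g powr \<alpha>) powr (1/\<alpha>)) powr \<alpha>"
  using \<alpha> Nr_nonneg[OF alpha_sum_Er[OF f g]] by (intro powr_mono2) auto
 thus ?thesis using \<alpha> by (simp add: powr_powr)
qed

text \<open>After division by a + b both numbers are at most 1, where x \<le> x^\<alpha>.\<close>

lemma powr_subadd: assumes "0 <= a" "0 <= b" shows "(a+b) powr \<alpha> <= a powr \<alpha>+b powr \<alpha>"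
proof (cases "a+b = 0")
 case False
 hence s: "a+b > 0" using assms by linarith
 have 1: "x/(a+b) <= (x/(a+b)) powr \<alpha>" if "0 <= x" "x <= a+b" for x
 proof (cases "x = 0")
  case False
  thus ?thesis using that s \<alpha> powr_mono'[of \<alpha> 1 "x/(a+b)"] by (simp add: divide_le_eq)
 qed (use s in simp)
 have "1 = a/(a+b)+b/(a+b)" using s by (simp add: add_divide_distrib[symmetric])
 also have "... <= (a/(a+b)) powr \<alpha>+(b/(a+b)) powr \<alpha>" using assms by (intro add_mono 1) auto
 also have "... = (a powr \<alpha>+b powr \<alpha>)/(a+b) powr \<alpha>" using assms s by (simp add: powr_divide add_divide_distrib)
 finally show ?thesis using s by (simp add: pos_le_divide_eq)
qed (use assms \<alpha> in simp)

lemma Nr_add: assumes f: "f : Er" and g: "g : Er" shows "Nr (%t. f t+g t) powr \<alpha> <= Nr f powr \<alpha>+Nr g powr \<alpha>"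
proof -
 have le: "\<bar>f t+g t\<bar> <= \<bar>(\<bar>f t\<bar> powr \<alpha>+\<bar>g t\<bar> powr \<alpha>) powr (1/\<alpha>)\<bar>" for t
 proof -
  have "\<bar>f t+g t\<bar> powr \<alpha> <= (\<bar>f t\<bar>+\<bar>g t\<bar>) powr \<alpha>" using \<alpha> by (intro powr_mono2) auto
  also have "... <= \<bar>f t\<bar> powr \<alpha>+\<bar>g t\<bar> powr \<alpha>" by (rule powr_subadd) auto
  finally have "(\<bar>f t+g t\<bar> powr \<alpha>) powr (1/\<alpha>) <= (\<bar>f t\<bar> powr \<alpha>+\<bar>g t\<bar> powr \<alpha>) powr (1/\<alpha>)" using \<alpha> by (intro powr_mono2) auto
  thus ?thesis using \<alpha> by (simp add: powr_powr)
 qed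
 note E = Er_add[OF f g]
 have "Nr (%t. f t+g t) powr \<alpha> <= Nr (%t. (\<bar>f t\<bar> powr \<alpha>+\<bar>g t\<bar> powr \<alpha>) powr (1/\<alpha>)) powr \<alpha>"
  using Er_ideal(2)[OF alpha_sum_Er[OF f g] Er_borel[OF E] le] Nr_nonneg[OF E] \<alpha> by (intro powr_mono2) auto
 also have "... <= Nr f powr \<alpha>+Nr g powr \<alpha>" by (rule Nr_alpha[OF f g])
 finally show ?thesis .
qed

lemma Nr_powr_mono: "f : Er ==> Nr f <= c ==> Nr f powr \<alpha> <= c powr \<alpha>"
 using Nr_nonneg \<alpha> by (intro powr_mono2) auto

lemma Nr_powr_le: assumes "f : Er" "Nr f powr \<alpha> <= c powr \<alpha>" "0 <= c" shows "Nr f <= c"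
proof (rule ccontr)
 assume "\<not> Nr f <= c"
 hence "c powr \<alpha> < Nr f powr \<alpha>" using assms(3) \<alpha> by (intro powr_less_mono2) auto
 thus False using assms(2) by simp
qed

lemma Nr_zero: "(%t. 0) : Er" "Nr (%t. 0) = 0"
proof -
 have "simple_function lebesgue_pos (%t. 0 :: complex)" by simp
 hence "cf (%t. 0) : E" using simple[of "%t. 0"] by (simp add: cf_def)
 thus z: "(%t. 0) : Er" by (simp add: Er_def)
 show "Nr (%t. 0) = 0" using Nr_scale[OF z, of 0] by simp
qed

lemma Er_sum: "(!!i. i < n ==> f i : Er) ==> (%t. \<Sum>i<(n::nat). f i t) : Er"
 by (induction n) (simp_all add: Nr_zero Er_add)

lemma Nr_sum: "(!!i. i < n ==> f i : Er) ==> Nr (%t. \<Sum>i<(n::nat). f i t) powr \<alpha> <= (\<Sum>i<n. Nr (f i) powr \<alpha>)"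
proof (induction n)
 case 0 thus ?case by (simp add: Nr_zero)
next
 case (Suc n)
 have "Nr (%t. (\<Sum>i<n. f i t)+f n t) powr \<alpha> <= Nr (%t. \<Sum>i<n. f i t) powr \<alpha>+Nr (f n) powr \<alpha>"
  using Suc.prems by (intro Nr_add Er_sum) auto
 also have "Nr (%t. \<Sum>i<n. f i t) powr \<alpha> <= (\<Sum>i<n. Nr (f i) powr \<alpha>)" using Suc by simp
 finally show ?case by simp
qed

lemma Nr_lower:
 assumes f: "!!i. i < n ==> f i : Er" and dj: "!!i j t. i < n ==> j < n ==> i ~= j ==> f i t = 0 \<or> f j t = 0"
 shows "(\<Sum>i<(n::nat). Nr (f i) powr q) <= Nr (%t. \<Sum>i<n. f i t) powr q"
proof -
 have "(\<Sum>i<n. N (cf (f i)) powr q) powr (1/q) <= 1*N (%t. \<Sum>i<n. cf (f i) t)"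
  using low[unfolded lower_estimate_def, rule_format, of n "%i. cf (f i)"] f dj by (auto simp: Er_def cf_def)
 hence "(\<Sum>i<n. Nr (f i) powr q) powr (1/q) <= Nr (%t. \<Sum>i<n. f i t)" by (simp add: Nr_def cf_def)
 hence "((\<Sum>i<n. Nr (f i) powr q) powr (1/q)) powr q <= Nr (%t. \<Sum>i<n. f i t) powr q"
  using q_pos by (intro powr_mono2) auto
 thus ?thesis using q_pos by (simp add: powr_powr sum_nonneg)
qed

lemma Nr_lower2:
 assumes f: "f : Er" and g: "g : Er" and dj: "!!t. f t = 0 \<or> g t = 0"
 shows "Nr f powr q+Nr g powr q <= Nr (%t. f t+g t) powr q"
proof -
 let ?F = "%i::nat. if i = 0 then f else g"
 have "(\<Sum>i<2. Nr (?F i) powr q) <= Nr (%t. \<Sum>i<2. ?F i t) powr q"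
  using f g dj by (intro Nr_lower) (auto split: if_splits)
 thus ?thesis by (simp add: numeral_2_eq_2)
qed


subsection \<open>Order continuity\<close>

abbreviation rs :: "(real => real) => real set => real => real"
 where "rs f A \<equiv> (%t. indicator A t*f t)"

lemma Er_rs: "f : Er ==> A : sets borel ==> rs f A : Er"
 and Nr_rs: "f : Er ==> A : sets borel ==> Nr (rs f A) <= Nr f"
 using Er_ideal[of f "rs f A"] Er_borel[of f] by (auto simp: indicator_def)

text \<open>Otherwise there are infinitely many disjoint pieces of norm at least eps, and n of them
  give n eps^q \<le> \<open>Nr f\<close> ^ q by the lower estimate.\<close>

lemma restrict_Cauchy:
 assumes f: "f : Er" and A: "!!k::nat. A k : sets borel" and dec: "!!i j. i <= j ==> A j \<subseteq> A i" and e: "0 < eps"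
 shows "\<exists>K. \<forall>i\<ge>K. \<forall>j\<ge>i. Nr (rs f (A i-A j)) < eps"
proof (rule ccontr)
 assume "\<not> ?thesis"
 hence "\<forall>K. \<exists>p. K <= fst p & fst p <= snd p & eps <= Nr (rs f (A (fst p)-A (snd p)))"
  by (simp add: not_less)
 then obtain p where p: "!!K. K <= fst (p K)" "!!K. fst (p K) <= snd (p K)" "!!K. eps <= Nr (rs f (A (fst (p K))-A (snd (p K))))"
  by metis
 \<comment> \<open>Each index pair is chosen beyond the end of the preceding pair, which makes the
   pieces \<open>B n\<close> disjoint.\<close>
 define k where "k = rec_nat 0 (%_ x. snd (p x))"
 have k: "k (Suc n) = snd (p (k n))" for n by (simp add: k_def)
 define B where "B n = A (fst (p (k n)))-A (snd (p (k n)))" for n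
 have BM: "B n : sets borel" for n unfolding B_def using A by auto
 have kinc: "k m <= k n" if "m <= n" for m n
  using that
 proof (induction n rule: dec_induct)
  case (step n)
  thus ?case unfolding k using p(1)[of "k n"] p(2)[of "k n"] by linarith
 qed simp
 have "B m \<inter> B n = {}" if "m < n" for m n
 proof -
  have "snd (p (k m)) <= fst (p (k n))"
   using kinc[of "Suc m" n] that p(1)[of "k n"] by (simp add: k)
  thus ?thesis unfolding B_def using dec by blast
 qed
 hence dj: "B m \<inter> B n = {}" if "m ~= n" for m n using that by (metis Int_commute linorder_neqE_nat)
 have bound: "real n*eps powr q <= Nr f powr q" for n
 proof -
  have "real n*eps powr q = (\<Sum>i<n. eps powr q)" by simp
  also have "... <= (\<Sum>i<n. Nr (rs f (B i)) powr q)"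
   using p(3) e q_pos unfolding B_def by (intro sum_mono powr_mono2) auto
  also have "... <= Nr (%t. \<Sum>i<n. rs f (B i) t) powr q"
   using dj by (intro Nr_lower Er_rs f BM) (auto simp: indicator_def)
  also have "... <= Nr f powr q"
  proof (intro powr_mono2)
   have m: "(%t. \<Sum>i<n. rs f (B i) t) : Er" by (intro Er_sum Er_rs f BM)
   show "0 <= Nr (%t. \<Sum>i<n. rs f (B i) t)" by (rule Nr_nonneg[OF m])
   show "Nr (%t. \<Sum>i<n. rs f (B i) t) <= Nr f"
   proof (rule Er_ideal(2)[OF f Er_borel[OF m]])
    fix t
    have eq: "(\<Sum>i<n. rs f (B i) t) = indicator (\<Union>i<n. B i) t*f t"
    proof -
     have "(\<Sum>i<n. indicator (B i) t) = (indicator (\<Union>i<n. B i) t :: real)"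
      by (rule indicator_UN_disjoint[symmetric]) (auto simp: disjoint_family_on_def dj)
     thus ?thesis by (simp add: sum_distrib_right[symmetric])
    qed
    show "\<bar>\<Sum>i<n. rs f (B i) t\<bar> <= \<bar>f t\<bar>" unfolding eq by (cases "t : (\<Union>i<n. B i)") (auto simp: indicator_def)
   qed
  qed (use q_pos in auto)
  finally show ?thesis .
 qed
 have "0 < eps powr q" using e by simp
 obtain n where "Nr f powr q/eps powr q < real n" using reals_Archimedean2 by blast
 hence "Nr f powr q < real n*eps powr q" using \<open>0 < eps powr q\<close> by (simp add: pos_divide_less_eq)
 thus False using bound[of n] by simp
qed

text \<open>The restrictions of \<open>f\<close> to the complements are Cauchy by
  \<open>restrict_Cauchy\<close>. Their limit in E agrees with \<open>f\<close> off each
  \<open>A j\<close>, hence almost everywhere, and the distance to the limit dominates the norm on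
  \<open>A k\<close>.\<close>

lemma order_cont:
 assumes f: "f : Er" and A: "!!k::nat. A k : sets borel" and dec: "!!i j. i <= j ==> A j \<subseteq> A i"
  and empty: "!!t. 0 < t ==> \<exists>k. t \<notin> A k"
 shows "(%k. Nr (rs f (A k))) \<longlonglongrightarrow> 0"
proof -
 define u where "u k = rs f (- A k)" for k
 have uE: "u k : Er" for k unfolding u_def by (intro Er_rs f) (use A in auto)
 have diff: "N (%t. cf (u m) t-cf (u n) t) = Nr (rs f (A m-A n))" if "m <= n" for m n
 proof -
  have "(%t. cf (u m) t-cf (u n) t) = (%t. (-1)*cf (rs f (A m-A n)) t)"
   using dec[OF that] by (auto simp: u_def cf_def indicator_def fun_eq_iff)
  moreover have "cf (rs f (A m-A n)) : E" using Er_rs[OF f, of "A m-A n"] A by (auto simp: Er_def)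
  ultimately show ?thesis by (simp only: homogeneous) (simp add: Nr_def)
 qed
 have "\<exists>k. \<forall>m\<ge>k. \<forall>n\<ge>k. N (%t. cf (u m) t-cf (u n) t) < eps" if e: "eps > 0" for eps
 proof -
  have "\<exists>K. \<forall>i\<ge>K. \<forall>j\<ge>i. Nr (rs f (A i-A j)) < eps" by (rule restrict_Cauchy[OF f A dec e])
  then obtain K where K: "!!i j. i >= K ==> j >= i ==> Nr (rs f (A i-A j)) < eps" by blast
  have sym: "N (%t. cf (u m) t-cf (u n) t) = N (%t. cf (u n) t-cf (u m) t)" for m n
  proof -
   have ue: "cf (u n) : E" for n using uE by (simp add: Er_def)
   have "(%t. cf (u m) t+(-1)*cf (u n) t) : E" by (rule add_mem[OF ue scale_mem[OF ue]])
   hence "N (%t. (-1)*(cf (u m) t+(-1)*cf (u n) t)) = cmod (-1)*N (%t. cf (u m) t+(-1)*cf (u n) t)"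
    by (rule homogeneous)
   thus ?thesis by simp
  qed
  have "N (%t. cf (u m) t-cf (u n) t) < eps" if "m >= K" "n >= K" for m n
   using that K[of m n] K[of n m] diff[of m n] diff[of n m] sym[of m n] by (cases "m <= n") auto
  thus ?thesis by blast
 qed
 then obtain g where g: "g : E" "(%n. N (%t. cf (u n) t-g t)) \<longlonglongrightarrow> 0"
  using complete[of "%n. cf (u n)"] uE by (auto simp: Er_def)
 have gm: "g : borel_measurable lebesgue_pos" by (rule measurable[OF g(1)])
 have Am: "A j : sets lebesgue" for j using A by auto
 have dE: "(%t. cf (u n) t-g t) : E" for n
  using add_mem[of "cf (u n)" "%t. (-1)*g t"] scale_mem[OF g(1), of "-1"] uE by (auto simp: Er_def)
 have ae: "AE t in lebesgue_pos. t : A j \<or> cf f t = g t" for j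
 proof -
  let ?d = "%t. cf (indicator (- A j)) t*(cf f t-g t)"
  have dm: "?d : borel_measurable lebesgue_pos"
   using A Er_borel[OF f] gm by (intro borel_measurable_times borel_measurable_diff cf_meas) auto
  have le: "AE t in lebesgue_pos. cmod (?d t) <= cmod (cf (u n) t-g t)" if "n >= j" for n
   using dec[OF that] by (intro AE_I2) (auto simp: u_def cf_def indicator_def)
  have "N ?d <= N (%t. cf (u n) t-g t)" if "n >= j" for n using ideal[OF dE dm le[OF that]] by blast
  hence "N ?d <= 0" by (intro LIMSEQ_le_const[OF g(2)]) auto
  moreover have dE': "?d : E" using ideal[OF dE dm le[OF order_refl]] by blast
  ultimately have "N ?d = 0" using nonneg[OF dE'] by simp
  hence "AE t in lebesgue_pos. ?d t = 0" using eq_0_iff[OF dE'] by blast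
  thus ?thesis by eventually_elim (auto simp: cf_def indicator_def split: if_splits)
 qed
 have ae_all: "AE t in lebesgue_pos. cf f t = g t"
 proof -
  have "AE t in lebesgue_pos. \<forall>j. t : A j \<or> cf f t = g t" using ae unfolding AE_all_countable by blast
  moreover have "AE t in lebesgue_pos. 0 < t" by (rule AE_pos)
  ultimately show ?thesis by eventually_elim (use empty in blast)
 qed
 have "Nr (rs f (A k)) <= N (%t. cf (u k) t-g t)" for k
 proof -
  have "AE t in lebesgue_pos. cmod (cf (rs f (A k)) t) <= cmod (cf (u k) t-g t)"
   using ae_all by eventually_elim (auto simp: u_def cf_def indicator_def norm_minus_commute)
  thus ?thesis unfolding Nr_def
   using ideal[OF dE cf_meas[OF Er_borel[OF Er_rs[OF f A]]]] by blast
 qed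
 moreover have "0 <= Nr (rs f (A k))" for k by (intro Nr_nonneg Er_rs f A)
 ultimately show ?thesis by (intro tendsto_sandwich[OF _ _ tendsto_const g(2)]) auto
qed

text \<open>The set \<open>A k\<close>, where some later g j exceeds \<eta> |f|, shrinks to the
  empty set, so \<open>order_cont\<close> handles it; off \<open>A k\<close> the bound \<eta> |f| is
  small in norm.\<close>

lemma dom_conv:
 assumes f: "f : Er" and g: "!!k. g k : borel_measurable borel" and le: "!!k t. 0 < t ==> \<bar>g k t\<bar> <= \<bar>f t\<bar>"
  and lim: "!!t. 0 < t ==> (%k::nat. g k t) \<longlonglongrightarrow> 0" and e: "0 < eps"
 shows "\<exists>K. \<forall>k\<ge>K. Nr (g k) < eps"
proof -
 \<comment> \<open>Two summands of norm at most c add up to norm at most 2^(1/\<alpha>) c, which is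
   eps / 2 for the c used below.\<close>
 define \<eta> where "\<eta> = eps/(2 powr (1/\<alpha>)*2*(Nr f+1))"
 have Nf: "0 <= Nr f" by (rule Nr_nonneg[OF f])
 have \<eta>: "0 < \<eta>" using e Nf by (auto simp: \<eta>_def intro!: divide_pos_pos mult_pos_pos)
 define A where "A k = {t. \<exists>j\<ge>k. \<bar>g j t\<bar> > \<eta>*\<bar>f t\<bar>} \<inter> {0<..}" for k
 have fm: "f : borel_measurable borel" by (rule Er_borel[OF f])
 have A: "A k : sets borel" for k
 proof -
  have "A k = (\<Union>j\<in>{k..}. {t. \<eta>*\<bar>f t\<bar> < \<bar>g j t\<bar>}) \<inter> {0<..}" by (auto simp: A_def)
  moreover have "{t. \<eta>*\<bar>f t\<bar> < \<bar>g j t\<bar>} : sets borel" for j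
   using borel_measurable_less[of "%t. \<eta>*\<bar>f t\<bar>" borel "%t. \<bar>g j t\<bar>"] fm g[of j] by auto
  ultimately show ?thesis by auto
 qed
 have "(%k. Nr (rs f (A k))) \<longlonglongrightarrow> 0"
 proof (rule order_cont[OF f A])
  show "A j \<subseteq> A i" if "i <= j" for i j using that by (auto simp: A_def intro: order_trans)
  fix t :: real assume t: "0 < t"
  show "\<exists>k. t \<notin> A k"
  proof (cases "f t = 0")
   case True thus ?thesis using le[OF t] by (auto simp: A_def not_less)
  next
   case False
   hence "0 < \<eta>*\<bar>f t\<bar>" using \<eta> by simp
   then obtain k where "!!j. j >= k ==> norm (g j t-0) < \<eta>*\<bar>f t\<bar>"
    using LIMSEQ_D[OF lim[OF t]] by blast
   thus ?thesis by (intro exI[of _ k]) (auto simp: A_def not_less less_imp_le)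
  qed
 qed
 moreover have "0 < eps/(2 powr (1/\<alpha>)*2)" using e by simp
 ultimately have "\<forall>\<^sub>F k in sequentially. Nr (rs f (A k)) < eps/(2 powr (1/\<alpha>)*2)" by (rule order_tendstoD(2))
 then obtain K where K: "!!k. k >= K ==> Nr (rs f (A k)) < eps/(2 powr (1/\<alpha>)*2)"
  unfolding eventually_sequentially by blast
 have "Nr (g k) < eps" if k: "k >= K" for k
 proof -
  let ?a = "%t. \<eta>*\<bar>f t\<bar>" and ?b = "%t. rs f (A k) t"
  define c where "c = eps/(2 powr (1/\<alpha>)*2)"
  have c0: "0 < c" using e by (simp add: c_def)
  have af: "(%t. \<bar>f t\<bar>) : Er" and Naf: "Nr (%t. \<bar>f t\<bar>) = Nr f" using Nr_pointwise[OF f, of "%t. \<bar>f t\<bar>"] fm by auto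
  have aE: "?a : Er" by (rule Er_scale[OF af])
  have bE: "(%t. \<bar>?b t\<bar>) : Er" "Nr (%t. \<bar>?b t\<bar>) = Nr ?b"
   using Nr_pointwise[OF Er_rs[OF f A[of k]], of "%t. \<bar>?b t\<bar>"] Er_borel[OF Er_rs[OF f A[of k]]] by auto
  have Na: "Nr ?a <= c"
  proof -
   have "Nr ?a = \<eta>*Nr f" using Nr_scale[OF af, of \<eta>] Naf \<eta> by simp
   also have "... <= \<eta>*(Nr f+1)" using \<eta> by simp
   also have "... = c"
   proof -
    have "z/(w * v) * v = z/w" if "v ~= 0" for z w v :: real using that by simp
    from this[of "Nr f+1" eps "2 powr (1/\<alpha>)*2"] show ?thesis unfolding \<eta>_def c_def using Nf by linarith
   qed
   finally show ?thesis .
  qed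
  have Nb: "Nr (%t. \<bar>?b t\<bar>) <= c" using K[OF k] bE by (simp add: c_def)
  have s: "(%t. ?a t+\<bar>?b t\<bar>) : Er" by (rule Er_add[OF aE bE(1)])
  have "Nr (%t. ?a t+\<bar>?b t\<bar>) powr \<alpha> <= Nr ?a powr \<alpha>+Nr (%t. \<bar>?b t\<bar>) powr \<alpha>" by (rule Nr_add[OF aE bE(1)])
  also have "... <= c powr \<alpha>+c powr \<alpha>" by (intro add_mono Nr_powr_mono aE bE Na Nb)
  also have "... = (2 powr (1/\<alpha>)*c) powr \<alpha>" using \<alpha> c0 by (simp add: powr_mult powr_powr)
  finally have "Nr (%t. ?a t+\<bar>?b t\<bar>) <= 2 powr (1/\<alpha>)*c" using c0 by (intro Nr_powr_le s) auto
  also have "... = eps/2" by (simp add: c_def)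
  also have "... < eps" using e by simp
  finally have lt: "Nr (%t. ?a t+\<bar>?b t\<bar>) < eps" .
  have "\<bar>g k t\<bar> <= \<bar>?a t+\<bar>?b t\<bar>\<bar>" if t: "0 < t" for t
  proof (cases "t : A k")
   case True
   have "0 <= \<eta>*\<bar>f t\<bar>" using \<eta> by simp
   thus ?thesis using le[OF t, of k] True by simp
  next
   case False
   hence "\<bar>g k t\<bar> <= \<eta>*\<bar>f t\<bar>" using t by (auto simp: A_def not_less)
   thus ?thesis using False by simp
  qed
  hence "Nr (g k) <= Nr (%t. ?a t+\<bar>?b t\<bar>)" by (intro Er_ideal(2)[OF s g])
  thus ?thesis using lt by linarith
 qed
 thus ?thesis by blast
qed

end

context E_space begin

subsection \<open>Equimeasurability and dilations\<close>

definition lev :: "(real => real) => real => ennreal"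
 where "lev f s = emeasure lborel {t. 0 < t & s < \<bar>f t\<bar>}"

lemma lev_sets: fixes f :: "real => real" shows "f : borel_measurable borel ==> {t. 0 < t & s < \<bar>f t\<bar>} : sets borel"
 using borel_measurable_less[of "%t. s" borel "%t. \<bar>f t\<bar>"]
 by (auto simp: Collect_conj_eq intro!: sets.Int)

text \<open>The rearrangement is computed from the distribution function alone, so symmetry of E can
  be used without computing rearrangements.\<close>

lemma Nr_equi:
 assumes f: "f : Er" and g: "g : borel_measurable borel" and eq: "!!s. 0 <= s ==> lev g s = lev f s"
 shows "g : Er" "Nr g = Nr f"
proof -
 have fm: "f : borel_measurable borel" by (rule Er_borel[OF f])
 let ?P = "%f. rs f {0<..}"
 have P: "emeasure lebesgue_pos {r : {0..}. s < cmod (cf (?P f) r)} = lev f s" if "f : borel_measurable borel" "0 <= s" for f s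
 proof -
  have "{r : {0..}. s < cmod (cf (?P f) r)} = {t. 0 < t & s < \<bar>f t\<bar>}"
   using that(2) by (auto simp: cf_def indicator_def split: if_splits)
  thus ?thesis using lev_sets[OF that(1), of s] by (simp add: lev_def emeasure_restrict_space subset_eq)
 qed
 have E: "cf (?P f) : E" using Er_rs[OF f, of "{0<..}"] by (simp add: Er_def)
 have gm: "?P g : borel_measurable borel" using g by measurable
 have "rearrangement (cf (?P g)) = rearrangement (cf (?P f))"
  unfolding rearrangement_def using P[OF fm] P[OF g] eq
  by (intro ext arg_cong[of _ _ Inf] Collect_cong ex_cong1 conj_cong refl) simp
 hence "cf (?P g) : E & N (cf (?P g)) = N (cf (?P f))" by (intro symmetric E cf_meas gm) simp
 hence Pg: "?P g : Er" "Nr (?P g) = Nr (?P f)" using gm by (auto simp: Er_def Nr_def)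
 have "g : Er & Nr g = Nr (?P g)" by (intro Nr_pointwise Pg g) auto
 moreover have "Nr (?P f) = Nr f" using Nr_pointwise[OF f, of "?P f"] Er_borel[OF Er_rs[OF f, of "{0<..}"]] by auto
 ultimately show "g : Er" "Nr g = Nr f" using Pg by auto
qed

lemma emeasure_shift: assumes "B : sets borel" shows "emeasure lborel {t. t-a : B} = emeasure lborel (B :: real set)"
proof -
 have "emeasure (distr lborel borel ((+) (- a))) B = emeasure lborel ((+) (- a) -` B \<inter> space lborel)"
  using assms by (intro emeasure_distr) auto
 moreover have "(+) (- a) -` B \<inter> space lborel = {t. t-a : B}" by auto
 ultimately show ?thesis by (simp add: lborel_distr_plus)
qed

lemma emeasure_half: assumes "B : sets borel" shows "emeasure lborel {t. t/2 : B} = 2*emeasure lborel (B :: real set)"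
proof -
 have "emeasure (distr lborel borel ((*) (1/2))) B = emeasure lborel ((*) (1/2) -` B \<inter> space lborel)"
  using assms by (intro emeasure_distr) auto
 moreover have "(*) (1/2) -` B \<inter> space lborel = {t. t/2 : B}" by auto
 moreover have "emeasure (distr lborel borel ((*) (1/2))) B = 2*emeasure lborel B"
  using assms by (subst lborel_distr_mult) (auto simp: emeasure_density_const)
 ultimately show ?thesis by simp
qed

text \<open>The half-open unit intervals are distributed alternately to two disjoint copies of \<open>f\<close>.\<close>

definition copy :: "int => (real => real) => real => real"
 where "copy c f t = (if (\<lceil>t\<rceil>-1) mod 2 = c then f (t - of_int ((\<lceil>t\<rceil>-1) div 2) - of_int c) else 0)"

lemma copy_borel:
 assumes "f : borel_measurable borel" shows "copy c f : borel_measurable borel"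
proof -
 have [measurable]: "(%t::real. (\<lceil>t\<rceil>-1) mod 2) : measurable borel (count_space UNIV)"
  "(%t::real. (\<lceil>t\<rceil>-1) div 2) : measurable borel (count_space UNIV)"
  using measurable_compose[OF measurable_real_ceiling, of "%i. (i-1) mod 2" "count_space UNIV"]
   measurable_compose[OF measurable_real_ceiling, of "%i. (i-1) div 2" "count_space UNIV"] by auto
 note [measurable] = assms
 show ?thesis unfolding copy_def by measurable
qed

text \<open>The k-th unit interval is translated to the position 2 k + c; the images are disjoint
  and translation preserves measure.\<close>

lemma lev_copy:
 assumes f: "f : borel_measurable borel" and s: "0 <= s" and c: "c = 0 \<or> c = 1"
 shows "lev (copy c f) s = lev f s"
proof -
 define L where "L = {t. 0 < t & s < \<bar>f t\<bar>}"
 have L: "L : sets borel" unfolding L_def by (rule lev_sets[OF f])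
 define B where "B k = L \<inter> {real k<..real k+1}" for k
 define A where "A k = {t. t-(real k + of_int c) : B k}" for k
 have B: "B k : sets borel" for k unfolding B_def using L by auto
 have A: "A k : sets borel" for k
 proof -
  have "A k = (%t. t-(real k + of_int c)) -` B k \<inter> space borel" by (auto simp: A_def)
  also have "... : sets borel" using B by (intro measurable_sets[OF borel_measurable_diff]) auto
  finally show ?thesis .
 qed
 have ceil: "\<lceil>t\<rceil> = 2*int k+c+1" if "t : A k" for t k
  using that by (intro ceiling_unique) (auto simp: A_def B_def)
 have dA: "disjoint_family A" unfolding disjoint_family_on_def
 proof (intro ballI impI, rule ccontr)
  fix i j assume "i ~= j" "A i \<inter> A j ~= {}"
  then obtain t where "t : A i" "t : A j" by blast
  thus False using ceil[of t i] ceil[of t j] \<open>i ~= j\<close> by simp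
 qed
 have dB: "disjoint_family B" unfolding disjoint_family_on_def
 proof (intro ballI impI, rule ccontr)
  fix i j assume "i ~= j" "B i \<inter> B j ~= {}"
  then obtain t where "t : {real i<..real i+1}" "t : {real j<..real j+1}" unfolding B_def by blast
  hence "\<lceil>t\<rceil> = int i+1" "\<lceil>t\<rceil> = int j+1" by (auto intro!: ceiling_unique)
  thus False using \<open>i ~= j\<close> by simp
 qed
 have "{t. 0 < t & s < \<bar>copy c f t\<bar>} = (\<Union>k. A k)"
 proof (intro set_eqI iffI)
  fix t assume t: "t : {t. 0 < t & s < \<bar>copy c f t\<bar>}"
  define k where "k = nat ((\<lceil>t\<rceil>-1) div 2)"
  have m: "(\<lceil>t\<rceil>-1) mod 2 = c" using t s by (auto simp: copy_def split: if_splits)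
  have "0 < \<lceil>t\<rceil>" using t by simp
  hence k: "(\<lceil>t\<rceil>-1) div 2 = int k" by (simp add: k_def)
  hence K: "\<lceil>t\<rceil> = 2*int k+c+1" using m mult_div_mod_eq[of 2 "\<lceil>t\<rceil>-1"] by linarith
  hence "real_of_int \<lceil>t\<rceil> = 2*real k + of_int c+1" by simp
  hence b: "2*real k + of_int c < t" "t <= 2*real k + of_int c+1" using ceiling_correct[of t] by linarith+
  have "s < \<bar>f (t-real k - of_int c)\<bar>" using t m k by (simp add: copy_def)
  hence "t : A k" using b by (auto simp: A_def B_def L_def algebra_simps)
  thus "t : (\<Union>k. A k)" by blast
 next
  fix t assume "t : (\<Union>k. A k)"
  then obtain k where t: "t : A k" by blast
  have "(\<lceil>t\<rceil>-1) mod 2 = c" "(\<lceil>t\<rceil>-1) div 2 = int k" using ceil[OF t] c by auto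
  thus "t : {t. 0 < t & s < \<bar>copy c f t\<bar>}" using t c by (auto simp: A_def B_def L_def copy_def algebra_simps)
 qed
 hence "lev (copy c f) s = (\<Sum>k. emeasure lborel (A k))"
  using suminf_emeasure[of A lborel] A dA by (simp add: lev_def image_subset_iff)
 also have "... = (\<Sum>k. emeasure lborel (B k))" unfolding A_def using emeasure_shift[OF B] by simp
 also have "... = emeasure lborel (\<Union>k. B k)" using B dB by (intro suminf_emeasure) auto
 also have "(\<Union>k. B k) = L"
 proof (intro set_eqI iffI)
  fix t assume t: "t : L"
  hence "0 < \<lceil>t\<rceil>" by (simp add: L_def)
  hence "real (nat (\<lceil>t\<rceil>-1)) = of_int \<lceil>t\<rceil>-1" by simp
  hence "t : B (nat (\<lceil>t\<rceil>-1))" using t ceiling_correct[of t] unfolding B_def by auto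
  thus "t : (\<Union>k. B k)" by blast
 qed (auto simp: B_def)
 finally show ?thesis by (simp add: lev_def L_def)
qed

lemma lev_copies:
 assumes f: "f : borel_measurable borel" and s: "0 <= s"
 shows "lev (%t. copy 0 f t+copy 1 f t) s = 2*lev f s"
proof -
 have "{t. 0 < t & s < \<bar>copy 0 f t+copy 1 f t\<bar>} = {t. 0 < t & s < \<bar>copy 0 f t\<bar>} \<union> {t. 0 < t & s < \<bar>copy 1 f t\<bar>}"
  using s by (auto simp: copy_def)
 moreover have "{t. 0 < t & s < \<bar>copy 0 f t\<bar>} \<inter> {t. 0 < t & s < \<bar>copy 1 f t\<bar>} = {}"
  using s by (auto simp: copy_def)
 ultimately have "lev (%t. copy 0 f t+copy 1 f t) s = lev (copy 0 f) s+lev (copy 1 f) s"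
  unfolding lev_def using lev_sets[OF copy_borel[OF f]] by (simp add: plus_emeasure)
 thus ?thesis using lev_copy[OF f s] by (simp add: mult_2)
qed

text \<open>The dilated function is equimeasurable with the sum of two disjoint copies of
  \<open>f\<close>, to which \<alpha>-subadditivity applies.\<close>

lemma dilate_up:
 assumes f: "f : Er" shows "(%t. f (t/2)) : Er" "Nr (%t. f (t/2)) powr \<alpha> <= 2*Nr f powr \<alpha>"
proof -
 have fm: "f : borel_measurable borel" by (rule Er_borel[OF f])
 have C: "copy c f : Er" "Nr (copy c f) = Nr f" if "c = 0 \<or> c = 1" for c
  using Nr_equi[OF f copy_borel[OF fm]] lev_copy[OF fm _ that] by auto
 let ?g = "%t. copy 0 f t+copy 1 f t"
 have g: "?g : Er" using C by (intro Er_add) auto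
 have "lev (%t. f (t/2)) s = lev ?g s" if "0 <= s" for s
 proof -
  have "{t. 0 < t & s < \<bar>f (t/2)\<bar>} = {t. t/2 : {t. 0 < t & s < \<bar>f t\<bar>}}" by auto
  hence "lev (%t. f (t/2)) s = 2*lev f s" unfolding lev_def using emeasure_half[OF lev_sets[OF fm]] by simp
  thus ?thesis using lev_copies[OF fm that] by simp
 qed
 moreover have "(%t. f (t/2)) : borel_measurable borel" using fm by measurable
 ultimately have "(%t. f (t/2)) : Er & Nr (%t. f (t/2)) = Nr ?g" using Nr_equi[OF g] by blast
 moreover have "Nr ?g powr \<alpha> <= 2*Nr f powr \<alpha>" using Nr_add[of "copy 0 f" "copy 1 f"] C by simp
 ultimately show "(%t. f (t/2)) : Er" "Nr (%t. f (t/2)) powr \<alpha> <= 2*Nr f powr \<alpha>" by auto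
qed

text \<open>The identity behind \<open>dilate_up\<close> read backwards: \<open>f\<close> is
  equimeasurable with two disjoint copies of the contracted function, and the lower estimate yields
  a gain of 2^(-1/q).\<close>

lemma dilate_down:
 assumes f: "f : Er" and f2: "(%t. f (2*t)) : Er" shows "2*Nr (%t. f (2*t)) powr q <= Nr f powr q"
proof -
 let ?h = "%t. f (2*t)"
 have fm: "f : borel_measurable borel" by (rule Er_borel[OF f])
 have hm: "?h : borel_measurable borel" by (rule Er_borel[OF f2])
 have C: "copy c ?h : Er" "Nr (copy c ?h) = Nr ?h" if "c = 0 \<or> c = 1" for c
  using Nr_equi[OF f2 copy_borel[OF hm]] lev_copy[OF hm _ that] by auto
 let ?g = "%t. copy 0 ?h t+copy 1 ?h t"
 have "lev ?g s = lev f s" if "0 <= s" for s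
 proof -
  have "{t. 0 < t & s < \<bar>f t\<bar>} = {t. t/2 : {t. 0 < t & s < \<bar>?h t\<bar>}}" by auto
  hence "lev f s = 2*lev ?h s" unfolding lev_def using emeasure_half[OF lev_sets[OF hm]] by simp
  thus ?thesis using lev_copies[OF hm that] by simp
 qed
 moreover have "?g : borel_measurable borel" using copy_borel[OF hm] by (intro borel_measurable_add)
 ultimately have "Nr ?g = Nr f" using Nr_equi(2)[OF f] by blast
 moreover have "Nr (copy 0 ?h) powr q+Nr (copy 1 ?h) powr q <= Nr ?g powr q"
  using C by (intro Nr_lower2) (auto simp: copy_def)
 ultimately show ?thesis using C by simp
qed

lemma dilate_up_pow:
 assumes f: "f : Er" shows "(%t. f (t/2^k)) : Er" "Nr (%t. f (t/2^k)) powr \<alpha> <= 2^k*Nr f powr \<alpha>"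
proof -
 have "(%t. f (t/2^k)) : Er & Nr (%t. f (t/2^k)) powr \<alpha> <= 2^k*Nr f powr \<alpha>"
 proof (induction k)
  case (Suc k)
  have "(%t. f (t/2^Suc k)) = (%t. (%t. f (t/2^k)) (t/2))" by (simp add: divide_divide_eq_left)
  thus ?case using dilate_up[of "%t. f (t/2^k)"] Suc by auto
 qed (use f in simp)
 thus "(%t. f (t/2^k)) : Er" "Nr (%t. f (t/2^k)) powr \<alpha> <= 2^k*Nr f powr \<alpha>" by auto
qed

definition decr :: "(real => real) => bool"
 where "decr f \<longleftrightarrow> f : borel_measurable borel & (\<forall>t>0. 0 <= f t) & (\<forall>s t. 0 < s --> s <= t --> f t <= f s)"

lemma decr_dilate: "decr f ==> 0 < c ==> decr (%t. f (c*t))"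
 unfolding decr_def by auto

lemma decr_dilate_Er: assumes "f : Er" "decr f" "1 <= c" shows "(%t. f (c*t)) : Er" "Nr (%t. f (c*t)) <= Nr f"
proof -
 have m: "(%t. f (c*t)) : borel_measurable borel" using assms(2,3) decr_dilate[of f c] by (simp add: decr_def)
 have "\<bar>f (c*t)\<bar> <= \<bar>f t\<bar>" if "0 < t" for t
 proof -
  have "t <= c*t" using that assms(3) by simp
  moreover have "0 < c*t" using that assms(3) by simp
  ultimately show ?thesis using assms(2) that by (auto simp: decr_def)
 qed
 thus "(%t. f (c*t)) : Er" "Nr (%t. f (c*t)) <= Nr f" using Er_ideal[OF assms(1) m] by auto
qed

lemma dilate_down_pow:
 assumes f: "f : Er" "decr f" shows "2^k*Nr (%t. f (2^k*t)) powr q <= Nr f powr q"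
proof (induction k)
 case (Suc k)
 have E: "(%t. f (2^k*t)) : Er" for k using decr_dilate_Er[OF f, of "2^k"] by simp
 have "(%t. f (2^Suc k*t)) = (%t. (%t. f (2^k*t)) (2*t))" by (simp add: mult_ac)
 hence "2*Nr (%t. f (2^Suc k*t)) powr q <= Nr (%t. f (2^k*t)) powr q"
  using dilate_down[of "%t. f (2^k*t)"] E[of k] E[of "Suc k"] by simp
 hence "2^k*(2*Nr (%t. f (2^Suc k*t)) powr q) <= 2^k*Nr (%t. f (2^k*t)) powr q"
  by (intro mult_left_mono) auto
 also have "... <= Nr f powr q" by (rule Suc)
 finally show ?case by (simp only: power_Suc mult_ac)
qed simp

text \<open>Otherwise a positive constant belongs to the space; being its own contraction it has
  norm 0 by \<open>dilate_down\<close>, which is absurd.\<close>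

lemma decr_vanishes:
 assumes f: "f : Er" "decr f" and s: "0 < s" shows "\<exists>t>0. f t < s"
proof (rule ccontr)
 assume "\<not> (\<exists>t>0. f t < s)"
 hence ge: "s <= f t" if "0 < t" for t using that by force
 have c: "(%t. s) : Er" using s ge by (intro Er_ideal(1)[OF f(1)]) fastforce+
 have "2*Nr (%t. s) powr q <= Nr (%t. s) powr q" using dilate_down[OF c] c by simp
 hence "Nr (%t. s) powr q = 0" by (smt (verit) powr_ge_zero)
 hence "N (cf (%t. s)) = 0" by (simp add: Nr_def)
 hence "AE t in lebesgue_pos. cf (%t. s) t = 0" using eq_0_iff[of "cf (%t. s)"] c by (simp add: Er_def)
 hence "AE t in lebesgue_pos. False" using s by (simp add: cf_def)
 hence "emeasure lebesgue_pos (space lebesgue_pos) = 0" by (simp add: eventually_False ae_filter_eq_bot_iff)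
 moreover have "emeasure lebesgue_pos {0..1} <= emeasure lebesgue_pos (space lebesgue_pos)"
  by (intro emeasure_mono) (auto simp: sets_restrict_space image_iff intro!: exI[of _ "{0..1::real}"])
 moreover have "emeasure lebesgue_pos {0..1} = 1" by (simp add: emeasure_restrict_space)
 ultimately show False by simp
qed


subsection \<open>Decreasing rearrangement\<close>

definition rearr :: "(real => real) => real => real"
 where "rearr u t = (if 0 < t then Inf {s. 0 <= s & lev u s <= ennreal t} else 0)"

lemma lev_mono: "u : borel_measurable borel ==> s <= s' ==> lev u s' <= lev u s"
 unfolding lev_def by (intro emeasure_mono) (auto simp: lev_sets)

text \<open>The level set at s is the increasing union of those at s + 1/(n+1). As a consequence the
  infimum in \<open>rearr\<close> is attained.\<close>

lemma lev_right_cont: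
 assumes u: "u : borel_measurable borel" and le: "!!s'. s < s' ==> lev u s' <= c" shows "lev u s <= c"
proof -
 have "{t. 0 < t & s < \<bar>u t\<bar>} = (\<Union>n. {t. 0 < t & s+1/real (Suc n) < \<bar>u t\<bar>})"
 proof (intro set_eqI iffI)
  fix t assume "t : {t. 0 < t & s < \<bar>u t\<bar>}"
  moreover then obtain n where "1/real (Suc n) < \<bar>u t\<bar>-s" using reals_Archimedean[of "\<bar>u t\<bar>-s"] by (auto simp: inverse_eq_divide)
  ultimately show "t : (\<Union>n. {t. 0 < t & s+1/real (Suc n) < \<bar>u t\<bar>})" by (auto intro!: exI[of _ n])
 next
  fix t assume "t : (\<Union>n. {t. 0 < t & s+1/real (Suc n) < \<bar>u t\<bar>})"
  then obtain n where "0 < t" "s+1/real (Suc n) < \<bar>u t\<bar>" by blast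
  moreover have "0 < 1/real (Suc n)" by simp
  ultimately show "t : {t. 0 < t & s < \<bar>u t\<bar>}" unfolding mem_Collect_eq by linarith
 qed
 moreover have "emeasure lborel (\<Union>n. {t. 0 < t & s+1/real (Suc n) < \<bar>u t\<bar>}) = (SUP n. emeasure lborel {t. 0 < t & s+1/real (Suc n) < \<bar>u t\<bar>})"
 proof (rule SUP_emeasure_incseq[symmetric])
  show "range (%n. {t. 0 < t & s+1/real (Suc n) < \<bar>u t\<bar>}) \<subseteq> sets lborel" using lev_sets[OF u] by auto
  show "incseq (%n. {t. 0 < t & s+1/real (Suc n) < \<bar>u t\<bar>})"
  proof (rule incseq_SucI, rule subsetI)
   fix n t assume "t : {t. 0 < t & s+1/real (Suc n) < \<bar>u t\<bar>}"
   moreover have "1/real (Suc (Suc n)) <= 1/real (Suc n)" by (simp add: frac_le)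
   ultimately show "t : {t. 0 < t & s+1/real (Suc (Suc n)) < \<bar>u t\<bar>}" unfolding mem_Collect_eq by linarith
  qed
 qed
 moreover have "... <= c" using le by (intro SUP_least) (auto simp: lev_def[symmetric])
 ultimately show ?thesis by (simp add: lev_def)
qed

lemma rearr_le_iff:
 assumes u: "u : borel_measurable borel" and ex: "\<exists>s\<ge>0. lev u s <= ennreal t" and t: "0 < t" and s: "0 <= s"
 shows "rearr u t <= s \<longleftrightarrow> lev u s <= ennreal t"
proof
 let ?S = "{s. 0 <= s & lev u s <= ennreal t}"
 have b: "bdd_below ?S" by (intro bdd_belowI[of _ 0]) auto
 show "rearr u t <= s" if "lev u s <= ennreal t" using that s t b by (auto simp: rearr_def intro: cInf_lower)
 assume le: "rearr u t <= s"
 show "lev u s <= ennreal t"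
 proof (rule lev_right_cont[OF u])
  fix s' assume "s < s'"
  hence *: "Inf ?S < s'" using le t by (simp add: rearr_def)
  have "?S ~= {}" using ex by auto
  from cInf_lessD[OF this *] obtain r where "r : ?S" "r < s'" by (elim bexE)
  thus "lev u s' <= ennreal t" using lev_mono[OF u, of r s'] by auto
 qed
qed

text \<open>A decreasing majorant \<open>Y\<close> confines the level set of \<open>u\<close> above
  Y t to [0, t], so the infimum defining the rearrangement at t > 0 is over a nonempty set.\<close>

lemma rearr:
 assumes u: "u : borel_measurable borel" and Y: "decr Y" and le: "!!t. 0 < t ==> \<bar>u t\<bar> <= Y t"
 shows "decr (rearr u)" "!!s. 0 <= s ==> lev (rearr u) s = lev u s"
  "!!s t. 0 < t ==> 0 <= s ==> rearr u t <= s ==> lev u s <= ennreal t"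
proof -
 have ex: "\<exists>s\<ge>0. lev u s <= ennreal t" if t: "0 < t" for t
 proof (intro exI conjI)
  show "0 <= Y t" using Y t by (simp add: decr_def)
  have "{r. 0 < r & Y t < \<bar>u r\<bar>} \<subseteq> {0..t}"
  proof
   fix r assume "r : {r. 0 < r & Y t < \<bar>u r\<bar>}"
   hence r: "0 < r" "Y t < Y r" using le[of r] by auto
   have "Y r <= Y t" if "t <= r" using Y t that by (simp add: decr_def)
   thus "r : {0..t}" using r by force
  qed
  hence "lev u (Y t) <= emeasure lborel {0..t}" unfolding lev_def by (intro emeasure_mono) auto
  thus "lev u (Y t) <= ennreal t" using t by simp
 qed
 have nn: "0 <= rearr u t" for t using ex[of t] by (auto simp: rearr_def intro!: cInf_greatest)
 have iff: "rearr u t <= s \<longleftrightarrow> lev u s <= ennreal t" if "0 < t" "0 <= s" for s t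
  by (rule rearr_le_iff[OF u ex[OF that(1)] that])
 thus "!!s t. 0 < t ==> 0 <= s ==> rearr u t <= s ==> lev u s <= ennreal t" by blast
 have mono: "rearr u t <= rearr u s" if "0 < s" "s <= t" for s t
 proof -
  have "lev u (rearr u s) <= ennreal s" using iff[of s "rearr u s"] that nn by auto
  also have "... <= ennreal t" using that by (intro ennreal_leI)
  finally show ?thesis using iff[of t "rearr u s"] that nn by auto
 qed
 have L: "{t. 0 < t & s < \<bar>rearr u t\<bar>} = {t. 0 < t & ennreal t < lev u s}" if "0 <= s" for s
  using iff[OF _ that] nn by (auto simp: not_le[symmetric])
 have S: "{t. 0 < t & ennreal t < lev u s} : sets borel" and E: "emeasure lborel {t. 0 < t & ennreal t < lev u s} = lev u s" for s
 proof -
  have "{t. 0 < t & ennreal t < lev u s} : sets borel & emeasure lborel {t. 0 < t & ennreal t < lev u s} = lev u s"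
  proof (cases "lev u s" rule: ennreal_cases)
   case (real r)
   hence "{t. 0 < t & ennreal t < lev u s} = {0<..<r}" by (auto simp: ennreal_less_iff)
   thus ?thesis using real by simp
  next
   case top
   hence "{t. 0 < t & ennreal t < lev u s} = {0<..}" by auto
   moreover have "emeasure lborel {0::real<..} = \<infinity>"
   proof -
    have "top <= emeasure lborel {0::real<..}"
    proof (rule dense_le)
     fix y :: ennreal assume "y < top"
     then obtain r where r: "y = ennreal r" "0 <= r" by (cases y rule: ennreal_cases) auto
     have "y = emeasure lborel {0<..<r}" using r by simp
     also have "... <= emeasure lborel {0::real<..}" by (intro emeasure_mono) auto
     finally show "y <= emeasure lborel {0::real<..}" .
    qed
    thus ?thesis by (simp add: top_unique)
   qed
   ultimately show ?thesis using top by simp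
  qed
  thus "{t. 0 < t & ennreal t < lev u s} : sets borel" "emeasure lborel {t. 0 < t & ennreal t < lev u s} = lev u s" by auto
 qed
 have "rearr u : borel_measurable borel"
 proof (rule borel_measurable_iff_greater[THEN iffD2], rule allI)
  fix a
  show "{w : space borel. a < rearr u w} : sets borel"
  proof (cases "0 <= a")
   case True
   have "{w : space borel. a < rearr u w} = {t. 0 < t & a < \<bar>rearr u t\<bar>}"
    using nn True by (auto simp: rearr_def split: if_splits)
   thus ?thesis using L[OF True] S by simp
  next
   case False
   hence "a < rearr u w" for w using nn[of w] by linarith
   hence "{w : space borel. a < rearr u w} = UNIV" by simp
   thus ?thesis by simp
  qed
 qed
 thus "decr (rearr u)" using nn mono by (auto simp: decr_def)
 show "!!s. 0 <= s ==> lev (rearr u) s = lev u s" using L E unfolding lev_def by simp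
qed

end

context E_space begin

subsection \<open>Uniform monotonicity\<close>

lemma powr_less_1: "0 < a ==> 0 < x ==> x < 1 ==> x powr a < (1::real)"
 using powr_less_mono2[of a x 1] by simp

text \<open>On the set \<open>Z\<close> where W < \<omega> Y the function \<open>W\<close> loses a
  fixed fraction. Averaging \<alpha>-th powers shows that \<open>Y\<close> restricted to the
  complement has almost full norm, and then the lower estimate makes \<open>Y\<close> small on
  \<open>Z\<close>. Off \<open>Z\<close> the difference of the powers is at most (\<zeta>
  Y)^ka.\<close>

lemma norm_gap:
 assumes ka: "0 < ka" and si: "0 < si"
 obtains de where "0 < de" "de < 1" "!!W Y. Y : Er ==> W : borel_measurable borel ==> (!!t. 0 < t ==> 0 <= W t & W t <= Y t) ==>
  Nr Y <= 1 ==> 1-de <= Nr W ==> Nr (%t. (Y t powr ka-W t powr ka) powr (1/ka)) <= si"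
proof -
 \<comment> \<open>Two terms of norm at most \<zeta> remain at the end, and 2 \<zeta>^\<alpha> \<le>
   si^\<alpha>.\<close>
 define \<zeta> where "\<zeta> = min (1/2) (si/2 powr (1/\<alpha>))"
 have \<zeta>: "0 < \<zeta>" "\<zeta> < 1" "\<zeta> <= si/2 powr (1/\<alpha>)" using si by (auto simp: \<zeta>_def)
 define r where "r = \<zeta> powr ka"
 have r: "0 < r" "r < 1" using \<zeta> ka by (auto simp: r_def powr_less_1)
 define \<omega> where "\<omega> = (1-r) powr (1/ka)"
 have \<omega>: "0 < \<omega>" "\<omega> < 1" using r ka by (auto simp: \<omega>_def powr_less_1)
 define ta where "ta = \<omega> powr \<alpha>"
 have ta: "0 < ta" "ta < 1" using \<omega> \<alpha> by (auto simp: ta_def powr_less_1)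
 define \<pi>' where "\<pi>' = (1-\<zeta> powr q) powr (\<alpha>/q)"
 have zq: "0 < \<zeta> powr q" "\<zeta> powr q < 1" using \<zeta> q_pos by (auto simp: powr_less_1)
 have \<pi>': "0 < \<pi>'" "\<pi>' < 1" using zq \<alpha> q_pos by (auto simp: \<pi>'_def powr_less_1)
 \<comment> \<open>Equals ta + (1 - ta) \<pi>': the bound for the \<alpha>-th power of the norm of
   \<open>W\<close> if that of \<open>Y\<close> off \<open>Z\<close> were only \<pi>'. Defining
   \<open>de\<close> by it forces at least \<pi>'.\<close>
 define a where "a = 1-(1-ta)*(1-\<pi>')"
 have "0 < (1-ta)*(1-\<pi>')" using ta \<pi>' by simp
 moreover have "(1-ta)*(1-\<pi>') < 1*1" using ta \<pi>' by (intro mult_strict_mono) auto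
 ultimately have a: "0 < a" "a < 1" by (auto simp: a_def)
 define de where "de = 1-a powr (1/\<alpha>)"
 have de: "0 < de" "de < 1" using a \<alpha> by (auto simp: de_def powr_less_1)
 show thesis
 proof (rule that[OF de])
  fix W Y assume Y: "Y : Er" and Wm: "W : borel_measurable borel" and WY: "!!t. 0 < t ==> 0 <= W t & W t <= Y t"
   and NY: "Nr Y <= 1" and NW: "1-de <= Nr W"
  have Ym: "Y : borel_measurable borel" by (rule Er_borel[OF Y])
  define Z where "Z = {t. W t < \<omega>*Y t}"
  have Z: "Z : sets borel" unfolding Z_def using borel_measurable_less[of W borel "%t. \<omega>*Y t"] Wm Ym by simp
  have Zc: "- Z : sets borel" using Z by auto
  let ?f = "%t. (1-ta) powr (1/\<alpha>)*rs Y (- Z) t" and ?g = "%t. ta powr (1/\<alpha>)*Y t"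
  have f: "?f : Er" and g: "?g : Er" by (intro Er_scale Er_rs Y Zc)+
  have P0: "0 <= Nr (rs Y (- Z))" by (intro Nr_nonneg Er_rs Y Zc)
  have Nf: "Nr ?f powr \<alpha> = (1-ta)*Nr (rs Y (- Z)) powr \<alpha>"
   using Nr_scale[OF Er_rs[OF Y Zc], of "(1-ta) powr (1/\<alpha>)"] ta \<alpha> P0 by (simp add: powr_mult powr_powr)
  have Ng: "Nr ?g powr \<alpha> <= ta"
  proof -
   have "Nr ?g powr \<alpha> = ta*Nr Y powr \<alpha>"
    using Nr_scale[OF Y, of "ta powr (1/\<alpha>)"] ta \<alpha> Nr_nonneg[OF Y] by (simp add: powr_mult powr_powr)
   also have "... <= ta*1" using Nr_powr_mono[OF Y NY] ta by (intro mult_left_mono) auto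
   finally show ?thesis by simp
  qed
  let ?h = "%t. (\<bar>?f t\<bar> powr \<alpha>+\<bar>?g t\<bar> powr \<alpha>) powr (1/\<alpha>)"
  \<comment> \<open>Pointwise W^\<alpha> is at most ta Y^\<alpha> plus (1 - ta) Y^\<alpha> off
    \<open>Z\<close>: on \<open>Z\<close> by the choice of \<omega>, off \<open>Z\<close> because W
    \<le> Y.\<close>
  have hW: "\<bar>W t\<bar> <= \<bar>?h t\<bar>" if t: "0 < t" for t
  proof -
   have Y0: "0 <= Y t" and WYt: "0 <= W t" "W t <= Y t" using WY[OF t] by auto
   have g': "\<bar>?g t\<bar> powr \<alpha> = ta*Y t powr \<alpha>" using ta \<alpha> Y0 by (simp add: abs_mult powr_mult powr_powr)
   have "W t powr \<alpha> <= \<bar>?f t\<bar> powr \<alpha>+\<bar>?g t\<bar> powr \<alpha>"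
   proof (cases "t : Z")
    case True
    hence "W t powr \<alpha> <= (\<omega>*Y t) powr \<alpha>" using WYt \<alpha> by (intro powr_mono2) (auto simp: Z_def)
    also have "... = ta*Y t powr \<alpha>" using \<omega> Y0 by (simp add: powr_mult ta_def)
    finally show ?thesis unfolding g' using True \<alpha> by simp
   next
    case False
    hence "\<bar>?f t\<bar> powr \<alpha> = (1-ta)*Y t powr \<alpha>" using ta \<alpha> Y0 by (simp add: abs_mult powr_mult powr_powr)
    moreover have "W t powr \<alpha> <= Y t powr \<alpha>" using WYt \<alpha> by (intro powr_mono2) auto
    ultimately show ?thesis unfolding g' by (simp add: algebra_simps)
   qed
   hence "(W t powr \<alpha>) powr (1/\<alpha>) <= ?h t" using \<alpha> by (intro powr_mono2) auto
   thus ?thesis using \<alpha> WYt by (simp add: powr_powr)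
  qed
  have hE: "?h : Er" by (rule alpha_sum_Er[OF f g])
  have WE: "W : Er" using Er_ideal(1)[OF Y Wm] WY by force
  have "a = (1-de) powr \<alpha>" using a \<alpha> by (simp add: de_def powr_powr)
  also have "... <= Nr W powr \<alpha>" using NW de \<alpha> by (intro powr_mono2) auto
  also have "... <= Nr ?h powr \<alpha>" using Er_ideal(2)[OF hE Wm hW] by (intro Nr_powr_mono WE)
  also have "... <= Nr ?f powr \<alpha>+Nr ?g powr \<alpha>" by (rule Nr_alpha[OF f g])
  also have "... <= (1-ta)*Nr (rs Y (- Z)) powr \<alpha>+ta" using Nf Ng by simp
  finally have "(1-ta)*\<pi>' <= (1-ta)*Nr (rs Y (- Z)) powr \<alpha>" by (simp add: a_def algebra_simps)
  hence "\<pi>' <= Nr (rs Y (- Z)) powr \<alpha>" using ta by simp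
  hence "\<pi>' powr (q/\<alpha>) <= (Nr (rs Y (- Z)) powr \<alpha>) powr (q/\<alpha>)" using \<pi>' \<alpha> q_pos by (intro powr_mono2) auto
  hence P: "1-\<zeta> powr q <= Nr (rs Y (- Z)) powr q" using \<alpha> q_pos zq by (simp add: \<pi>'_def powr_powr)
  have YE: "rs Y Z : Er" by (rule Er_rs[OF Y Z])
  have "Nr (rs Y Z) powr q+Nr (rs Y (- Z)) powr q <= Nr (%t. rs Y Z t+rs Y (- Z) t) powr q"
   by (intro Nr_lower2 Er_rs Y Z Zc) (auto simp: indicator_def)
  also have "(%t. rs Y Z t+rs Y (- Z) t) = Y" by (auto simp: indicator_def)
  also have "Nr Y powr q <= 1 powr q" using NY Nr_nonneg[OF Y] q_pos by (intro powr_mono2) auto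
  finally have zz: "Nr (rs Y Z) powr q <= \<zeta> powr q" using P by simp
  have NZ: "Nr (rs Y Z) <= \<zeta>"
  proof (rule ccontr)
   assume "\<not> Nr (rs Y Z) <= \<zeta>"
   hence "\<zeta> powr q < Nr (rs Y Z) powr q" using \<zeta> q_pos by (intro powr_less_mono2) auto
   thus False using zz by simp
  qed
  let ?U = "%t. (Y t powr ka-W t powr ka) powr (1/ka)"
  let ?V = "%t. \<zeta>*Y t+rs Y Z t"
  have zY: "(%t. \<zeta>*Y t) : Er" by (rule Er_scale[OF Y])
  have VE: "?V : Er" by (rule Er_add[OF zY YE])
  have Um: "?U : borel_measurable borel" using Ym Wm by measurable
  have UV: "\<bar>?U t\<bar> <= \<bar>?V t\<bar>" if t: "0 < t" for t
  proof -
   have Y0: "0 <= Y t" and WYt: "0 <= W t" "W t <= Y t" using WY[OF t] by auto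
   have p: "W t powr ka <= Y t powr ka" using WYt ka by (intro powr_mono2) auto
   have zY0: "0 <= \<zeta>*Y t" using \<zeta> Y0 by simp
   show ?thesis
   proof (cases "t : Z")
    case True
    have "?U t <= (Y t powr ka) powr (1/ka)" using p ka by (intro powr_mono2) auto
    thus ?thesis using True ka Y0 zY0 by (simp add: powr_powr)
   next
    case False
    hence "(\<omega>*Y t) powr ka <= W t powr ka" using \<omega> Y0 ka by (intro powr_mono2) (auto simp: Z_def)
    hence "(1-r)*Y t powr ka <= W t powr ka" using \<omega> Y0 ka r by (simp add: powr_mult \<omega>_def powr_powr)
    hence "?U t <= (r*Y t powr ka) powr (1/ka)" using p ka by (intro powr_mono2) (auto simp: algebra_simps)
    also have "... = \<zeta>*Y t" using \<zeta> Y0 ka by (simp add: r_def powr_mult powr_powr)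
    finally show ?thesis using False zY0 by simp
   qed
  qed
  have UE: "?U : Er" by (rule Er_ideal(1)[OF VE Um UV])
  have "Nr ?U powr \<alpha> <= Nr ?V powr \<alpha>" by (intro Nr_powr_mono UE Er_ideal(2)[OF VE Um UV])
  also have "... <= Nr (%t. \<zeta>*Y t) powr \<alpha>+Nr (rs Y Z) powr \<alpha>" by (rule Nr_add[OF zY YE])
  also have "... <= \<zeta> powr \<alpha>+\<zeta> powr \<alpha>"
   using Nr_scale[OF Y, of \<zeta>] \<zeta> NY Nr_nonneg[OF Y] by (intro add_mono Nr_powr_mono NZ YE zY) (simp add: mult_le_cancel_left2)
  also have "... <= 2*(si/2 powr (1/\<alpha>)) powr \<alpha>" using powr_mono2[of \<alpha> \<zeta> "si/2 powr (1/\<alpha>)"] \<zeta> \<alpha> by simp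
  also have "... = si powr \<alpha>" using si \<alpha> by (simp add: powr_divide powr_powr)
  finally show "Nr ?U <= si" using si by (intro Nr_powr_le UE) auto
 qed
qed


subsection \<open>Controlling a function by integrated gaps\<close>

text \<open>The consequence of the trace inequality for m = \<mu>(b - a), isolated so that the
  estimate in E concerns functions only.\<close>

definition gap_bound :: "real => (real => real) => (real => real) => (real => real) => bool"
 where "gap_bound ka Y W m \<longleftrightarrow> (\<forall>ga t. 0 < ga --> 0 < t -->
  (\<integral>\<^sup>+ r. ennreal (indicator {0<..} r*(max 0 (Y r powr ka-ga)-max 0 (W r powr ka-ga))) \<partial>lborel) <= ennreal (ga*t) --> m t <= 2*ga)"

text \<open>\<open>hY\<close> confines the integrand to (0, L t]. There the gap u = Y^ka - W^ka is
  at most nu plus the dyadic layers above 2^j nu, whose sets have measure at most t / 4^(j+1) by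
  \<open>hV\<close>. The integral is then at most 2 ga t, and \<open>gap_bound\<close> is applied at
  2 t.\<close>

lemma tr_gap_pointwise:
 fixes L :: real
 assumes ka: "0 < ka" and L: "1 <= L" and Y: "decr Y" and Wm: "W : borel_measurable borel"
  and WY: "!!t. 0 < t ==> 0 <= W t & W t <= Y t" and B: "!!t. 0 < t ==> Y t <= B"
  and TI: "gap_bound ka Y W m"
  and U: "U = (%t. (Y t powr ka-W t powr ka) powr (1/ka))"
  and t: "0 < t" and ga: "0 < ga" and BJ: "B powr ka <= 2^J*(ga/L)"
  and hY: "Y (L*t) powr ka <= ga" and hV: "!!j. j < J ==> rearr U (t/4^Suc j) <= (2^j*(ga/L)) powr (1/ka)"
 shows "m (2*t) <= 2*ga"
proof -
 have Ym: "Y : borel_measurable borel" and Y0: "!!t. 0 < t ==> 0 <= Y t" and Yd: "!!s t. 0 < s ==> s <= t ==> Y t <= Y s"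
  using Y by (auto simp: decr_def)
 have Um: "U : borel_measurable borel" unfolding U using Ym Wm by measurable
 \<comment> \<open>The base height spread over (0, L t] then contributes exactly ga t.\<close>
 define nu where "nu = ga/L"
 have nu: "0 < nu" "nu <= ga" using ga L by (auto simp: nu_def divide_le_eq mult_le_cancel_left1)
 have WYk: "W r powr ka <= Y r powr ka" if "0 < r" for r using WY[OF that] ka by (intro powr_mono2) auto
 have U0: "0 <= U r" for r by (simp add: U)
 have UY: "\<bar>U r\<bar> <= Y r" if r: "0 < r" for r
 proof -
  have "U r <= (Y r powr ka) powr (1/ka)" unfolding U using ka WYk[OF r] by (intro powr_mono2) auto
  thus ?thesis using U0[of r] Y0[OF r] ka by (simp add: powr_powr)
 qed
 define S where "S j = {r. 0 < r & (2^j*nu) powr (1/ka) < \<bar>U r\<bar>}" for j :: nat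
 have S: "S j : sets borel" for j unfolding S_def by (rule lev_sets[OF Um])
 have Siff: "r : S j \<longleftrightarrow> 2^j*nu < Y r powr ka-W r powr ka" if r: "0 < r" for r j
 proof -
  let ?u = "Y r powr ka-W r powr ka"
  have p: "0 <= 2^j*nu" "0 <= ?u" using nu WYk[OF r] by auto
  have "(2^j*nu) powr (1/ka) < ?u powr (1/ka) \<longleftrightarrow> 2^j*nu < ?u"
   using powr_less_mono2[of "1/ka" "2^j*nu" ?u] powr_mono2[of "1/ka" ?u "2^j*nu"] ka p
   by (meson divide_pos_pos less_eq_real_def linorder_not_le zero_less_one)
  thus ?thesis using r by (simp add: S_def U)
 qed
 let ?I = "%r. indicator {0<..} r*(max 0 (Y r powr ka-ga)-max 0 (W r powr ka-ga)) :: real"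
 let ?K = "%r. nu*indicator {0..L*t} r+(\<Sum>j<J. 2^Suc j*nu*indicator (S j) r) :: real"
 \<comment> \<open>Only the highest dyadic level below u is needed; its term 2^(j+1) nu already
   dominates u. The bound \<open>B\<close> makes finitely many levels sufficient.\<close>
 have dy: "u <= nu+(\<Sum>j<J. if 2^j*nu < u then 2^Suc j*nu else 0)" if "u <= 2^J*nu" for u
  using that
 proof (induction J)
  case (Suc J)
  have nn: "0 <= (\<Sum>j<J. if 2^j*nu < u then 2^Suc j*nu else 0)" using nu by (intro sum_nonneg) auto
  show ?case
  proof (cases "2^J*nu < u")
   case True
   thus ?thesis using Suc.prems nn nu by simp
  next
   case False
   thus ?thesis using Suc.IH by simp
  qed
 qed simp
 have IK: "?I r <= ?K r" for r
 proof (cases "0 < r & ga < Y r powr ka")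
  case True
  have rL: "r <= L*t"
  proof (rule ccontr)
   assume "\<not> r <= L*t"
   hence "Y r powr ka <= Y (L*t) powr ka" using Yd[of "L*t" r] Y0 t L ka True by (intro powr_mono2) auto
   thus False using hY True by linarith
  qed
  let ?u = "Y r powr ka-W r powr ka"
  have "Y r powr ka <= B powr ka" using B Y0 True ka by (intro powr_mono2) auto
  moreover have "0 <= W r powr ka" by simp
  ultimately have u: "?u <= 2^J*nu" using BJ unfolding nu_def by linarith
  have "?u <= nu+(\<Sum>j<J. 2^Suc j*nu*indicator (S j) r)"
  proof -
   have "(\<Sum>j<J. 2^Suc j*nu*indicator (S j) r) = (\<Sum>j<J. if 2^j*nu < Y r powr ka-W r powr ka then 2^Suc j*nu else 0)"
    using Siff True by (intro sum.cong) (auto simp: indicator_def)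
   thus ?thesis using dy[OF u] by simp
  qed
  moreover have "?I r <= ?u" using True WYk[of r] by (auto simp: max_def)
  ultimately show ?thesis using rL True by (simp add: indicator_def)
 next
  case False
  have "0 <= ?K r" using nu by (intro add_nonneg_nonneg sum_nonneg) auto
  moreover have "?I r <= 0" using False by (auto simp: indicator_def)
  ultimately show ?thesis by linarith
 qed
 have levS: "emeasure lborel (S j) <= ennreal (t/4^Suc j)" if "j < J" for j
  using rearr(3)[OF Um Y UY, of "t/4^Suc j" "(2^j*nu) powr (1/ka)"] hV[OF that] t by (simp add: lev_def S_def nu_def)
 have Sm: "(%r. ennreal (2^Suc j*nu)*indicator (S j) r) : borel_measurable lborel" for j using S by simp
 have "(\<integral>\<^sup>+ r. ennreal (?I r) \<partial>lborel) <= (\<integral>\<^sup>+ r. ennreal nu*indicator {0..L*t} r+(\<Sum>j<J. ennreal (2^Suc j*nu)*indicator (S j) r) \<partial>lborel)"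
 proof (rule nn_integral_mono)
  fix r
  have "ennreal (?I r) <= ennreal (?K r)" by (rule ennreal_leI[OF IK])
  also have "... = ennreal (nu*indicator {0..L*t} r)+ennreal (\<Sum>j<J. 2^Suc j*nu*indicator (S j) r)"
   using nu by (intro ennreal_plus sum_nonneg) auto
  also have "ennreal (\<Sum>j<J. 2^Suc j*nu*indicator (S j) r) = (\<Sum>j<J. ennreal (2^Suc j*nu*indicator (S j) r))"
   using nu by (intro sum_ennreal[symmetric]) auto
  finally show "ennreal (?I r) <= ennreal nu*indicator {0..L*t} r+(\<Sum>j<J. ennreal (2^Suc j*nu)*indicator (S j) r)"
   using nu by (simp add: ennreal_mult' ennreal_indicator)
 qed
 also have "... = ennreal nu*emeasure lborel {0..L*t}+(\<Sum>j<J. ennreal (2^Suc j*nu)*emeasure lborel (S j))"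
 proof -
  have "(\<integral>\<^sup>+ r. ennreal nu*indicator {0..L*t} r+(\<Sum>j<J. ennreal (2^Suc j*nu)*indicator (S j) r) \<partial>lborel)
   = (\<integral>\<^sup>+ r. ennreal nu*indicator {0..L*t} r \<partial>lborel)+(\<integral>\<^sup>+ r. (\<Sum>j<J. ennreal (2^Suc j*nu)*indicator (S j) r) \<partial>lborel)"
   using Sm by (intro nn_integral_add borel_measurable_sum) auto
  also have "(\<integral>\<^sup>+ r. (\<Sum>j<J. ennreal (2^Suc j*nu)*indicator (S j) r) \<partial>lborel) = (\<Sum>j<J. \<integral>\<^sup>+ r. ennreal (2^Suc j*nu)*indicator (S j) r \<partial>lborel)"
   by (rule nn_integral_sum[OF Sm])
  also have "... = (\<Sum>j<J. ennreal (2^Suc j*nu)*emeasure lborel (S j))"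
   using S by (intro sum.cong nn_integral_cmult_indicator) auto
  also have "(\<integral>\<^sup>+ r. ennreal nu*indicator {0..L*t} r \<partial>lborel) = ennreal nu*emeasure lborel {0..L*t}"
   by (intro nn_integral_cmult_indicator) auto
  finally show ?thesis .
 qed
 also have "... <= ennreal nu*ennreal (L*t)+(\<Sum>j<J. ennreal (2^Suc j*nu)*ennreal (t/4^Suc j))"
  using levS t L by (intro add_mono sum_mono mult_left_mono) auto
 also have "... = ennreal (nu*(L*t)+(\<Sum>j<J. 2^Suc j*nu*(t/4^Suc j)))"
 proof -
  have "ennreal nu*ennreal (L*t) = ennreal (nu*(L*t))" using nu by (intro ennreal_mult'[symmetric]) simp
  moreover have "(\<Sum>j<J. ennreal (2^Suc j*nu)*ennreal (t/4^Suc j)) = (\<Sum>j<J. ennreal (2^Suc j*nu*(t/4^Suc j)))"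
   using nu t by (intro sum.cong ennreal_mult'[symmetric]) auto
  moreover have "... = ennreal (\<Sum>j<J. 2^Suc j*nu*(t/4^Suc j))" using nu t by (intro sum_ennreal) auto
  moreover have "ennreal (nu*(L*t))+ennreal (\<Sum>j<J. 2^Suc j*nu*(t/4^Suc j)) = ennreal (nu*(L*t)+(\<Sum>j<J. 2^Suc j*nu*(t/4^Suc j)))"
   using nu t L by (intro ennreal_plus[symmetric] sum_nonneg) auto
  ultimately show ?thesis by (simp only:)
 qed
 \<comment> \<open>The layers contribute nu t times a geometric series with sum at most 1, and nu
   \<le> ga.\<close>
 also have "... <= ennreal (ga*(2*t))"
 proof (rule ennreal_leI)
  have geo: "(\<Sum>j<n. (1/2)^Suc j) <= (1::real)" for n
  proof -
   have "(\<Sum>j<n. (1/2)^Suc j) = 1-(1/2::real)^n" by (induction n) auto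
   thus ?thesis by simp
  qed
  have e: "2^Suc j*nu*(t/4^Suc j) = (nu*t)*(1/2)^Suc j" for j
  proof -
   have "(4::real)^Suc j = 2^Suc j*2^Suc j" by (simp add: power_mult_distrib[symmetric])
   thus ?thesis by (simp add: power_one_over field_simps)
  qed
  have "(\<Sum>j<J. 2^Suc j*nu*(t/4^Suc j)) = (nu*t)*(\<Sum>j<J. (1/2)^Suc j)"
   unfolding e by (rule sum_distrib_left[symmetric])
  also have "... <= (nu*t)*1" using nu t by (intro mult_left_mono geo) auto
  also have "... <= ga*t" using nu t by simp
  finally show "nu*(L*t)+(\<Sum>j<J. 2^Suc j*nu*(t/4^Suc j)) <= ga*(2*t)"
   using L by (simp add: nu_def)
 qed
 finally show ?thesis using TI ga t unfolding gap_bound_def by auto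
qed

text \<open>A function S of small norm is built so that at each t the hypotheses of
  \<open>tr_gap_pointwise\<close> hold with ga about S(t)^ka / 2. This gives m(2 t) \<le> S(t)^ka
  except where m(2 t) is tiny. The three contributions to the norm get \<open>bt\<close> =
  si^\<alpha> / 3 each.\<close>

lemma tr_gap:
 assumes ka: "0 < ka" "3*ka <= \<alpha>" and si: "0 < si"
 obtains de where "0 < de" "de < 1" "!!W Y m B. Y : Er ==> decr Y ==> W : borel_measurable borel ==>
  (!!t. 0 < t ==> 0 <= W t & W t <= Y t & Y t <= B) ==> Nr Y <= 1 ==> 1-de <= Nr W ==> decr m ==>
  (!!t. 0 < t ==> m t <= Y t powr ka) ==> gap_bound ka Y W m ==>
  (%t. m (2*t) powr (1/ka)) : Er & Nr (%t. m (2*t) powr (1/ka)) <= si"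
proof -
 define c where "c = 2 powr (1/ka)"
 have c: "0 < c" by (simp add: c_def)
 define bt where "bt = si powr \<alpha>/3"
 have bt: "0 < bt" using si by (simp add: bt_def)
 \<comment> \<open>Contracting the variable by L = 2^l shrinks the norm by 2^(-l/q), which makes the
   term c Y(L t) of S small.\<close>
 obtain l :: nat where l: "c powr \<alpha>*2 powr (- real l*(\<alpha>/q)) <= bt"
 proof -
  obtain l :: nat where "log 2 (c powr \<alpha>/bt)/(\<alpha>/q) < real l" using reals_Archimedean2 by blast
  hence "log 2 (c powr \<alpha>/bt) < real l*(\<alpha>/q)" using \<alpha> q_pos pos_divide_less_eq[of "\<alpha>/q"] by simp
  hence "c powr \<alpha>/bt < 2 powr (real l*(\<alpha>/q))" using c bt by (subst (asm) log_less_iff) auto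
  hence "c powr \<alpha>*2 powr (- (real l*(\<alpha>/q))) <= bt" using bt by (simp add: powr_minus field_simps)
  thus ?thesis using that by simp
 qed
 define L :: real where "L = 2^l"
 have L: "1 <= L" by (simp add: L_def)
 \<comment> \<open>The norm allowed for the gap function U; the layers of S, dilated rearrangements
   of U, then sum up to \<open>bt\<close>. The factor 8 comes from 4^(j+1) / 8^j = 8 /
   2^(j+1).\<close>
 define ro where "ro = (bt/(8*(c*L powr (1/ka)) powr \<alpha>)) powr (1/\<alpha>)"
 have cL: "0 < c*L powr (1/ka)" using c L by simp
 hence ro: "0 < ro" unfolding ro_def using bt c L by simp
 have ro\<alpha>: "8*(c*L powr (1/ka)) powr \<alpha>*ro powr \<alpha> = bt"
 proof -
  have "ro powr \<alpha> = bt/(8*(c*L powr (1/ka)) powr \<alpha>)" using \<alpha> bt cL by (simp add: ro_def powr_powr)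
  moreover have "8*(c*L powr (1/ka)) powr \<alpha> ~= 0" using c L by simp
  ultimately show ?thesis by simp
 qed
 obtain de where de: "0 < de" "de < 1" and gap: "!!W Y. Y : Er ==> W : borel_measurable borel ==> (!!t. 0 < t ==> 0 <= W t & W t <= Y t) ==>
  Nr Y <= 1 ==> 1-de <= Nr W ==> Nr (%t. (Y t powr ka-W t powr ka) powr (1/ka)) <= ro"
  by (fact norm_gap[OF ka(1) ro])
 show thesis
 proof (rule that[OF de])
  fix W Y m B
  assume Y: "Y : Er" "decr Y" and Wm: "W : borel_measurable borel" and WYB: "!!t. 0 < t ==> 0 <= W t & W t <= Y t & Y t <= B"
   and NY: "Nr Y <= 1" and NW: "1-de <= Nr W" and m: "decr m" and mY: "!!t. 0 < t ==> m t <= Y t powr ka" and TI: "gap_bound ka Y W m"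
  define U where "U = (%t. (Y t powr ka-W t powr ka) powr (1/ka))"
  have Ym: "Y : borel_measurable borel" and Y0: "!!t. 0 < t ==> 0 <= Y t" and Yd: "!!s t. 0 < s ==> s <= t ==> Y t <= Y s"
   using Y by (auto simp: decr_def)
  have mm: "(%t. m (2*t)) : borel_measurable borel" and m0: "!!t. 0 < t ==> 0 <= m t" using m by (auto simp: decr_def)
  have Um: "U : borel_measurable borel" unfolding U_def using Ym Wm by measurable
  have UY: "\<bar>U r\<bar> <= Y r" if r: "0 < r" for r
  proof -
   have "W r powr ka <= Y r powr ka" using WYB[OF r] ka by (intro powr_mono2) auto
   hence "U r <= (Y r powr ka) powr (1/ka)" unfolding U_def using ka by (intro powr_mono2) auto
   thus ?thesis using Y0[OF r] ka by (simp add: U_def powr_powr)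
  qed
  have UE: "U : Er" using Er_ideal(1)[OF Y(1) Um] UY by force
  have NU: "Nr U <= ro" unfolding U_def by (rule gap[OF Y(1) Wm _ NY NW]) (use WYB in blast)
  define V where "V = rearr U"
  have V: "decr V" unfolding V_def by (rule rearr(1)[OF Um Y(2) UY])
  have VE: "V : Er" "Nr V = Nr U" unfolding V_def
   using Nr_equi[OF UE _ rearr(2)[OF Um Y(2) UY]] V by (auto simp: decr_def V_def)
  define M where "M = (%t. m (2*t) powr (1/ka))"
  have Mm: "M : borel_measurable borel" unfolding M_def using mm by measurable
  have MY: "\<bar>M t\<bar> <= \<bar>Y t\<bar>" if t: "0 < t" for t
  proof -
   have "M t <= (Y (2*t) powr ka) powr (1/ka)" unfolding M_def using mY[of "2*t"] m0[of "2*t"] t ka by (intro powr_mono2) auto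
   thus ?thesis using Yd[of t "2*t"] Y0[of "2*t"] Y0[OF t] t ka by (simp add: powr_powr M_def)
  qed
  have ME: "M : Er" by (rule Er_ideal(1)[OF Y(1) Mm MY])
  \<comment> \<open>The part where m(2 t) is small. Dominated convergence disposes of it; the index
    depends on the functions, which is harmless because \<open>de\<close> is already fixed.\<close>
  define g where "g k t = (if m (2*t) <= 2/real (Suc k) then M t else 0)" for k t
  have gm: "g k : borel_measurable borel" for k unfolding g_def using mm Mm by measurable
  have gE: "g k : Er" for k by (rule Er_ideal(1)[OF Y(1) gm]) (use MY in \<open>auto simp: g_def\<close>)
  have "\<exists>K. \<forall>k\<ge>K. Nr (g k) < bt powr (1/\<alpha>)"
  proof (rule dom_conv[OF Y(1) gm])
   show "\<bar>g k t\<bar> <= \<bar>Y t\<bar>" if "0 < t" for k t using MY[OF that] by (simp add: g_def)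
   show "(%k. g k t) \<longlonglongrightarrow> 0" if t: "0 < t" for t
   proof (cases "m (2*t) = 0")
    case True
    hence "g k t = 0" for k by (simp add: g_def M_def)
    thus ?thesis by simp
   next
    case False
    hence "0 < m (2*t)/2" using m0[of "2*t"] t by simp
    then obtain n where "inverse (real (Suc n)) < m (2*t)/2" using reals_Archimedean by blast
    hence n: "2/real (Suc n) < m (2*t)" by (simp add: inverse_eq_divide)
    have "g k t = 0" if "n <= k" for k
    proof -
     have "2/real (Suc k) <= 2/real (Suc n)" using that by (simp add: frac_le)
     thus ?thesis using n by (simp add: g_def)
    qed
    thus ?thesis by (intro tendsto_eventually) (auto simp: eventually_sequentially)
   qed
   show "0 < bt powr (1/\<alpha>)" using bt by simp
  qed
  then obtain k where k: "Nr (g k) < bt powr (1/\<alpha>)" by blast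
  define ga\<^sub>0 where "ga\<^sub>0 = 1/real (Suc k)"
  have ga0: "0 < ga\<^sub>0" by (simp add: ga\<^sub>0_def)
  obtain J :: nat where J: "B powr ka <= 2^J*(ga\<^sub>0/L)"
  proof -
   obtain J where "B powr ka/(ga\<^sub>0/L) < 2^J" using real_arch_pow[of 2 "B powr ka/(ga\<^sub>0/L)"] by auto
   hence "B powr ka < 2^J*(ga\<^sub>0/L)" using ga0 L by (subst (asm) pos_divide_less_eq) auto
   thus ?thesis using that[of J] by simp
  qed
  \<comment> \<open>The weight is such that \<open>G j t\<close> \<le> c ga^(1/ka) is the same as
    the condition \<open>hV\<close> of \<open>tr_gap_pointwise\<close>.\<close>
  define G where "G j t = c*L powr (1/ka)/(2^j) powr (1/ka)*V (t/4^Suc j)" for j t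
  define S where "S t = c*Y (L*t)+(\<Sum>j<J. G j t)" for t
  have YL: "(%t. Y (L*t)) : Er" by (rule decr_dilate_Er[OF Y L])
  have V4: "(%t. V (t/4^Suc j)) : Er" "Nr (%t. V (t/4^Suc j)) powr \<alpha> <= 4^Suc j*Nr U powr \<alpha>" for j
  proof -
   have e: "(4::real)^Suc j = 2^(2*Suc j)" by (simp add: power_mult)
   show "(%t. V (t/4^Suc j)) : Er" "Nr (%t. V (t/4^Suc j)) powr \<alpha> <= 4^Suc j*Nr U powr \<alpha>"
    using dilate_up_pow[OF VE(1), of "2*Suc j"] VE(2) unfolding e by auto
  qed
  have GE: "G j : Er" for j unfolding G_def by (intro Er_scale V4)
  have SE: "S : Er" unfolding S_def by (intro Er_add Er_sum Er_scale GE YL)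
  have V0: "0 <= V t" if "0 < t" for t using V that by (simp add: decr_def)
  have G0: "0 <= G j t" if "0 < t" for j t unfolding G_def using V0[of "t/4^Suc j"] that c by (intro mult_nonneg_nonneg divide_nonneg_nonneg) auto
  have MgS: "M t <= g k t+S t" if t: "0 < t" for t
  proof (cases "m (2*t) <= 2*ga\<^sub>0")
   case True
   have "0 <= S t" unfolding S_def using G0[OF t] Y0[of "L*t"] t L c by (intro add_nonneg_nonneg sum_nonneg) auto
   thus ?thesis using True by (simp add: g_def ga\<^sub>0_def)
  next
   case False
   have sG: "0 <= (\<Sum>j<J. G j t)" by (intro sum_nonneg G0 t)
   have cY: "0 <= c*Y (L*t)" using Y0[of "L*t"] t L c by simp
   have S0: "0 <= S t" unfolding S_def using cY sG by simp
   \<comment> \<open>Then S(t)^ka \<le> 2 ga, which yields all hypotheses at t; and where m(2 t) > 2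
     \<open>ga\<^sub>0\<close> the conclusion m(2 t) \<le> 2 ga can only mean m(2 t) \<le>
     S(t)^ka.\<close>
   define ga where "ga = max ga\<^sub>0 (S t powr ka/2)"
   have ga: "ga\<^sub>0 <= ga" "S t powr ka/2 <= ga" "0 < ga" using ga0 by (auto simp: ga_def)
   have "(S t powr ka) powr (1/ka) <= (2*ga) powr (1/ka)" using ga ka by (intro powr_mono2) auto
   hence Sga: "S t <= c*ga powr (1/ka)" using S0 ka ga by (simp add: powr_powr powr_mult c_def)
   have "m (2*t) <= 2*ga"
   proof (rule tr_gap_pointwise[OF ka(1) L Y(2) Wm _ _ TI U_def t ga(3)])
    show "0 <= W t & W t <= Y t" "Y t <= B" if "0 < t" for t using WYB[OF that] by auto
    have "2^J*(ga\<^sub>0/L) <= 2^J*(ga/L)" using ga L by (intro mult_left_mono divide_right_mono) auto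
    thus "B powr ka <= 2^J*(ga/L)" using J by linarith
    have "c*Y (L*t) <= c*ga powr (1/ka)" using Sga sG by (simp add: S_def)
    hence "Y (L*t) <= ga powr (1/ka)" using c by simp
    hence "Y (L*t) powr ka <= (ga powr (1/ka)) powr ka" using Y0[of "L*t"] t L ka by (intro powr_mono2) auto
    thus "Y (L*t) powr ka <= ga" using ka ga by (simp add: powr_powr)
    fix j assume j: "j < J"
    have "G j t <= (\<Sum>j<J. G j t)" using j G0[OF t] by (intro member_le_sum) auto
    hence "G j t <= c*ga powr (1/ka)" using Sga cY by (simp add: S_def)
    hence le: "c*L powr (1/ka)/(2^j) powr (1/ka)*V (t/4^Suc j) <= c*ga powr (1/ka)" by (simp only: G_def)
    have "v <= p*(x/y)" if le: "c*y/p * v <= c*x" and y: "0 < y" and p: "0 < p" for v p x y :: real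
    proof -
     have "c*y/p * v = c*(y/p * v)" by simp
     hence "c*(y/p * v) <= c*x" using le by simp
     hence "y/p * v <= x" by (rule mult_left_le_imp_le[OF _ c])
     thus ?thesis using y p by (simp add: field_simps)
    qed
    from this[OF le] have "V (t/4^Suc j) <= (2^j) powr (1/ka)*(ga powr (1/ka)/L powr (1/ka))" using L by auto
    also have "... = (2^j*(ga/L)) powr (1/ka)" using ga L by (simp add: powr_mult powr_divide)
    finally show "rearr U (t/4^Suc j) <= (2^j*(ga/L)) powr (1/ka)" by (simp add: V_def)
   qed
   hence "m (2*t) <= S t powr ka" using False by (auto simp: ga_def max_def split: if_splits)
   hence "M t <= (S t powr ka) powr (1/ka)" unfolding M_def using m0[of "2*t"] t ka by (intro powr_mono2) auto
   thus ?thesis using S0 ka False by (simp add: powr_powr g_def ga\<^sub>0_def)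
  qed
  have sumE: "(%t. g k t+S t) : Er" by (rule Er_add[OF gE SE])
  have "Nr M <= Nr (%t. g k t+S t)"
  proof (rule Er_ideal(2)[OF sumE Mm])
   show "\<bar>M t\<bar> <= \<bar>g k t+S t\<bar>" if "0 < t" for t using MgS[OF that] by (simp add: M_def)
  qed
  hence "Nr M powr \<alpha> <= Nr (%t. g k t+S t) powr \<alpha>" by (intro Nr_powr_mono ME)
  also have "... <= Nr (g k) powr \<alpha>+Nr S powr \<alpha>" by (rule Nr_add[OF gE SE])
  also have "Nr S powr \<alpha> <= Nr (%t. c*Y (L*t)) powr \<alpha>+Nr (%t. \<Sum>j<J. G j t) powr \<alpha>"
   unfolding S_def by (intro Nr_add Er_sum Er_scale GE YL)
  also have "Nr (%t. \<Sum>j<J. G j t) powr \<alpha> <= (\<Sum>j<J. Nr (G j) powr \<alpha>)" by (intro Nr_sum GE)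
  finally have tot: "Nr M powr \<alpha> <= Nr (g k) powr \<alpha>+(Nr (%t. c*Y (L*t)) powr \<alpha>+(\<Sum>j<J. Nr (G j) powr \<alpha>))" by simp
  have b1: "Nr (g k) powr \<alpha> <= bt"
   using Nr_powr_mono[OF gE less_imp_le[OF k]] \<alpha> bt by (simp add: powr_powr)
  have b2: "Nr (%t. c*Y (L*t)) powr \<alpha> <= bt"
  proof -
   let ?n = "Nr (%t. Y (L*t))"
   have n0: "0 <= ?n" by (rule Nr_nonneg[OF YL])
   have "2^l*?n powr q <= Nr Y powr q" using dilate_down_pow[OF Y, of l] by (simp add: L_def)
   also have "... <= 1 powr q" using NY Nr_nonneg[OF Y(1)] q_pos by (intro powr_mono2) auto
   finally have "?n powr q <= 2 powr (- real l)" by (simp add: powr_minus powr_realpow field_simps)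
   hence "(?n powr q) powr (\<alpha>/q) <= (2 powr (- real l)) powr (\<alpha>/q)" using \<alpha> q_pos by (intro powr_mono2) auto
   hence "?n powr \<alpha> <= 2 powr (- real l*(\<alpha>/q))" using q_pos by (simp add: powr_powr)
   hence "c powr \<alpha>*?n powr \<alpha> <= c powr \<alpha>*2 powr (- real l*(\<alpha>/q))" by (intro mult_left_mono) auto
   moreover have "Nr (%t. c*Y (L*t)) powr \<alpha> = c powr \<alpha>*?n powr \<alpha>"
    using Nr_scale[OF YL, of c] c n0 by (simp add: powr_mult)
   ultimately show ?thesis using l by linarith
  qed
  have b3: "(\<Sum>j<J. Nr (G j) powr \<alpha>) <= bt"
  proof -
   define D where "D = (c*L powr (1/ka)) powr \<alpha>*ro powr \<alpha>"
   have D: "0 <= D" "8*D = bt" using ro\<alpha> by (auto simp: D_def)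
   have "Nr (G j) powr \<alpha> <= 8*D*(1/2)^Suc j" for j
   proof -
    let ?a = "c*L powr (1/ka)/(2^j) powr (1/ka)"
    have a: "0 < ?a" using cL by simp
    have "Nr (G j) = ?a*Nr (%t. V (t/4^Suc j))" unfolding G_def using Nr_scale[OF V4(1), of ?a j] a by (simp only: abs_of_pos)
    hence "Nr (G j) powr \<alpha> = ?a powr \<alpha>*Nr (%t. V (t/4^Suc j)) powr \<alpha>"
     by (simp only: powr_mult)
    also have "... <= ?a powr \<alpha>*(4^Suc j*ro powr \<alpha>)"
     using V4(2)[of j] Nr_powr_mono[OF UE NU] by (intro mult_left_mono) (auto intro: order_trans)
    also have "?a powr \<alpha> = (c*L powr (1/ka)) powr \<alpha>/((2^j) powr (1/ka)) powr \<alpha>" by (rule powr_divide)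
    also have "((2^j) powr (1/ka)) powr \<alpha> = 2 powr (real j*(\<alpha>/ka))" by (simp add: powr_realpow[symmetric] powr_powr)
    also have "(c*L powr (1/ka)) powr \<alpha>/2 powr (real j*(\<alpha>/ka))*(4^Suc j*ro powr \<alpha>) = D*(4^Suc j/2 powr (real j*(\<alpha>/ka)))"
     by (simp add: D_def)
    \<comment> \<open>The only use of 3 ka \<le> \<alpha>: the weights decay at least like 8^-j and
      beat the dilation cost 4^(j+1).\<close>
    also have "... <= D*(4^Suc j/8^j)"
    proof (intro mult_left_mono divide_left_mono D)
     have "3 <= \<alpha>/ka" using ka by (simp add: pos_le_divide_eq)
     hence "2 powr (real j*3) <= 2 powr (real j*(\<alpha>/ka))" by (intro powr_mono mult_left_mono) auto
     moreover have "2 powr (real j*3) = (8::real)^j"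
     proof -
      have "2 powr (real j*3) = (2::real) powr real (3*j)" by (simp add: mult.commute)
      also have "... = 2^(3*j)" by (subst powr_realpow) auto
      finally show ?thesis by (simp add: power_mult)
     qed
     ultimately show "8^j <= 2 powr (real j*(\<alpha>/ka))" by simp
    qed auto
    also have "... = 8*D*(1/2)^Suc j"
    proof -
     have "(8::real)^j = 4^j*2^j" by (simp add: power_mult_distrib[symmetric])
     thus ?thesis by (simp add: power_one_over)
    qed
    finally show ?thesis .
   qed
   hence "(\<Sum>j<J. Nr (G j) powr \<alpha>) <= (\<Sum>j<J. bt*(1/2)^Suc j)" unfolding D(2) by (rule sum_mono)
   also have "... = bt*(1-(1/2)^J)"
   proof -
    have "(\<Sum>j<n. (1/2)^Suc j) = 1-(1/2::real)^n" for n by (induction n) auto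
    thus ?thesis unfolding sum_distrib_left[symmetric] by simp
   qed
   also have "... <= bt" using bt by (simp add: mult_le_cancel_left2)
   finally show ?thesis .
  qed
  have "Nr M powr \<alpha> <= si powr \<alpha>" using tot b1 b2 b3 by (simp add: bt_def)
  hence "Nr M <= si" using si by (intro Nr_powr_le ME) auto
  thus "(%t. m (2*t) powr (1/ka)) : Er & Nr (%t. m (2*t) powr (1/ka)) <= si" using ME by (simp add: M_def)
 qed
qed

end

locale vn_E = vn_trace M \<tau> + E_space E N \<alpha> q
 for M :: "('h::complex_hilbert => 'h) set" and \<tau> E N \<alpha> q
begin

section \<open>Singular value functions\<close>

text \<open>Real-valued singular values. At t \<le> 0, where the true value may be infinite, the
  value 0 is irrelevant for the norm.\<close>

definition muf :: "'h unbdd_op => real => real"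
 where "muf z t = (if 0 < t then Inf {s. 0 <= s & dle z t s} else 0)"

lemma muf_le: "dle z t s ==> 0 <= s ==> muf z t <= s"
 unfolding muf_def by (auto intro!: cInf_lower bdd_belowI[of _ 0])

context
 fixes z assumes z: "tmeas z"
begin

lemma muf_ex: "0 < t ==> {s. 0 <= s & dle z t s} ~= {}"
 using z by (auto simp: tmeas_def)

lemma muf_nonneg: "0 <= muf z t"
 unfolding muf_def using muf_ex[of t] by (auto intro!: cInf_greatest)

lemma muf_less: assumes "0 < t" "muf z t < s" shows "dle z t s"
proof -
 have "Inf {s. 0 <= s & dle z t s} < s" using assms by (simp add: muf_def)
 from cInf_lessD[OF muf_ex[OF assms(1)] this] obtain r where r: "dle z t r" "r < s" by auto
 show ?thesis by (rule dle_mono[OF r(1) order_refl less_imp_le[OF r(2)]])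
qed

lemma muf_decr: "decr (muf z)"
proof -
 have mono: "muf z t <= muf z s" if "0 < s" "s <= t" for s t
 proof (rule dense_le)
  fix r assume "r < muf z t"
  show "r <= muf z s"
  proof (rule ccontr)
   assume "\<not> r <= muf z s"
   hence d: "dle z s r" "0 <= r" using that muf_less[of s r] muf_nonneg[of s] by auto
   have "muf z t <= r" by (rule muf_le[OF dle_mono[OF d(1) that(2) order_refl] d(2)])
   thus False using \<open>r < muf z t\<close> by simp
  qed
 qed
 have "{w. a < muf z w} : sets borel" for a
 proof (cases "0 <= a")
  case True
  hence "0 < w" if "a < muf z w" for w using that by (auto simp: muf_def split: if_splits)
  hence "is_interval {w. a < muf z w}" unfolding is_interval_1 by (fastforce intro: less_le_trans mono)
  thus ?thesis by (rule real_interval_borel_measurable)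
 next
  case False
  hence "a < muf z w" for w using muf_nonneg[of w] by linarith
  thus ?thesis by simp
 qed
 hence "muf z : borel_measurable borel" by (simp add: borel_measurable_iff_greater)
 thus ?thesis using mono muf_nonneg by (auto simp: decr_def)
qed

lemma muf_borel: "muf z : borel_measurable borel" using muf_decr by (simp add: decr_def)

lemma muf_le_muf:
 assumes t: "0 < t" and le: "!!s. 0 <= s ==> dle z t s ==> muf w r <= s" shows "muf w r <= muf z t"
proof (rule dense_ge)
 fix s assume "muf z t < s"
 thus "muf w r <= s" using muf_less[OF t] muf_nonneg[of t] le by auto
qed

end

abbreviation mB :: "('h => 'h) => real => real"
 where "mB T \<equiv> muf (graph_of T)"

lemma M_tmeas: assumes "T : M" shows "tmeas (graph_of T)"
proof -
 obtain K where "K > 0" "!!x. norm (T x) <= K*norm x" using bcl_bdd[OF M_bcl[OF assms]] by blast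
 thus ?thesis unfolding tmeas_def by (intro allI impI exI[of _ K]) (auto intro!: dB_bdd)
qed

lemma mB_bound: "0 < t ==> (!!x. norm (T x) <= K*norm x) ==> 0 <= K ==> mB T t <= K"
 by (rule muf_le[OF dB_bdd]) auto

lemma mB_nle:
 assumes T: "T : M" and n: "!!x. norm (S x) <= norm (T x)" and t: "0 < t" shows "mB S t <= mB T t"
proof (rule muf_le_muf[OF M_tmeas[OF T] t])
 fix s assume s: "0 <= s" "dB T t s"
 show "mB S t <= s" by (rule muf_le[OF dB_nle[OF s(2) n] s(1)])
qed

lemma mB_adj: assumes T: "T : M" shows "mB (adj T) t = mB T t"
proof (cases "0 < t")
 case True
 have le: "mB (adj S) t <= mB S t" if S: "S : M" for S
 proof (rule muf_le_muf[OF M_tmeas[OF S] True])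
  fix s assume s: "0 <= s" "dB S t s"
  show "mB (adj S) t <= s" by (rule muf_le[OF dB_adj[OF S s(2,1)] s(1)])
 qed
 show ?thesis using le[OF T] le[OF M_adj[OF T]] by (simp add: adj_adj[OF M_bcl[OF T]])
qed (simp add: muf_def)

lemma mB_square: assumes T: "T : M" shows "mB (%x. adj T (T x)) t = (mB T t)^2"
proof (cases "0 < t")
 case True
 have TT: "(%x. adj T (T x)) : M" by (rule M_compose[OF M_adj[OF T] T])
 note Tm = M_tmeas[OF T] and TTm = M_tmeas[OF TT]
 have "sqrt (mB (%x. adj T (T x)) t) <= mB T t"
 proof (rule dense_ge)
  fix s assume s: "mB T t < s"
  hence s0: "0 <= s" using muf_nonneg[OF Tm, of t] by simp
  have "dB (%x. adj T (T x)) t (s^2)" using dB_square[OF T s0] muf_less[OF Tm True s] by blast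
  hence "mB (%x. adj T (T x)) t <= s^2" by (intro muf_le) auto
  thus "sqrt (mB (%x. adj T (T x)) t) <= s" using s0 by (intro real_le_lsqrt) auto
 qed
 moreover have "mB T t <= sqrt (mB (%x. adj T (T x)) t)"
 proof (rule dense_ge)
  fix s assume s: "sqrt (mB (%x. adj T (T x)) t) < s"
  hence s0: "0 <= s" using muf_nonneg[OF TTm, of t] by (meson less_imp_le order_trans real_sqrt_ge_zero)
  have "(sqrt (mB (%x. adj T (T x)) t))^2 < s^2" using s muf_nonneg[OF TTm, of t] by (intro power_strict_mono) auto
  hence "mB (%x. adj T (T x)) t < s^2" using muf_nonneg[OF TTm, of t] by simp
  hence "dB T t s" using dB_square[OF T s0] muf_less[OF TTm True] by blast
  thus "mB T t <= s" using s0 by (intro muf_le)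
 qed
 ultimately have "mB T t = sqrt (mB (%x. adj T (T x)) t)" by simp
 thus ?thesis using muf_nonneg[OF TTm, of t] by simp
qed (simp add: muf_def)

text \<open>On a common vector of \<open>cutp c s'\<close> and the complement of
  \<open>cutp b s\<close> the strict lower bound for \<open>c\<close> contradicts the upper bound
  for \<open>b\<close>.\<close>

lemma cutp_tr_mono:
 assumes c: "c : M" "positive_op c" and b: "b : M" "positive_op b" and le: "!!x. inner (c x) x <= inner (b x) x"
  and s: "s <= s'"
 shows "\<tau> (cutp c s') <= \<tau> (cutp b s)"
proof -
 have "\<tau> (cutp c s') <= \<tau> (%x. x-(x-cutp b s x))"
 proof (rule tr_disjoint[OF Pr_cutp[OF c] Pr_compl[OF Pr_cutp[OF b]]])
  fix x assume x: "cutp c s' x = x" "x-cutp b s x = x"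
  show "x = 0"
  proof (rule ccontr)
   assume n: "x ~= 0"
   have "s'*(norm x)^2 < inner (c x) x" by (rule cutp_above[OF c x(1) n])
   also have "... <= inner (b x) x" by (rule le)
   also have "... <= s*(norm x)^2" using x(2) by (intro cutp_below[OF b]) simp
   also have "... <= s'*(norm x)^2" using s by (intro mult_right_mono) auto
   finally show False by simp
  qed
 qed
 thus ?thesis by simp
qed

lemma mB_form_mono:
 assumes c: "c : M" "positive_op c" and b: "b : M" "positive_op b" and le: "!!x. inner (c x) x <= inner (b x) x" and t: "0 < t"
 shows "mB c t <= mB b t"
proof (rule muf_le_muf[OF M_tmeas[OF b(1)] t])
 fix s assume s: "0 <= s" "dB b t s"
 hence "dB c t s" using dB_iff_cutp[OF b s(1)] dB_iff_cutp[OF c s(1)] cutp_tr_mono[OF c b le order_refl[of s]] by (auto intro: order_trans)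
 thus "mB c t <= s" using s by (intro muf_le)
qed


section \<open>The trace inequality\<close>

text \<open>F is bounded by upper Riemann sums of d, G from below by lower ones. Over steps of
  length \<eta> the errors telescope to the single term \<eta> d(l), which vanishes with
  \<eta>.\<close>

lemma layer_unique:
 fixes F G d :: "real => ennreal"
 assumes F: "!!s \<eta>. l <= s ==> 0 < \<eta> ==> F s <= F (s+\<eta>)+ennreal \<eta>*d s"
  and G: "!!s \<eta>. l <= s ==> 0 < \<eta> ==> G (s+\<eta>)+ennreal \<eta>*d (s+\<eta>) <= G s"
  and F0: "!!s. K <= s ==> F s = 0" and d: "d l < \<infinity>"
 shows "F l <= G l"
proof -
 have st: "F s <= G s+ennreal \<eta>*d s" if "l <= s" "0 < \<eta>" "K <= s+real j*\<eta>" for s \<eta> j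
  using that
 proof (induction j arbitrary: s)
  case 0 thus ?case by (simp add: F0)
 next
  case (Suc j)
  have "F s <= F (s+\<eta>)+ennreal \<eta>*d s" using Suc.prems by (intro F) auto
  also have "F (s+\<eta>) <= G (s+\<eta>)+ennreal \<eta>*d (s+\<eta>)" using Suc.prems by (intro Suc.IH) (auto simp: algebra_simps)
  also have "... <= G s" using Suc.prems by (intro G) auto
  finally show ?case by (simp add: add_right_mono)
 qed
 obtain r where r: "d l = ennreal r" "0 <= r" using d by (cases "d l" rule: ennreal_cases) auto
 show ?thesis
 proof (rule ennreal_le_epsilon)
  fix e :: real assume e: "0 < e"
  define \<eta> where "\<eta> = e/(r+1)"
  have \<eta>: "0 < \<eta>" using e r by (simp add: \<eta>_def)
  obtain j where "(K-l)/\<eta> < real j" using reals_Archimedean2 by blast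
  hence "K <= l+real j*\<eta>" using \<eta> by (simp add: pos_divide_less_eq)
  hence "F l <= G l+ennreal \<eta>*d l" using \<eta> by (intro st) auto
  also have "ennreal \<eta>*d l = ennreal (\<eta>*r)" using r \<eta> by (simp add: ennreal_mult'')
  also have "... <= ennreal e"
  proof (rule ennreal_leI)
   have "\<eta>*r <= \<eta>*(r+1)" using \<eta> by simp
   also have "... = e" using r by (simp add: \<eta>_def)
   finally show "\<eta>*r <= e" .
  qed
  finally show "F l <= G l+ennreal e" by (simp add: add_left_mono)
 qed
qed

lemma cutp_reduces:
 assumes b: "b : M" "positive_op b"
 shows "inner (b x) x = inner (b (cutp b s x)) (cutp b s x)+inner (b (x-cutp b s x)) (x-cutp b s x)"
  "(norm x)^2 = (norm (cutp b s x))^2+(norm (x-cutp b s x))^2" "cutp b s (x-cutp b s x) = 0"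
proof -
 let ?e = "cutp b s"
 note e = Pr_cutp[OF b, of s]
 define w where "w = x-?e x"
 have x: "x = ?e x+w" by (simp add: w_def)
 show w0: "?e (x-?e x) = 0" by (simp add: bcl_simps(2)[OF Pr_bcl[OF e]] Pr_idem[OF e])
 hence o: "inner (?e z) w = 0" for z using Pr_ci[OF e, of z w] by (simp add: inner_eq_Re_cinner w_def)
 have o1: "inner (b (?e x)) w = 0" using o[of "b x"] by (simp add: cutp_com[OF b])
 have o2: "inner (b w) (?e x) = 0" using o1 sa_in[OF pos_sa[OF b(2)], of w "?e x"] by (simp add: inner_commute)
 have o': "inner w (?e x) = 0" using o[of x] by (simp add: inner_commute)
 have "inner (b (?e x+w)) (?e x+w) = inner (b (?e x)) (?e x)+inner (b w) w"
  by (simp add: bcl_simps(1)[OF M_bcl[OF b(1)]] inner_add_left inner_add_right o1 o2)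
 hence "inner (b x) x = inner (b (?e x)) (?e x)+inner (b w) w" by (simp only: x[symmetric])
 thus "inner (b x) x = inner (b (?e x)) (?e x)+inner (b (x-?e x)) (x-?e x)" by (simp only: w_def)
 have "(norm (?e x+w))^2 = (norm (?e x))^2+(norm w)^2"
  by (simp add: power2_norm_eq_inner inner_add_left inner_add_right o o')
 hence "(norm x)^2 = (norm (?e x))^2+(norm w)^2" by (simp only: x[symmetric])
 thus "(norm x)^2 = (norm (?e x))^2+(norm (x-?e x))^2" by (simp only: w_def)
qed

lemma Pr_form: "Pr p ==> inner (p x) x = (norm (p x))^2"
 using Pr_ci[of p "p x" x] Pr_idem[of p x] by (simp add: power2_norm_eq_inner inner_eq_Re_cinner)

lemma pos_scale: "positive_op S ==> 0 <= r ==> positive_op (%x. r *\<^sub>R S x)"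
 unfolding pos_iff by (auto intro: sa_scaleR)

lemma pos_add: "positive_op S ==> positive_op T ==> positive_op (%x. S x+T x)"
 unfolding pos_iff by (auto intro: sa_add simp: inner_add_left)

definition pos_part :: "('h => 'h) => real => 'h => 'h"
 where "pos_part b s x = b (cutp b s x)-s *\<^sub>R cutp b s x"

context
 fixes b :: "'h => 'h"
 assumes b: "b : M" "positive_op b"
begin

lemma cutp_le: assumes "s <= s'" shows "cutp b s (cutp b s' x) = cutp b s' x"
proof -
 let ?e = "cutp b s" and ?f = "cutp b s'"
 note e = Pr_cutp[OF b, of s] and f = Pr_cutp[OF b, of s']
 define w where "w = ?f x-?e (?f x)"
 have com: "?f (?e z) = ?e (?f z)" for z
  unfolding cutp_def[of b s] by (rule cut_com[OF cutp_arg[OF b] Pr_bcl[OF f], symmetric, symmetric])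
   (simp add: bcl_simps[OF Pr_bcl[OF f]] cutp_com[OF b])
 have fw: "?f w = w" unfolding w_def by (simp add: bcl_simps[OF Pr_bcl[OF f]] com Pr_idem[OF f])
 have ew: "?e w = 0" unfolding w_def by (simp add: bcl_simps[OF Pr_bcl[OF e]] Pr_idem[OF e])
 have "w = 0"
 proof (rule ccontr)
  assume n: "w ~= 0"
  have "s'*(norm w)^2 < inner (b w) w" by (rule cutp_above[OF b fw n])
  also have "... <= s*(norm w)^2" by (rule cutp_below[OF b ew])
  also have "... <= s'*(norm w)^2" using assms by (intro mult_right_mono) auto
  finally show False by simp
 qed
 thus ?thesis by (simp add: w_def)
qed

lemma pos_part_form: "inner (pos_part b s x) x = inner (b (cutp b s x)) (cutp b s x)-s*(norm (cutp b s x))^2"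
proof -
 note e = Pr_cutp[OF b, of s]
 have "inner (cutp b s z) x = inner z (cutp b s x)" for z using Pr_ci[OF e] by (simp add: inner_eq_Re_cinner)
 from this[of "b (cutp b s x)"] this[of "cutp b s x"] show ?thesis
  by (simp add: pos_part_def inner_diff_left cutp_com[OF b, symmetric] Pr_idem[OF e] power2_norm_eq_inner)
qed

lemma pos_part_M: "pos_part b s : M"
 unfolding pos_part_def by (intro M_diff M_scaleR M_compose[OF b(1) Pr_M] Pr_M Pr_cutp[OF b])

lemma pos_part_form_nonneg: "0 <= inner (pos_part b s x) x"
 using cutp_above[OF b Pr_idem[OF Pr_cutp[OF b]], of s x] unfolding pos_part_form
 by (cases "cutp b s x = 0") (auto simp: bcl_simps(4)[OF M_bcl[OF b(1)]])

lemma pos_part_pos: "positive_op (pos_part b s)"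
proof -
 note e = Pr_cutp[OF b, of s]
 have "adjoint_pair (pos_part b s) (pos_part b s)" unfolding adjoint_pair_def
 proof (intro allI)
  fix x y
  have bs: "cinner (b u) v = cinner u (b v)" for u v using sa_cinner[OF pos_sa[OF b(2)]] .
  have "cinner (b (cutp b s x)) y = cinner x (b (cutp b s y))" by (simp add: bs Pr_ci[OF e] cutp_com[OF b])
  moreover have "cinner (s *\<^sub>R cutp b s x) y = cinner x (s *\<^sub>R cutp b s y)"
   using sa_cinner[OF sa_scaleR[OF pr_sa[OF Pr_proj[OF e]]], of s x y] .
  ultimately show "cinner (pos_part b s x) y = cinner x (pos_part b s y)"
   by (simp add: pos_part_def ci_diff_left ci_diff_right)
 qed
 hence "selfadj (pos_part b s)" using M_bcl[OF pos_part_M] by (simp add: selfadj_def)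
 thus ?thesis unfolding pos_iff using pos_part_form_nonneg by blast
qed

text \<open>Between the two cuts the form of \<open>b\<close> lies between s and s + u, so raising
  the level by u costs between u times the smaller and u times the larger cut.\<close>

lemma pos_part_step:
 assumes u: "0 <= u"
 shows "inner (pos_part b s x) x <= inner (pos_part b (s+u) x) x+u*(norm (cutp b s x))^2"
  "inner (pos_part b (s+u) x) x+u*(norm (cutp b (s+u) x))^2 <= inner (pos_part b s x) x"
proof -
 let ?e = "cutp b s" and ?f = "cutp b (s+u)"
 note e = Pr_cutp[OF b, of s] and f = Pr_cutp[OF b, of "s+u"]
 have ef: "?e (?f z) = ?f z" for z using cutp_le u by simp
 have fe: "?f (?e z) = ?f z" for z
 proof (rule ci_eqI)
  fix y show "cinner (?f (?e z)) y = cinner (?f z) y" by (simp add: Pr_ci[OF f] Pr_ci[OF e] ef)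
 qed
 define w where "w = ?e x-?f x"
 note red = cutp_reduces[OF b, where x = "?e x" and s = "s+u", unfolded fe, folded w_def]
 have w: "?e w = w" unfolding w_def by (simp add: bcl_simps(2)[OF Pr_bcl[OF e]] ef Pr_idem[OF e])
 have "s*(norm w)^2 <= inner (b w) w"
  using cutp_above[OF b w] by (cases "w = 0") (auto simp: bcl_simps(4)[OF M_bcl[OF b(1)]])
 moreover have "inner (b w) w <= (s+u)*(norm w)^2" by (rule cutp_below[OF b red(3)])
 ultimately show "inner (pos_part b s x) x <= inner (pos_part b (s+u) x) x+u*(norm (?e x))^2"
  "inner (pos_part b (s+u) x) x+u*(norm (?f x))^2 <= inner (pos_part b s x) x"
  unfolding pos_part_form using red(1,2) by (simp_all add: algebra_simps)
qed

lemma tr_pos_part_step: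
 assumes w: "0 <= w"
 shows "\<tau> (pos_part b s) <= \<tau> (pos_part b (s+w))+ennreal w*\<tau> (cutp b s)"
  "\<tau> (pos_part b (s+w))+ennreal w*\<tau> (cutp b (s+w)) <= \<tau> (pos_part b s)"
proof -
 have PM: "(%x. w *\<^sub>R cutp b r x) : M" "positive_op (%x. w *\<^sub>R cutp b r x)" for r
  by (rule M_scaleR[OF Pr_M[OF Pr_cutp[OF b]]]) (rule pos_scale[OF Pr_pos[OF Pr_cutp[OF b]] w])
 have eq: "\<tau> (%x. pos_part b (s+w) x+w *\<^sub>R cutp b r x) = \<tau> (pos_part b (s+w))+ennreal w*\<tau> (cutp b r)" for r
  using add[OF pos_part_M pos_part_pos PM] scale[OF Pr_M[OF Pr_cutp[OF b]] Pr_pos[OF Pr_cutp[OF b]] w] by simp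
 have S: "(%x. pos_part b (s+w) x+w *\<^sub>R cutp b r x) : M" "positive_op (%x. pos_part b (s+w) x+w *\<^sub>R cutp b r x)" for r
  by (rule M_add[OF pos_part_M PM(1)]) (rule pos_add[OF pos_part_pos PM(2)])
 show "\<tau> (pos_part b s) <= \<tau> (pos_part b (s+w))+ennreal w*\<tau> (cutp b s)"
  unfolding eq[symmetric] using pos_part_step(1)[OF w]
  by (intro tr_mono[OF pos_part_M pos_part_pos S]) (simp add: inner_add_left Pr_form[OF Pr_cutp[OF b]])
 show "\<tau> (pos_part b (s+w))+ennreal w*\<tau> (cutp b (s+w)) <= \<tau> (pos_part b s)"
  unfolding eq[symmetric] using pos_part_step(2)[OF w]
  by (intro tr_mono[OF S pos_part_M pos_part_pos]) (simp add: inner_add_left Pr_form[OF Pr_cutp[OF b]])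
qed

text \<open>One estimate uses strict, the other non-strict level sets. These one-sided bounds are
  what the step inequalities need; no exact distribution function has to be identified.\<close>

lemma lev_mB:
 assumes s: "0 <= s"
 shows "emeasure lborel {t. 0 < t & s < mB b t} <= \<tau> (cutp b s)"
  "0 < s ==> \<tau> (cutp b s) <= emeasure lborel {t. 0 < t & s <= mB b t}"
proof -
 note bm = M_tmeas[OF b(1)]
 have m: "mB b : borel_measurable borel" by (rule muf_borel[OF bm])
 show "emeasure lborel {t. 0 < t & s < mB b t} <= \<tau> (cutp b s)"
 proof (cases "\<tau> (cutp b s)" rule: ennreal_cases)
  case (real r)
  have "{t. 0 < t & s < mB b t} \<subseteq> {0..r}"
  proof
   fix t assume t: "t : {t. 0 < t & s < mB b t}"
   have "t < r"
   proof (rule ccontr)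
    assume "\<not> t < r"
    hence "dB b t s" using dB_iff_cutp[OF b s] real by (auto simp: ennreal_leI)
    thus False using t muf_le[of "graph_of b" t s] s by auto
   qed
   thus "t : {0..r}" using t by auto
  qed
  hence "emeasure lborel {t. 0 < t & s < mB b t} <= emeasure lborel {0..r}" by (intro emeasure_mono) auto
  thus ?thesis using real by simp
 qed simp
 assume s0: "0 < s"
 show "\<tau> (cutp b s) <= emeasure lborel {t. 0 < t & s <= mB b t}"
 proof (rule dense_le)
  fix y assume y: "y < \<tau> (cutp b s)"
  then obtain r where r: "y = ennreal r" "0 <= r" by (cases y rule: ennreal_cases) auto
  have "{0<..r} \<subseteq> {t. 0 < t & s <= mB b t}"
  proof
   fix t assume t: "t : {0<..r}"
   have "\<not> dB b t s"
   proof
    assume "dB b t s"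
    hence "\<tau> (cutp b s) <= ennreal t" using dB_iff_cutp[OF b s] by blast
    also have "... <= y" using t r by (auto intro: ennreal_leI)
    finally show False using y by simp
   qed
   thus "t : {t. 0 < t & s <= mB b t}" using t muf_less[OF bm, of t s] by force
  qed
  moreover have "{t. 0 < t & s <= mB b t} : sets lborel"
   using borel_measurable_le[of "%t. s" borel "mB b"] m by (auto simp: Collect_conj_eq intro!: sets.Int)
  ultimately have "emeasure lborel {0<..r} <= emeasure lborel {t. 0 < t & s <= mB b t}" by (intro emeasure_mono)
  thus "y <= emeasure lborel {t. 0 < t & s <= mB b t}" using r by simp
 qed
qed

definition tail :: "real => ennreal"
 where "tail s = (\<integral>\<^sup>+ t. ennreal (indicator {0<..} t*max 0 (mB b t-s)) \<partial>lborel)"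

lemma tail_step:
 assumes s: "0 <= s" and w: "0 < w"
 shows "tail s <= tail (s+w)+ennreal w*\<tau> (cutp b s)"
  "tail (s+w)+ennreal w*\<tau> (cutp b (s+w)) <= tail s"
proof -
 have m [measurable]: "mB b : borel_measurable borel" by (rule muf_borel[OF M_tmeas[OF b(1)]])
 have S [measurable]: "{t. 0 < t & s < mB b t} : sets borel" "{t. 0 < t & s+w <= mB b t} : sets borel" by measurable
 have eq: "tail (s+w)+ennreal w*emeasure lborel A = (\<integral>\<^sup>+ t. ennreal (indicator {0<..} t*max 0 (mB b t-(s+w))+w*indicator A t) \<partial>lborel)"
  if A [measurable]: "A : sets borel" for A
 proof -
  have "(\<integral>\<^sup>+ t. ennreal (indicator {0<..} t*max 0 (mB b t-(s+w))+w*indicator A t) \<partial>lborel)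
   = (\<integral>\<^sup>+ t. ennreal (indicator {0<..} t*max 0 (mB b t-(s+w)))+ennreal w*indicator A t \<partial>lborel)"
   using w by (intro nn_integral_cong) (auto simp: ennreal_plus ennreal_mult' ennreal_indicator)
  also have "... = tail (s+w)+(\<integral>\<^sup>+ t. ennreal w*indicator A t \<partial>lborel)"
   unfolding tail_def by (intro nn_integral_add) auto
  also have "(\<integral>\<^sup>+ t. ennreal w*indicator A t \<partial>lborel) = ennreal w*emeasure lborel A"
   using A by (intro nn_integral_cmult_indicator) auto
  finally show ?thesis by simp
 qed
 have "tail s <= tail (s+w)+ennreal w*emeasure lborel {t. 0 < t & s < mB b t}"
  unfolding eq[OF S(1)] unfolding tail_def using w by (intro nn_integral_mono ennreal_leI) (auto simp: indicator_def max_def)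
 also have "... <= tail (s+w)+ennreal w*\<tau> (cutp b s)" using lev_mB(1)[OF s] by (intro add_left_mono mult_left_mono) auto
 finally show "tail s <= tail (s+w)+ennreal w*\<tau> (cutp b s)" .
 have "tail (s+w)+ennreal w*\<tau> (cutp b (s+w)) <= tail (s+w)+ennreal w*emeasure lborel {t. 0 < t & s+w <= mB b t}"
  using s w by (intro add_left_mono mult_left_mono lev_mB(2)) auto
 also have "... <= tail s" unfolding eq[OF S(2)] unfolding tail_def using w by (intro nn_integral_mono ennreal_leI) (auto simp: indicator_def max_def)
 finally show "tail (s+w)+ennreal w*\<tau> (cutp b (s+w)) <= tail s" .
qed

text \<open>Both sides satisfy the step inequalities with the same density
  \<tau>(\<open>cutp b s\<close>) and vanish beyond a bound of \<open>b\<close>, so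
  \<open>layer_unique\<close> applies in both directions.\<close>

lemma tr_pos_part:
 assumes s: "0 <= s" and fin: "\<tau> (cutp b s) < \<infinity>"
 shows "\<tau> (pos_part b s) = tail s" "tail s < \<infinity>"
proof -
 obtain K where K: "K > 0" "!!x. norm (b x) <= K*norm x" using bcl_bdd[OF M_bcl[OF b(1)]] by blast
 have c0: "cutp b r x = 0" if "K <= r" for r x
 proof (rule ccontr)
  let ?w = "cutp b r x"
  assume n: "?w ~= 0"
  have "r*(norm ?w)^2 < inner (b ?w) ?w" by (rule cutp_above[OF b Pr_idem[OF Pr_cutp[OF b]] n])
  also have "... <= norm (b ?w)*norm ?w" by (rule norm_cauchy_schwarz)
  also have "... <= K*norm ?w*norm ?w" using K by (intro mult_right_mono) auto
  also have "... <= r*(norm ?w)^2" using that by (simp add: power2_eq_square mult_right_mono mult.assoc)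
  finally show False by simp
 qed
 have p0: "\<tau> (pos_part b r) = 0" if "K <= r" for r
 proof -
  have "pos_part b r = (%x. 0)" using c0[OF that] by (auto simp: pos_part_def bcl_simps(4)[OF M_bcl[OF b(1)]])
  thus ?thesis by (simp add: tr_zero)
 qed
 have t0: "tail r = 0" if "K <= r" for r
 proof -
  have "max 0 (mB b t-r) = 0" if "0 < t" for t using mB_bound[OF that K(2)] K(1) \<open>K <= r\<close> by simp
  hence "indicator {0<..} t*max 0 (mB b t-r) = 0" for t by (auto simp: indicator_def)
  thus ?thesis unfolding tail_def by (simp only: ennreal_0 nn_integral_const mult_zero_left)
 qed
 have "\<tau> (pos_part b s) <= tail s"
  by (rule layer_unique[of s "%s. \<tau> (pos_part b s)" "%s. \<tau> (cutp b s)" tail K])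
   (use s fin p0 in \<open>auto intro!: tr_pos_part_step tail_step\<close>)
 moreover have "tail s <= \<tau> (pos_part b s)"
  by (rule layer_unique[of s tail "%s. \<tau> (cutp b s)" "%s. \<tau> (pos_part b s)" K])
   (use s fin t0 in \<open>auto intro!: tr_pos_part_step tail_step\<close>)
 ultimately show "\<tau> (pos_part b s) = tail s" by simp
 have "tail s <= tail (s+K)+ennreal K*\<tau> (cutp b s)" using s K by (intro tail_step)
 also have "tail (s+K) = 0" using s by (intro t0) simp
 finally have "tail s <= ennreal K*\<tau> (cutp b s)" by simp
 also have "... < \<infinity>" using fin by (simp add: ennreal_mult_less_top)
 finally show "tail s < \<infinity>" .
qed

end

end

context vn_E begin

lemma pos_cpr:
 assumes p: "Pr p" and X: "X : M" "positive_op X"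
 shows "(%x. p (X (p x))) : M" "positive_op (%x. p (X (p x)))" "inner (p (X (p x))) x = inner (X (p x)) (p x)"
proof -
 show f: "inner (p (X (p x))) x = inner (X (p x)) (p x)" for x by (simp add: inner_eq_Re_cinner Pr_ci[OF p])
 show m: "(%x. p (X (p x))) : M" by (rule M_compose[OF Pr_M[OF p] M_compose[OF X(1) Pr_M[OF p]]])
 have "cinner (X u) v = cinner u (X v)" for u v using sa_cinner[OF pos_sa[OF X(2)]] .
 hence "selfadj (%x. p (X (p x)))" using M_bcl[OF m] by (simp add: selfadj_def adjoint_pair_def Pr_ci[OF p])
 thus "positive_op (%x. p (X (p x)))" unfolding pos_iff f using pos_in[OF X(2)] by blast
qed

text \<open>With S the root of \<open>X\<close>, the trace property turns p X p = (p S)(S p) into S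
  p S, which lies below S^2 = X.\<close>

lemma tr_cpr_le:
 assumes p: "Pr p" and X: "X : M" "positive_op X"
 shows "\<tau> (%x. p (X (p x))) <= \<tau> X"
proof -
 let ?S = "sqop X"
 have S: "?S : M" "positive_op ?S" by (rule M_sqop[OF X], rule sqop_pos[OF X(2)])
 note Sc = sa_cinner[OF pos_sa[OF S(2)]]
 have T: "(%x. ?S (p x)) : M" "(%x. p (?S x)) : M" by (rule M_compose[OF S(1) Pr_M[OF p]], rule M_compose[OF Pr_M[OF p] S(1)])
 have "adjoint_pair (%x. ?S (p x)) (%x. p (?S x))" unfolding adjoint_pair_def by (simp add: Sc Pr_ci[OF p])
 from tracial[OF T this] have "\<tau> (%x. p (X (p x))) = \<tau> (%x. ?S (p (?S x)))"
  by (simp add: comp_def sqop_sq[OF X(2)] Pr_idem[OF p])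
 also have "... <= \<tau> X"
 proof (rule tr_mono[OF _ _ X])
  have f: "inner (?S (p (?S x))) x = (norm (p (?S x)))^2" for x
   using Sc[of "p (?S x)" x] Pr_ci[OF p, of "p (?S x)" "?S x"] Pr_idem[OF p]
   by (simp add: inner_eq_Re_cinner power2_norm_eq_inner)
  show m: "(%x. ?S (p (?S x))) : M" by (rule M_compose[OF S(1) T(2)])
  have "selfadj (%x. ?S (p (?S x)))" using M_bcl[OF m] by (simp add: selfadj_def adjoint_pair_def Pr_ci[OF p] Sc)
  thus "positive_op (%x. ?S (p (?S x)))" unfolding pos_iff f by simp
  fix x
  have "(norm (p (?S x)))^2 <= (norm (?S x))^2" using pr_nle[OF Pr_proj[OF p]] by (intro power_mono) auto
  also have "... = inner (X x) x" using Sc[of "?S x" x] by (simp add: power2_norm_eq_inner inner_eq_Re_cinner sqop_sq[OF X(2)])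
  finally show "inner (?S (p (?S x))) x <= inner (X x) x" unfolding f .
 qed
 finally show ?thesis .
qed

text \<open>Let e and f be the cuts of a at l and of c at 2 l, and p their join. Compression by p
  gives \<tau>(p a p) \<ge> \<tau>((a - l)_+) + l \<tau>(e) and \<tau>(p c p) \<ge> 2 l \<tau>(f),
  whereas \<tau>(p b p) \<le> l (\<tau>(e) + \<tau>(f)) + \<tau>((b - l)_+). The level 2 l pays for
  the term l \<tau>(f) and leaves another one.\<close>

lemma tr_inequality:
 assumes a: "a : M" "positive_op a" and b: "b : M" "positive_op b" and c: "c = (%x. b x-a x)"
  and cp: "positive_op c" and l: "0 < l" and fin: "\<tau> (cutp b l) < \<infinity>"
 shows "ennreal l*\<tau> (cutp c (2*l))+tail a l <= tail b l"
proof -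
 have cM: "c : M" unfolding c by (rule M_diff[OF b(1) a(1)])
 note cc = cM cp
 have ab: "inner (a x) x <= inner (b x) x" for x using pos_in[OF cp, of x] by (simp add: c inner_diff_left)
 have cb: "inner (c x) x <= inner (b x) x" for x using pos_in[OF a(2), of x] by (simp add: c inner_diff_left)
 let ?e = "cutp a l" and ?f = "cutp c (2*l)"
 note e = Pr_cutp[OF a, of l] and f = Pr_cutp[OF cc, of "2*l"]
 have efin: "\<tau> ?e < \<infinity>" using cutp_tr_mono[OF a b ab order_refl, of l] fin by simp
 have "\<tau> ?f <= \<tau> (cutp b l)" by (rule cutp_tr_mono[OF cc b cb]) (use l in simp)
 hence ffin: "\<tau> ?f < \<infinity>" using fin by simp
 let ?n = "meet (%x. x-?e x) (%x. x-?f x)"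
 note ce = Pr_compl[OF e] and cf' = Pr_compl[OF f]
 have n: "Pr ?n" by (rule Pr_meet[OF ce cf'])
 \<comment> \<open>The join, as the complement of the meet of the complements; subadditivity of the
   trace is then \<open>meet_trace\<close>.\<close>
 define p where "p = (%x. x-?n x)"
 have p: "Pr p" unfolding p_def by (rule Pr_compl[OF n])
 have pt: "\<tau> p <= \<tau> ?e+\<tau> ?f" using meet_trace[OF ce cf'] by (simp add: p_def)
 have z: "?e (?n x) = 0" "?f (?n x) = 0" for x using meet_range[OF ce cf', of "?n x"] Pr_idem[OF n] by auto
 have ep: "?e (p x) = ?e x" "?f (p x) = ?f x" for x
  unfolding p_def by (simp_all add: bcl_simps(2)[OF Pr_bcl[OF e]] bcl_simps(2)[OF Pr_bcl[OF f]] z)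
 note ca = pos_cpr[OF p a] and cb' = pos_cpr[OF p b] and cC = pos_cpr[OF p cc]
 have S1: "\<tau> (pos_part a l)+ennreal l*\<tau> ?e <= \<tau> (%x. p (a (p x)))"
 proof -
  have PM: "(%x. l *\<^sub>R ?e x) : M" "positive_op (%x. l *\<^sub>R ?e x)"
   using l by (intro M_scaleR[OF Pr_M[OF e]], intro pos_scale[OF Pr_pos[OF e]]) simp
  have "\<tau> (pos_part a l)+ennreal l*\<tau> ?e = \<tau> (%x. pos_part a l x+l *\<^sub>R ?e x)"
   using add[OF pos_part_M[OF a] pos_part_pos[OF a] PM] scale[OF Pr_M[OF e] Pr_pos[OF e], of l] l by simp
  also have "... <= \<tau> (%x. p (a (p x)))"
  proof (rule tr_mono[OF M_add[OF pos_part_M[OF a] PM(1)] pos_add[OF pos_part_pos[OF a] PM(2)] ca(1,2)])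
   fix x show "inner (pos_part a l x+l *\<^sub>R ?e x) x <= inner (p (a (p x))) x"
    using cutp_reduces(1)[OF a, where x = "p x" and s = l] pos_in[OF a(2), of "p x-?e (p x)"]
    by (simp add: ca(3) inner_add_left pos_part_form[OF a] Pr_form[OF e] ep)
  qed
  finally show ?thesis .
 qed
 have S2: "ennreal (2*l)*\<tau> ?f <= \<tau> (%x. p (c (p x)))"
 proof -
  have PM: "(%x. (2*l) *\<^sub>R ?f x) : M" "positive_op (%x. (2*l) *\<^sub>R ?f x)"
   using l by (intro M_scaleR[OF Pr_M[OF f]], intro pos_scale[OF Pr_pos[OF f]]) simp
  have "ennreal (2*l)*\<tau> ?f = \<tau> (%x. (2*l) *\<^sub>R ?f x)"
   using scale[OF Pr_M[OF f] Pr_pos[OF f], of "2*l"] l by simp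
  also have "... <= \<tau> (%x. p (c (p x)))"
  proof (rule tr_mono[OF PM cC(1,2)])
   fix x
   have "2*l*(norm (?f x))^2 <= inner (c (?f x)) (?f x)"
    using cutp_above[OF cc Pr_idem[OF f], of x] by (cases "?f x = 0") (auto simp: bcl_simps(4)[OF M_bcl[OF cM]])
   thus "inner ((2*l) *\<^sub>R ?f x) x <= inner (p (c (p x))) x"
    using cutp_reduces(1)[OF cc, where x = "p x" and s = "2*l"] pos_in[OF cp, of "p x-?f (p x)"]
    by (simp add: cC(3) Pr_form[OF f] ep)
  qed
  finally show ?thesis .
 qed
 have S3: "\<tau> (%x. p (b (p x))) = \<tau> (%x. p (a (p x)))+\<tau> (%x. p (c (p x)))"
 proof -
  have "(%x. p (b (p x))) = (%x. p (a (p x))+p (c (p x)))"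
   by (simp add: c bcl_simps(1)[OF Pr_bcl[OF p], symmetric])
  thus ?thesis using add[OF ca(1,2) cC(1,2)] by simp
 qed
 have S4: "\<tau> (%x. p (b (p x))) <= ennreal l*(\<tau> ?e+\<tau> ?f)+\<tau> (pos_part b l)"
 proof -
  note X = pos_part_M[OF b, of l] pos_part_pos[OF b, of l]
  note cX = pos_cpr[OF p X]
  have PM: "(%x. l *\<^sub>R p x) : M" "positive_op (%x. l *\<^sub>R p x)"
   using l by (intro M_scaleR[OF Pr_M[OF p]], intro pos_scale[OF Pr_pos[OF p]]) simp
  have "\<tau> (%x. p (b (p x))) <= \<tau> (%x. l *\<^sub>R p x+p (pos_part b l (p x)))"
  proof (rule tr_mono[OF cb'(1,2) M_add[OF PM(1) cX(1)] pos_add[OF PM(2) cX(2)]])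
   fix x
   let ?y = "p x"
   have "inner (b ?y) ?y <= l*(norm ?y)^2+inner (pos_part b l ?y) ?y"
    unfolding pos_part_form[OF b] using cutp_reduces[OF b, where s = l and x = ?y] cutp_below[OF b cutp_reduces(3)[OF b, where s = l and x = ?y]]
    by (simp add: algebra_simps)
   thus "inner (p (b (p x))) x <= inner (l *\<^sub>R p x+p (pos_part b l (p x))) x"
    by (simp add: cb'(3) inner_add_left cX(3) Pr_form[OF p])
  qed
  also have "... = ennreal l*\<tau> p+\<tau> (%x. p (pos_part b l (p x)))"
   using add[OF PM cX(1,2)] scale[OF Pr_M[OF p] Pr_pos[OF p], of l] l by simp
  also have "... <= ennreal l*(\<tau> ?e+\<tau> ?f)+\<tau> (pos_part b l)"
   by (intro add_mono mult_left_mono pt tr_cpr_le[OF p X]) auto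
  finally show ?thesis .
 qed
 have two: "ennreal (2*l)*\<tau> ?f = ennreal l*\<tau> ?f+ennreal l*\<tau> ?f"
 proof -
  have "ennreal (2*l) = ennreal l+ennreal l" unfolding mult_2 using l by (intro ennreal_plus) auto
  thus ?thesis by (simp only: distrib_right)
 qed
 let ?A = "ennreal l*(\<tau> ?e+\<tau> ?f)"
 have "?A+(ennreal l*\<tau> ?f+\<tau> (pos_part a l)) = (\<tau> (pos_part a l)+ennreal l*\<tau> ?e)+ennreal (2*l)*\<tau> ?f"
  unfolding two by (simp add: distrib_left add_ac)
 also have "... <= \<tau> (%x. p (a (p x)))+\<tau> (%x. p (c (p x)))" by (rule add_mono[OF S1 S2])
 also have "... <= ?A+\<tau> (pos_part b l)" using S4 unfolding S3 .
 finally have "?A+(ennreal l*\<tau> ?f+\<tau> (pos_part a l)) <= ?A+\<tau> (pos_part b l)" .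
 \<comment> \<open>Cancellation in the extended reals needs finite traces, which both cuts inherit
   from the cut of b.\<close>
 moreover have "?A ~= \<infinity>" using efin ffin by (simp add: ennreal_mult_eq_top_iff less_top)
 ultimately have "ennreal l*\<tau> ?f+\<tau> (pos_part a l) <= \<tau> (pos_part b l)" by (simp add: ennreal_add_left_cancel_le)
 thus ?thesis using tr_pos_part(1)[OF a _ efin] tr_pos_part(1)[OF b _ fin] l by simp
qed


section \<open>Right multiplication by a projection that almost preserves the norm\<close>

definition rt :: "nat => ('h => 'h) => 'h => 'h" where "rt i = sqop ^^ i"

lemma rt_Suc: "rt (Suc i) B = sqop (rt i B)" by (simp add: rt_def)

lemma rt: assumes B: "B : M" "positive_op B" shows rt_M: "rt i B : M" and rt_pos: "positive_op (rt i B)"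
proof -
 have "rt i B : M & positive_op (rt i B)"
  by (induction i) (auto simp: rt_Suc M_sqop sqop_pos, auto simp: rt_def B)
 thus "rt i B : M" "positive_op (rt i B)" by auto
qed

lemma rt_sq: "B : M ==> positive_op B ==> rt (Suc i) B (rt (Suc i) B x) = rt i B x"
 by (simp add: rt_Suc sqop_sq rt_pos)

lemma mB_sqop: assumes B: "B : M" "positive_op B" shows "mB (sqop B) t = mB B t powr (1/2)"
proof -
 let ?S = "sqop B"
 have S: "?S : M" "positive_op ?S" by (rule M_sqop[OF B], rule sqop_pos[OF B(2)])
 have "adj ?S = ?S"
  by (rule ext, rule ci_eqI) (simp only: adj_cinner'[OF M_bcl[OF S(1)]] sa_cinner[OF pos_sa[OF S(2)]])
 hence "mB B t = (mB ?S t)^2" using mB_square[OF S(1), of t] by (simp add: sqop_sq[OF B(2)])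
 moreover have "0 <= mB ?S t" by (rule muf_nonneg[OF M_tmeas[OF S(1)]])
 ultimately show ?thesis by (simp add: powr_half_sqrt)
qed

lemma mB_rt: assumes B: "B : M" "positive_op B" shows "mB (rt i B) t = mB B t powr (1/2^i)"
proof (induction i)
 case 0
 show ?case using muf_nonneg[OF M_tmeas[OF B(1)], of t] by (simp add: rt_def)
next
 case (Suc i)
 thus ?case by (simp add: rt_Suc mB_sqop[OF rt[OF B]] powr_powr mult.commute)
qed

lemma rt_mono:
 assumes A: "A : M" "positive_op A" and B: "B : M" "positive_op B" and le: "!!x. inner (A x) x <= inner (B x) x"
 shows "inner (rt i A x) x <= inner (rt i B x) x"
proof (induction i arbitrary: x)
 case (Suc i)
 have n: "(norm (rt (Suc i) T x))^2 = inner (rt i T x) x" if T: "T : M" "positive_op T" for T x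
  using sa_in[OF pos_sa[OF rt_pos[OF T]], of "Suc i" "rt (Suc i) T x" x]
  by (simp add: rt_sq[OF T] power2_norm_eq_inner)
 show ?case by (rule sqrt_monotone[OF rt_pos[OF A] rt_pos[OF B]]) (simp add: n[OF A] n[OF B] Suc)
qed (use le in \<open>simp add: rt_def\<close>)

text \<open>From b^2 - a^2 = b (b - a) + (b - a) a for consecutive roots, with \<mu>(a) \<le>
  \<mu>(b) by monotonicity of roots. Iteration collects the exponents 1/2 + ... + 1/2^k = 1 - 1/2^k
  of \<mu>(B).\<close>

lemma mB_root_diff:
 assumes A: "A : M" "positive_op A" and B: "B : M" "positive_op B" and le: "!!x. inner (A x) x <= inner (B x) x" and t: "0 < t" and k: "0 < k"
 shows "mB (%x. B x-A x) (4^k*t) <= 2^k*mB B t powr (1-1/2^k)*mB (%x. rt k B x-rt k A x) t"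
proof -
 define D where "D i = (%x. rt i B x-rt i A x)" for i
 have DM: "D i : M" for i unfolding D_def by (rule M_diff[OF rt_M[OF B] rt_M[OF A]])
 have nn: "0 <= mB (D i) t" "0 <= mB (rt i B) t" for i t using muf_nonneg[OF M_tmeas] DM rt_M[OF B] by auto
 \<comment> \<open>Each of the two products uses up 2 t and their sum 4 t. Bounds with arbitrary r
   and s above the singular values are proved before passing to the limit in either.\<close>
 have step: "mB (D i) (4*t) <= 2*mB (rt (Suc i) B) t*mB (D (Suc i)) t" if t: "0 < t" for i t
 proof -
  let ?b = "rt (Suc i) B" and ?a = "rt (Suc i) A" and ?D = "D (Suc i)"
  have form: "D i = (%x. ?b (?D x)+?D (?a x))"
   by (rule ext) (simp add: D_def rt_sq[OF A] rt_sq[OF B] bcl_simps(2)[OF M_bcl[OF rt_M[OF B]]])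
  have mab: "mB ?a t <= mB ?b t" by (rule mB_form_mono[OF rt[OF A] rt[OF B] rt_mono[OF A B le] t])
  have b: "mB (D i) (4*t) <= 2*r * s" if r: "mB ?b t < r" and s: "mB ?D t < s" for r s
  proof -
   have r0: "0 <= r" "0 <= s" using r s nn(2)[of "Suc i" t] nn(1)[of "Suc i" t] by auto
   have db: "dB ?b t r" by (rule muf_less[OF M_tmeas[OF rt_M[OF B]] t r])
   have da: "dB ?a t r" by (rule muf_less[OF M_tmeas[OF rt_M[OF A]] t]) (use mab r in simp)
   have dD: "dB ?D t s" by (rule muf_less[OF M_tmeas[OF DM] t s])
   have t0: "0 <= t" "0 <= t+t" using t by auto
   have "dB (%x. ?b (?D x)) (t+t) (r * s)" by (rule dB_mult[OF dD db t0(1) t0(1) r0(1) DM])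
   moreover have "dB (%x. ?D (?a x)) (t+t) (s*r)" by (rule dB_mult[OF da dD t0(1) t0(1) r0(2) rt_M[OF A]])
   ultimately have "dB (D i) (t+t+(t+t)) (r * s+s*r)" unfolding form using t0 by (intro dB_add)
   hence "mB (D i) (t+t+(t+t)) <= r * s+s*r" using r0 by (intro muf_le) auto
   moreover have "t+t+(t+t) = 4*t" "r * s+s*r = 2*r * s" by auto
   ultimately show ?thesis by simp
  qed
  have b': "mB (D i) (4*t) <= 2*r*mB ?D t" if r: "mB ?b t < r" for r
  proof (rule le_if_le_add_mult[where c = "2*r"])
   fix d :: real assume "0 < d"
   hence "mB (D i) (4*t) <= 2*r*(mB ?D t+d)" by (intro b r) simp
   thus "mB (D i) (4*t) <= 2*r*mB ?D t+d*(2*r)" by (simp add: algebra_simps)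
  qed
  show ?thesis
  proof (rule le_if_le_add_mult[where c = "2*mB ?D t"])
   fix d :: real assume "0 < d"
   hence "mB (D i) (4*t) <= 2*(mB ?b t+d)*mB ?D t" by (intro b') simp
   thus "mB (D i) (4*t) <= 2*mB ?b t*mB ?D t+d*(2*mB ?D t)" by (simp add: algebra_simps)
  qed
 qed
 have main: "mB (D 0) (4^k*t) <= 2^k*(\<Prod>i<k. mB (rt (Suc i) B) t)*mB (D k) t" if t': "0 < t" for t
  using t'
 proof (induction k arbitrary: t)
  case (Suc k)
  note t = \<open>0 < t\<close>
  have dec: "mB (rt (Suc i) B) (4*t) <= mB (rt (Suc i) B) t" for i
   using muf_decr[OF M_tmeas[OF rt_M[OF B, of "Suc i"]]] t by (simp add: decr_def)
  let ?P = "%t. \<Prod>i<k. mB (rt (Suc i) B) t"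
  have P0: "0 <= ?P t" for t by (intro prod_nonneg ballI muf_nonneg[OF M_tmeas[OF rt_M[OF B]]])
  have "mB (D 0) (4^k*(4*t)) <= 2^k*?P (4*t)*mB (D k) (4*t)" using t by (intro Suc.IH) simp
  also have "... <= 2^k*?P t*mB (D k) (4*t)"
   by (intro mult_right_mono mult_left_mono prod_mono conjI dec muf_nonneg[OF M_tmeas[OF rt_M[OF B]]] muf_nonneg[OF M_tmeas[OF DM]]) simp
  also have "... <= 2^k*?P t*(2*mB (rt (Suc k) B) t*mB (D (Suc k)) t)"
   by (intro mult_left_mono step t mult_nonneg_nonneg P0) simp
  finally show ?case by (simp add: mult_ac)
 qed simp
 have pr: "(\<Prod>i<k. mB (rt (Suc i) B) t) = mB B t powr (1-1/2^k)"
 proof (cases "mB B t = 0")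
  case True
  hence "(\<Prod>i<k. mB (rt (Suc i) B) t) = 0" using k by (auto simp: mB_rt[OF B])
  thus ?thesis using True by simp
 next
  case False
  have "(\<Prod>i<k. mB (rt (Suc i) B) t) = mB B t powr (1-1/2^k)" for k
  proof (induction k)
   case (Suc k)
   have "(1-1/2^k)+1/2^Suc k = 1-1/(2::real)^Suc k" by simp
   thus ?case using Suc by (simp add: mB_rt[OF B] powr_add[symmetric])
  qed (use False in simp)
  thus ?thesis .
 qed
 have D0: "D 0 = (%x. B x-A x)" by (simp add: D_def rt_def)
 show ?thesis using main[OF t] unfolding pr D0 unfolding D_def .
qed

text \<open>A product of powers is linearized at the threshold Q = ro y; on either side the larger
  factor replaces the smaller one.\<close>

lemma powr_interpolate:
 fixes y Q ta ro :: real
 assumes y: "0 <= y" and Q: "0 <= Q" and ro: "0 < ro" and ta: "0 < ta" "ta < 1"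
 shows "y powr (1-ta)*Q powr ta <= ro powr ta*y+ro powr (ta-1)*Q"
proof (cases "Q <= ro*y")
 case True
 have "y powr (1-ta)*Q powr ta <= y powr (1-ta)*(ro*y) powr ta" using True Q ta by (intro mult_left_mono powr_mono2) auto
 also have "... = ro powr ta*(y powr (1-ta)*y powr ta)" by (simp add: powr_mult)
 also have "y powr (1-ta)*y powr ta = y" using y by (simp add: powr_add[symmetric])
 finally show ?thesis using Q by (simp add: add_increasing2)
next
 case False
 hence "y <= Q/ro" using ro by (simp add: field_simps)
 hence "y powr (1-ta)*Q powr ta <= (Q/ro) powr (1-ta)*Q powr ta" using y ta by (intro mult_right_mono powr_mono2) auto
 also have "... = (Q powr (1-ta)*Q powr ta)/ro powr (1-ta)" by (simp add: powr_divide)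
 also have "Q powr (1-ta)*Q powr ta = Q" using Q by (simp add: powr_add[symmetric])
 also have "Q/ro powr (1-ta) = ro powr (ta-1)*Q" using powr_minus_divide[of ro "1-ta"] by simp
 finally show ?thesis using y by (simp add: add_increasing)
qed

text \<open>With B = y y* and A = y g y* the difference B - A is y (1 - g) y*, whose singular values
  are the squares of those of y (1 - g). \<open>tr_gap\<close> makes those of the difference of
  roots small in E, and \<open>mB_root_diff\<close> with \<open>powr_interpolate\<close> returns to
  B - A.\<close>

lemma norm_complement_small:
 assumes eps: "0 < eps"
 obtains de where "0 < de" "de < 1" "!!y g. y : M ==> Pr g ==> mB y : Er ==> Nr (mB y) <= 1 ==>
  1-de <= Nr (mB (%x. y (g x))) ==> Nr (mB (%x. y (x-g x))) <= eps"
proof -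
 obtain k' :: nat where "6/\<alpha> < 2^k'" using real_arch_pow[of 2 "6/\<alpha>"] by auto
 hence "6/\<alpha> < 2^Suc k'" by (rule less_le_trans) simp
 then obtain k :: nat where k: "0 < k" "6/\<alpha> < 2^k" by (metis zero_less_Suc)
 define ta :: real where "ta = 1/2^k"
 \<comment> \<open>Twice \<open>ta\<close>, because \<mu>(B) is already the square of Y = \<mu>(y):
   the k-th root of B has singular values Y^ka.\<close>
 define ka where "ka = 2*ta"
 have "(2::real)^1 <= 2^k" using k by (intro power_increasing) auto
 hence ta: "0 < ta" "ta < 1" by (auto simp: ta_def)
 have ka: "0 < ka" "3*ka <= \<alpha>" using ta k \<alpha> by (auto simp: ka_def ta_def field_simps)
 define c where "c = sqrt (2^k)"
 have c: "0 < c" "c^2 = 2^k" by (auto simp: c_def)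
 \<comment> \<open>The dilation 4^k of \<open>mB_root_diff\<close> times the 2 of
   \<open>tr_gap\<close>. The value of \<open>e\<close> makes D (e^\<alpha> + e^\<alpha>) =
   eps^\<alpha>.\<close>
 define D :: real where "D = 2^(2*k+1)"
 have D: "0 < D" by (simp add: D_def)
 define e where "e = eps/(2*D) powr (1/\<alpha>)"
 have e: "0 < e" using eps D by (simp add: e_def)
 \<comment> \<open>First \<open>ro\<close> makes the coefficient of Y in the interpolation equal to
   \<open>e\<close>; then \<open>si\<close> makes the other coefficient times the norm of Q at most
   \<open>e\<close>.\<close>
 define ro where "ro = (e/c) powr (1/ta)"
 have ro: "0 < ro" "c*ro powr ta = e" using e c ta by (auto simp: ro_def powr_powr)
 define si where "si = e/(c*ro powr (ta-1))"
 have si: "0 < si" "c*ro powr (ta-1) * si = e" using e c ro by (auto simp: si_def)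
 obtain de where de: "0 < de" "de < 1" and
  gap: "!!W Y m B. Y : Er ==> decr Y ==> W : borel_measurable borel ==>
  (!!t. 0 < t ==> 0 <= W t & W t <= Y t & Y t <= B) ==> Nr Y <= 1 ==> 1-de <= Nr W ==> decr m ==>
  (!!t. 0 < t ==> m t <= Y t powr ka) ==> gap_bound ka Y W m ==>
  (%t. m (2*t) powr (1/ka)) : Er & Nr (%t. m (2*t) powr (1/ka)) <= si"
  by (fact tr_gap[OF ka si(1)])
 show thesis
 proof (rule that[OF de])
  fix y g assume y: "y : M" and g: "Pr g" and yE: "mB y : Er" and Ny: "Nr (mB y) <= 1" and Ng: "1-de <= Nr (mB (%x. y (g x)))"
  have ay: "adj y : M" by (rule M_adj[OF y])
  have sq: "(%x. y (h (adj y x))) : M" "positive_op (%x. y (h (adj y x)))" "inner (y (h (adj y x))) x = (norm (h (adj y x)))^2"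
   "mB (%x. y (h (adj y x))) t = (mB (%x. y (h x)) t)^2" "(%x. y (h x)) : M" if h: "Pr h" for h x t
  proof -
   let ?T = "%x. h (adj y x)"
   show S: "(%x. y (h x)) : M" by (rule M_compose[OF y Pr_M[OF h]])
   have T: "?T : M" by (rule M_compose[OF Pr_M[OF h] ay])
   have aT: "adj (%x. y (h x)) = ?T"
    by (rule ext, rule ci_eqI) (simp only: adj_cinner'[OF M_bcl[OF S]] Pr_ci[OF h] adj_cinner'[OF M_bcl[OF y]])
   hence aT': "adj ?T = (%x. y (h x))" using adj_adj[OF M_bcl[OF S]] by simp
   show m: "(%x. y (h (adj y x))) : M" by (rule M_compose[OF y T])
   have f: "cinner (y (h (adj y u))) v = cinner (h (adj y u)) (h (adj y v))" for u v
    by (simp only: adj_cinner[OF M_bcl[OF y]] Pr_ci[OF h, symmetric] Pr_idem[OF h])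
   thus "inner (y (h (adj y x))) x = (norm (h (adj y x)))^2" for x by (simp add: inner_eq_Re_cinner power2_norm_eq_inner)
   hence "0 <= inner (y (h (adj y x))) x" for x by simp
   moreover have "cinner (y (h (adj y u))) v = cinner u (y (h (adj y v)))" for u v
    by (subst f) (simp only: Pr_ci[OF h] Pr_idem[OF h] adj_cinner'[OF M_bcl[OF y]])
   ultimately show "positive_op (%x. y (h (adj y x)))" unfolding pos_iff selfadj_def adjoint_pair_def using M_bcl[OF m] by blast
   show "mB (%x. y (h (adj y x))) t = (mB (%x. y (h x)) t)^2"
    using mB_square[OF T, of t] mB_adj[OF S, of t] unfolding aT' aT by (simp add: Pr_idem[OF h])
  qed
  note I = sq[OF Pr_ident] and G = sq[OF g] and Gc = sq[OF Pr_compl[OF g]]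
  define B where "B = (%x. y (adj y x))"
  define A where "A = (%x. y (g (adj y x)))"
  define Y where "Y = mB y"
  define W where "W = mB (%x. y (g x))"
  define X where "X = mB (%x. y (x-g x))"
  have B: "B : M" "positive_op B" using I(1,2) by (auto simp: B_def)
  have A: "A : M" "positive_op A" using G(1,2) by (auto simp: A_def)
  have Y0: "0 <= Y t" and W0: "0 <= W t" and X0: "0 <= X t" for t
   unfolding Y_def W_def X_def by (intro muf_nonneg M_tmeas y G(5) Gc(5))+
  have AB: "inner (A x) x <= inner (B x) x" for x
   using I(3)[of x] G(3)[of x] pr_nle[OF Pr_proj[OF g], of "adj y x"] by (simp add: A_def B_def power_mono)
  let ?b = "rt k B" and ?a = "rt k A"
  define c' where "c' = (%x. ?b x-?a x)"
  have cM: "c' : M" unfolding c'_def by (rule M_diff[OF rt_M[OF B] rt_M[OF A]])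
  have cp: "positive_op c'" unfolding pos_iff c'_def
   using rt_mono[OF A B AB] sa_diff[OF pos_sa[OF rt_pos[OF B]] pos_sa[OF rt_pos[OF A]]]
   by (simp add: inner_diff_left)
  have bY: "mB ?b t = Y t powr ka" and aW: "mB ?a t = W t powr ka" for t
  proof -
   have r: "(z^2) powr ta = z powr ka" for z :: real
    by (simp add: power2_eq_square powr_mult powr_add[symmetric] ka_def)
   have "mB B t = (Y t)^2" unfolding B_def Y_def by (rule I(4))
   thus "mB ?b t = Y t powr ka" using mB_rt[OF B, of k t] r[of "Y t"] unfolding ta_def by simp
   have "mB A t = (W t)^2" unfolding A_def W_def by (rule G(4))
   thus "mB ?a t = W t powr ka" using mB_rt[OF A, of k t] r[of "W t"] unfolding ta_def by simp
  qed
  obtain K where K: "K > 0" "!!x. norm (y x) <= K*norm x" using bcl_bdd[OF M_bcl[OF y]] by blast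
  have YK: "Y t <= K" if "0 < t" for t unfolding Y_def using mB_bound[OF that K(2)] K(1) by simp
  have WY: "W t <= Y t" if t: "0 < t" for t
  proof -
   have "(W t)^2 <= (Y t)^2" using mB_form_mono[OF A B AB t] G(4)[of t] I(4)[of t] by (simp add: A_def B_def W_def Y_def)
   thus ?thesis using Y0 by (rule power2_le_imp_le)
  qed
  have Yd: "decr Y" unfolding Y_def by (rule muf_decr[OF M_tmeas[OF y]])
  have Wm: "W : borel_measurable borel" unfolding W_def by (rule muf_borel[OF M_tmeas[OF G(5)]])
  have YE: "Y : Er" using yE by (simp add: Y_def)
  define Q where "Q = (%t. mB c' (2*t) powr (1/ka))"
  have "Q : Er & Nr Q <= si" unfolding Q_def
  proof (rule gap[OF YE Yd Wm])
   show "0 <= W t & W t <= Y t & Y t <= K" if "0 < t" for t using W0 WY[OF that] YK[OF that] by blast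
   show "Nr Y <= 1" "1-de <= Nr W" using Ny Ng by (auto simp: Y_def W_def)
   show "decr (mB c')" by (rule muf_decr[OF M_tmeas[OF cM]])
   have cb: "inner (c' x) x <= inner (?b x) x" for x using pos_in[OF rt_pos[OF A], of k x] by (simp add: c'_def inner_diff_left)
   show "mB c' t <= Y t powr ka" if "0 < t" for t using mB_form_mono[OF cM cp rt[OF B] cb that] by (simp add: bY)
   show "gap_bound ka Y W (mB c')" unfolding gap_bound_def
   proof (intro allI impI)
    fix l t :: real assume l: "0 < l" and t: "0 < t"
     and int: "(\<integral>\<^sup>+ r. ennreal (indicator {0<..} r*(max 0 (Y r powr ka-l)-max 0 (W r powr ka-l))) \<partial>lborel) <= ennreal (l*t)"
    \<comment> \<open>Since Y vanishes at infinity, the cut of the root of B at any positive level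
      has finite trace, as the trace inequality requires.\<close>
    obtain s where s: "0 < s" "Y s < l powr (1/ka)" using decr_vanishes[OF YE Yd, of "l powr (1/ka)"] l by auto
    have "Y s powr ka < (l powr (1/ka)) powr ka" using s Y0 ka by (intro powr_less_mono2) auto
    hence "mB ?b s < l" using l ka by (simp add: powr_powr bY)
    hence "dB ?b s l" by (rule muf_less[OF M_tmeas[OF rt_M[OF B]] s(1)])
    hence "\<tau> (cutp ?b l) <= ennreal s" using dB_iff_cutp[OF rt[OF B] less_imp_le[OF l]] by simp
    hence fin: "\<tau> (cutp ?b l) < \<infinity>" by (rule le_less_trans) simp
    have ti: "ennreal l*\<tau> (cutp c' (2*l))+tail ?a l <= tail ?b l"
     by (rule tr_inequality[OF rt[OF A] rt[OF B] c'_def cp l fin])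
    have bf: "tail ?b l < \<infinity>" using tr_pos_part(2)[OF rt[OF B] _ fin] l by simp
    hence af: "tail ?a l ~= \<infinity>" using ti by (auto simp: top_unique)
    have [measurable]: "Y : borel_measurable borel" using Yd by (simp add: decr_def)
    note [measurable] = Wm
    have "tail ?b l = (\<integral>\<^sup>+ r. ennreal (indicator {0<..} r*(max 0 (Y r powr ka-l)-max 0 (W r powr ka-l)))
     + ennreal (indicator {0<..} r*max 0 (W r powr ka-l)) \<partial>lborel)"
     unfolding tail_def[OF rt[OF B]] bY
    proof (intro nn_integral_cong)
     fix r
     show "ennreal (indicator {0<..} r*max 0 (Y r powr ka-l)) = ennreal (indicator {0<..} r*(max 0 (Y r powr ka-l)-max 0 (W r powr ka-l)))
      + ennreal (indicator {0<..} r*max 0 (W r powr ka-l))"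
     proof (cases "0 < r")
      case True
      have "W r powr ka <= Y r powr ka" using WY[OF True] W0 ka by (intro powr_mono2) auto
      hence "max 0 (W r powr ka-l) <= max 0 (Y r powr ka-l)" by (intro max.mono) auto
      thus ?thesis using True by (subst ennreal_plus[symmetric]) auto
     qed simp
    qed
    also have "... = (\<integral>\<^sup>+ r. ennreal (indicator {0<..} r*(max 0 (Y r powr ka-l)-max 0 (W r powr ka-l))) \<partial>lborel)+tail ?a l"
     unfolding tail_def[OF rt[OF A]] aW by (intro nn_integral_add) auto
    also have "... <= ennreal (l*t)+tail ?a l" using int by (rule add_right_mono)
    finally have "tail ?b l <= ennreal (l*t)+tail ?a l" .
    with ti have "ennreal l*\<tau> (cutp c' (2*l))+tail ?a l <= ennreal (l*t)+tail ?a l" by (rule order_trans)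
    hence "tail ?a l+ennreal l*\<tau> (cutp c' (2*l)) <= tail ?a l+ennreal (l*t)" by (simp only: add.commute)
    hence "ennreal l*\<tau> (cutp c' (2*l)) <= ennreal l*ennreal t" using af l by (simp add: ennreal_add_left_cancel_le ennreal_mult')
    hence "\<tau> (cutp c' (2*l)) <= ennreal t" using l by (subst (asm) ennreal_mult_le_mult_iff) auto
    hence "dB c' t (2*l)" using dB_iff_cutp[OF cM cp] l by simp
    thus "mB c' t <= 2*l" using l by (intro muf_le) auto
   qed
  qed
  hence QE: "Q : Er" and NQ: "Nr Q <= si" by auto
  \<comment> \<open>Taking square roots in \<open>mB_root_diff\<close> gives X(D t) \<le> c Y(2
    t)^(1 - ta) Q(t)^ta, since \<mu>(c') at 2 t is Q(t)^(2 ta).\<close>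
  have Xle: "X (D*t) <= e*Y t+c*ro powr (ta-1)*Q t" if t: "0 < t" for t
  proof -
   let ?y = "Y (2*t)"
   have t2: "0 < 2*t" using t by simp
   have e0: "(X (4^k*(2*t)))^2 = mB (%x. B x-A x) (4^k*(2*t))"
    using Gc(4)[of "4^k*(2*t)"] by (simp add: X_def A_def B_def bcl_simps(2)[OF M_bcl[OF y]])
   have le: "mB (%x. B x-A x) (4^k*(2*t)) <= 2^k*mB B (2*t) powr (1-1/2^k)*mB c' (2*t)"
    unfolding c'_def by (rule mB_root_diff[OF A B AB t2 k(1)])
   have e1: "mB B (2*t) = ?y^2" using I(4)[of "2*t"] by (simp add: B_def Y_def)
   have e2: "1-1/2^k = 1-ta" by (simp add: ta_def)
   have e3: "(?y^2) powr (1-ta) = (?y powr (1-ta))^2" by (simp add: power2_eq_square powr_mult)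
   have e4: "mB c' (2*t) = (Q t powr ta)^2"
   proof -
    have "0 <= mB c' (2*t)" by (rule muf_nonneg[OF M_tmeas[OF cM]])
    thus ?thesis using ta by (simp add: Q_def ka_def powr_powr power2_eq_square powr_add[symmetric])
   qed
   have e5: "2^k*(?y powr (1-ta))^2*(Q t powr ta)^2 = (c*(?y powr (1-ta)*Q t powr ta))^2"
    by (simp add: power_mult_distrib c(2))
   have "(X (4^k*(2*t)))^2 <= (c*(?y powr (1-ta)*Q t powr ta))^2"
    using le by (simp only: e0 e1 e2 e3 e4 e5)
   hence "X (4^k*(2*t)) <= c*(?y powr (1-ta)*Q t powr ta)" by (rule power2_le_imp_le) (use c in simp)
   moreover have "4^k*(2*t) = D*t" by (simp add: D_def power_mult)
   ultimately have "X (D*t) <= c*(?y powr (1-ta)*Q t powr ta)" by (simp only:)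
   also have "c*(?y powr (1-ta)*Q t powr ta) <= c*(ro powr ta*?y+ro powr (ta-1)*Q t)"
    using Y0 ro(1) ta c(1) by (intro mult_left_mono powr_interpolate) (auto simp: Q_def)
   also have "... = e*?y+c*ro powr (ta-1)*Q t" by (simp add: distrib_left mult.assoc[symmetric] ro(2))
   also have "... <= e*Y t+c*ro powr (ta-1)*Q t" using e Yd t by (intro add_right_mono mult_left_mono) (auto simp: decr_def)
   finally show ?thesis .
  qed
  let ?F = "%t. e*Y t+c*ro powr (ta-1)*Q t"
  have E1: "(%t. e*Y t) : Er" and E2: "(%t. c*ro powr (ta-1)*Q t) : Er" by (rule Er_scale[OF YE], rule Er_scale[OF QE])
  have F: "?F : Er" by (rule Er_add[OF E1 E2])
  have n1: "Nr (%t. e*Y t) <= e" using Nr_scale[OF YE, of e] Ny e by (simp add: Y_def mult_left_le)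
  have n2: "Nr (%t. c*ro powr (ta-1)*Q t) <= e"
  proof -
   have p: "0 < c*ro powr (ta-1)" using c ro by simp
   have "Nr (%t. c*ro powr (ta-1)*Q t) = c*ro powr (ta-1)*Nr Q" using Nr_scale[OF QE] p by (simp only: abs_of_pos)
   also have "... <= c*ro powr (ta-1) * si" using NQ p by (intro mult_left_mono) auto
   finally show ?thesis using si by simp
  qed
  have "Nr ?F powr \<alpha> <= e powr \<alpha>+e powr \<alpha>"
   using Nr_add[OF E1 E2] Nr_powr_mono[OF E1 n1] Nr_powr_mono[OF E2 n2] by linarith
  moreover have XE: "(%t. ?F (t/2^(2*k+1))) : Er" "Nr (%t. ?F (t/2^(2*k+1))) powr \<alpha> <= D*Nr ?F powr \<alpha>"
   using dilate_up_pow[OF F, of "2*k+1"] by (auto simp: D_def)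
  moreover have Xm: "X : borel_measurable borel" unfolding X_def by (rule muf_borel[OF M_tmeas[OF Gc(5)]])
  have "\<bar>X t\<bar> <= \<bar>?F (t/2^(2*k+1))\<bar>" if t: "0 < t" for t
  proof -
   have "0 < t/D" using t D by simp
   from Xle[OF this] have "X t <= ?F (t/D)" using D by simp
   thus ?thesis using X0[of t] by (simp add: D_def)
  qed
  hence "X : Er" "Nr X <= Nr (%t. ?F (t/2^(2*k+1)))" using Er_ideal[OF XE(1) Xm] by auto
  moreover hence "Nr X powr \<alpha> <= Nr (%t. ?F (t/2^(2*k+1))) powr \<alpha>" by (intro Nr_powr_mono)
  ultimately have "Nr X powr \<alpha> <= D*(e powr \<alpha>+e powr \<alpha>)" using D by (meson mult_left_mono order_trans less_imp_le)
  also have "... = eps powr \<alpha>"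
  proof -
   have "e powr \<alpha> = eps powr \<alpha>/(2*D)" using \<alpha> D by (simp add: e_def powr_divide powr_powr)
   thus ?thesis using D by simp
  qed
  finally have "Nr X <= eps" using eps \<open>X : Er\<close> by (intro Nr_powr_le) auto
  thus "Nr (mB (%x. y (x-g x))) <= eps" by (simp add: X_def)
 qed
qed

end

section \<open>The uniform Kadec-Klee-Huff property\<close>

context vn_E begin

lemma muf_eq_sing:
 assumes x: "x : measurable_ops M \<tau>" and t: "0 < t"
 shows "sing_val \<tau> x t = ennreal (muf x t)"
proof -
 note tx = mops_tmeas[OF x]
 have "mu x t = ennreal (muf x t)"
 proof (rule antisym)
  show "mu x t <= ennreal (muf x t)"
  proof (rule ennreal_le_epsilon)
   fix e :: real assume e: "0 < e"
   have "dle x t (muf x t+e)" by (rule muf_less[OF tx t]) (use e in simp)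
   hence "mu x t <= ennreal (muf x t+e)" using muf_nonneg[OF tx, of t] e by (intro mu_le) auto
   thus "mu x t <= ennreal (muf x t)+ennreal e" using muf_nonneg[OF tx, of t] e by simp
  qed
  show "ennreal (muf x t) <= mu x t" unfolding mu_def by (intro Inf_greatest) (auto intro!: ennreal_leI muf_le)
 qed
 thus ?thesis using sing_val_eq_mu[OF mops_aff[OF x]] by simp
qed

text \<open>The two functions agree for t > 0. The value at 0, possibly an artefact of
  \<open>enn2real\<close>, lies on a null set.\<close>

lemma sing_fun_iff:
 assumes x: "x : measurable_ops M \<tau>"
 shows "sing_fun \<tau> x : E \<longleftrightarrow> muf x : Er" "muf x : Er ==> N (sing_fun \<tau> x) = Nr (muf x)"
proof -
 note tx = mops_tmeas[OF x]
 have e: "sing_fun \<tau> x t = cf (muf x) t" if "0 < t" for t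
  using muf_eq_sing[OF x that] muf_nonneg[OF tx, of t] by (simp add: sing_fun_def cf_def)
 define g where "g t = (if t = 0 then enn2real (sing_val \<tau> x 0) else muf x t)" for t
 have gm: "g : borel_measurable borel" unfolding g_def using muf_borel[OF tx] by measurable
 have "sing_fun \<tau> x t = cf g t" if "t : space lebesgue_pos" for t
  using that e[of t] by (cases "t = 0") (auto simp: g_def cf_def sing_fun_def)
 hence m: "sing_fun \<tau> x : borel_measurable lebesgue_pos" using cf_meas[OF gm] by (subst measurable_cong)
 have ae: "AE t in lebesgue_pos. cmod (sing_fun \<tau> x t) <= cmod (cf (muf x) t)" "AE t in lebesgue_pos. cmod (cf (muf x) t) <= cmod (sing_fun \<tau> x t)"
  using e by (auto intro!: AE_pos)
 have cm: "cf (muf x) : borel_measurable lebesgue_pos" by (rule cf_meas[OF muf_borel[OF tx]])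
 have 1: "sing_fun \<tau> x : E & N (sing_fun \<tau> x) <= Nr (muf x)" if "muf x : Er"
  using ideal[OF _ m ae(1)] that by (simp add: Er_def Nr_def)
 have 2: "muf x : Er & Nr (muf x) <= N (sing_fun \<tau> x)" if "sing_fun \<tau> x : E"
  using ideal[OF that cm ae(2)] muf_borel[OF tx] by (simp add: Er_def Nr_def)
 show "sing_fun \<tau> x : E \<longleftrightarrow> muf x : Er" "muf x : Er ==> N (sing_fun \<tau> x) = Nr (muf x)" using 1 2 by (auto intro: antisym)
qed

text \<open>The triangle inequality is exact at doubled argument, \<mu>_2t(z) \<le> \<mu>_t(x) +
  \<mu>_t(y), and the dilation costs the factor 2. No closedness is involved, so approximants may be
  subtracted algebraically.\<close>

lemma muf_tri:
 assumes z: "!!v w w'. (v, w) : x ==> (v, w') : y ==> \<exists>u. (v, u) : z & norm u <= norm w+norm w'"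
  and x: "tmeas x" "muf x : Er" "Nr (muf x) powr \<alpha> <= a" and y: "tmeas y" "muf y : Er" "Nr (muf y) powr \<alpha> <= b"
 shows "tmeas z" "muf z : Er" "Nr (muf z) powr \<alpha> <= 2*(a+b)"
proof -
 show tz: "tmeas z" using x(1) y(1) z by (rule tmeas_add)
 let ?F = "%t. muf x t+muf y t"
 have F: "?F : Er" by (rule Er_add[OF x(2) y(2)])
 have le: "muf z (2*t) <= ?F t" if t: "0 < t" for t
 proof (rule field_le_epsilon)
  fix e :: real assume e: "0 < e"
  have "dle x t (muf x t+e/2)" "dle y t (muf y t+e/2)"
   using e by (auto intro!: muf_less[OF x(1) t] muf_less[OF y(1) t])
  hence "dle z (t+t) ((muf x t+e/2)+(muf y t+e/2))" using t z by (intro dle_add[of x _ _ y]) auto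
  hence "muf z (t+t) <= (muf x t+e/2)+(muf y t+e/2)"
   using e muf_nonneg[OF x(1), of t] muf_nonneg[OF y(1), of t] by (intro muf_le) auto
  moreover have "t+t = 2*t" "(muf x t+e/2)+(muf y t+e/2) = muf x t+muf y t+e" by auto
  ultimately show "muf z (2*t) <= muf x t+muf y t+e" by (simp only:)
 qed
 note d = dilate_up[OF F]
 have "\<bar>muf z t\<bar> <= \<bar>?F (t/2)\<bar>" if "0 < t" for t using le[of "t/2"] that muf_nonneg[OF tz, of t] by simp
 note id = Er_ideal[OF d(1) muf_borel[OF tz] this]
 show "muf z : Er" by (rule id(1))
 have "Nr (muf z) powr \<alpha> <= Nr (%t. ?F (t/2)) powr \<alpha>" by (rule Nr_powr_mono[OF id])
 also have "... <= 2*Nr ?F powr \<alpha>" by (rule d(2))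
 also have "... <= 2*(a+b)" using Nr_add[OF x(2) y(2)] x(3) y(3) by simp
 finally show "Nr (muf z) powr \<alpha> <= 2*(a+b)" .
qed

lemma mB_tri:
 assumes S: "S : M" "mB S : Er" "Nr (mB S) powr \<alpha> <= a" and T: "T : M" "mB T : Er" "Nr (mB T) powr \<alpha> <= b"
  and R: "!!x. R x = S x+T x"
 shows "mB R : Er" "Nr (mB R) powr \<alpha> <= 2*(a+b)"
 by (rule muf_tri[OF _ M_tmeas[OF S(1)] S(2,3) M_tmeas[OF T(1)] T(2,3)]; simp add: R norm_triangle_ineq)+

lemma head_small:
 assumes f: "f : Er" and e: "0 < eps"
 shows "\<exists>u>0. Nr (rs f {0<..u}) < eps"
proof -
 have "(%k. Nr (rs f {0<..1/real (Suc k)})) \<longlonglongrightarrow> 0"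
 proof (rule order_cont[OF f])
  show "{0<..1/real (Suc j)} \<subseteq> {0<..1/real (Suc i)}" if "i <= j" for i j
  proof -
   have "1/real (Suc j) <= 1/real (Suc i)" using that by (intro divide_left_mono) auto
   thus ?thesis by auto
  qed
  fix t :: real assume "0 < t"
  then obtain k where "inverse (real (Suc k)) < t" using reals_Archimedean by blast
  thus "\<exists>k. t \<notin> {0<..1/real (Suc k)}" by (intro exI[of _ k]) (simp add: inverse_eq_divide)
 qed simp
 from order_tendstoD(2)[OF this e] obtain k where "Nr (rs f {0<..1/real (Suc k)}) < eps" unfolding eventually_sequentially by blast
 thus ?thesis by (intro exI[of _ "1/real (Suc k)"]) simp
qed

lemma Er_indicator: "(indicator {0<..A::real} :: real => real) : Er"
proof -
 let ?f = "indicator {0<..A} :: real => real"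
 have m: "?f : borel_measurable borel" by simp
 have "finite (cf ?f ` space lebesgue_pos)"
  by (rule finite_subset[of _ "{0, 1}"]) (auto simp: cf_def indicator_def)
 hence "simple_function lebesgue_pos (cf ?f)" by (intro simple_function_borel_measurable cf_meas m)
 moreover have "emeasure lebesgue_pos {t : {0..}. cf ?f t ~= 0} < \<infinity>"
 proof -
  have "{t : {0..}. cf ?f t ~= 0} = {0<..A}" by (auto simp: cf_def indicator_def)
  moreover have "emeasure lebesgue_pos {0<..A} = emeasure lborel {0<..A}" by (simp add: emeasure_restrict_space subset_eq)
  moreover have "emeasure lborel {0<..A} < \<infinity>" by (cases "0 <= A") auto
  ultimately show ?thesis by simp
 qed
 ultimately have "cf ?f : E" by (rule simple)
 thus ?thesis using m by (simp add: Er_def)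
qed

text \<open>An operator bounded by \<open>K\<close> and vanishing on a projection of cotrace
  \<open>A\<close> has singular values below a step function.\<close>

lemma step_bound:
 assumes z: "tmeas z" and K: "0 <= K" "!!t. 0 < t ==> dle z t K" and A: "dle z A 0"
 shows "muf z : Er" "Nr (muf z) <= K*Nr (indicator {0<..A})"
proof -
 have I: "(%t. K*indicator {0<..A} t) : Er" by (rule Er_scale[OF Er_indicator])
 have "\<bar>muf z t\<bar> <= \<bar>K*indicator {0<..A} t\<bar>" if t: "0 < t" for t
 proof (cases "t <= A")
  case True
  have "muf z t <= K" by (rule muf_le[OF K(2)[OF t] K(1)])
  thus ?thesis using True t K(1) muf_nonneg[OF z, of t] by simp
 next
  case False
  hence "dle z t 0" by (intro dle_mono[OF A]) auto
  hence "muf z t <= 0" by (intro muf_le) auto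
  thus ?thesis using False muf_nonneg[OF z, of t] by simp
 qed
 from Er_ideal[OF I muf_borel[OF z] this] Nr_scale[OF Er_indicator, of K A] K(1)
 show "muf z : Er" "Nr (muf z) <= K*Nr (indicator {0<..A})" by auto
qed

text \<open>For measurable \<open>x\<close> failure of \<open>dle\<close> at (t, s) is the strict
  inequality t < \<tau>(\<open>spa x s\<close>), which persists for slightly larger t.\<close>

lemma muf_right_cont:
 assumes x: "x : measurable_ops M \<tau>" and t: "0 < t" and s: "s < muf x t"
 shows "\<exists>t'>t. s <= muf x t'"
proof (cases "0 <= s")
 case True
 note tx = mops_tmeas[OF x] and iff = dle_iff[OF mops_aff[OF x] True]
 have "\<not> dle x t s" using s muf_le[of x t s] True by auto
 hence "ennreal t < \<tau> (spa x s)" by (simp add: iff not_le)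
 then obtain v where v: "ennreal t < v" "v < \<tau> (spa x s)" using dense by blast
 then obtain t' where t': "v = ennreal t'" "0 <= t'" by (cases v rule: ennreal_cases) auto
 hence "t < t'" using v t by (simp add: ennreal_less_iff)
 moreover have "\<not> dle x t' s" using v t' by (simp add: iff not_le)
 hence "s <= muf x t'" using muf_less[OF tx, of t' s] t \<open>t < t'\<close> by force
 ultimately show ?thesis by blast
next
 case False
 thus ?thesis using muf_nonneg[OF mops_tmeas[OF x], of "t+1"] by (intro exI[of _ "t+1"]) auto
qed

text \<open>The lower bound on the norm of the limit must tolerate errors both in the value and in
  the argument of \<mu>. The perturbed functions converge pointwise by right continuity, so
  \<open>dom_conv\<close> applies to the differences.\<close>

lemma shift_norm:
 assumes x: "x : measurable_ops M \<tau>" and f: "muf x : Er" and a: "0 < a" "a < Nr (muf x)"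
 shows "\<exists>ka>0. a < Nr (%t. max 0 (muf x (t+ka)-ka))"
proof (rule ccontr)
 assume neg: "\<not> ?thesis"
 note tx = mops_tmeas[OF x]
 have fm [measurable]: "muf x : borel_measurable borel" by (rule muf_borel[OF tx])
 have f0: "0 <= muf x t" for t by (rule muf_nonneg[OF tx])
 have fd: "muf x t <= muf x s" if "0 < s" "s <= t" for s t using muf_decr[OF tx] that by (simp add: decr_def)
 define v where "v k = 1/real (Suc k)" for k
 have v: "0 < v k" for k by (simp add: v_def)
 have vl: "v \<longlonglongrightarrow> 0" unfolding v_def by (rule LIMSEQ_Suc[OF lim_1_over_n])
 define h where "h k t = max 0 (muf x (t+v k)-v k)" for k t
 have hm: "h k : borel_measurable borel" for k unfolding h_def by measurable
 have hf: "0 <= h k t" "h k t <= muf x t" if "0 < t" for k t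
  using fd[of t "t+v k"] f0[of t] that v[of k] by (auto simp: h_def)
 have hE: "h k : Er" for k using Er_ideal(1)[OF f hm] hf f0 by fastforce
 let ?d = "%k t. muf x t-h k t"
 have dm: "?d k : borel_measurable borel" for k using hm by measurable
 define e where "e = (Nr (muf x) powr \<alpha>-a powr \<alpha>) powr (1/\<alpha>)"
 have pos: "0 < Nr (muf x) powr \<alpha>-a powr \<alpha>" using a \<alpha> powr_less_mono2[of \<alpha> a "Nr (muf x)"] by simp
 have "\<exists>K. \<forall>k\<ge>K. Nr (?d k) < e"
 proof (rule dom_conv[OF f dm])
  show "\<bar>?d k t\<bar> <= \<bar>muf x t\<bar>" if "0 < t" for k t using hf[OF that, of k] by simp
  show "(%k. ?d k t) \<longlonglongrightarrow> 0" if t: "0 < t" for t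
  proof (rule LIMSEQ_I)
   fix r :: real assume r: "0 < r"
   obtain t' where t': "t < t'" "muf x t-r/2 <= muf x t'" using muf_right_cont[OF x t, of "muf x t-r/2"] r by auto
   have "\<forall>\<^sub>F k in sequentially. v k < min (r/2) (t'-t)" by (rule order_tendstoD(2)[OF vl]) (use r t' in simp)
   then obtain K where K: "!!k. k >= K ==> v k < min (r/2) (t'-t)" unfolding eventually_sequentially by blast
   have "norm (?d k t-0) < r" if "k >= K" for k
   proof -
    have "muf x t' <= muf x (t+v k)" using K[OF that] t v[of k] by (intro fd) auto
    hence "muf x t-r < h k t" using K[OF that] t' unfolding h_def by linarith
    thus ?thesis using hf[OF t, of k] by simp
   qed
   thus "\<exists>K. \<forall>k\<ge>K. norm (?d k t-0) < r" by blast
  qed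
  show "0 < e" using pos by (simp add: e_def)
 qed
 then obtain k where k: "Nr (?d k) < e" by blast
 have dE: "?d k : Er" using Er_ideal(1)[OF f dm] hf[of _ k] f0 by fastforce
 have "Nr (h k) <= a" using neg v[of k] unfolding h_def by (meson not_le)
 hence 1: "Nr (h k) powr \<alpha> <= a powr \<alpha>" by (rule Nr_powr_mono[OF hE])
 have "Nr (?d k) powr \<alpha> < e powr \<alpha>" using k Nr_nonneg[OF dE] \<alpha> by (intro powr_less_mono2) auto
 also have "e powr \<alpha> = Nr (muf x) powr \<alpha>-a powr \<alpha>" using pos \<alpha> by (simp add: e_def powr_powr)
 finally have "Nr (h k) powr \<alpha>+Nr (?d k) powr \<alpha> < Nr (muf x) powr \<alpha>" using 1 by simp
 moreover have "Nr (%t. h k t+?d k t) powr \<alpha> <= Nr (h k) powr \<alpha>+Nr (?d k) powr \<alpha>" by (rule Nr_add[OF hE dE])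
 ultimately show False by simp
qed

lemma spa_mono':
 assumes x: "aff x" and s: "0 <= s" "s <= r"
 shows "spa x s (spa x r v) = spa x r v" "spa x r (spa x s v) = spa x r v"
proof -
 show 1: "spa x s (spa x r v) = spa x r v" for v by (rule spa_mono[OF affD(1)[OF x] s])
 note p = Pr_ci[OF Pr_spa[OF x]]
 show "spa x r (spa x s v) = spa x r v" by (rule ci_eqI) (simp add: p 1)
qed

text \<open>The approximant is x h, where 1 - h is a spectral projection far out. The error has
  singular values at most \<mu>(x) and vanishes on \<open>h\<close>, so it is dominated by the head
  of \<mu>(x) on (0, v], small by order continuity.\<close>

lemma approx_bdd:
 assumes x: "x : measurable_ops M \<tau>" and f: "muf x : Er" and e: "0 < eps" and u: "0 < u"
 obtains y h where "y : M" "Pr h" "\<tau> (%r. r-h r) <= ennreal u" "!!r. h r = r ==> (r, y r) : x"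
  "!!t. 0 < t ==> mB y t <= muf x t" "tmeas (algdiff x (graph_of y))" "muf (algdiff x (graph_of y)) : Er"
  "Nr (muf (algdiff x (graph_of y))) <= eps"
proof -
 note ax = mops_aff[OF x] and tx = mops_tmeas[OF x]
 note lin = aff_linear[OF ax]
 obtain v where v: "0 < v" "Nr (rs (muf x) {0<..v}) < eps" using head_small[OF f e] by blast
 obtain s0 where s0: "0 <= s0" "\<tau> (spa x s0) < \<infinity>" using x by (auto simp: mops_iff)
 have "(0::ennreal) < ennreal (min u v)" using u v by simp
 from spa_tr_small[OF ax s0 this] obtain R where R: "s0 <= R" "\<tau> (spa x R) < ennreal (min u v)" by blast
 have R0: "0 <= R" using R s0 by simp
 let ?E = "spa x R"
 define h where "h = (%r. r-?E r)"
 have EP: "Pr ?E" by (rule Pr_spa[OF ax])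
 have h: "Pr h" unfolding h_def by (rule Pr_compl[OF EP])
 have bq: "bd x h R" unfolding h_def by (rule bd_spa[OF ax R0])
 obtain y where y: "y : M" "!!r. (h r, y r) : x" using bdd_part[OF ax h bq] by blast
 have qt: "\<tau> (%r. r-h r) = \<tau> ?E" by (simp add: h_def)
 have le: "\<tau> ?E <= ennreal u" "\<tau> ?E <= ennreal v"    by (rule order_trans[OF less_imp_le[OF R(2)] ennreal_leI], simp)+
 have E0: "spa x s (?E r) = 0" if "0 <= s" "spa x s r = 0" for s r
 proof (cases "s <= R")
  case True
  have "?E r = ?E (spa x s r)" using spa_mono'(2)[OF ax that(1) True] by simp
  thus ?thesis using that by (simp add: bcl_simps(4)[OF Pr_bcl[OF EP]] bcl_simps(4)[OF Pr_bcl[OF Pr_spa[OF ax]]])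
 next
  case False
  thus ?thesis using spa_mono'(2)[OF ax R0, of s r] that by simp
 qed
 \<comment> \<open>Optimal projections for \<mu>(x) can be taken spectral, so they are compatible
   with \<open>?E\<close>, and neither \<open>y\<close> nor the error has larger singular values
   than \<open>x\<close>.\<close>
 have opt: "\<exists>p. Pr p & \<tau> (%r. r-p r) <= ennreal t & (\<forall>r \<eta>. p r = r --> (r, \<eta>) : x --> norm \<eta> <= s*norm r) \<and>
   (\<forall>r. p r = r --> p (?E r) = ?E r) & bd x p s" if "0 <= s" "dle x t s" for t s
 proof -
  let ?F = "spa x s" and ?p = "%r. r-spa x s r"
  have b: "bd x ?p s" by (rule bd_spa[OF ax that(1)])
  have "\<tau> ?F <= ennreal t" using dle_iff[OF ax that(1)] that(2) by blast
  moreover have "norm \<eta> <= s*norm r" if "?p r = r" "(r, \<eta>) : x" for r \<eta>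
   using b that lin_uniq[OF lin] unfolding bd_def by blast
  moreover have "?p (?E r) = ?E r" if "?p r = r" for r using E0[OF \<open>0 <= s\<close>, of r] that by simp
  ultimately show ?thesis using b Pr_compl[OF Pr_spa[OF ax]] by (intro exI[of _ ?p]) simp
 qed
 have p2: "norm (y r) <= s*norm r" "(r, \<eta>) : x ==> norm (\<eta>-y r) <= s*norm r"
  if p: "Pr p" "\<forall>r \<eta>. p r = r --> (r, \<eta>) : x --> norm \<eta> <= s*norm r" "\<forall>r. p r = r --> p (?E r) = ?E r" "p r = r" "0 <= s" for p s r \<eta>
 proof -
  have "p (h r) = h r" using p by (simp add: h_def bcl_simps(2)[OF Pr_bcl[OF p(1)]])
  hence "norm (y r) <= s*norm (h r)" using p(2) y(2) by blast
  also have "... <= s*norm r" using p(5) pr_nle[OF Pr_proj[OF h]] by (intro mult_left_mono)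
  finally show "norm (y r) <= s*norm r" .
  assume "(r, \<eta>) : x"
  hence "(r-h r, \<eta>-y r) : x" by (rule lin_diff[OF lin _ y(2)])
  hence "(?E r, \<eta>-y r) : x" by (simp add: h_def)
  hence "norm (\<eta>-y r) <= s*norm (?E r)" using p(2,3,4) by blast
  also have "... <= s*norm r" using p(5) pr_nle[OF Pr_proj[OF EP]] by (intro mult_left_mono)
  finally show "norm (\<eta>-y r) <= s*norm r" .
 qed
 let ?w = "algdiff x (graph_of y)"
 have wI: "(r, \<eta>) : x ==> (r, \<eta>-y r) : ?w" for r \<eta> by (rule adiffI) simp_all
 have dw: "dle ?w t s" and dy: "dB y t s" if st: "0 <= s" "dle x t s" for t s
 proof -
  obtain p where p: "Pr p" "\<tau> (%r. r-p r) <= ennreal t" "\<forall>r \<eta>. p r = r --> (r, \<eta>) : x --> norm \<eta> <= s*norm r"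
   "\<forall>r. p r = r --> p (?E r) = ?E r" "bd x p s" using opt[OF st] by blast
  have "bd (graph_of y) p s" unfolding bd_graph_of using p2(1)[OF p(1,3,4) _ st(1)] by blast
  thus "dB y t s" using p(1,2) unfolding dle_def by blast
  have "bd ?w p s" unfolding bd_def
  proof (intro allI impI)
   fix r assume px: "p r = r"
   then obtain \<eta> where "(r, \<eta>) : x" using p(5) by (auto simp: bd_def)
   thus "\<exists>\<eta>. (r, \<eta>) : ?w & norm \<eta> <= s*norm r" using p2(2)[OF p(1,3,4) px st(1)] wI by blast
  qed
  thus "dle ?w t s" using p(1,2) unfolding dle_def by blast
 qed
 have tw: "tmeas ?w" using tx dw unfolding tmeas_def by blast
 have w0: "dle ?w v 0"
 proof -
  have "bd ?w h 0" unfolding bd_def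
  proof (intro allI impI)
   fix r assume "h r = r"
   thus "\<exists>\<eta>. (r, \<eta>) : ?w & norm \<eta> <= 0*norm r" using wI[of r "y r"] y(2)[of r] by auto
  qed
  thus ?thesis unfolding dle_def using h le(2) qt by auto
 qed
 have "\<bar>muf ?w t\<bar> <= \<bar>rs (muf x) {0<..v} t\<bar>" if t: "0 < t" for t
 proof (cases "t <= v")
  case True
  have "muf ?w t <= muf x t" by (rule muf_le_muf[OF tx t]) (rule muf_le[OF dw])
  thus ?thesis using True t muf_nonneg[OF tw, of t] by simp
 next
  case False
  hence "dle ?w t 0" by (intro dle_mono[OF w0]) auto
  hence "muf ?w t <= 0" by (intro muf_le) auto
  thus ?thesis using False muf_nonneg[OF tw, of t] by simp
 qed
 note id = Er_ideal[OF Er_rs[OF f] muf_borel[OF tw] this]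
 show thesis
 proof (rule that[OF y(1) h _ _ _ tw])
  show "\<tau> (%r. r-h r) <= ennreal u" using le qt by simp
  show "(r, y r) : x" if "h r = r" for r using y(2)[of r] that by simp
  show "mB y t <= muf x t" if "0 < t" for t by (rule muf_le_muf[OF tx that]) (rule muf_le[OF dy])
  show "muf ?w : Er" by (rule id(1)) simp_all
  have "Nr (muf ?w) <= Nr (rs (muf x) {0<..v})" by (rule id(2)) simp_all
  thus "Nr (muf ?w) <= eps" using v by simp
 qed
qed

end

context vn_E begin

text \<open>\<open>z\<close> is \<open>x\<close> cut to the part of its modulus in (ka, R]. The cut
  below ka leaves an error bounded by ka, the cut above R one supported on trace less than ka; this
  is the final \<open>dle\<close>.\<close>

lemma spec_piece:
 assumes x: "x : measurable_ops M \<tau>" and f: "muf x : Er" and k: "0 < ka"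
 obtains e z p where "Pr e" "\<tau> e < \<infinity>" "z : M" "!!v. z (e v) = z v" "!!v. e v = v ==> (v, z v) : x"
  "Pr p" "\<tau> p < \<infinity>" "!!v. p (e v) = e v" "!!v. p (z v) = z v" "dle (algdiff x (graph_of z)) ka ka"
proof -
 note ax = mops_aff[OF x] and tx = mops_tmeas[OF x]
 note lin = aff_linear[OF ax]
 obtain t where t: "0 < t" "muf x t < ka" using decr_vanishes[OF f muf_decr[OF tx] k] by blast
 have "dle x t ka" by (rule muf_less[OF tx t])
 hence "\<tau> (spa x ka) <= ennreal t" using dle_iff[OF ax, of ka] k by simp
 hence fin: "\<tau> (spa x ka) < \<infinity>" by (rule le_less_trans) simp
 have "(0::ennreal) < ennreal ka" using k by simp
 from spa_tr_small[OF ax less_imp_le[OF k] fin this] obtain R where R: "ka <= R" "\<tau> (spa x R) < ennreal ka" by blast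
 have R0: "0 <= R" "0 <= ka" using R k by auto
 let ?E = "spa x ka" and ?F = "spa x R"
 have EP: "Pr ?E" and FP: "Pr ?F" by (rule Pr_spa[OF ax])+
 note EF = spa_mono'[OF ax R0(2) R(1)]
 define e where "e = (%v. ?E v - ?F v)"
 have e: "Pr e" unfolding e_def by (rule Pr_sub_diff[OF FP EP EF(1)])
 have Ee: "?E (e v) = e v" and Fe: "?F (e v) = 0" for v
  unfolding e_def by (simp_all add: bcl_simps(2)[OF Pr_bcl[OF EP]] bcl_simps(2)[OF Pr_bcl[OF FP]] EF Pr_idem[OF EP] Pr_idem[OF FP])
 have te: "\<tau> e < \<infinity>" using tr_Pr_mono[OF e EP Ee] fin by simp
 define f' where "f' = (%v. v - ?F v)"
 have f': "Pr f'" unfolding f'_def by (rule Pr_compl[OF FP])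
 have "bd x f' R" unfolding f'_def by (rule bd_spa[OF ax R0(1)])
 from bdd_part[OF ax f' this] obtain B where B: "B : M" "!!v. (f' v, B v) : x" by blast
 define z where "z = (%v. B (e v))"
 have z: "z : M" unfolding z_def by (rule M_compose[OF B(1) Pr_M[OF e]])
 have ze: "z (e v) = z v" for v by (simp add: z_def Pr_idem[OF e])
 have zx: "(e v, z v) : x" for v using B(2)[of "e v"] by (simp add: f'_def Fe z_def)
 let ?K = "{v. adj z v = 0}"
 \<comment> \<open>The range projection of \<open>z\<close>, equivalent to a part of
   \<open>e\<close> and thus of finite trace. The join \<open>p\<close> of \<open>e\<close> and
   \<open>l\<close> defines the corner in which convergence is tested.\<close>
 define l where "l = (%v. v - proj ?K v)"
 have az: "adj z : M" by (rule M_adj[OF z])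
 note kp = Pr_kernel[OF az]
 have l: "Pr l" unfolding l_def by (rule Pr_compl[OF kp])
 have eaz: "e (adj z v) = adj z v" for v
  by (rule ci_eqI) (simp only: Pr_ci[OF e] adj_cinner'[OF M_bcl[OF z]] ze)
 have tl: "\<tau> l <= \<tau> e" unfolding l_def by (rule tr_support[OF az e eaz])
 have K: "csub ?K" "closed ?K" by (rule csub_kernel[OF M_bcl[OF az]], rule closed_kernel[OF M_bcl[OF az]])
 have lz: "l (z v) = z v" for v
 proof -
  have "proj ?K (z v) = 0"
  proof (rule ci_eqI)
   fix u
   have "adj z (proj ?K u) = 0" using proj_in[OF K, of u] by simp
   hence "cinner (z v) (proj ?K u) = 0" by (simp add: adj_cinner[OF M_bcl[OF z]] ci_zero_right)
   thus "cinner (proj ?K (z v)) u = cinner 0 u" by (simp add: Pr_ci[OF kp] ci_zero_left)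
  qed
  thus ?thesis by (simp add: l_def)
 qed
 note ce = Pr_compl[OF e] and cl = Pr_compl[OF l]
 let ?m = "meet (%v. v - e v) (%v. v - l v)"
 have m: "Pr ?m" by (rule Pr_meet[OF ce cl])
 define p where "p = (%v. v - ?m v)"
 have p: "Pr p" unfolding p_def by (rule Pr_compl[OF m])
 have "\<tau> p <= \<tau> e+\<tau> l" using meet_trace[OF ce cl] by (simp add: p_def)
 also have "... < \<infinity>" using te tl by (simp add: le_less_trans)
 finally have tp: "\<tau> p < \<infinity>" .
 have m0: "e (?m v) = 0" "l (?m v) = 0" for v using meet_range[OF ce cl, of "?m v"] Pr_idem[OF m] by auto
 have "?m (e v) = 0" "?m (l v) = 0" for v
  by (rule ci_eqI, simp add: Pr_ci[OF m] Pr_ci[OF e] Pr_ci[OF l] m0 ci_zero_left ci_zero_right)+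
 hence pe: "p (e v) = e v" "p (l v) = l v" for v by (simp_all add: p_def)
 have pz: "p (z v) = z v" for v using pe(2)[of "z v"] by (simp add: lz)
 have "bd (algdiff x (graph_of z)) f' ka" unfolding bd_def
 proof (intro allI impI)
  fix v assume "f' v = v"
  hence F0: "?F v = 0" by (simp add: f'_def)
  have "?E (v - ?E v) = 0" by (simp add: bcl_simps(2)[OF Pr_bcl[OF EP]] Pr_idem[OF EP])
  then obtain w where w: "(v - ?E v, w) : x" "norm w <= ka*norm (v - ?E v)"
   using spa_below[OF affD(1)[OF ax] R0(2)] by blast
  have "(v - ?E v + e v, w+z v) : x" by (rule lin_add[OF lin w(1) zx])
  hence "(v, w+z v) : x" by (simp add: e_def F0)
  hence "(v, w+z v - z v) : algdiff x (graph_of z)" by (rule adiffI) simp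
  moreover have "norm (v - ?E v) <= norm v" by (rule pr_nle[OF Pr_proj[OF Pr_compl[OF EP]]])
  hence "norm w <= ka*norm v" using w(2) R0(2) by (meson mult_left_mono order_trans)
  ultimately show "\<exists>w. (v, w) : algdiff x (graph_of z) & norm w <= ka*norm v" by auto
 qed
 moreover have "\<tau> (%v. v - f' v) <= ennreal ka" using R(2) by (simp add: f'_def less_imp_le)
 ultimately have d: "dle (algdiff x (graph_of z)) ka ka" unfolding dle_def using f' by blast
 show thesis
 proof (rule that[OF e te z ze _ p tp pe(1) pz d])
  show "(v, z v) : x" if "e v = v" for v using zx[of v] that by simp
 qed
qed

lemma sub_proj: "Pr p ==> Pr r ==> (!!v. r (p v) = p v) ==> p (r v) = p v"
 by (rule ci_eqI) (simp add: Pr_ci)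

lemma adj_compose: "S : M ==> T : M ==> adj (%x. S (T x)) = (%x. adj T (adj S x))"
 by (rule ext, rule ci_eqI) (simp only: adj_cinner'[OF M_bcl[OF M_compose]] adj_cinner'[OF M_bcl])

lemma adj_Pr: "Pr p ==> adj p = p"
 by (rule ext, rule ci_eqI) (simp only: adj_cinner'[OF Pr_bcl] Pr_ci)

lemma mB_right_le:
 assumes y: "y : M" and g: "Pr g" and t: "0 < t" shows "mB (%v. y (g v)) t <= mB y t"
proof -
 have "mB (%v. y (g v)) t = mB (%v. g (adj y v)) t"
  using mB_adj[OF M_compose[OF y Pr_M[OF g]], of t] by (simp add: adj_compose[OF y Pr_M[OF g]] adj_Pr[OF g])
 also have "... <= mB (adj y) t" by (rule mB_nle[OF M_adj[OF y] pr_nle[OF Pr_proj[OF g]] t])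
 finally show ?thesis by (simp add: mB_adj[OF y])
qed

text \<open>With \<open>y\<close> the bounded approximant of \<open>xs n\<close> and
  \<open>g\<close> a small reduction of \<open>e\<close>, y - z is the sum of y (1 - g), (1 - p) y
  g, p y g - z g and z g - z. The third is uniformly small by convergence on the corner of
  \<open>p\<close>, the fourth has small support, and the first two are instances of
  \<open>gap\<close>.\<close>

lemma limit_approx:
 assumes eps: "0 < eps" and de: "0 < de" "de < 1"
  and gap: "!!y g. y : M ==> Pr g ==> mB y : Er ==> Nr (mB y) <= 1 ==>
   1-de <= Nr (mB (%x. y (g x))) ==> Nr (mB (%x. y (x-g x))) <= eps"
  and x: "x : measurable_ops M \<tau>" and f: "muf x : Er" and nx: "1-de < Nr (muf x)"
  and xs: "!!n. xs n : measurable_ops M \<tau>" "!!n. muf (xs n) : Er" "!!n. Nr (muf (xs n)) <= 1"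
  and lim: "limitin (subtopology (local_measure_topology M \<tau>) X) xs x sequentially"
 shows "\<exists>z\<in>M. \<exists>k. \<forall>n\<ge>k. tmeas (algdiff (xs n) (graph_of z)) & muf (algdiff (xs n) (graph_of z)) : Er \<and>
  Nr (muf (algdiff (xs n) (graph_of z))) powr \<alpha> <= 46*eps powr \<alpha>"
proof -
 note ax = mops_aff[OF x] and tx = mops_tmeas[OF x]
 obtain ka where ka: "0 < ka" "1-de < Nr (%t. max 0 (muf x (t+ka)-ka))"
  using shift_norm[OF x f _ nx] de by auto
 have k2: "0 < ka/2" using ka by simp
 obtain e z p where e: "Pr e" "\<tau> e < \<infinity>" and z: "z : M" "!!\<xi>. z (e \<xi>) = z \<xi>" "!!\<xi>. e \<xi> = \<xi> ==> (\<xi>, z \<xi>) : x"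
  and p: "Pr p" "\<tau> p < \<infinity>" "!!\<xi>. p (e \<xi>) = e \<xi>" "!!\<xi>. p (z \<xi>) = z \<xi>" and v: "dle (algdiff x (graph_of z)) (ka/2) (ka/2)"
  by (rule spec_piece[OF x f k2]) (rule that; assumption)
 obtain K where K: "K > 0" "!!x. norm (z x) <= K*norm x" using bcl_bdd[OF M_bcl[OF z(1)]] by blast
 obtain A where A: "0 <= A" "\<tau> e = ennreal A" using e(2) by (cases "\<tau> e" rule: ennreal_cases) auto
 define I where "I = Nr (indicator {0<..A})"
 have I: "0 <= I" unfolding I_def by (rule Nr_nonneg[OF Er_indicator])
 \<comment> \<open>\<open>T3\<close> is bounded by c with support of trace A, so its norm is at most
   c I; the part ka/4 belongs to the error budget of \<open>big\<close>.\<close>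
 define c where "c = min (ka/4) (eps/(I+1))"
 have c: "0 < c" "c <= ka/4" "c*I <= eps"
 proof -
  show "0 < c" using ka eps I by (simp add: c_def)
  show "c <= ka/4" unfolding c_def by (rule min.cobounded1)
  have "c*I <= (eps/(I+1))*(I+1)" using I eps by (intro mult_mono) (auto simp: c_def)
  thus "c*I <= eps" using I by simp
 qed
 have KI: "(%t. K*indicator {0<..1} t) : Er" by (rule Er_scale[OF Er_indicator])
 obtain u0 where u0: "0 < u0" "Nr (rs (%t. K*indicator {0<..1} t) {0<..u0}) < eps" using head_small[OF KI eps] by blast
 \<comment> \<open>\<open>T4\<close> is bounded by K and vanishes off trace 2 u: u \<le> u0/2 makes
   its norm at most eps, u \<le> 1/2 keeps (0, 2 u] inside (0, 1], and u \<le> ka/8 serves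
   \<open>big\<close>.\<close>
 define u where "u = min (min (u0/2) (1/2)) (ka/8)"
 have u: "0 < u" "u <= u0/2" "u <= 1/2" "u <= ka/8" using u0 ka by (auto simp: u_def)
 have Ku: "K*Nr (indicator {0<..2*u}) <= eps"
 proof -
  have "(%t. K*indicator {0<..2*u} t) = rs (%t. K*indicator {0<..1} t) {0<..2*u}" using u by (auto simp: indicator_def fun_eq_iff)
  hence "K*Nr (indicator {0<..2*u}) = Nr (rs (%t. K*indicator {0<..1} t) {0<..2*u})"
   using Nr_scale[OF Er_indicator, of K "2*u"] K(1) by simp
  also have "... <= Nr (rs (%t. K*indicator {0<..1} t) {0<..u0})"
   using u K(1) Er_borel[OF Er_rs[OF KI, of "{0<..2*u}"]] by (intro Er_ideal(2) Er_rs KI) (auto simp: indicator_def)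
  finally show ?thesis using u0 by simp
 qed
 obtain k where k: "!!n. n >= k ==> dle (cdiff p (xs n) x) u c"
  using local_conv_corner[OF p(1) lim p(2) c(1) u(1)] by blast
 have "tmeas (algdiff (xs n) (graph_of z)) & muf (algdiff (xs n) (graph_of z)) : Er \<and>
  Nr (muf (algdiff (xs n) (graph_of z))) powr \<alpha> <= 46*eps powr \<alpha>" if n: "n >= k" for n
 proof -
  obtain r where r: "Pr r" "\<tau> (%\<xi>. \<xi>-r \<xi>) <= ennreal u" "bd (cdiff p (xs n) x) r c" using k[OF n] unfolding dle_def by blast
  obtain y h where y: "y : M" and h: "Pr h" "\<tau> (%\<xi>. \<xi>-h \<xi>) <= ennreal u" "!!\<xi>. h \<xi> = \<xi> ==> (\<xi>, y \<xi>) : xs n"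
   and my: "!!t. 0 < t ==> mB y t <= muf (xs n) t" and w: "tmeas (algdiff (xs n) (graph_of y))"
    "muf (algdiff (xs n) (graph_of y)) : Er" "Nr (muf (algdiff (xs n) (graph_of y))) <= eps"
   by (rule approx_bdd[OF xs(1)[of n] xs(2)[of n] eps u(1)]) (rule that; assumption)
  note yt = M_tmeas[OF y]
  have yE: "mB y : Er" "Nr (mB y) <= 1"
  proof -
   have "\<bar>mB y t\<bar> <= \<bar>muf (xs n) t\<bar>" if "0 < t" for t using my[OF that] muf_nonneg[OF yt, of t] by simp
   from Er_ideal[OF xs(2) muf_borel[OF yt] this] xs(3)[of n] show "mB y : Er" "Nr (mB y) <= 1" by auto
  qed
  \<comment> \<open>On the range of g the limit equals \<open>z\<close>, the corner estimate holds,
    and \<open>xs n\<close> equals \<open>y\<close>.\<close>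
  define g where "g = meet e (meet r h)"
  note rh = Pr_meet[OF r(1) h(1)]
  have g: "Pr g" unfolding g_def by (rule Pr_meet[OF e(1) rh])
  have gfix: "e (g \<xi>) = g \<xi>" "r (g \<xi>) = g \<xi>" "h (g \<xi>) = g \<xi>" for \<xi>
   using meet_range[OF e(1) rh, of "g \<xi>"] meet_range[OF r(1) h(1), of "g \<xi>"] Pr_idem[OF g, of \<xi>] by (auto simp: g_def)
  have pg: "p (g \<xi>) = g \<xi>" for \<xi> using p(3)[of "g \<xi>"] by (simp add: gfix)
  have teg: "\<tau> (%\<xi>. e \<xi>-g \<xi>) <= ennreal (2*u)"
  proof -
   have "\<tau> (%\<xi>. e \<xi>-g \<xi>) <= \<tau> (%\<xi>. \<xi>-meet r h \<xi>)" unfolding g_def by (rule meet_tr_diff[OF e(1) rh])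
   also have "... <= \<tau> (%\<xi>. \<xi>-r \<xi>)+\<tau> (%\<xi>. \<xi>-h \<xi>)" by (rule meet_trace[OF r(1) h(1)])
   also have "... <= ennreal u+ennreal u" by (intro add_mono r(2) h(2))
   also have "... = ennreal (2*u)" unfolding mult_2 using u by (intro ennreal_plus[symmetric]) auto
   finally show ?thesis .
  qed
  have close: "norm (p (y (g \<xi>))-z (g \<xi>)) <= c*norm \<xi>" for \<xi>
  proof -
   obtain \<zeta> where "(g \<xi>, \<zeta>) : cdiff p (xs n) x" "norm \<zeta> <= c*norm (g \<xi>)" using r(3) gfix(2)[of \<xi>] unfolding bd_def by blast
   then obtain \<eta> \<eta>' where \<eta>: "(p (g \<xi>), \<eta>) : xs n" "(p (g \<xi>), \<eta>') : x" "norm (p (\<eta>-\<eta>')) <= c*norm (g \<xi>)"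
    unfolding cdiff_def[OF p(1)] by auto
   have "\<eta> = y (g \<xi>)" using lin_uniq[OF aff_linear[OF mops_aff[OF xs(1)]] _ h(3)[OF gfix(3)[of \<xi>]]] \<eta>(1) pg by simp
   moreover have "\<eta>' = z (g \<xi>)" using lin_uniq[OF aff_linear[OF ax] _ z(3)[OF gfix(1)[of \<xi>]]] \<eta>(2) pg by simp
   ultimately have "norm (p (y (g \<xi>))-z (g \<xi>)) <= c*norm (g \<xi>)" using \<eta>(3) by (simp add: bcl_simps(2)[OF Pr_bcl[OF p(1)]] p(4))
   also have "... <= c*norm \<xi>" using c(1) pr_nle[OF Pr_proj[OF g]] by (intro mult_left_mono) auto
   finally show ?thesis .
  qed
  define T1 where "T1 = (%\<xi>. y (\<xi>-g \<xi>))"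
  define T2 where "T2 = (%\<xi>. y (g \<xi>)-p (y (g \<xi>)))"
  define T3 where "T3 = (%\<xi>. p (y (g \<xi>))-z (g \<xi>))"
  define T4 where "T4 = (%\<xi>. z (g \<xi>)-z \<xi>)"
  define P where "P = (%\<xi>. p (y (g \<xi>)))"
  have yg: "(%\<xi>. y (g \<xi>)) : M" by (rule M_compose[OF y Pr_M[OF g]])
  have PM: "P : M" unfolding P_def by (rule M_compose[OF Pr_M[OF p(1)] yg])
  have zg: "(%\<xi>. z (g \<xi>)) : M" by (rule M_compose[OF z(1) Pr_M[OF g]])
  have T1: "T1 : M" unfolding T1_def by (rule M_compose[OF y Pr_M[OF Pr_compl[OF g]]])
  have T2: "T2 : M" unfolding T2_def by (rule M_diff[OF yg PM[unfolded P_def]])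
  have T3: "T3 : M" unfolding T3_def by (rule M_diff[OF PM[unfolded P_def] zg])
  have T4: "T4 : M" unfolding T4_def by (rule M_diff[OF zg z(1)])
  have eg: "Pr (%\<xi>. e \<xi>-g \<xi>)" by (rule Pr_sub_diff[OF g e(1) gfix(1)])
  have gcom: "g (e \<xi>) = g \<xi>" for \<xi> by (rule sub_proj[OF g e(1) gfix(1)])
  have b3: "mB T3 : Er" "Nr (mB T3) powr \<alpha> <= eps powr \<alpha>"
  proof -
   have "\<tau> g <= ennreal A" using tr_Pr_mono[OF g e(1) gfix(1)] A by simp
   moreover have "T3 (\<xi>-g \<xi>) = 0" for \<xi>
    unfolding T3_def by (simp add: bcl_simps(2,4)[OF Pr_bcl[OF g]] Pr_idem[OF g] bcl_simps(4)[OF M_bcl[OF y]] bcl_simps(4)[OF M_bcl[OF z(1)]] bcl_simps(4)[OF Pr_bcl[OF p(1)]])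
   ultimately have c0: "dB T3 A 0" by (rule dB_cutoff[OF g])
   have cc: "dB T3 t c" if "0 < t" for t using that close by (intro dB_bdd) (auto simp: T3_def)
   note sb = step_bound[OF M_tmeas[OF T3] less_imp_le[OF c(1)] cc c0]
   show E: "mB T3 : Er" by (rule sb(1))
   have "Nr (mB T3) <= eps" using sb(2) c(3) by (simp add: I_def)
   thus "Nr (mB T3) powr \<alpha> <= eps powr \<alpha>" by (rule Nr_powr_mono[OF E])
  qed
  have d4: "dB T4 (2*u) 0"
  proof (rule dB_cutoff[OF eg teg])
   fix \<xi>
   let ?v = "\<xi>-(e \<xi>-g \<xi>)"
   have "g ?v = g \<xi>" by (simp add: bcl_simps(2)[OF Pr_bcl[OF g]] gcom Pr_idem[OF g])
   moreover have "e ?v = g \<xi>" by (simp add: bcl_simps(2)[OF Pr_bcl[OF e(1)]] gfix Pr_idem[OF e(1)])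
   ultimately show "T4 ?v = 0" using z(2)[of ?v] by (simp add: T4_def)
  qed
  have b4: "mB T4 : Er" "Nr (mB T4) powr \<alpha> <= eps powr \<alpha>"
  proof -
   have "norm (T4 \<xi>) <= K*norm \<xi>" for \<xi>
   proof -
    have "T4 \<xi> = - z (\<xi>-g \<xi>)" by (simp add: T4_def bcl_simps(2)[OF M_bcl[OF z(1)]])
    hence "norm (T4 \<xi>) <= K*norm (\<xi>-g \<xi>)" using K(2)[of "\<xi>-g \<xi>"] by simp
    also have "... <= K*norm \<xi>" using K(1) pr_nle[OF Pr_proj[OF Pr_compl[OF g]], of \<xi>] by (intro mult_left_mono) auto
    finally show ?thesis .
   qed
   hence cc: "dB T4 t K" if "0 < t" for t using that by (intro dB_bdd) auto
   note sb = step_bound[OF M_tmeas[OF T4] less_imp_le[OF K(1)] cc d4]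
   show E: "mB T4 : Er" by (rule sb(1))
   have "Nr (mB T4) <= eps" using sb(2) Ku by simp
   thus "Nr (mB T4) powr \<alpha> <= eps powr \<alpha>" by (rule Nr_powr_mono[OF E])
  qed
  have nP: "norm (P \<xi>) <= norm (y (g \<xi>))" for \<xi> unfolding P_def by (rule pr_nle[OF Pr_proj[OF p(1)]])
  have dom: "mB S : Er" "Nr (mB S) <= Nr (mB T)" if S: "S : M" and T: "mB T : Er" "T : M" and le: "!!t. 0 < t ==> mB S t <= mB T t" for S T
  proof -
   have "\<bar>mB S t\<bar> <= \<bar>mB T t\<bar>" if "0 < t" for t using le[OF that] muf_nonneg[OF M_tmeas[OF S], of t] by simp
   from Er_ideal[OF T(1) muf_borel[OF M_tmeas[OF S]] this] show "mB S : Er" "Nr (mB S) <= Nr (mB T)" by auto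
  qed
  note ygE = dom[OF yg yE(1) y mB_right_le[OF y g]]
  have Ple: "mB P t <= mB (%\<xi>. y (g \<xi>)) t" if "0 < t" for t by (rule mB_nle[OF yg nP that])
  note PE = dom[OF PM ygE(1) yg Ple]
  \<comment> \<open>z = P - T3 - T4 and x = z + (x - z) give \<mu>(x) at t + ka \<le> \<mu>(P) at t,
    up to ka: the errors are 2 u + ka/2 in the argument and c + ka/2 in the value.\<close>
  have big: "1-de <= Nr (mB P)"
  proof -
   have low: "muf x (t+ka)-ka <= mB P t" if t: "0 < t" for t
   proof (rule dense_ge)
    fix s assume s: "mB P t < s"
    have s0: "0 <= s" using s muf_nonneg[OF M_tmeas[OF PM], of t] by simp
    have "dB P t s" by (rule muf_less[OF M_tmeas[OF PM] t s])
    moreover have "dB T3 0 c" using close by (intro dB_bdd) (auto simp: T3_def)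
    ultimately have "dB (%\<xi>. P \<xi>-T3 \<xi>) (t+0) (s+c)" using t by (intro dB_diff) auto
    hence "dB (%\<xi>. (P \<xi>-T3 \<xi>)-T4 \<xi>) (t+0+2*u) (s+c+0)" by (rule dB_diff[OF _ d4]) (use t u in auto)
    moreover have "(%\<xi>. (P \<xi>-T3 \<xi>)-T4 \<xi>) = z" by (simp add: P_def T3_def T4_def)
    ultimately have dz: "dB z (t+0+2*u) (s+c+0)" by simp
    have "dle x (t+0+2*u+ka/2) (s+c+0+ka/2)"
    proof (rule dle_add[OF dz v])
     show "0 <= t+0+2*u" "0 <= ka/2" using t u ka by auto
     fix \<xi> \<eta> \<eta>' assume a: "(\<xi>, \<eta>) : graph_of z" "(\<xi>, \<eta>') : algdiff x (graph_of z)"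
     from a(2) obtain \<zeta> where "(\<xi>, \<zeta>) : x" "\<eta>' = \<zeta>-z \<xi>" by (rule adiffE) simp
     thus "\<exists>\<zeta>. (\<xi>, \<zeta>) : x & norm \<zeta> <= norm \<eta>+norm \<eta>'" using a(1) norm_triangle_ineq[of \<eta> \<eta>'] by (intro exI[of _ \<zeta>]) simp
    qed
    hence "dle x (t+ka) (s+ka)" by (rule dle_mono) (use u c ka in auto)
    hence "muf x (t+ka) <= s+ka" using s0 ka by (intro muf_le) auto
    thus "muf x (t+ka)-ka <= s" by simp
   qed
   have "Nr (%t. max 0 (muf x (t+ka)-ka)) <= Nr (mB P)"
   proof (rule Er_ideal(2)[OF PE(1)])
    have [measurable]: "muf x : borel_measurable borel" by (rule muf_borel[OF tx])
    show "(%t. max 0 (muf x (t+ka)-ka)) : borel_measurable borel" by measurable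
    show "\<bar>max 0 (muf x (t+ka)-ka)\<bar> <= \<bar>mB P t\<bar>" if "0 < t" for t
     using low[OF that] muf_nonneg[OF M_tmeas[OF PM], of t] by simp
   qed
   thus ?thesis using ka(2) by simp
  qed
  have b1: "mB T1 : Er" "Nr (mB T1) powr \<alpha> <= eps powr \<alpha>"
  proof -
   have "mB T1 t <= mB y t" if t: "0 < t" for t unfolding T1_def by (rule mB_right_le[OF y Pr_compl[OF g] t])
   note E = dom[OF T1 yE(1) y this]
   show "mB T1 : Er" by (rule E(1)) simp
   have "1-de <= Nr (mB (%\<xi>. y (g \<xi>)))" using big PE(2) by simp
   from gap[OF y g yE this] have "Nr (mB T1) <= eps" by (simp add: T1_def)
   thus "Nr (mB T1) powr \<alpha> <= eps powr \<alpha>" by (rule Nr_powr_mono[OF \<open>mB T1 : Er\<close>])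
  qed
  \<comment> \<open>The left-handed version of the claim, obtained by passing to adjoints: (y g)* is
    multiplied on the right by p, and the norm of p y g is large by \<open>big\<close>.\<close>
  have b2: "mB T2 : Er" "Nr (mB T2) powr \<alpha> <= eps powr \<alpha>"
  proof -
   let ?a = "adj (%\<xi>. y (g \<xi>))"
   have aM: "?a : M" by (rule M_adj[OF yg])
   have pc: "Pr (%\<xi>. \<xi>-p \<xi>)" by (rule Pr_compl[OF p(1)])
   have aP: "adj P = (%\<xi>. ?a (p \<xi>))" unfolding P_def by (simp add: adj_compose[OF Pr_M[OF p(1)] yg] adj_Pr[OF p(1)])
   have aT: "adj T2 = (%\<xi>. ?a (\<xi>-p \<xi>))" unfolding T2_def by (simp add: adj_compose[OF Pr_M[OF pc] yg] adj_Pr[OF pc])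
   have eq: "mB ?a = mB (%\<xi>. y (g \<xi>))" "mB (%\<xi>. ?a (p \<xi>)) = mB P" "mB (%\<xi>. ?a (\<xi>-p \<xi>)) = mB T2"
    using mB_adj[OF yg] mB_adj[OF PM] mB_adj[OF T2] unfolding aP aT by (simp_all add: fun_eq_iff)
   have "Nr (mB (%\<xi>. ?a (\<xi>-p \<xi>))) <= eps"
    by (rule gap[OF aM p(1)]) (use ygE yE big eq in auto)
   hence n: "Nr (mB T2) <= eps" unfolding eq .
   have "norm (T2 \<xi>) <= norm (y (g \<xi>))" for \<xi> unfolding T2_def by (rule pr_nle[OF Pr_proj[OF pc]])
   hence "mB T2 t <= mB (%\<xi>. y (g \<xi>)) t" if "0 < t" for t by (rule mB_nle[OF yg _ that])
   note m2 = dom(1)[OF T2 ygE(1) yg this]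
   show m: "mB T2 : Er" by (rule m2)
   show "Nr (mB T2) powr \<alpha> <= eps powr \<alpha>" by (rule Nr_powr_mono[OF m n])
  qed
  let ?e = "eps powr \<alpha>"
  define S3 where "S3 = (%\<xi>. T3 \<xi>+T4 \<xi>)"
  define S2 where "S2 = (%\<xi>. T2 \<xi>+S3 \<xi>)"
  define S1 where "S1 = (%\<xi>. T1 \<xi>+S2 \<xi>)"
  have S3: "S3 : M" unfolding S3_def by (rule M_add[OF T3 T4])
  have S2: "S2 : M" unfolding S2_def by (rule M_add[OF T2 S3])
  have S1: "S1 : M" unfolding S1_def by (rule M_add[OF T1 S2])
  note c3 = mB_tri[OF T3 b3 T4 b4, of S3, unfolded S3_def, OF refl, folded S3_def]
  note c2 = mB_tri[OF T2 b2 S3 c3, of S2, unfolded S2_def, OF refl, folded S2_def]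
  note c1 = mB_tri[OF T1 b1 S2 c2, of S1, unfolded S1_def, OF refl, folded S1_def]
  have S1yz: "S1 \<xi> = y \<xi>-z \<xi>" for \<xi>
   by (simp add: S1_def S2_def S3_def T1_def T2_def T3_def T4_def bcl_simps(2)[OF M_bcl[OF y]])
  let ?v = "algdiff (xs n) (graph_of z)"
  have tri: "\<exists>\<zeta>. (\<xi>, \<zeta>) : ?v & norm \<zeta> <= norm \<eta>+norm \<eta>'"
   if a: "(\<xi>, \<eta>) : algdiff (xs n) (graph_of y)" "(\<xi>, \<eta>') : graph_of S1" for \<xi> \<eta> \<eta>'
  proof -
   from a(1) obtain \<zeta> where \<zeta>: "(\<xi>, \<zeta>) : xs n" "\<eta> = \<zeta>-y \<xi>" by (rule adiffE) simp
   have "(\<xi>, \<zeta>-z \<xi>) : ?v" by (rule adiffI[OF \<zeta>(1)]) simp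
   moreover have "\<zeta>-z \<xi> = \<eta>+\<eta>'" using \<zeta>(2) a(2) by (simp add: S1yz)
   ultimately show ?thesis using norm_triangle_ineq[of \<eta> \<eta>'] by (intro exI[of _ "\<zeta>-z \<xi>"]) simp
  qed
  note fin = muf_tri[OF tri w(1,2) Nr_powr_mono[OF w(2,3)] M_tmeas[OF S1] c1]
  \<comment> \<open>Four nested uses of the quasi-triangle inequality \<open>muf_tri\<close>, each
    doubling the sum.\<close>
  have "2*(?e+2*(?e+2*(?e+2*(?e+?e)))) = 46*?e" by simp
  thus ?thesis using fin by simp
 qed
 thus ?thesis using z(1) by blast
qed

lemma UKKH_op_space: "UKKH (op_space E M \<tau>) strong_diff (op_space_norm N \<tau>)
  (subtopology (local_measure_topology M \<tau>) (op_space E M \<tau>))"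
 unfolding UKKH_def
proof (intro allI impI)
 fix eps' :: real assume e': "0 < eps'"
 \<comment> \<open>184 = 2 (46 + 46): one further quasi-triangle inequality compares two members of
   the sequence through \<open>z\<close>.\<close>
 define eps where "eps = eps'/184 powr (1/\<alpha>)"
 have eps: "0 < eps" using e' by (simp add: eps_def)
 have eps\<alpha>: "184*eps powr \<alpha> = eps' powr \<alpha>" using e' \<alpha> by (simp add: eps_def powr_divide powr_powr)
 obtain de where de: "0 < de" "de < 1" and gap: "!!y g. y : M ==> Pr g ==> mB y : Er ==> Nr (mB y) <= 1 ==>
   1-de <= Nr (mB (%x. y (g x))) ==> Nr (mB (%x. y (x-g x))) <= eps"
  by (fact norm_complement_small[OF eps])
 have op: "x : measurable_ops M \<tau>" "muf x : Er" "op_space_norm N \<tau> x = Nr (muf x)" if "x : op_space E M \<tau>" for x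
  using that sing_fun_iff[of x] by (auto simp: op_space_def op_space_norm_def)
 show "\<exists>de. 0 < de & de < 1 & (\<forall>(xs :: nat => _) x. (\<forall>n. xs n : op_space E M \<tau> & op_space_norm N \<tau> (xs n) <= 1) -->
   x : op_space E M \<tau> --> limitin (subtopology (local_measure_topology M \<tau>) (op_space E M \<tau>)) xs x sequentially -->
   op_space_norm N \<tau> x > 1-de -->
   (\<exists>k>0. \<forall>n\<ge>k. \<forall>m\<ge>k. op_space_norm N \<tau> (strong_diff (xs n) (xs m)) <= eps'))"
 proof (intro exI[of _ de] conjI de allI impI)
  fix xs :: "nat => 'h unbdd_op" and x
  assume xs: "\<forall>n. xs n : op_space E M \<tau> & op_space_norm N \<tau> (xs n) <= 1" and x: "x : op_space E M \<tau>"
   and lim: "limitin (subtopology (local_measure_topology M \<tau>) (op_space E M \<tau>)) xs x sequentially"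
   and nx: "op_space_norm N \<tau> x > 1-de"
  have xs': "xs n : measurable_ops M \<tau>" "muf (xs n) : Er" "Nr (muf (xs n)) <= 1" for n using spec[OF xs, of n] op[of "xs n"] by auto
  have nx': "1-de < Nr (muf x)" using nx op[OF x] by simp
  from limit_approx[OF eps de gap op(1,2)[OF x] nx' xs' lim]
  obtain z k where k: "!!n. n >= k ==> tmeas (algdiff (xs n) (graph_of z)) & muf (algdiff (xs n) (graph_of z)) : Er \<and>
   Nr (muf (algdiff (xs n) (graph_of z))) powr \<alpha> <= 46*eps powr \<alpha>" by blast
  have "op_space_norm N \<tau> (strong_diff (xs n) (xs m)) <= eps'" if n: "n >= k" and m: "m >= k" for n m
  proof -
   let ?d = "strong_diff (xs n) (xs m)"
   have tri: "\<exists>u. (v, u) : ?d & norm u <= norm w+norm w'"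
    if a: "(v, w) : algdiff (xs n) (graph_of z)" "(v, w') : algdiff (xs m) (graph_of z)" for v w w'
   proof -
    from a(1) obtain u where u: "(v, u) : xs n" "w = u-z v" by (rule adiffE) simp
    from a(2) obtain u' where u': "(v, u') : xs m" "w' = u'-z v" by (rule adiffE) simp
    have "(v, u-u') : algdiff (xs n) (xs m)" by (rule adiffI[OF u(1) u'(1)])
    hence "(v, u-u') : ?d" unfolding str_diff_adiff using closure_subset by blast
    moreover have "u-u' = w-w'" using u(2) u'(2) by simp
    ultimately show ?thesis using norm_triangle_ineq4[of w w'] by (intro exI[of _ "u-u'"]) simp
   qed
   note t = muf_tri[OF tri conjunct1[OF k[OF n]] _ _ conjunct1[OF k[OF m]]]
   have E: "muf ?d : Er" and b: "Nr (muf ?d) powr \<alpha> <= 2*(46*eps powr \<alpha>+46*eps powr \<alpha>)" using t(2,3) k[OF n] k[OF m] by blast+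
   have "Nr (muf ?d) powr \<alpha> <= eps' powr \<alpha>" using b eps\<alpha> by simp
   hence "Nr (muf ?d) <= eps'" using e' by (intro Nr_powr_le E) auto
   thus ?thesis using sing_fun_iff(2)[OF str_diff_meas[OF xs'(1) xs'(1)] E] by (simp add: op_space_norm_def)
  qed
  \<comment> \<open>The definition asks for a positive index, hence the successor.\<close>
  thus "\<exists>k>0. \<forall>n\<ge>k. \<forall>m\<ge>k. op_space_norm N \<tau> (strong_diff (xs n) (xs m)) <= eps'" by (intro exI[of _ "Suc k"]) auto
 qed
qed

end

theorem theorem2p7:
  fixes E :: "(real \<Rightarrow> complex) set" and N :: "(real \<Rightarrow> complex) \<Rightarrow> real"
    and M :: "('h::complex_hilbert \<Rightarrow> 'h) set" and \<tau> :: "('h \<Rightarrow> 'h) \<Rightarrow> ennreal"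
    and \<alpha> q :: real
  assumes "symmetric_quasi_banach_space E N"
    and "von_neumann_algebra M" and "fns_trace M \<tau>"
    and "0 < \<alpha>" and "\<alpha> \<le> 1"
    and "p_convex \<alpha> E N" and "convexity_const \<alpha> E N = 1"
    and "\<alpha> \<le> q" and "lower_estimate q E N 1"
  shows "UKKH (op_space E M \<tau>) strong_diff (op_space_norm N \<tau>)
    (subtopology (local_measure_topology M \<tau>) (op_space E M \<tau>))"
proof -
  interpret vn_E M \<tau> E N \<alpha> q
    using assms convexity_bound_1[OF assms(6,7)]
    by (simp add: vn_E_def vn_trace_def vn_trace_axioms_def E_space_def E_space_axioms_def)
  show ?thesis by (rule UKKH_op_space)
qed

end
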